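(* Let $\varphi:\mathbb S^3\to\mathbb R$ be a fixed function, and let $\hat{\mathfrak g}=\mathfrak g\rtimes_\Omega\mathbb R$ be the central extension of the Lie algebra $\mathfrak g=\{S_\theta f\}$ of the quantomorphism group $\mathcal D_q(\mathbb S^3)$ by the trivial cocycle $\Omega(S_\theta f,S_\theta g)=\int_{\mathbb S^3}\varphi\{f,g\}\,d\mu$, with inner product $\langle\langle(u,a),(v,b)\rangle\rangle^{\mathcal A}=\langle u,v\rangle^{\mathcal A}+ab$. Suppose the Lie group $\widehat G$ exists and is the 1-dimensional central extension of $\mathcal D_q(\mathbb S^3)$ with $T_e\widehat G=\hat{\mathfrak g}$. (1) For a curve $(u,a)=(S_\theta f(t),a(t))$ in $\hat{\mathfrak g}$, the Euler–Arnold (geodesic) equation on $\widehat G$ with this weak metric is $$\partial_tu+\mathrm{ad}^*_uu-a(t)Tu=0,\qquad \partial_ta(t)=0,$$ so that $a(t)=a$ is constant, and the first equation is equivalent to $$\partial_t\Delta_{\theta,\mathcal A}f+\{f,\Delta_{\theta,\mathcal A}f\}-a\{\varphi,f\}=0 .$$ (2) Suppose that $\varphi$ is $E$-invariant; more precisely, for a given differentiable function $h:\mathbb S^2\to\mathbb R$ let $\varphi$ be the lift to $\mathbb S^3$ of the function $(z,\lambda)\mapsto\frac{2z}{\mathrm{Ro}}+2z\,h(z,\lambda)$ on $\mathbb S^2$, and let $\rho^2=\gamma z^2$, where $\gamma$ is the Lamb parameter and $\mathrm{Ro}$ the Rossby number. Then for $a=1$ the equation in (1) reduces to the equation on $\mathbb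 S^2$ $$\partial_t(\gamma z^2-\Delta)f+\Big\{f,\ (\gamma z^2-\Delta)f+\frac{2z}{\mathrm{Ro}}+2zh\Big\}=0,$$ for which the transported quantity is $\hat m(t)=(\gamma z^2-\Delta)f+\frac{2z}{\mathrm{Ro}}+2zh$.
   Context: $\mathbb S^3=\{(w_1,w_2)\in\mathbb C^2:|w_1|^2+|w_2|^2=1\}$ carries the standard round metric $g^{\mathbb S^3}$ with volume form $\mu$. It is identified with $SU(2)$ by $F:\begin{pmatrix}w_1&w_2\\-\bar w_2&\bar w_1\end{pmatrix}\mapsto(w_1,w_2)$. The fields $E=E_1,E_2,E_3$ are the left-invariant fields given by the basis $E_1=\begin{pmatrix}i&0\\0&-i\end{pmatrix}$, $E_2=\begin{pmatrix}0&1\\-1&0\end{pmatrix}$, $E_3=\begin{pmatrix}0&i\\i&0\end{pmatrix}$ of $\mathfrak{su}(2)$, transported to $\mathbb S^3$ by $dF$. Under this identification $E$ corresponds to the Reeb field $\partial_{\xi_1}+\partial_{\xi_2}$ (where $w_1=\cos\eta\,e^{i\xi_1}$, $w_2=\sin\eta\,e^{i\xi_2}$), which generates the circle action whose quotient is the Hopf fibration $\pi:\mathbb S^3\to\mathbb S^2$ onto the sphere of radius $\tfrac12$. $E$-invariant functions on $\mathbb S^3$ are identified with functions on $\mathbb S^2$; $z=\cos\vartheta$, with $\vartheta$ the latitudinal angle, and $\lambda$ (longitude) are coordinates on $\mathbb S^2$. Let $\theta$ be the 1-form dual to $E$ in the dual basis of $\{E_i\}$. The quantomorphism group consists of the diffeomorphisms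 of $\mathbb S^3$ (of Sobolev class $H^s$) preserving $\theta$, and $\mathfrak g=\{S_\theta f:f\in H^{s+1}(\mathbb S^3,\mathbb R),\ Ef=0\}$, where $u=S_\theta f$ if and only if $\theta(u)=f$, $i_ud\theta=-df$; explicitly $S_\theta f=fE-\tfrac12(E_3f)E_2+\tfrac12(E_2f)E_3$. The bracket of functions is $\{f,g\}=(S_\theta f)(g)$, with $\{\varphi,f\}=-\{f,\varphi\}=-(S_\theta f)(\varphi)$. $\rho:\mathbb S^2\to\mathbb R$ is a function in $H^s$, and its lift to $\mathbb S^3$ is denoted by the same symbol. The inner product on $\mathfrak g$ is $\langle S_\theta f,S_\theta g\rangle^{\mathcal A}=\int_{\mathbb S^3}g^{\mathbb S^3}(\mathcal A S_\theta f,S_\theta g)\,d\mu$ with $\mathcal A(aE+bE_2+cE_3)=\rho^2aE+bE_2+cE_3$. With $S^*_{\theta,\mathcal A}$ the adjoint of $S_\theta$ for this metric, the contact Laplacian is $\Delta_{\theta,\mathcal A}=S^*_{\theta,\mathcal A}S_\theta$, given by $\Delta_{\theta,\mathcal A}f=(\rho^2-\Delta)f$, where $\Delta$ is the Laplacian on the sphere $\mathbb S^2$ (of radius $\tfrac12$) lifted to $\mathbb S^3$; it is invertible. The Lie bracket on $\hat{\mathfrak g}$ is $[(u,a),(v,b)]=(S_\theta\{f,g\},\Omega(u,v))$ for $u=S_\theta f$, $v=S_\theta g$. The operator $T:\mathfrak g\to\mathfrak g$ is defined by $\langle Tu,v\rangle^{\mathcal A}=\Omega(u,v)$, so that $Tu=S_\theta\Delta_{\theta,\mathcal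 A}^{-1}\{\varphi,f\}$ for $u=S_\theta f$. The operator $\mathrm{ad}^*$ on $\mathfrak g$ is defined by $\langle\mathrm{ad}^*_uv,w\rangle^{\mathcal A}=\langle v,\mathrm{ad}_uw\rangle^{\mathcal A}$ with $\mathrm{ad}_uw=-S_\theta\{f,h\}$ for $u=S_\theta f$, $w=S_\theta h$, and on $\hat{\mathfrak g}$ one has $\widehat{\mathrm{ad}}^*_{(u,a)}(v,b)=(\mathrm{ad}^*_uv-b\,Tu,0)$; the Euler–Arnold equation is $\partial_t(u,a)+\widehat{\mathrm{ad}}^*_{(u,a)}(u,a)=0$.
   Formalization: If φ is not E-invariant, {φ,f} in the scalar equation of (1) is replaced by its average over Hopf fibres; Δ is 1/4 of the Laplacian of the radius-1/2 sphere, as the given S_θ forces; E_i are the fields M ↦ E_i M, to agree with E = ∂_{ξ1}+∂_{ξ2}. *)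

theory Defs
  imports "HOL-Analysis.Analysis"
begin

section \<open>Square-integrable functions and derivatives of curves in \<open>L\<^sup>2\<close>\<close>

text \<open>Elements of \<open>L\<^sup>2\<close> are represented by honest functions; all notions below are
  insensitive to changes on null sets.\<close>

definition L2 :: "'a measure \<Rightarrow> ('a \<Rightarrow> 'b::real_normed_vector) set" where
  "L2 M = {f. f \<in> borel_measurable M \<and> integrable M (\<lambda>x. (norm (f x))\<^sup>2)}"

definition L2_tendsto ::
  "'a measure \<Rightarrow> ('i \<Rightarrow> 'a \<Rightarrow> 'b::real_normed_vector) \<Rightarrow> ('a \<Rightarrow> 'b) \<Rightarrow> 'i filter \<Rightarrow> bool" where
  "L2_tendsto M F f Fl \<longleftrightarrow> ((\<lambda>i. LINT x|M. (norm (F i x - f x))\<^sup>2) \<longlongrightarrow> 0) Fl"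

definition has_L2_derivative ::
  "'a measure \<Rightarrow> real set \<Rightarrow> (real \<Rightarrow> 'a \<Rightarrow> 'b::real_normed_vector) \<Rightarrow> ('a \<Rightarrow> 'b) \<Rightarrow> real \<Rightarrow> bool" where
  "has_L2_derivative M I F G t \<longleftrightarrow>
     (\<forall>\<tau>\<in>I. F \<tau> \<in> L2 M) \<and> G \<in> L2 M \<and>
     L2_tendsto M (\<lambda>\<tau> x. (F \<tau> x - F t x) /\<^sub>R (\<tau> - t)) G (at t within I)"

text \<open>Graph of the \<open>L\<^sup>2\<close>-closure of an operator \<open>D\<close> with domain \<open>C\<close>.\<close>

definition L2_closure ::
  "'a measure \<Rightarrow> ('a \<Rightarrow> real) set \<Rightarrow> (('a \<Rightarrow> real) \<Rightarrow> 'a \<Rightarrow> real) \<Rightarrow> ('a \<Rightarrow> real) \<Rightarrow> ('a \<Rightarrow> real) \<Rightarrow> bool" where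
  "L2_closure M C D f g \<longleftrightarrow> f \<in> L2 M \<and> g \<in> L2 M \<and>
     (\<exists>\<psi>::nat \<Rightarrow> 'a \<Rightarrow> real. (\<forall>n. \<psi> n \<in> C \<and> \<psi> n \<in> L2 M \<and> D (\<psi> n) \<in> L2 M) \<and>
        L2_tendsto M \<psi> f sequentially \<and> L2_tendsto M (\<lambda>n. D (\<psi> n)) g sequentially)"


section \<open>The round sphere \<open>S\<^sup>3\<close> and its frame\<close>

type_synonym c2 = "complex \<times> complex"

abbreviation S3 :: "c2 set" where "S3 \<equiv> sphere 0 1"

text \<open>Volume measure of the round metric: \<open>4\<close> times the Lebesgue measure of the cone
  \<open>{t w | w \<in> A, 0 < t < 1}\<close>.\<close>

definition \<mu>S3 :: "c2 measure" where
  "\<mu>S3 = scale_measure 4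
     (distr (restrict_space lborel (ball 0 1 - {0})) (restrict_space borel S3)
            (\<lambda>x. x /\<^sub>R norm x))"

datatype axis = A1 | A2 | A3

text \<open>\<open>frame i w\<close> is the image under the identification with \<open>SU(2)\<close> of \<open>E\<^sub>i\<close> times the matrix
  of \<open>w\<close> (see \<open>frame_matrix\<close>). This order of multiplication makes \<open>frame A1\<close> the Reeb field
  \<open>\<partial>\<^sub>\<xi>\<^sub>1 + \<partial>\<^sub>\<xi>\<^sub>2\<close> and gives the signs in \<open>S\<theta>\<close> (see \<open>S\<theta>_characterization\<close>).\<close>

primrec frame :: "axis \<Rightarrow> c2 \<Rightarrow> c2" where
  "frame A1 w = (\<i> * fst w, \<i> * snd w)"
| "frame A2 w = (- cnj (snd w), cnj (fst w))"
| "frame A3 w = (- \<i> * cnj (snd w), \<i> * cnj (fst w))"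

primrec su2_basis :: "axis \<Rightarrow> complex^2^2" where
  "su2_basis A1 = vector [vector [\<i>, 0], vector [0, -\<i>]]"
| "su2_basis A2 = vector [vector [0, 1], vector [-1, 0]]"
| "su2_basis A3 = vector [vector [0, \<i>], vector [\<i>, 0]]"

definition SU2_of :: "c2 \<Rightarrow> complex^2^2" where
  "SU2_of w = vector [vector [fst w, snd w], vector [- cnj (snd w), cnj (fst w)]]"

lemma frame_matrix: "SU2_of (frame i w) = su2_basis i ** SU2_of w"
  by (cases i)
     (simp_all add: SU2_of_def matrix_matrix_mult_def vec_eq_iff forall_2 sum_2 vector_2)

lemma frame_orthonormal:
  assumes "w \<in> S3"
  shows "frame i w \<bullet> frame j w = (if i = j then 1 else 0)" and "frame i w \<bullet> w = 0"
proof -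
  have "(norm w)\<^sup>2 = 1" using assms by simp
  hence *: "Re (fst w) * Re (fst w) + Im (fst w) * Im (fst w)
        + (Re (snd w) * Re (snd w) + Im (snd w) * Im (snd w)) = 1"
    by (simp add: power2_norm_eq_inner inner_prod_def inner_complex_def)
  show "frame i w \<bullet> frame j w = (if i = j then 1 else 0)"
    using * by (cases i; cases j) (simp_all add: inner_prod_def inner_complex_def algebra_simps)
  show "frame i w \<bullet> w = 0"
    by (cases i) (simp_all add: inner_prod_def inner_complex_def)
qed

text \<open>Derivative along \<open>frame i\<close>, whose flow is \<open>w \<mapsto> cos t w + sin t (frame i w)\<close>.\<close>

definition frame_deriv :: "axis \<Rightarrow> (c2 \<Rightarrow> real) \<Rightarrow> c2 \<Rightarrow> real" where
  "frame_deriv i \<psi> w = deriv (\<lambda>t. \<psi> (cos t *\<^sub>R w + sin t *\<^sub>R frame i w)) 0"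


section \<open>Smooth functions and Sobolev spaces on \<open>S\<^sup>3\<close>\<close>

primrec Ck_on :: "nat \<Rightarrow> 'a::euclidean_space set \<Rightarrow> ('a \<Rightarrow> real) \<Rightarrow> bool" where
  "Ck_on 0 U F \<longleftrightarrow> continuous_on U F"
| "Ck_on (Suc k) U F \<longleftrightarrow> F differentiable_on U \<and>
     (\<forall>b\<in>Basis. Ck_on k U (\<lambda>x. frechet_derivative F (at x) b))"

definition smooth_S3 :: "(c2 \<Rightarrow> real) set" where
  "smooth_S3 = {\<psi>. \<exists>U F. open U \<and> S3 \<subseteq> U \<and> (\<forall>k. Ck_on k U F) \<and> (\<forall>w\<in>S3. \<psi> w = F w)}"

text \<open>\<open>H\<^sup>k\<close> is the completion of the smooth functions in the norm given by the \<open>L\<^sup>2\<close>-norms of all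
  iterated frame derivatives of order at most \<open>k\<close>.\<close>

definition sobolev :: "nat \<Rightarrow> (c2 \<Rightarrow> real) set" where
  "sobolev k = {f. \<exists>(\<psi>::nat \<Rightarrow> c2 \<Rightarrow> real) D. (\<forall>n. \<psi> n \<in> smooth_S3) \<and> D [] = f \<and>
     (\<forall>\<alpha>. length \<alpha> \<le> k \<longrightarrow> D \<alpha> \<in> L2 \<mu>S3 \<and>
        L2_tendsto \<mu>S3 (\<lambda>n. foldr frame_deriv \<alpha> (\<psi> n)) (D \<alpha>) sequentially)}"

definition sobolev_deriv :: "axis \<Rightarrow> (c2 \<Rightarrow> real) \<Rightarrow> c2 \<Rightarrow> real" where
  "sobolev_deriv i f = (SOME g. L2_closure \<mu>S3 smooth_S3 (frame_deriv i) f g)"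

definition E_invariant :: "(c2 \<Rightarrow> real) \<Rightarrow> bool" where
  "E_invariant f \<longleftrightarrow> L2_closure \<mu>S3 smooth_S3 (frame_deriv A1) f (\<lambda>_. 0)"

definition sobolev_inv :: "nat \<Rightarrow> (c2 \<Rightarrow> real) set" where
  "sobolev_inv k = {f \<in> sobolev k. E_invariant f}"

definition has_sobolev_derivative ::
  "nat \<Rightarrow> real set \<Rightarrow> (real \<Rightarrow> c2 \<Rightarrow> real) \<Rightarrow> (c2 \<Rightarrow> real) \<Rightarrow> real \<Rightarrow> bool" where
  "has_sobolev_derivative k I f g t \<longleftrightarrow> (\<forall>\<tau>\<in>I. f \<tau> \<in> sobolev k) \<and> g \<in> sobolev k \<and>
     (\<forall>\<alpha>. length \<alpha> \<le> k \<longrightarrow>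
        has_L2_derivative \<mu>S3 I (\<lambda>\<tau>. foldr sobolev_deriv \<alpha> (f \<tau>)) (foldr sobolev_deriv \<alpha> g) t)"


section \<open>Contact vector fields and brackets\<close>

definition S\<theta> :: "(c2 \<Rightarrow> real) \<Rightarrow> c2 \<Rightarrow> c2" where
  "S\<theta> f w = f w *\<^sub>R frame A1 w
     - (sobolev_deriv A3 f w / 2) *\<^sub>R frame A2 w + (sobolev_deriv A2 f w / 2) *\<^sub>R frame A3 w"

definition \<theta> :: "c2 \<Rightarrow> c2 \<Rightarrow> real" where
  "\<theta> w v = frame A1 w \<bullet> v"

text \<open>Since \<open>frame A1\<close> is linear, \<open>d\<theta> w u v = D\<^sub>u (\<theta> w v) - D\<^sub>v (\<theta> w u)\<close>.\<close>

definition d\<theta> :: "c2 \<Rightarrow> c2 \<Rightarrow> c2 \<Rightarrow> real" where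
  "d\<theta> w u v = \<theta> u v - \<theta> v u"

lemma S\<theta>_characterization:
  assumes "w \<in> S3"
  shows "\<theta> w (S\<theta> f w) = f w"
    and "d\<theta> w (S\<theta> f w) (frame A1 w) = 0"
    and "d\<theta> w (S\<theta> f w) (frame A2 w) = - sobolev_deriv A2 f w"
    and "d\<theta> w (S\<theta> f w) (frame A3 w) = - sobolev_deriv A3 f w"
proof -
  note o = frame_orthonormal(1)[OF assms]
  show "\<theta> w (S\<theta> f w) = f w"
    by (simp add: \<theta>_def S\<theta>_def inner_add_right inner_diff_right o del: frame.simps)
  have lin: "d\<theta> w (S\<theta> f w) v = f w * d\<theta> w (frame A1 w) v
      - sobolev_deriv A3 f w / 2 * d\<theta> w (frame A2 w) v
      + sobolev_deriv A2 f w / 2 * d\<theta> w (frame A3 w) v" for v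
    by (simp add: d\<theta>_def \<theta>_def S\<theta>_def inner_prod_def inner_complex_def scaleR_conv_of_real
        algebra_simps)
  have k: "d\<theta> w (frame A1 w) (frame A1 w) = 0" "d\<theta> w (frame A2 w) (frame A2 w) = 0"
    "d\<theta> w (frame A3 w) (frame A3 w) = 0" "d\<theta> w (frame A1 w) (frame A2 w) = 0"
    "d\<theta> w (frame A1 w) (frame A3 w) = 0" "d\<theta> w (frame A2 w) (frame A1 w) = 0"
    "d\<theta> w (frame A3 w) (frame A1 w) = 0"
    by (simp_all add: d\<theta>_def \<theta>_def inner_prod_def inner_complex_def algebra_simps)
  have "d\<theta> w (frame A2 w) (frame A3 w) = 2 * (frame A3 w \<bullet> frame A3 w)"
    "d\<theta> w (frame A3 w) (frame A2 w) = - 2 * (frame A3 w \<bullet> frame A3 w)"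
    by (simp_all add: d\<theta>_def \<theta>_def inner_prod_def inner_complex_def algebra_simps)
  hence k': "d\<theta> w (frame A2 w) (frame A3 w) = 2" "d\<theta> w (frame A3 w) (frame A2 w) = - 2"
    by (simp_all add: o del: frame.simps)
  show "d\<theta> w (S\<theta> f w) (frame A1 w) = 0"
    "d\<theta> w (S\<theta> f w) (frame A2 w) = - sobolev_deriv A2 f w"
    "d\<theta> w (S\<theta> f w) (frame A3 w) = - sobolev_deriv A3 f w"
    by (simp_all add: lin k k' del: frame.simps)
qed

definition field_deriv :: "(c2 \<Rightarrow> c2) \<Rightarrow> (c2 \<Rightarrow> real) \<Rightarrow> c2 \<Rightarrow> real" where
  "field_deriv u g w = (u w \<bullet> frame A1 w) * sobolev_deriv A1 g w
     + (u w \<bullet> frame A2 w) * sobolev_deriv A2 g w + (u w \<bullet> frame A3 w) * sobolev_deriv A3 g w"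

definition bracket :: "(c2 \<Rightarrow> real) \<Rightarrow> (c2 \<Rightarrow> real) \<Rightarrow> c2 \<Rightarrow> real" where
  "bracket f g = field_deriv (S\<theta> f) g"

text \<open>\<open>bracket_rev \<phi> f\<close> is \<open>{\<phi>,f}\<close>. For \<open>\<phi>\<close> not \<open>E\<close>-invariant, \<open>{\<phi>,f}\<close> is \<open>-(S\<theta> f)(\<phi>)\<close> and not \<open>(S\<theta> \<phi>)(f)\<close>.\<close>

definition bracket_rev :: "(c2 \<Rightarrow> real) \<Rightarrow> (c2 \<Rightarrow> real) \<Rightarrow> c2 \<Rightarrow> real" where
  "bracket_rev \<phi> f w = - bracket f \<phi> w"

text \<open>If \<open>\<phi>\<close> is not \<open>E\<close>-invariant, neither is \<open>{\<phi>,f}\<close>; the cocycle, which only tests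
  against \<open>E\<close>-invariant functions, sees its projection \<open>fibre_average\<close>.\<close>

definition fibre_average :: "(c2 \<Rightarrow> real) \<Rightarrow> c2 \<Rightarrow> real" where
  "fibre_average F w =
     (LBINT \<tau>:{0..2*pi}. F (cis \<tau> * fst w, cis \<tau> * snd w)) / (2 * pi)"


section \<open>The Hopf fibration and the sphere of radius \<open>1/2\<close>\<close>

text \<open>Functions on \<open>S\<^sup>2\<close> are identified with their lifts along \<open>hopf\<close>. Since \<open>hopf\<close> is a Riemannian
  submersion with fibres of length \<open>2\<pi>\<close>, \<open>\<nu>S2\<close> is \<open>2\<pi>\<close> times the area measure, and a function on
  \<open>S\<^sup>2\<close> is smooth iff its lift is.\<close>

type_synonym cr = "complex \<times> real"

abbreviation S2 :: "cr set" where "S2 \<equiv> sphere 0 (1/2)"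

definition hopf :: "c2 \<Rightarrow> cr" where
  "hopf w = (fst w * cnj (snd w), ((cmod (fst w))\<^sup>2 - (cmod (snd w))\<^sup>2) / 2)"

definition \<nu>S2 :: "cr measure" where
  "\<nu>S2 = distr \<mu>S3 (restrict_space borel S2) hopf"

definition smooth_S2 :: "(cr \<Rightarrow> real) set" where
  "smooth_S2 = {\<psi>. \<psi> \<circ> hopf \<in> smooth_S3}"

definition zcoord :: "cr \<Rightarrow> real" where
  "zcoord x = 2 * snd x"

text \<open>Laplace-Beltrami operator of the sphere of radius \<open>r\<close> about \<open>0\<close>: the Euclidean Laplacian of
  the extension which is constant along rays.\<close>

definition laplace_beltrami :: "real \<Rightarrow> ('a::euclidean_space \<Rightarrow> real) \<Rightarrow> 'a \<Rightarrow> real" where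
  "laplace_beltrami r \<psi> x =
     (\<Sum>b\<in>Basis. (deriv ^^ 2) (\<lambda>t. \<psi> ((r / norm (x + t *\<^sub>R b)) *\<^sub>R (x + t *\<^sub>R b))) 0)"

text \<open>The Laplacian is normalized as in the coordinates \<open>(z, \<lambda>)\<close>, where it reads
  \<open>\<partial>\<^sub>z ((1 - z\<^sup>2) \<partial>\<^sub>z) + (1 - z\<^sup>2)\<inverse> \<partial>\<^sub>\<lambda>\<^sup>2\<close>, i.e. \<open>r\<^sup>2\<close> times the Laplace-Beltrami operator of the
  sphere of radius \<open>r = 1/2\<close>. Because of the factors \<open>1/2\<close> in \<open>S\<theta>\<close>, this is the normalization
  for which the contact Laplacian is \<open>\<rho>\<^sup>2 - \<Delta>\<close>.\<close>

definition laplacian_S2 :: "(cr \<Rightarrow> real) \<Rightarrow> cr \<Rightarrow> real" where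
  "laplacian_S2 g = (SOME k. L2_closure \<nu>S2 smooth_S2
     (\<lambda>\<psi> x. (1/2)\<^sup>2 * laplace_beltrami (1/2) \<psi> x) g k)"

definition bracket_S2 :: "(cr \<Rightarrow> real) \<Rightarrow> (cr \<Rightarrow> real) \<Rightarrow> cr \<Rightarrow> real" where
  "bracket_S2 f g = (SOME b. b \<in> L2 \<nu>S2 \<and>
     (AE w in \<mu>S3. b (hopf w) = bracket (f \<circ> hopf) (g \<circ> hopf) w))"


section \<open>The Lie algebra of the quantomorphism group, its metric and contact Laplacian\<close>

text \<open>In the following, \<open>s\<close> is the Sobolev exponent of the group. Both \<open>ad\<^sup>*\<close> and the time
  derivative lose derivatives, hence \<open>ad\<^sup>*\<close> and \<open>T\<close> take values in \<open>quanto_fields 2\<close>, which contains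
  the Lie algebra \<open>quanto_fields (s + 1)\<close>; tests are against the Lie algebra itself.\<close>

definition quanto_fields :: "nat \<Rightarrow> (c2 \<Rightarrow> c2) set" where
  "quanto_fields k = S\<theta> ` sobolev_inv k"

definition inertia :: "(cr \<Rightarrow> real) \<Rightarrow> (c2 \<Rightarrow> c2) \<Rightarrow> c2 \<Rightarrow> c2" where
  "inertia \<rho> u w = ((\<rho> (hopf w))\<^sup>2 * (u w \<bullet> frame A1 w)) *\<^sub>R frame A1 w
     + (u w \<bullet> frame A2 w) *\<^sub>R frame A2 w + (u w \<bullet> frame A3 w) *\<^sub>R frame A3 w"

definition metric :: "(cr \<Rightarrow> real) \<Rightarrow> (c2 \<Rightarrow> c2) \<Rightarrow> (c2 \<Rightarrow> c2) \<Rightarrow> real" where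
  "metric \<rho> u v = (LINT w|\<mu>S3. inertia \<rho> u w \<bullet> v w)"

text \<open>Adjoint of \<open>S\<theta>\<close>, from the \<open>metric\<close> to the \<open>L\<^sup>2\<close> inner product on \<open>E\<close>-invariant functions.\<close>

definition S\<theta>_adj :: "nat \<Rightarrow> (cr \<Rightarrow> real) \<Rightarrow> (c2 \<Rightarrow> c2) \<Rightarrow> c2 \<Rightarrow> real" where
  "S\<theta>_adj s \<rho> v = (SOME m. m \<in> sobolev_inv 0 \<and>
     (\<forall>k\<in>sobolev_inv (s + 1). (LINT w|\<mu>S3. m w * k w) = metric \<rho> v (S\<theta> k)))"

definition contact_laplacian :: "nat \<Rightarrow> (cr \<Rightarrow> real) \<Rightarrow> (c2 \<Rightarrow> real) \<Rightarrow> c2 \<Rightarrow> real" where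
  "contact_laplacian s \<rho> f = S\<theta>_adj s \<rho> (S\<theta> f)"

definition contact_laplacian_invertible :: "nat \<Rightarrow> (cr \<Rightarrow> real) \<Rightarrow> bool" where
  "contact_laplacian_invertible s \<rho> \<longleftrightarrow>
     (\<forall>k\<in>sobolev_inv 0. \<exists>p\<in>sobolev_inv 2. AE w in \<mu>S3. contact_laplacian s \<rho> p w = k w) \<and>
     (\<forall>p\<in>sobolev_inv 2. \<forall>q\<in>sobolev_inv 2.
        (AE w in \<mu>S3. contact_laplacian s \<rho> p w = contact_laplacian s \<rho> q w) \<longrightarrow>
        (AE w in \<mu>S3. p w = q w))"

definition lie_bracket :: "(c2 \<Rightarrow> c2) \<Rightarrow> (c2 \<Rightarrow> c2) \<Rightarrow> c2 \<Rightarrow> c2" where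
  "lie_bracket u v = S\<theta> (bracket (\<lambda>w. \<theta> w (u w)) (\<lambda>w. \<theta> w (v w)))"

definition ad :: "(c2 \<Rightarrow> c2) \<Rightarrow> (c2 \<Rightarrow> c2) \<Rightarrow> c2 \<Rightarrow> c2" where
  "ad u v w = - lie_bracket u v w"

definition ad_star :: "nat \<Rightarrow> (cr \<Rightarrow> real) \<Rightarrow> (c2 \<Rightarrow> c2) \<Rightarrow> (c2 \<Rightarrow> c2) \<Rightarrow> c2 \<Rightarrow> c2" where
  "ad_star s \<rho> u v = (SOME x. x \<in> quanto_fields 2 \<and>
     (\<forall>y\<in>quanto_fields (s + 1). metric \<rho> x y = metric \<rho> v (ad u y)))"


section \<open>The central extension and its Euler-Arnold equation\<close>

definition cocycle :: "(c2 \<Rightarrow> real) \<Rightarrow> (c2 \<Rightarrow> c2) \<Rightarrow> (c2 \<Rightarrow> c2) \<Rightarrow> real" where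
  "cocycle \<phi> u v =
     (LINT w|\<mu>S3. \<phi> w * bracket (\<lambda>w. \<theta> w (u w)) (\<lambda>w. \<theta> w (v w)) w)"

definition T_op :: "nat \<Rightarrow> (cr \<Rightarrow> real) \<Rightarrow> (c2 \<Rightarrow> real) \<Rightarrow> (c2 \<Rightarrow> c2) \<Rightarrow> c2 \<Rightarrow> c2" where
  "T_op s \<rho> \<phi> u = (SOME x. x \<in> quanto_fields 2 \<and>
     (\<forall>y\<in>quanto_fields (s + 1). metric \<rho> x y = cocycle \<phi> u y))"

definition ext_bracket ::
  "(c2 \<Rightarrow> real) \<Rightarrow> (c2 \<Rightarrow> c2) \<times> real \<Rightarrow> (c2 \<Rightarrow> c2) \<times> real \<Rightarrow> (c2 \<Rightarrow> c2) \<times> real" where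
  "ext_bracket \<phi> X Y = (lie_bracket (fst X) (fst Y), cocycle \<phi> (fst X) (fst Y))"

definition ext_ad ::
  "(c2 \<Rightarrow> real) \<Rightarrow> (c2 \<Rightarrow> c2) \<times> real \<Rightarrow> (c2 \<Rightarrow> c2) \<times> real \<Rightarrow> (c2 \<Rightarrow> c2) \<times> real" where
  "ext_ad \<phi> X Y = ((\<lambda>w. - fst (ext_bracket \<phi> X Y) w), - snd (ext_bracket \<phi> X Y))"

definition ext_metric ::
  "(cr \<Rightarrow> real) \<Rightarrow> (c2 \<Rightarrow> c2) \<times> real \<Rightarrow> (c2 \<Rightarrow> c2) \<times> real \<Rightarrow> real" where
  "ext_metric \<rho> X Y = metric \<rho> (fst X) (fst Y) + snd X * snd Y"

definition ext_ad_star ::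
  "nat \<Rightarrow> (cr \<Rightarrow> real) \<Rightarrow> (c2 \<Rightarrow> real) \<Rightarrow> (c2 \<Rightarrow> c2) \<times> real \<Rightarrow> (c2 \<Rightarrow> c2) \<times> real \<Rightarrow> (c2 \<Rightarrow> c2) \<times> real" where
  "ext_ad_star s \<rho> \<phi> X Y = (SOME Z. Z \<in> quanto_fields 2 \<times> UNIV \<and>
     (\<forall>W\<in>quanto_fields (s + 1) \<times> UNIV. ext_metric \<rho> Z W = ext_metric \<rho> Y (ext_ad \<phi> X W)))"

text \<open>\<open>\<partial>\<^sub>t X + ad\<^sup>*\<^sub>X X = 0\<close> for the curve \<open>X = (u, a)\<close>.\<close>

definition euler_arnold ::
  "nat \<Rightarrow> (cr \<Rightarrow> real) \<Rightarrow> (c2 \<Rightarrow> real) \<Rightarrow> real set \<Rightarrow> (real \<Rightarrow> c2 \<Rightarrow> c2) \<Rightarrow> (real \<Rightarrow> real) \<Rightarrow> bool" where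
  "euler_arnold s \<rho> \<phi> I u a \<longleftrightarrow> (\<forall>t\<in>I. let Z = ext_ad_star s \<rho> \<phi> (u t, a t) (u t, a t) in
     has_L2_derivative \<mu>S3 I u (\<lambda>w. - fst Z w) t \<and> (a has_real_derivative - snd Z) (at t within I))"

text \<open>\<open>\<partial>\<^sub>t u + ad\<^sup>*\<^sub>u u - c T u = 0\<close> at time \<open>t\<close>, for \<open>u = S\<theta> f\<close>.\<close>

definition field_equation ::
  "nat \<Rightarrow> (cr \<Rightarrow> real) \<Rightarrow> (c2 \<Rightarrow> real) \<Rightarrow> real set \<Rightarrow> (real \<Rightarrow> c2 \<Rightarrow> real) \<Rightarrow> real \<Rightarrow> real \<Rightarrow> bool" where
  "field_equation s \<rho> \<phi> I f c t \<longleftrightarrow> has_L2_derivative \<mu>S3 I (\<lambda>\<tau>. S\<theta> (f \<tau>))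
     (\<lambda>w. - (ad_star s \<rho> (S\<theta> (f t)) (S\<theta> (f t)) w - c *\<^sub>R T_op s \<rho> \<phi> (S\<theta> (f t)) w)) t"

text \<open>\<open>\<partial>\<^sub>t \<Delta>f + {f, \<Delta>f} - c R = 0\<close> at time \<open>t\<close>, with \<open>\<Delta>\<close> the contact Laplacian.\<close>

definition function_equation ::
  "nat \<Rightarrow> (cr \<Rightarrow> real) \<Rightarrow> real set \<Rightarrow> (real \<Rightarrow> c2 \<Rightarrow> real) \<Rightarrow> real \<Rightarrow> (c2 \<Rightarrow> real) \<Rightarrow> real \<Rightarrow> bool" where
  "function_equation s \<rho> I f c R t \<longleftrightarrow>
     has_L2_derivative \<mu>S3 I (\<lambda>\<tau>. contact_laplacian s \<rho> (f \<tau>))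
       (\<lambda>w. - (bracket (f t) (contact_laplacian s \<rho> (f t)) w - c * R w)) t"

text \<open>\<open>\<partial>\<^sub>t m + u(m) = 0\<close> for a curve \<open>m\<close> of functions on \<open>S\<^sup>2\<close>, with velocity \<open>u = S\<theta> f\<close>.\<close>

definition transported_S2 ::
  "real set \<Rightarrow> (real \<Rightarrow> cr \<Rightarrow> real) \<Rightarrow> (real \<Rightarrow> cr \<Rightarrow> real) \<Rightarrow> bool" where
  "transported_S2 I f m \<longleftrightarrow> (\<forall>t\<in>I. has_L2_derivative \<mu>S3 I (\<lambda>\<tau>. m \<tau> \<circ> hopf)
     (\<lambda>w. - field_deriv (S\<theta> (f t \<circ> hopf)) (m t \<circ> hopf) w) t)"

end

theory Submission
  imports Defs
begin

text \<open>
  The metric \<open>\<langle>S\<theta> f, S\<theta> k\<rangle>\<close> is the \<open>L\<^sup>2\<close> inner product of \<open>\<Delta> f\<close> and \<open>k\<close>, where \<open>\<Delta> = \<rho>\<^sup>2 - (E\<^sub>2\<^sup>2 + E\<^sub>3\<^sup>2) / 4\<close> is the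
  contact Laplacian (\<open>contact_laplacian_AE\<close>). So a field that is defined by its metric products with the Lie algebra
  is \<open>S\<theta> (\<Delta>\<^sup>-\<^sup>1 K)\<close> as soon as these products are the inner products with an invariant function \<open>K\<close>; the
  predicate \<open>represents\<close> records this. Since \<open>S\<theta> f\<close> is divergence free,
  \<open>\<integral> \<phi> {f, k} = - \<integral> {f, \<phi>} k\<close> (\<open>bracket_integration_by_parts\<close>), and it follows that \<open>ad\<^sup>*\<close> of \<open>S\<theta> f\<close> on itself
  is represented by \<open>{f, \<Delta> f}\<close> and \<open>T (S\<theta> f)\<close> by \<open>{\<phi>, f}\<close>, or by its fibre average if \<open>\<phi>\<close> is not invariant. The
  extended \<open>ad\<^sup>*\<close> is represented by \<open>{f, \<Delta> f} - a {\<phi>, f}\<close> and has vanishing central component, which gives the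
  Euler-Arnold equation and the constancy of \<open>a\<close> (\<open>euler_arnold_iff\<close>). Applying \<open>\<Delta>\<close>, which is injective and
  commutes with the time derivative, turns the equation of fields into the one of functions
  (\<open>field_equation_iff_function_equation\<close>).

  All functions involved have only Sobolev regularity. The analysis rests on the orthogonal projections \<open>proj n\<close> of
  \<open>L\<^sup>2 (S\<^sup>3)\<close> to the polynomials of degree at most \<open>n\<close>. The frame derivatives preserve these finite-dimensional
  spaces and are antisymmetric, hence they commute with \<open>proj n\<close>; as the polynomials are dense, the smooth functions
  \<open>proj n f\<close> approximate \<open>f\<close> together with all derivatives that it has, and they are invariant if \<open>f\<close> is. Products
  are controlled by an elementary Sobolev embedding (\<open>sobolev_uniform_approximation\<close>): three derivatives in
  \<open>L\<^sup>2\<close> give uniform convergence, so that \<open>H\<^sup>4\<close> functions have bounded first derivatives, and the brackets of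
  \<open>f \<in> H\<^sup>4\<close> with \<open>H\<^sup>1\<close> functions are in \<open>L\<^sup>2\<close>.

  For the equations on \<open>S\<^sup>2\<close>, invariant functions descend along the Hopf fibration (\<open>inv_descends\<close>). Horizontal great
  circles of \<open>S\<^sup>3\<close> project to great circles of \<open>S\<^sup>2\<close>, and computing the Laplace-Beltrami operator along them gives
  \<open>E\<^sub>2\<^sup>2 + E\<^sub>3\<^sup>2\<close> applied to the lift (\<open>laplace_beltrami_hopf\<close>). Therefore \<open>\<gamma> z\<^sup>2 - \<Delta>\<close> on \<open>S\<^sup>2\<close> lifts to the contact
  Laplacian, and all forms of the equation on \<open>S\<^sup>2\<close> lift to the same equation (\<open>sphere_equations\<close>).
\<close>

section \<open>Calculus in \<open>L\<^sup>2\<close>\<close>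

lemma L2_real_iff: "f \<in> L2 M \<longleftrightarrow> f \<in> borel_measurable M \<and> integrable M (\<lambda>x. (f x)\<^sup>2)"
  for f :: "'a \<Rightarrow> real"
  by (simp add: L2_def)

lemma L2_measurable: "f \<in> L2 M \<Longrightarrow> f \<in> borel_measurable M"
  by (simp add: L2_def)

lemma L2_integrable_norm2: "f \<in> L2 M \<Longrightarrow> integrable M (\<lambda>x. (norm (f x))\<^sup>2)"
  by (simp add: L2_def)

lemma L2_integrable_sq: "f \<in> L2 M \<Longrightarrow> integrable M (\<lambda>x. (f x)\<^sup>2)" for f :: "'a \<Rightarrow> real"
  by (simp add: L2_real_iff)

lemma norm_add_sq_le: "(norm (a + b))\<^sup>2 \<le> 2 * (norm a)\<^sup>2 + 2 * (norm b)\<^sup>2"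
  for a b :: "'a::real_normed_vector"
proof -
  have "(norm (a + b))\<^sup>2 \<le> (norm a + norm b)\<^sup>2"
    by (intro power_mono norm_triangle_ineq norm_ge_zero)
  also have "\<dots> \<le> 2 * (norm a)\<^sup>2 + 2 * (norm b)\<^sup>2"
    using sum_squares_bound[of "norm a" "norm b"] by (simp add: power2_sum)
  finally show ?thesis .
qed

lemma L2_add:
  fixes f g :: "'a \<Rightarrow> 'b::{second_countable_topology, real_normed_vector}"
  assumes f: "f \<in> L2 M" and g: "g \<in> L2 M" shows "(\<lambda>x. f x + g x) \<in> L2 M"
proof -
  note [measurable] = L2_measurable[OF f] L2_measurable[OF g]
  have "integrable M (\<lambda>x. (norm (f x + g x))\<^sup>2)"
    by (rule Bochner_Integration.integrable_bound[where
          f = "\<lambda>x. 2 * (norm (f x))\<^sup>2 + 2 * (norm (g x))\<^sup>2"])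
       (use L2_integrable_norm2[OF f] L2_integrable_norm2[OF g] in
         \<open>auto simp: norm_add_sq_le\<close>)
  then show ?thesis by (simp add: L2_def)
qed

lemma L2_scaleR:
  fixes f :: "'a \<Rightarrow> 'b::{second_countable_topology, real_normed_vector}"
  assumes f: "f \<in> L2 M" shows "(\<lambda>x. c *\<^sub>R f x) \<in> L2 M"
  using L2_integrable_norm2[OF f] L2_measurable[OF f] by (simp add: L2_def power_mult_distrib)

lemma L2_scale: "f \<in> L2 M \<Longrightarrow> (\<lambda>x. c * f x) \<in> L2 M" for f :: "'a \<Rightarrow> real"
  using L2_scaleR[of f M c] by simp

lemma L2_minus:
  fixes f :: "'a \<Rightarrow> 'b::{second_countable_topology, real_normed_vector}"
  shows "f \<in> L2 M \<Longrightarrow> (\<lambda>x. - f x) \<in> L2 M"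
  using L2_scaleR[of f M "-1"] by simp

lemma L2_diff:
  fixes f g :: "'a \<Rightarrow> 'b::{second_countable_topology, real_normed_vector}"
  shows "f \<in> L2 M \<Longrightarrow> g \<in> L2 M \<Longrightarrow> (\<lambda>x. f x - g x) \<in> L2 M"
  using L2_add[OF _ L2_minus, of f M g] by simp

lemma L2_zero [simp]: "(\<lambda>x. 0 :: 'b::real_normed_vector) \<in> L2 M"
  by (simp add: L2_def)

lemma L2_sum:
  assumes "\<And>i. i \<in> A \<Longrightarrow> f i \<in> L2 M" shows "(\<lambda>x. \<Sum>i\<in>A. f i x :: real) \<in> L2 M"
  using assms by (induction A rule: infinite_finite_induct) (auto intro: L2_add)

lemma L2_cong_AE:
  fixes f g :: "'a \<Rightarrow> 'b::real_normed_vector"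
  assumes f: "f \<in> L2 M" and g: "g \<in> borel_measurable M" and ae: "AE x in M. f x = g x"
  shows "g \<in> L2 M"
proof -
  have "integrable M (\<lambda>x. (norm (g x))\<^sup>2)"
    by (rule integrable_cong_AE_imp[OF L2_integrable_norm2[OF f]])
       (use g L2_measurable[OF f] ae in auto)
  then show ?thesis using g by (simp add: L2_def)
qed

lemma L2_mult_integrable:
  fixes f g :: "'a \<Rightarrow> real"
  assumes f: "f \<in> L2 M" and g: "g \<in> L2 M" shows "integrable M (\<lambda>x. f x * g x)"
proof (rule Bochner_Integration.integrable_bound[where f = "\<lambda>x. (f x)\<^sup>2 + (g x)\<^sup>2"])
  show "integrable M (\<lambda>x. (f x)\<^sup>2 + (g x)\<^sup>2)"
    using L2_integrable_sq[OF f] L2_integrable_sq[OF g] by simp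
  show "(\<lambda>x. f x * g x) \<in> borel_measurable M"
    using L2_measurable[OF f] L2_measurable[OF g] by simp
  have "\<bar>a * b\<bar> \<le> a\<^sup>2 + b\<^sup>2" for a b :: real
    using sum_squares_bound[of "\<bar>a\<bar>" "\<bar>b\<bar>"] mult_nonneg_nonneg[of "\<bar>a\<bar>" "\<bar>b\<bar>"]
    unfolding abs_mult power2_abs by linarith
  then show "AE x in M. norm (f x * g x) \<le> norm ((f x)\<^sup>2 + (g x)\<^sup>2)" by auto
qed

lemma L2_bounded_mult:
  fixes u f :: "'a \<Rightarrow> real"
  assumes u: "u \<in> borel_measurable M" "AE x in M. \<bar>u x\<bar> \<le> B" and f: "f \<in> L2 M"
  shows "(\<lambda>x. u x * f x) \<in> L2 M"
proof -
  note [measurable] = u(1) L2_measurable[OF f]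
  have "integrable M (\<lambda>x. (u x * f x)\<^sup>2)"
  proof (rule Bochner_Integration.integrable_bound[where f = "\<lambda>x. B\<^sup>2 * (f x)\<^sup>2"])
    show "AE x in M. norm ((u x * f x)\<^sup>2) \<le> norm (B\<^sup>2 * (f x)\<^sup>2)"
      using u(2)
    proof eventually_elim
      case (elim x)
      then have "(u x)\<^sup>2 \<le> B\<^sup>2" by (metis abs_ge_zero power2_abs power_mono)
      then show ?case by (simp add: power_mult_distrib mult_right_mono)
    qed
  qed (use L2_integrable_sq[OF f] in auto)
  then show ?thesis by (simp add: L2_real_iff)
qed

lemma (in finite_measure) L2_bounded:
  assumes "u \<in> borel_measurable M" "AE x in M. \<bar>u x :: real\<bar> \<le> B" shows "u \<in> L2 M"
proof -
  have "(\<lambda>x. 1 :: real) \<in> L2 M" by (simp add: L2_def)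
  from L2_bounded_mult[OF assms this] show ?thesis by simp
qed

lemma (in finite_measure) L2_integrable:
  assumes "f \<in> L2 M" shows "integrable M (f :: 'a \<Rightarrow> real)"
proof -
  have "(\<lambda>x. 1 :: real) \<in> L2 M" by (simp add: L2_def)
  from L2_mult_integrable[OF assms this] show ?thesis by simp
qed

lemma nonneg_quadratic_form_discriminant:
  fixes a b c :: real
  assumes q: "\<And>s t. 0 \<le> s\<^sup>2 * a + 2 * s * t * b + t\<^sup>2 * c"
  shows "b\<^sup>2 \<le> a * c"
proof -
  have a0: "0 \<le> a" and c0: "0 \<le> c" using q[of 1 0] q[of 0 1] by auto
  show ?thesis
  proof (cases "c = 0")
    case True
    have "b = 0"
    proof (rule ccontr)
      assume b: "b \<noteq> 0"
      have "(2 * b)\<^sup>2 * a + 2 * (2 * b) * (- (a + 1)) * b = - (4 * b\<^sup>2)"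
        by (simp add: power2_eq_square algebra_simps)
      with q[of "2 * b" "- (a + 1)"] True have "0 \<le> - (4 * b\<^sup>2)" by simp
      then show False using b by simp
    qed
    then show ?thesis using a0 c0 by simp
  next
    case False
    have "c\<^sup>2 * a + 2 * c * (- b) * b + (- b)\<^sup>2 * c = c * (a * c - b\<^sup>2)"
      by (simp add: power2_eq_square algebra_simps)
    with q[of c "- b"] have "0 \<le> c * (a * c - b\<^sup>2)" by simp
    then show ?thesis using False c0 by (simp add: zero_le_mult_iff)
  qed
qed

lemma L2_Cauchy_Schwarz:
  fixes f g :: "'a \<Rightarrow> real"
  assumes f: "f \<in> L2 M" and g: "g \<in> L2 M"
  shows "(LINT x|M. f x * g x)\<^sup>2 \<le> (LINT x|M. (f x)\<^sup>2) * (LINT x|M. (g x)\<^sup>2)"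
proof (rule nonneg_quadratic_form_discriminant)
  fix s t :: real
  have eq: "(s * f x + t * g x)\<^sup>2 = s\<^sup>2 * (f x)\<^sup>2 + 2 * s * t * (f x * g x) + t\<^sup>2 * (g x)\<^sup>2" for x
    by (simp add: power2_eq_square algebra_simps)
  have "0 \<le> (LINT x|M. (s * f x + t * g x)\<^sup>2)" by simp
  also have "\<dots> = (LINT x|M. s\<^sup>2 * (f x)\<^sup>2 + 2 * s * t * (f x * g x) + t\<^sup>2 * (g x)\<^sup>2)"
    by (simp only: eq)
  also have "\<dots> = s\<^sup>2 * (LINT x|M. (f x)\<^sup>2) + 2 * s * t * (LINT x|M. f x * g x)
      + t\<^sup>2 * (LINT x|M. (g x)\<^sup>2)"
    using L2_integrable_sq[OF f] L2_integrable_sq[OF g] L2_mult_integrable[OF f g] by simp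
  finally show "0 \<le> s\<^sup>2 * (LINT x|M. (f x)\<^sup>2) + 2 * s * t * (LINT x|M. f x * g x)
      + t\<^sup>2 * (LINT x|M. (g x)\<^sup>2)" .
qed

lemma L2_tendsto_real:
  "L2_tendsto M F f Fl \<longleftrightarrow> ((\<lambda>i. LINT x|M. (F i x - f x)\<^sup>2) \<longlongrightarrow> 0) Fl" for f :: "'a \<Rightarrow> real"
  by (simp add: L2_tendsto_def)

lemma L2_tendsto_inner:
  fixes F G :: "'i \<Rightarrow> 'a \<Rightarrow> real"
  assumes F: "L2_tendsto M F f Fl" "\<forall>\<^sub>F i in Fl. F i \<in> L2 M" and f: "f \<in> L2 M"
    and G: "L2_tendsto M G g Fl" "\<forall>\<^sub>F i in Fl. G i \<in> L2 M" and g: "g \<in> L2 M"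
  shows "((\<lambda>i. LINT x|M. F i x * G i x) \<longlongrightarrow> (LINT x|M. f x * g x)) Fl"
proof -
  let ?a = "\<lambda>i. LINT x|M. (F i x - f x)\<^sup>2" and ?b = "\<lambda>i. LINT x|M. (G i x - g x)\<^sup>2"
  let ?r = "\<lambda>i. sqrt (?a i * ?b i) + sqrt (?a i * (LINT x|M. (g x)\<^sup>2))
    + sqrt ((LINT x|M. (f x)\<^sup>2) * ?b i)"
  have "(?r \<longlongrightarrow> sqrt (0 * 0) + sqrt (0 * (LINT x|M. (g x)\<^sup>2)) + sqrt ((LINT x|M. (f x)\<^sup>2) * 0)) Fl"
    using F(1) G(1) unfolding L2_tendsto_real by (intro tendsto_intros)
  then have r: "(?r \<longlongrightarrow> 0) Fl" by simp
  have "\<forall>\<^sub>F i in Fl. norm ((LINT x|M. F i x * G i x) - (LINT x|M. f x * g x)) \<le> ?r i"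
    using F(2) G(2)
  proof eventually_elim
    case (elim i)
    note Fi = L2_diff[OF elim(1) f] and Gi = L2_diff[OF elim(2) g]
    have CS: "\<bar>LINT x|M. u x * v x\<bar> \<le> sqrt ((LINT x|M. (u x)\<^sup>2) * (LINT x|M. (v x)\<^sup>2))"
      if "u \<in> L2 M" "v \<in> L2 M" for u v :: "'a \<Rightarrow> real"
      using L2_Cauchy_Schwarz[OF that] by (simp add: real_le_rsqrt)
    have "(LINT x|M. F i x * G i x) - (LINT x|M. f x * g x)
      = (LINT x|M. F i x * G i x - f x * g x)"
      using L2_mult_integrable[OF elim] L2_mult_integrable[OF f g] by simp
    also have "\<dots> = (LINT x|M. (F i x - f x) * (G i x - g x) + (F i x - f x) * g x
        + f x * (G i x - g x))"
      by (intro Bochner_Integration.integral_cong) (auto simp: algebra_simps)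
    also have "\<dots> = (LINT x|M. (F i x - f x) * (G i x - g x)) + (LINT x|M. (F i x - f x) * g x)
        + (LINT x|M. f x * (G i x - g x))"
      using L2_mult_integrable[OF Fi Gi] L2_mult_integrable[OF Fi g] L2_mult_integrable[OF f Gi]
      by (simp del: right_diff_distrib left_diff_distrib)
    finally show ?case
      using CS[OF Fi Gi] CS[OF Fi g] CS[OF f Gi] by simp
  qed
  from Lim_null_comparison[OF this r] show ?thesis by (simp add: LIM_zero_iff)
qed

lemma L2_zero_AE:
  fixes f :: "'a \<Rightarrow> real"
  assumes "f \<in> L2 M" "(LINT x|M. (f x)\<^sup>2) = 0" shows "AE x in M. f x = 0"
  using integral_nonneg_eq_0_iff_AE[OF L2_integrable_sq[OF assms(1)]] assms(2) by auto

lemma L2_tendsto_cong_AE: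
  assumes "\<forall>\<^sub>F i in Fl. AE x in M. F i x = G i x" "AE x in M. f x = g x"
    and "\<forall>\<^sub>F i in Fl. F i \<in> borel_measurable M" "\<forall>\<^sub>F i in Fl. G i \<in> borel_measurable M"
    and [measurable]: "f \<in> borel_measurable M" "g \<in> borel_measurable M"
  shows "L2_tendsto M F (f :: 'a \<Rightarrow> 'b::{second_countable_topology, real_normed_vector}) Fl
    \<longleftrightarrow> L2_tendsto M G g Fl"
  unfolding L2_tendsto_def
proof (rule tendsto_cong)
  show "\<forall>\<^sub>F i in Fl. (LINT x|M. (norm (F i x - f x))\<^sup>2) = (LINT x|M. (norm (G i x - g x))\<^sup>2)"
    using assms(1,3,4)
  proof eventually_elim
    case (elim i)
    note [measurable] = elim(2,3)
    show ?case
      by (rule integral_cong_AE) (use elim(1) assms(2) in auto)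
  qed
qed

lemma L2_tendsto_add:
  fixes F G :: "'i \<Rightarrow> 'a \<Rightarrow> 'b::{second_countable_topology, real_normed_vector}"
  assumes F: "L2_tendsto M F f Fl" "\<forall>\<^sub>F i in Fl. F i \<in> L2 M" and f: "f \<in> L2 M"
    and G: "L2_tendsto M G g Fl" "\<forall>\<^sub>F i in Fl. G i \<in> L2 M" and g: "g \<in> L2 M"
  shows "L2_tendsto M (\<lambda>i x. F i x + G i x) (\<lambda>x. f x + g x) Fl"
proof -
  let ?a = "\<lambda>i. LINT x|M. (norm (F i x - f x))\<^sup>2" and ?b = "\<lambda>i. LINT x|M. (norm (G i x - g x))\<^sup>2"
  have r: "((\<lambda>i. 2 * ?a i + 2 * ?b i) \<longlongrightarrow> 0) Fl"
    using tendsto_add[OF tendsto_mult_left[OF F(1)[unfolded L2_tendsto_def], of 2]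
        tendsto_mult_left[OF G(1)[unfolded L2_tendsto_def], of 2]] by simp
  have "\<forall>\<^sub>F i in Fl. norm (LINT x|M. (norm (F i x + G i x - (f x + g x)))\<^sup>2) \<le> 2 * ?a i + 2 * ?b i"
    using F(2) G(2)
  proof eventually_elim
    case (elim i)
    note Fi = L2_diff[OF elim(1) f] and Gi = L2_diff[OF elim(2) g]
    note ints = L2_integrable_norm2[OF Fi] L2_integrable_norm2[OF Gi]
    have "(LINT x|M. (norm (F i x + G i x - (f x + g x)))\<^sup>2)
        = (LINT x|M. (norm ((F i x - f x) + (G i x - g x)))\<^sup>2)" by (simp add: algebra_simps)
    also have "\<dots> \<le> (LINT x|M. 2 * (norm (F i x - f x))\<^sup>2 + 2 * (norm (G i x - g x))\<^sup>2)"
      by (intro integral_mono L2_integrable_norm2[OF L2_add[OF Fi Gi]] norm_add_sq_le)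
        (use ints in auto)
    also have "\<dots> = 2 * ?a i + 2 * ?b i" using ints by simp
    finally show ?case by simp
  qed
  from Lim_null_comparison[OF this r] show ?thesis by (simp add: L2_tendsto_def)
qed

lemma L2_tendsto_scale:
  fixes f :: "'a \<Rightarrow> real"
  assumes "L2_tendsto M F f Fl" shows "L2_tendsto M (\<lambda>i x. c * F i x) (\<lambda>x. c * f x) Fl"
proof -
  have "((\<lambda>i. c\<^sup>2 * (LINT x|M. (F i x - f x)\<^sup>2)) \<longlongrightarrow> c\<^sup>2 * 0) Fl"
    using assms unfolding L2_tendsto_real by (intro tendsto_intros)
  also have "(\<lambda>i. c\<^sup>2 * (LINT x|M. (F i x - f x)\<^sup>2)) = (\<lambda>i. LINT x|M. (c * F i x - c * f x)\<^sup>2)"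
    by (simp add: power_mult_distrib flip: right_diff_distrib)
  finally show ?thesis by (simp add: L2_tendsto_real)
qed

lemma L2_tendsto_diff:
  fixes F G :: "'i \<Rightarrow> 'a \<Rightarrow> real"
  assumes F: "L2_tendsto M F f Fl" "\<forall>\<^sub>F i in Fl. F i \<in> L2 M" and f: "f \<in> L2 M"
    and G: "L2_tendsto M G g Fl" "\<forall>\<^sub>F i in Fl. G i \<in> L2 M" and g: "g \<in> L2 M"
  shows "L2_tendsto M (\<lambda>i x. F i x - G i x) (\<lambda>x. f x - g x) Fl"
proof -
  have "L2_tendsto M (\<lambda>i x. F i x + (-1) * G i x) (\<lambda>x. f x + (-1) * g x) Fl"
    by (rule L2_tendsto_add[OF F f L2_tendsto_scale[OF G(1)]])
       (use G(2) g in \<open>auto elim: eventually_mono intro: L2_minus\<close>)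
  then show ?thesis by simp
qed

lemma L2_tendsto_const [simp]: "L2_tendsto M (\<lambda>i. f) f Fl"
  by (simp add: L2_tendsto_def)

lemma L2_tendsto_bounded_mult:
  fixes f :: "'a \<Rightarrow> real"
  assumes F: "L2_tendsto M F f Fl" "\<forall>\<^sub>F i in Fl. F i \<in> L2 M" and f: "f \<in> L2 M"
    and u: "u \<in> borel_measurable M" "AE x in M. \<bar>u x\<bar> \<le> B"
  shows "L2_tendsto M (\<lambda>i x. u x * F i x) (\<lambda>x. u x * f x) Fl"
proof -
  have r: "((\<lambda>i. B\<^sup>2 * (LINT x|M. (F i x - f x)\<^sup>2)) \<longlongrightarrow> 0) Fl"
    using tendsto_mult_left[OF F(1)[unfolded L2_tendsto_real], of "B\<^sup>2"] by simp
  have "\<forall>\<^sub>F i in Fl. norm (LINT x|M. (u x * F i x - u x * f x)\<^sup>2) \<le> B\<^sup>2 * (LINT x|M. (F i x - f x)\<^sup>2)"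
    using F(2)
  proof eventually_elim
    case (elim i)
    note Fi = L2_diff[OF elim f]
    have "(LINT x|M. (u x * (F i x - f x))\<^sup>2) \<le> (LINT x|M. B\<^sup>2 * (F i x - f x)\<^sup>2)"
    proof (rule integral_mono_AE)
      show "AE x in M. (u x * (F i x - f x))\<^sup>2 \<le> B\<^sup>2 * (F i x - f x)\<^sup>2"
        using u(2)
      proof eventually_elim
        case (elim x)
        then have "(u x)\<^sup>2 \<le> B\<^sup>2" by (metis abs_ge_zero power2_abs power_mono)
        then show ?case by (simp add: power_mult_distrib mult_right_mono)
      qed
    qed (use L2_integrable_sq[OF L2_bounded_mult[OF u Fi]] L2_integrable_sq[OF Fi] in auto)
    then show ?case by (simp add: right_diff_distrib)
  qed
  from Lim_null_comparison[OF this r] show ?thesis by (simp add: L2_tendsto_real)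
qed

lemma L2_tendsto_unique:
  fixes f g :: "'a \<Rightarrow> real"
  assumes "Fl \<noteq> bot" "L2_tendsto M F f Fl" "L2_tendsto M F g Fl"
    "\<forall>\<^sub>F i in Fl. F i \<in> L2 M" "f \<in> L2 M" "g \<in> L2 M"
  shows "AE x in M. f x = g x"
proof -
  have "L2_tendsto M (\<lambda>i x. F i x - F i x) (\<lambda>x. f x - g x) Fl"
    by (intro L2_tendsto_diff assms)
  then have "((\<lambda>i. LINT x|M. (0 - (f x - g x))\<^sup>2) \<longlongrightarrow> 0) Fl"
    unfolding L2_tendsto_real diff_self .
  then have "(LINT x|M. (0 - (f x - g x))\<^sup>2) = 0"
    by (rule tendsto_unique[OF assms(1) tendsto_const])
  then have "AE x in M. 0 - (f x - g x) = 0"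
    by (rule L2_zero_AE[OF L2_diff[OF L2_zero L2_diff[OF assms(5,6)]]])
  then show ?thesis by eventually_elim simp
qed

lemma L2_tendsto_AE_subseq:
  fixes f :: "'a \<Rightarrow> real"
  assumes F: "L2_tendsto M F f sequentially" "\<And>n. F n \<in> L2 M" and f: "f \<in> L2 M"
  shows "\<exists>r. strict_mono r \<and> (AE x in M. (\<lambda>n. F (r n) x) \<longlonglongrightarrow> f x)"
proof -
  have "\<exists>r::nat\<Rightarrow>nat. strict_mono r \<and> (AE x in M. (\<lambda>n. (F (r n) x - f x)\<^sup>2) \<longlonglongrightarrow> 0)"
    by (rule tendsto_L1_AE_subseq)
       (use L2_integrable_sq[OF L2_diff[OF F(2) f]] F(1) in \<open>auto simp: L2_tendsto_real\<close>)
  then obtain r :: "nat \<Rightarrow> nat" where r: "strict_mono r"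
      "AE x in M. (\<lambda>n. (F (r n) x - f x)\<^sup>2) \<longlonglongrightarrow> 0" by blast
  from r(2) have "AE x in M. (\<lambda>n. F (r n) x) \<longlonglongrightarrow> f x"
  proof eventually_elim
    case (elim x)
    then have "(\<lambda>n. sqrt ((F (r n) x - f x)\<^sup>2)) \<longlonglongrightarrow> sqrt 0" by (rule tendsto_real_sqrt)
    then show ?case by (simp add: tendsto_rabs_zero_iff LIM_zero_iff)
  qed
  with r(1) show ?thesis by blast
qed

section \<open>Isometry invariance of Lebesgue measure and of the measure of \<open>S\<^sup>3\<close>\<close>

lemma nn_integral_lborel_translate:
  fixes t :: "'a::euclidean_space"
  assumes [measurable]: "h \<in> borel_measurable borel"
  shows "(\<integral>\<^sup>+x. h (x + t) \<partial>lborel) = (\<integral>\<^sup>+x. h x \<partial>lborel)"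
proof -
  have "(\<integral>\<^sup>+x. h x \<partial>lborel) = (\<integral>\<^sup>+x. h x \<partial>distr lborel borel ((+) t))"
    by (simp add: lborel_distr_plus)
  also have "\<dots> = (\<integral>\<^sup>+x. h (x + t) \<partial>lborel)"
    by (subst nn_integral_distr) (auto simp: add.commute)
  finally show ?thesis by simp
qed

lemma nn_integral_lborel_reflect:
  fixes t :: "'a::euclidean_space"
  assumes [measurable]: "h \<in> borel_measurable borel"
  shows "(\<integral>\<^sup>+x. h (t - x) \<partial>lborel) = (\<integral>\<^sup>+x. h x \<partial>lborel)"
proof -
  have "lborel = distr lborel borel (\<lambda>x::'a. t - x)"
    using lborel_affine[of "-1" t] by (simp add: density_1)
  then have "(\<integral>\<^sup>+x. h x \<partial>lborel) = (\<integral>\<^sup>+x. h x \<partial>distr lborel borel (\<lambda>x. t - x))"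
    by simp
  also have "\<dots> = (\<integral>\<^sup>+x. h (t - x) \<partial>lborel)"
    by (subst nn_integral_distr) auto
  finally show ?thesis by simp
qed

text \<open>The image measure is translation invariant, so integrating \<open>1\<^sub>B(x) 1\<^sub>U(x + y)\<close> in both orders
  shows that it is proportional to Lebesgue measure; the unit ball \<open>U\<close> fixes the factor.\<close>

lemma distr_lborel_isometry:
  fixes Q :: "'a::euclidean_space \<Rightarrow> 'b::euclidean_space"
  assumes lin: "linear Q" and iso: "\<And>x. norm (Q x) = norm x" and dim: "DIM('a) = DIM('b)"
  shows "distr lborel borel Q = lborel"
proof (rule measure_eqI)
  show "sets (distr lborel borel Q) = sets lborel" by simp
  have [measurable]: "Q \<in> borel_measurable borel"
    using lin by (intro borel_measurable_continuous_onI linear_continuous_on)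
      (simp add: linear_conv_bounded_linear)
  have inj: "inj Q"
    unfolding linear_injective_0[OF lin] using iso by (metis norm_eq_zero)
  have "dim (range Q) = DIM('b)"
    using dim_image_eq[OF lin, of UNIV] inj dim by simp
  then have surj: "range Q = UNIV"
    using lin by (metis dim_eq_full linear_subspace_image span_eq_iff subspace_UNIV)
  fix B assume "B \<in> sets (distr lborel borel Q)"
  then have B [measurable]: "B \<in> sets borel" by simp
  let ?U = "ball (0 :: 'b) 1" and ?V = "ball (0 :: 'a) 1"
  have U [measurable]: "?U \<in> sets borel" by simp
  let ?F = "\<lambda>x y. indicator B (Q x) * indicator ?U (Q x + y) :: ennreal"
  have 1: "(\<integral>\<^sup>+x. \<integral>\<^sup>+y. ?F x y \<partial>lborel \<partial>lborel)
      = emeasure (distr lborel borel Q) B * emeasure lborel ?U"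
  proof -
    have "(\<integral>\<^sup>+y. ?F x y \<partial>lborel) = indicator B (Q x) * emeasure lborel ?U" for x
      using nn_integral_lborel_translate[of "indicator ?U" "Q x"]
      by (simp add: nn_integral_cmult add.commute)
    then have "(\<integral>\<^sup>+x. \<integral>\<^sup>+y. ?F x y \<partial>lborel \<partial>lborel)
        = (\<integral>\<^sup>+x. indicator B (Q x) * emeasure lborel ?U \<partial>lborel)" by (simp only:)
    also have "\<dots> = (\<integral>\<^sup>+x. indicator B (Q x) \<partial>lborel) * emeasure lborel ?U"
      by (rule nn_integral_multc) simp
    also have "(\<integral>\<^sup>+x. indicator B (Q x) \<partial>lborel) = (\<integral>\<^sup>+x. indicator B x \<partial>distr lborel borel Q)"
      by (rule nn_integral_distr[symmetric]) simp_all
    also have "\<dots> = emeasure (distr lborel borel Q) B" by (rule nn_integral_indicator) simp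
    finally show ?thesis .
  qed
  have 2: "(\<integral>\<^sup>+x. ?F x y \<partial>lborel) = (\<integral>\<^sup>+x. indicator B (Q x - y) * indicator ?U (Q x) \<partial>lborel)" for y
  proof -
    obtain u where u: "Q u = y" using surj by (metis surjD)
    have "(\<integral>\<^sup>+x. indicator B (Q x - y) * indicator ?U (Q x) \<partial>lborel)
      = (\<integral>\<^sup>+x. indicator B (Q (x + u) - y) * indicator ?U (Q (x + u)) \<partial>lborel)"
      by (rule nn_integral_lborel_translate[symmetric]) simp
    then show ?thesis by (simp add: linear_add[OF lin] u)
  qed
  have "(\<integral>\<^sup>+x. \<integral>\<^sup>+y. ?F x y \<partial>lborel \<partial>lborel) = (\<integral>\<^sup>+y. \<integral>\<^sup>+x. ?F x y \<partial>lborel \<partial>lborel)"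
    by (rule lborel_pair.Fubini') simp
  also have "\<dots> = (\<integral>\<^sup>+y. \<integral>\<^sup>+x. indicator B (Q x - y) * indicator ?U (Q x) \<partial>lborel \<partial>lborel)"
    by (simp only: 2)
  also have "\<dots> = (\<integral>\<^sup>+x. \<integral>\<^sup>+y. indicator B (Q x - y) * indicator ?U (Q x) \<partial>lborel \<partial>lborel)"
    by (rule lborel_pair.Fubini'[symmetric]) simp
  also have "\<dots> = (\<integral>\<^sup>+x. emeasure lborel B * indicator ?V x \<partial>lborel)"
  proof (rule nn_integral_cong)
    fix x
    have "indicator ?U (Q x) = (indicator ?V x :: ennreal)"
      by (simp add: indicator_def iso)
    then show "(\<integral>\<^sup>+y. indicator B (Q x - y) * indicator ?U (Q x) \<partial>lborel)
      = emeasure lborel B * (indicator ?V x :: ennreal)"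
      using nn_integral_lborel_reflect[of "indicator B" "Q x"] by (simp add: nn_integral_multc)
  qed
  also have "\<dots> = emeasure lborel B * emeasure lborel ?V"
    by (rule nn_integral_cmult_indicator) simp
  also have "emeasure lborel ?V = emeasure lborel ?U"
    by (simp add: emeasure_ball dim)
  finally have "emeasure (distr lborel borel Q) B * emeasure lborel ?U
      = emeasure lborel B * emeasure lborel ?U" using 1 by simp
  moreover have "emeasure lborel ?U \<noteq> 0" "emeasure lborel ?U \<noteq> \<infinity>"
    by (simp_all add: emeasure_ball zero_less_power less_imp_neq[symmetric])
  ultimately show "emeasure (distr lborel borel Q) B = emeasure lborel B"
    by (simp add: ennreal_mult_cancel_left mult.commute[of _ "emeasure lborel ?U"])
qed

lemma space_\<mu>S3 [simp]: "space \<mu>S3 = S3"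
  by (simp add: \<mu>S3_def space_restrict_space space_scale_measure)

lemma sets_\<mu>S3: "sets \<mu>S3 = sets (restrict_space borel S3)"
  by (simp add: \<mu>S3_def)

lemma measurable_\<mu>S3_cong [measurable_cong]: "sets \<mu>S3 = sets (restrict_space borel S3)"
  by (rule sets_\<mu>S3)

lemma radial_projection_measurable:
  "(\<lambda>x::c2. x /\<^sub>R norm x) \<in> measurable (restrict_space lborel (ball 0 1 - {0})) (restrict_space borel S3)"
  by (rule measurable_restrict_space2)
     (auto simp: space_restrict_space intro!: measurable_restrict_space1)

lemma nn_integral_\<mu>S3:
  assumes [measurable]: "h \<in> borel_measurable (restrict_space borel S3)"
  shows "(\<integral>\<^sup>+w. h w \<partial>\<mu>S3)
    = 4 * (\<integral>\<^sup>+x. h (x /\<^sub>R norm x) * indicator (ball 0 1 - {0}) x \<partial>lborel)"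
proof -
  have m: "(\<lambda>x. x /\<^sub>R norm x) \<in> measurable (restrict_space lborel (ball 0 1 - {0})) (restrict_space borel S3)"
    by (rule radial_projection_measurable)
  have "(\<integral>\<^sup>+w. h w \<partial>\<mu>S3) = 4 * (\<integral>\<^sup>+x. h (x /\<^sub>R norm x) \<partial>restrict_space lborel (ball 0 1 - {0}))"
    unfolding \<mu>S3_def by (subst nn_integral_scale_measure) (simp_all add: nn_integral_distr[OF m])
  also have "(\<integral>\<^sup>+x. h (x /\<^sub>R norm x) \<partial>restrict_space lborel (ball 0 1 - {0}))
      = (\<integral>\<^sup>+x. h (x /\<^sub>R norm x) * indicator (ball 0 1 - {0}) x \<partial>lborel)"
    by (rule nn_integral_restrict_space) simp
  finally show ?thesis .
qed

lemma finite_measure_\<mu>S3: "finite_measure \<mu>S3"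
proof
  have "emeasure \<mu>S3 (space \<mu>S3) = (\<integral>\<^sup>+w. 1 \<partial>\<mu>S3)" by simp
  also have "\<dots> = 4 * emeasure lborel (ball 0 1 - {0 :: c2})"
    by (subst nn_integral_\<mu>S3) auto
  also have "\<dots> \<le> 4 * emeasure lborel (ball 0 1 :: c2 set)"
    by (intro mult_left_mono emeasure_mono) auto
  also have "\<dots> < \<infinity>"
    by (simp add: emeasure_ball ennreal_mult_less_top)
  finally show "emeasure \<mu>S3 (space \<mu>S3) \<noteq> \<infinity>" by simp
qed

interpretation \<mu>S3: finite_measure \<mu>S3 by (rule finite_measure_\<mu>S3)

lemma isometry_measurable_\<mu>S3:
  assumes lin: "linear (Q :: c2 \<Rightarrow> c2)" and iso: "\<And>x. norm (Q x) = norm x"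
  shows "Q \<in> measurable \<mu>S3 \<mu>S3"
proof -
  have [measurable]: "Q \<in> borel_measurable borel"
    using lin by (intro borel_measurable_continuous_onI linear_continuous_on)
      (simp add: linear_conv_bounded_linear)
  show ?thesis
    unfolding measurable_cong_sets[OF sets_\<mu>S3 sets_\<mu>S3]
    by (rule measurable_restrict_space2) (auto simp: space_restrict_space iso intro!: measurable_restrict_space1)
qed

lemma distr_\<mu>S3_isometry:
  assumes lin: "linear (Q :: c2 \<Rightarrow> c2)" and iso: "\<And>x. norm (Q x) = norm x"
  shows "distr \<mu>S3 \<mu>S3 Q = \<mu>S3"
proof (rule measure_eqI)
  have [measurable]: "Q \<in> borel_measurable borel"
    using lin by (intro borel_measurable_continuous_onI linear_continuous_on)
      (simp add: linear_conv_bounded_linear)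
  note Q = isometry_measurable_\<mu>S3[OF lin iso]
  fix A assume "A \<in> sets (distr \<mu>S3 \<mu>S3 Q)"
  then have A: "A \<in> sets \<mu>S3" by simp
  then have A': "A \<in> sets borel" "A \<subseteq> S3" by (auto simp: sets_\<mu>S3 sets_restrict_space_iff)
  note [measurable] = A'(1)
  have h: "indicator A \<in> borel_measurable (restrict_space borel S3)"
    by (intro measurable_restrict_space1) simp
  have hQ: "(\<lambda>w. indicator A (Q w)) \<in> borel_measurable (restrict_space borel S3)"
    by (intro measurable_restrict_space1) simp
  let ?k = "\<lambda>x::c2. indicator A (x /\<^sub>R norm x) * indicator (ball 0 1 - {0}) x :: ennreal"
  have [measurable]: "ball 0 1 - {0 :: c2} \<in> sets borel" by simp
  have k: "?k \<in> borel_measurable borel" by measurable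
  have "emeasure (distr \<mu>S3 \<mu>S3 Q) A = (\<integral>\<^sup>+w. indicator A w \<partial>distr \<mu>S3 \<mu>S3 Q)"
    using A by simp
  also have "\<dots> = (\<integral>\<^sup>+w. indicator A (Q w) \<partial>\<mu>S3)"
    using Q A by (subst nn_integral_distr) auto
  also have "\<dots> = 4 * (\<integral>\<^sup>+x. indicator A (Q (x /\<^sub>R norm x)) * indicator (ball 0 1 - {0}) x \<partial>lborel)"
    by (rule nn_integral_\<mu>S3[OF hQ])
  also have "(\<lambda>x. indicator A (Q (x /\<^sub>R norm x)) * indicator (ball 0 1 - {0}) x :: ennreal) = (\<lambda>x. ?k (Q x))"
    by (rule ext) (simp add: linear_scale[OF lin] iso indicator_def flip: norm_eq_zero[of "Q _"] split del: if_split)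
  also have "(\<integral>\<^sup>+x. ?k (Q x) \<partial>lborel) = (\<integral>\<^sup>+x. ?k x \<partial>distr lborel borel Q)"
    using k by (intro nn_integral_distr[symmetric]) simp_all
  also have "\<dots> = (\<integral>\<^sup>+x. ?k x \<partial>lborel)"
    by (simp only: distr_lborel_isometry[OF lin iso refl])
  also have "4 * \<dots> = (\<integral>\<^sup>+w. indicator A w \<partial>\<mu>S3)"
    by (rule nn_integral_\<mu>S3[OF h, symmetric])
  also have "\<dots> = emeasure \<mu>S3 A" using A by simp
  finally show "emeasure (distr \<mu>S3 \<mu>S3 Q) A = emeasure \<mu>S3 A" .
qed simp

lemma continuous_measurable_\<mu>S3:
  assumes "continuous_on S3 (f :: c2 \<Rightarrow> 'a::topological_space)" shows "f \<in> borel_measurable \<mu>S3"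
  unfolding measurable_cong_sets[OF sets_\<mu>S3 refl] using assms
  by (rule borel_measurable_continuous_on_restrict)

lemma continuous_L2_\<mu>S3:
  fixes f :: "c2 \<Rightarrow> real"
  assumes "continuous_on S3 f" shows "f \<in> L2 \<mu>S3"
proof -
  have "bounded (f ` S3)" by (intro compact_imp_bounded compact_continuous_image assms) simp
  then obtain B where "\<forall>w\<in>S3. \<bar>f w\<bar> \<le> B" by (auto simp: bounded_iff)
  then show ?thesis
    by (intro \<mu>S3.L2_bounded[of _ B] continuous_measurable_\<mu>S3 assms AE_I2) simp
qed

section \<open>Smooth functions on \<open>S\<^sup>3\<close>\<close>

lemma Ck_on_subset:
  assumes "Ck_on k U F" "V \<subseteq> U" shows "Ck_on k V F"
  using assms(1)
proof (induction k arbitrary: F)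
  case 0
  then show ?case using assms(2) by (simp add: continuous_on_subset)
next
  case (Suc k)
  then have "F differentiable_on V" using assms(2) differentiable_on_subset[of F U V] by simp
  with Suc show ?case by simp
qed

lemma differentiable_on_openD:
  assumes "open U" "F differentiable_on U" "x \<in> U"
  shows "(F has_derivative frechet_derivative F (at x)) (at x)"
  using assms differentiable_on_eq_differentiable_at frechet_derivative_works by blast

lemma Ck_on_cong:
  assumes U: "open U" and "\<And>x. x \<in> U \<Longrightarrow> F x = G x" and "Ck_on k U F" shows "Ck_on k U G"
  using assms(2,3)
proof (induction k arbitrary: F G)
  case 0
  then show ?case using continuous_on_cong[OF refl, of U F G] by simp
next
  case (Suc n)
  have F: "F differentiable_on U" "\<forall>b\<in>Basis. Ck_on n U (\<lambda>x. frechet_derivative F (at x) b)"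
    using Suc.prems(2) unfolding Ck_on.simps(2) by (rule conjunct1, rule conjunct2)
  have der: "(G has_derivative frechet_derivative F (at x)) (at x)" if x: "x \<in> U" for x
    by (rule has_derivative_transform_within_open[OF differentiable_on_openD[OF U F(1) x] U x Suc.prems(1)])
  then have "G differentiable_on U"
    unfolding differentiable_on_eq_differentiable_at[OF U] differentiable_def by blast
  moreover have "Ck_on n U (\<lambda>x. frechet_derivative G (at x) b)" if b: "b \<in> Basis" for b
  proof (rule Suc.IH)
    show "Ck_on n U (\<lambda>x. frechet_derivative F (at x) b)" using F(2) b by (rule bspec)
    show "frechet_derivative F (at x) b = frechet_derivative G (at x) b" if "x \<in> U" for x
      by (rule fun_cong[OF frechet_derivative_at[OF der[OF that]]])
  qed
  ultimately show ?case unfolding Ck_on.simps(2) by blast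
qed

lemma Ck_on_SucD: "Ck_on (Suc k) U F \<Longrightarrow> Ck_on k U F"
proof (induction k arbitrary: F)
  case 0
  then show ?case by (simp add: differentiable_imp_continuous_on)
next
  case (Suc k)
  from Suc.prems have F: "F differentiable_on U \<and> (\<forall>b\<in>Basis. Ck_on (Suc k) U (\<lambda>x. frechet_derivative F (at x) b))"
    unfolding Ck_on.simps(2)[of "Suc k"] .
  show ?case
    unfolding Ck_on.simps(2)[of k]
  proof (intro conjI ballI Suc.IH)
    show "F differentiable_on U" using F by (rule conjunct1)
    show "Ck_on (Suc k) U (\<lambda>x. frechet_derivative F (at x) b)" if "b \<in> Basis" for b
      using conjunct2[OF F] that by (rule bspec)
  qed
qed

lemma Ck_on_const: "Ck_on k U (\<lambda>x. c)"
  by (induction k arbitrary: c) (auto simp: frechet_derivative_const)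

lemma Ck_on_bounded_linear:
  assumes "bounded_linear l" shows "Ck_on k U l"
proof (cases k)
  case 0
  then show ?thesis using assms by (simp add: linear_continuous_on)
next
  case (Suc n)
  have "frechet_derivative l (at x) = l" for x
    using frechet_derivative_at[OF bounded_linear_imp_has_derivative[OF assms]] by simp
  then show ?thesis using assms
    by (simp add: Suc Ck_on_const bounded_linear_imp_differentiable_on)
qed

lemma Ck_on_add:
  assumes "open U" "Ck_on k U F" "Ck_on k U G" shows "Ck_on k U (\<lambda>x. F x + G x)"
  using assms(2,3)
proof (induction k arbitrary: F G)
  case 0
  then show ?case by (auto intro: continuous_intros)
next
  case (Suc k)
  have "Ck_on k U (\<lambda>x. frechet_derivative (\<lambda>x. F x + G x) (at x) b)" if b: "b \<in> Basis" for b
  proof (rule Ck_on_cong[OF assms(1)])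
    show "Ck_on k U (\<lambda>x. frechet_derivative F (at x) b + frechet_derivative G (at x) b)"
      using Suc.prems b by (intro Suc.IH) auto
    show "frechet_derivative F (at x) b + frechet_derivative G (at x) b
        = frechet_derivative (\<lambda>x. F x + G x) (at x) b" if "x \<in> U" for x
    proof -
      have "F differentiable at x" "G differentiable at x"
        using Suc.prems that assms(1) by (auto simp: differentiable_on_eq_differentiable_at)
      then have "((\<lambda>x. F x + G x) has_derivative
          (\<lambda>h. frechet_derivative F (at x) h + frechet_derivative G (at x) h)) (at x)"
        by (intro has_derivative_add) (simp_all add: frechet_derivative_works[symmetric])
      then show ?thesis by (simp add: frechet_derivative_at[symmetric])
    qed
  qed
  then show ?case using Suc.prems by (auto intro: differentiable_on_add)
qed

lemma Ck_on_mult: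
  assumes "open U" "Ck_on k U F" "Ck_on k U G" shows "Ck_on k U (\<lambda>x. F x * G x)"
  using assms(2,3)
proof (induction k arbitrary: F G)
  case 0
  then show ?case by (auto intro: continuous_intros)
next
  case (Suc k)
  have "Ck_on k U (\<lambda>x. frechet_derivative (\<lambda>x. F x * G x) (at x) b)" if b: "b \<in> Basis" for b
  proof (rule Ck_on_cong[OF assms(1)])
    show "Ck_on k U (\<lambda>x. F x * frechet_derivative G (at x) b + frechet_derivative F (at x) b * G x)"
      using Suc.prems b Ck_on_SucD by (intro Ck_on_add[OF assms(1)] Suc.IH) auto
    show "F x * frechet_derivative G (at x) b + frechet_derivative F (at x) b * G x
        = frechet_derivative (\<lambda>x. F x * G x) (at x) b" if "x \<in> U" for x
    proof -
      have "F differentiable at x" "G differentiable at x"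
        using Suc.prems that assms(1) by (auto simp: differentiable_on_eq_differentiable_at)
      then have "((\<lambda>x. F x * G x) has_derivative
          (\<lambda>h. F x * frechet_derivative G (at x) h + frechet_derivative F (at x) h * G x)) (at x)"
        by (intro has_derivative_mult) (simp_all add: frechet_derivative_works[symmetric])
      then show ?thesis by (simp add: frechet_derivative_at[symmetric])
    qed
  qed
  then show ?case using Suc.prems by (auto intro: differentiable_on_mult)
qed

lemma Ck_on_sum:
  assumes "open U" "\<And>b. b \<in> B \<Longrightarrow> Ck_on k U (F b)" shows "Ck_on k U (\<lambda>x. \<Sum>b\<in>B. F b x)"
  using assms(2)
  by (induction B rule: infinite_finite_induct) (auto intro: Ck_on_const Ck_on_add[OF assms(1)])

lemma smooth_S3E:
  assumes "\<psi> \<in> smooth_S3"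
  obtains U F where "open U" "S3 \<subseteq> U" "\<And>k. Ck_on k U F" "\<And>w. w \<in> S3 \<Longrightarrow> \<psi> w = F w"
  using assms unfolding smooth_S3_def by blast

lemma smooth_S3I:
  assumes "open U" "S3 \<subseteq> U" "\<And>k. Ck_on k U F" "\<And>w. w \<in> S3 \<Longrightarrow> \<psi> w = F w"
  shows "\<psi> \<in> smooth_S3"
  using assms unfolding smooth_S3_def by blast

lemma smooth_S3_cong:
  assumes "\<psi> \<in> smooth_S3" and eq: "\<And>w. w \<in> S3 \<Longrightarrow> \<psi> w = \<xi> w" shows "\<xi> \<in> smooth_S3"
proof -
  obtain U F where 1: "open U" "S3 \<subseteq> U" "\<And>k. Ck_on k U F" "\<And>w. w \<in> S3 \<Longrightarrow> \<psi> w = F w"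
    using assms(1) by (rule smooth_S3E) blast
  have "\<xi> w = F w" if "w \<in> S3" for w using eq[OF that] 1(4)[OF that] by (rule subst)
  from smooth_S3I[OF 1(1-3) this] show ?thesis .
qed

lemma smooth_S3_const [simp]: "(\<lambda>w. c) \<in> smooth_S3"
  by (rule smooth_S3I[of UNIV, OF open_UNIV subset_UNIV Ck_on_const refl])

lemma smooth_S3_bounded_linear: "bounded_linear l \<Longrightarrow> l \<in> smooth_S3"
  by (rule smooth_S3I[of UNIV, OF open_UNIV subset_UNIV Ck_on_bounded_linear refl])

lemma smooth_S3_add:
  assumes "\<psi> \<in> smooth_S3" "\<xi> \<in> smooth_S3" shows "(\<lambda>w. \<psi> w + \<xi> w) \<in> smooth_S3"
proof -
  obtain U F where 1: "open U" "S3 \<subseteq> U" "\<And>k. Ck_on k U F" "\<And>w. w \<in> S3 \<Longrightarrow> \<psi> w = F w"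
    using assms(1) by (rule smooth_S3E) blast
  obtain V G where 2: "open V" "S3 \<subseteq> V" "\<And>k. Ck_on k V G" "\<And>w. w \<in> S3 \<Longrightarrow> \<xi> w = G w"
    using assms(2) by (rule smooth_S3E) blast
  show ?thesis
  proof (rule smooth_S3I)
    show "Ck_on k (U \<inter> V) (\<lambda>w. F w + G w)" for k
      by (intro Ck_on_add open_Int 1(1) 2(1) Ck_on_subset[OF 1(3)] Ck_on_subset[OF 2(3)]) auto
  qed (use 1 2 in auto)
qed

lemma smooth_S3_mult:
  assumes "\<psi> \<in> smooth_S3" "\<xi> \<in> smooth_S3" shows "(\<lambda>w. \<psi> w * \<xi> w) \<in> smooth_S3"
proof -
  obtain U F where 1: "open U" "S3 \<subseteq> U" "\<And>k. Ck_on k U F" "\<And>w. w \<in> S3 \<Longrightarrow> \<psi> w = F w"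
    using assms(1) by (rule smooth_S3E) blast
  obtain V G where 2: "open V" "S3 \<subseteq> V" "\<And>k. Ck_on k V G" "\<And>w. w \<in> S3 \<Longrightarrow> \<xi> w = G w"
    using assms(2) by (rule smooth_S3E) blast
  show ?thesis
  proof (rule smooth_S3I)
    show "Ck_on k (U \<inter> V) (\<lambda>w. F w * G w)" for k
      by (intro Ck_on_mult open_Int 1(1) 2(1) Ck_on_subset[OF 1(3)] Ck_on_subset[OF 2(3)]) auto
  qed (use 1 2 in auto)
qed

lemma smooth_S3_scale: "\<psi> \<in> smooth_S3 \<Longrightarrow> (\<lambda>w. c * \<psi> w) \<in> smooth_S3"
  by (rule smooth_S3_mult) simp_all

lemma smooth_S3_diff:
  "\<psi> \<in> smooth_S3 \<Longrightarrow> \<xi> \<in> smooth_S3 \<Longrightarrow> (\<lambda>w. \<psi> w - \<xi> w) \<in> smooth_S3"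
  using smooth_S3_add[of \<psi> "\<lambda>w. -1 * \<xi> w"] smooth_S3_scale[of \<xi> "-1"] by simp

lemma real_polynomial_smooth_S3: "real_polynomial_function p \<Longrightarrow> p \<in> smooth_S3"
  by (induction p rule: real_polynomial_function.induct)
    (rule smooth_S3_bounded_linear smooth_S3_const smooth_S3_add smooth_S3_mult; assumption)+

lemma smooth_S3_continuous: "\<psi> \<in> smooth_S3 \<Longrightarrow> continuous_on S3 \<psi>"
proof -
  assume "\<psi> \<in> smooth_S3"
  then obtain U F where 1: "open U" "S3 \<subseteq> U" "\<And>k. Ck_on k U F" "\<And>w. w \<in> S3 \<Longrightarrow> \<psi> w = F w"
    by (rule smooth_S3E) blast
  have "continuous_on S3 F" using 1(3)[of 0] 1(2) continuous_on_subset by simp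
  then show "continuous_on S3 \<psi>" by (rule continuous_on_eq) (rule 1(4)[symmetric])
qed

lemma smooth_S3_L2: "\<psi> \<in> smooth_S3 \<Longrightarrow> \<psi> \<in> L2 \<mu>S3"
  by (intro continuous_L2_\<mu>S3 smooth_S3_continuous)

lemma smooth_S3_bounded: "\<psi> \<in> smooth_S3 \<Longrightarrow> \<exists>B. \<forall>w\<in>S3. \<bar>\<psi> w\<bar> \<le> B"
  using compact_imp_bounded[OF compact_continuous_image[OF smooth_S3_continuous]]
  by (auto simp: bounded_iff)

section \<open>Derivatives along the frame\<close>

lemma frame_linear: "linear (frame i)"
  by (cases i) (auto intro!: linearI simp: algebra_simps scaleR_conv_of_real)

lemma frame_bounded_linear: "bounded_linear (frame i)"
  using frame_linear linear_conv_bounded_linear by blast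

lemma norm_frame [simp]: "norm (frame i w) = norm w"
  by (cases i) (simp_all add: norm_prod_def norm_mult norm_mult add.commute)

lemma frame_frame [simp]: "frame i (frame i w) = - w"
  by (cases i) (simp_all add: prod_eq_iff)

lemma inner_frame_self [simp]: "frame i w \<bullet> w = 0" "w \<bullet> frame i w = 0"
  by (cases i; simp add: inner_prod_def inner_complex_def)+

definition flow :: "axis \<Rightarrow> real \<Rightarrow> c2 \<Rightarrow> c2" where
  "flow i t w = cos t *\<^sub>R w + sin t *\<^sub>R frame i w"

lemma flow_linear: "linear (flow i t)"
  by (rule linearI)
    (simp_all add: flow_def linear_add[OF frame_linear] linear_scale[OF frame_linear] algebra_simps)

lemma norm_cos_sin:
  fixes w :: "'a::real_inner"
  assumes "norm e = norm w" "e \<bullet> w = 0" shows "norm (cos t *\<^sub>R w + sin t *\<^sub>R e) = norm w"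
proof -
  have "(cos t *\<^sub>R w + sin t *\<^sub>R e) \<bullet> (cos t *\<^sub>R w + sin t *\<^sub>R e)
      = cos t * cos t * (w \<bullet> w) + 2 * cos t * sin t * (e \<bullet> w) + sin t * sin t * (e \<bullet> e)"
    by (simp add: inner_add_left inner_add_right inner_commute algebra_simps)
  also have "\<dots> = (cos t * cos t + sin t * sin t) * (w \<bullet> w)"
    using assms by (simp only: norm_eq distrib_right mult_zero_right add_0_right)
  also have "\<dots> = w \<bullet> w" by (simp only: sin_cos_squared_add3 mult_1)
  finally show ?thesis by (simp only: norm_eq)
qed

lemma norm_flow [simp]: "norm (flow i t w) = norm w"
  unfolding flow_def by (rule norm_cos_sin) simp_all

lemma flow_zero [simp]: "flow i 0 w = w"
  by (simp add: flow_def)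

lemma flow_has_vector_derivative:
  "((\<lambda>t. flow i t w) has_vector_derivative frame i (flow i t w)) (at t)"
proof -
  have "((\<lambda>t. flow i t w) has_vector_derivative (- sin t) *\<^sub>R w + cos t *\<^sub>R frame i w) (at t)"
    unfolding flow_def by (auto intro!: derivative_eq_intros)
  also have "(- sin t) *\<^sub>R w + cos t *\<^sub>R frame i w = frame i (flow i t w)"
    by (simp add: flow_def linear_add[OF frame_linear] linear_scale[OF frame_linear])
  finally show ?thesis .
qed

lemma frame_expansion:
  assumes "norm w = 1" "v \<bullet> w = 0"
  shows "v = (v \<bullet> frame A1 w) *\<^sub>R frame A1 w + (v \<bullet> frame A2 w) *\<^sub>R frame A2 w
    + (v \<bullet> frame A3 w) *\<^sub>R frame A3 w"
proof -
  have "(w \<bullet> w) *\<^sub>R v = (v \<bullet> w) *\<^sub>R w + (v \<bullet> frame A1 w) *\<^sub>R frame A1 w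
    + (v \<bullet> frame A2 w) *\<^sub>R frame A2 w + (v \<bullet> frame A3 w) *\<^sub>R frame A3 w"
    by (auto simp: prod_eq_iff complex_eq_iff inner_prod_def inner_complex_def algebra_simps)
  moreover have "w \<bullet> w = 1" using assms(1) by (simp add: norm_eq_1)
  ultimately show ?thesis using assms(2) by simp
qed

text \<open>The derivative of \<open>\<psi>\<close> at \<open>w \<in> S\<^sup>3\<close> in the tangent direction \<open>v\<close>.\<close>

definition sphere_deriv :: "(c2 \<Rightarrow> real) \<Rightarrow> c2 \<Rightarrow> c2 \<Rightarrow> real" where
  "sphere_deriv \<psi> w v = (v \<bullet> frame A1 w) * frame_deriv A1 \<psi> w
     + (v \<bullet> frame A2 w) * frame_deriv A2 \<psi> w + (v \<bullet> frame A3 w) * frame_deriv A3 \<psi> w"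

lemma sphere_deriv_frame: "w \<in> S3 \<Longrightarrow> sphere_deriv \<psi> w (frame i w) = frame_deriv i \<psi> w"
  by (cases i) (simp_all add: sphere_deriv_def frame_orthonormal(1) del: frame.simps)

lemma frame_deriv_extension:
  assumes U: "open U" "S3 \<subseteq> U" "F differentiable_on U" and F: "\<And>w. w \<in> S3 \<Longrightarrow> \<psi> w = F w" and w: "w \<in> S3"
  shows "frame_deriv i \<psi> w = frechet_derivative F (at w) (frame i w)"
proof -
  have "F differentiable at w"
    using U w by (auto simp: differentiable_on_eq_differentiable_at)
  then have "(F has_derivative frechet_derivative F (at w)) (at w)"
    by (simp add: frechet_derivative_works[symmetric])
  then have "((F \<circ> (\<lambda>t. flow i t w)) has_vector_derivative frechet_derivative F (at w) (frame i w)) (at 0)"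
    using vector_derivative_diff_chain_within[of "\<lambda>t. flow i t w" "frame i w" 0 UNIV F]
      flow_has_vector_derivative[of i w 0] by (auto simp: has_derivative_at_withinI)
  moreover have "F \<circ> (\<lambda>t. flow i t w) = (\<lambda>t. \<psi> (cos t *\<^sub>R w + sin t *\<^sub>R frame i w))"
    using w F norm_flow[of i _ w] by (auto simp: flow_def)
  ultimately show ?thesis
    by (simp add: frame_deriv_def has_real_derivative_iff_has_vector_derivative[symmetric] DERIV_imp_deriv)
qed

lemma smooth_S3_frame_deriv:
  assumes "\<psi> \<in> smooth_S3" shows "frame_deriv i \<psi> \<in> smooth_S3"
proof -
  obtain U F where 1: "open U" "S3 \<subseteq> U" "\<And>k. Ck_on k U F" "\<And>w. w \<in> S3 \<Longrightarrow> \<psi> w = F w"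
    using assms by (rule smooth_S3E) blast
  let ?G = "\<lambda>x. \<Sum>b\<in>Basis. (frame i x \<bullet> b) * frechet_derivative F (at x) b"
  have d: "F differentiable_on U" using 1(3)[of 1] by simp
  have "Ck_on k U ?G" for k
  proof (intro Ck_on_sum Ck_on_mult 1)
    show "Ck_on k U (\<lambda>x. frame i x \<bullet> b)" for b
      by (intro Ck_on_bounded_linear bounded_linear_inner_left_comp frame_bounded_linear)
    show "Ck_on k U (\<lambda>x. frechet_derivative F (at x) b)" if "b \<in> Basis" for b
      using 1(3)[of "Suc k"] that by simp
  qed
  moreover have "frame_deriv i \<psi> w = ?G w" if "w \<in> S3" for w
  proof -
    have "linear (frechet_derivative F (at w))"
      using d 1 that by (intro linear_frechet_derivative) (auto simp: differentiable_on_eq_differentiable_at)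
    then have "frechet_derivative F (at w) (\<Sum>b\<in>Basis. (frame i w \<bullet> b) *\<^sub>R b) = ?G w"
      by (simp add: linear_sum linear_scale)
    moreover have "frame_deriv i \<psi> w = frechet_derivative F (at w) (frame i w)"
      by (rule frame_deriv_extension[OF 1(1,2) d 1(4) that])
    ultimately show ?thesis by (simp only: euclidean_representation)
  qed
  ultimately show ?thesis using 1(1,2) unfolding smooth_S3_def by blast
qed

lemma smooth_S3_chain:
  assumes \<psi>: "\<psi> \<in> smooth_S3" and c: "\<forall>\<^sub>F s in nhds t. c s \<in> S3"
    and v: "(c has_vector_derivative v) (at t)"
  shows "((\<lambda>s. \<psi> (c s)) has_real_derivative sphere_deriv \<psi> (c t) v) (at t)"
proof -
  obtain U F where 1: "open U" "S3 \<subseteq> U" "\<And>k. Ck_on k U F" "\<And>w. w \<in> S3 \<Longrightarrow> \<psi> w = F w"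
    using \<psi> by (rule smooth_S3E) blast
  have d: "F differentiable_on U" using 1(3)[of 1] by simp
  have ct: "c t \<in> S3" using eventually_nhds_x_imp_x[OF c] .
  have "((\<lambda>s. c s \<bullet> c s) has_real_derivative c t \<bullet> v + v \<bullet> c t) (at t)"
    using v by (auto intro!: derivative_eq_intros simp: has_vector_derivative_def has_field_derivative_def algebra_simps)
  moreover have "((\<lambda>s. c s \<bullet> c s) has_real_derivative 0) (at t)"
  proof -
    have "\<forall>\<^sub>F s in nhds t. c s \<bullet> c s = 1" using c by eventually_elim (simp add: norm_eq_1)
    then show ?thesis using DERIV_cong_ev[of t t "\<lambda>s. c s \<bullet> c s" "\<lambda>_. 1" 0 0] by simp
  qed
  ultimately have "c t \<bullet> v + v \<bullet> c t = 0" by (rule DERIV_unique)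
  then have "v \<bullet> c t = 0" by (simp add: inner_commute)
  note ex = frame_expansion[OF _ this]
  have "F differentiable at (c t)"
    using 1 d ct by (auto simp: differentiable_on_eq_differentiable_at)
  then have D: "(F has_derivative frechet_derivative F (at (c t))) (at (c t))"
    by (simp add: frechet_derivative_works[symmetric])
  then have "((F \<circ> c) has_vector_derivative frechet_derivative F (at (c t)) v) (at t)"
    using vector_derivative_diff_chain_within[of c v t UNIV F] v by (auto simp: has_derivative_at_withinI)
  moreover have fd: "frame_deriv i \<psi> (c t) = frechet_derivative F (at (c t)) (frame i (c t))" for i
    by (rule frame_deriv_extension[OF 1(1,2) d 1(4) ct])
  have "frechet_derivative F (at (c t)) v = sphere_deriv \<psi> (c t) v"
    using ct by (subst ex) (simp_all add: sphere_deriv_def fd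
      linear_add[OF has_derivative_linear[OF D]] linear_scale[OF has_derivative_linear[OF D]] del: frame.simps)
  ultimately have "((F \<circ> c) has_real_derivative sphere_deriv \<psi> (c t) v) (at t)"
    unfolding has_real_derivative_iff_has_vector_derivative by (simp only:)
  moreover have "\<forall>\<^sub>F s in nhds t. (F \<circ> c) s = \<psi> (c s)"
    using c by eventually_elim (simp add: 1(4))
  ultimately show ?thesis using DERIV_cong_ev[of t t "F \<circ> c" "\<lambda>s. \<psi> (c s)"] by blast
qed

lemma smooth_S3_flow:
  assumes "\<psi> \<in> smooth_S3" "w \<in> S3"
  shows "((\<lambda>t. \<psi> (flow i t w)) has_real_derivative frame_deriv i \<psi> (flow i t w)) (at t)"
  using smooth_S3_chain[OF assms(1) _ flow_has_vector_derivative[of i w t]] assms(2)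
  by (simp add: sphere_deriv_frame)

lemma frame_deriv_eqI:
  assumes "w \<in> S3" "((\<lambda>t. \<psi> (flow i t w)) has_real_derivative D) (at 0)"
  shows "frame_deriv i \<psi> w = D"
  using assms(2) unfolding frame_deriv_def flow_def by (rule DERIV_imp_deriv)

lemma frame_deriv_cong:
  assumes "w \<in> S3" "\<And>w. w \<in> S3 \<Longrightarrow> \<psi> w = \<xi> w" shows "frame_deriv i \<psi> w = frame_deriv i \<xi> w"
proof -
  have "\<psi> (cos t *\<^sub>R w + sin t *\<^sub>R frame i w) = \<xi> (cos t *\<^sub>R w + sin t *\<^sub>R frame i w)" for t
    using assms norm_flow[of i t w] by (simp add: flow_def)
  then show ?thesis by (simp add: frame_deriv_def)
qed

lemma frame_deriv_const [simp]: "frame_deriv i (\<lambda>w. c) = (\<lambda>w. 0)"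
  by (simp add: frame_deriv_def fun_eq_iff)

lemma frame_deriv_add:
  assumes "\<psi> \<in> smooth_S3" "\<xi> \<in> smooth_S3" "w \<in> S3"
  shows "frame_deriv i (\<lambda>w. \<psi> w + \<xi> w) w = frame_deriv i \<psi> w + frame_deriv i \<xi> w"
  using smooth_S3_flow[OF assms(1,3), of i 0] smooth_S3_flow[OF assms(2,3), of i 0]
  by (intro frame_deriv_eqI assms(3)) (auto intro!: derivative_eq_intros)

lemma frame_deriv_mult:
  assumes "\<psi> \<in> smooth_S3" "\<xi> \<in> smooth_S3" "w \<in> S3"
  shows "frame_deriv i (\<lambda>w. \<psi> w * \<xi> w) w = frame_deriv i \<psi> w * \<xi> w + \<psi> w * frame_deriv i \<xi> w"
  using smooth_S3_flow[OF assms(1,3), of i 0] smooth_S3_flow[OF assms(2,3), of i 0]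
  by (intro frame_deriv_eqI assms(3)) (auto intro!: derivative_eq_intros)

lemma frame_deriv_scale:
  assumes "\<psi> \<in> smooth_S3" "w \<in> S3"
  shows "frame_deriv i (\<lambda>w. c * \<psi> w) w = c * frame_deriv i \<psi> w"
  using frame_deriv_mult[OF smooth_S3_const assms, of i c] by simp

lemma frame_deriv_diff:
  assumes "\<psi> \<in> smooth_S3" "\<xi> \<in> smooth_S3" "w \<in> S3"
  shows "frame_deriv i (\<lambda>w. \<psi> w - \<xi> w) w = frame_deriv i \<psi> w - frame_deriv i \<xi> w"
  using frame_deriv_add[OF assms(1) smooth_S3_scale[OF assms(2), of "-1"] assms(3), of i]
    frame_deriv_scale[OF assms(2,3), of i "-1"] by simp

lemma frame_deriv_bounded_linear:
  assumes "bounded_linear l" "w \<in> S3" shows "frame_deriv i l w = l (frame i w)"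
proof (rule frame_deriv_eqI[OF assms(2)])
  have "((\<lambda>t. l (flow i t w)) has_vector_derivative l (frame i (flow i 0 w))) (at 0)"
    by (rule bounded_linear.has_vector_derivative[OF assms(1) flow_has_vector_derivative])
  then show "((\<lambda>t. l (flow i t w)) has_real_derivative l (frame i w)) (at 0)"
    by (simp add: has_real_derivative_iff_has_vector_derivative)
qed

lemma integral_\<mu>S3_isometry:
  assumes "linear Q" "\<And>x. norm (Q x) = norm x" "h \<in> borel_measurable \<mu>S3"
  shows "(LINT w|\<mu>S3. h (Q w)) = (LINT w|\<mu>S3. h w :: real)"
proof -
  have "(LINT w|\<mu>S3. h w) = (LINT w|distr \<mu>S3 \<mu>S3 Q. h w)"
    by (simp only: distr_\<mu>S3_isometry[OF assms(1,2)])
  also have "\<dots> = (LINT w|\<mu>S3. h (Q w))"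
    by (rule integral_distr[OF isometry_measurable_\<mu>S3[OF assms(1,2)] assms(3)])
  finally show ?thesis by (rule sym)
qed

lemma difference_quotient_tendsto:
  fixes g :: "real \<Rightarrow> real"
  assumes "(g has_real_derivative d) (at 0)"
  shows "(\<lambda>n. (g (1 / real (Suc n)) - g 0) * real (Suc n)) \<longlonglongrightarrow> d"
proof -
  have "((\<lambda>h. (g (0 + h) - g 0) / h) \<longlongrightarrow> d) (at 0)"
    using assms unfolding DERIV_def .
  moreover have "filterlim (\<lambda>n. 1 / real (Suc n)) (at 0) sequentially"
    using LIMSEQ_inverse_real_of_nat by (auto simp: filterlim_at inverse_eq_divide)
  ultimately have "(\<lambda>n. (g (0 + 1 / real (Suc n)) - g 0) / (1 / real (Suc n))) \<longlonglongrightarrow> d"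
    by (rule filterlim_compose)
  then show ?thesis by (simp only: add_0 divide_divide_eq_right div_by_1)
qed

lemma difference_quotient_bound:
  fixes g g' :: "real \<Rightarrow> real"
  assumes g: "\<And>t. (g has_real_derivative g' t) (at t)" and B: "\<And>t. \<bar>g' t\<bar> \<le> B"
  shows "\<bar>(g (1 / real (Suc n)) - g 0) * real (Suc n)\<bar> \<le> B"
proof -
  have *: "\<bar>g h - g 0\<bar> \<le> h * B" if h: "0 < h" for h
  proof -
    obtain z where "g h - g 0 = (h - 0) * g' z" using MVT2[OF h, of g g'] g by metis
    then show ?thesis using h B[of z] by (simp add: abs_mult)
  qed
  define q where "q = real (Suc n)"
  have q: "0 < q" by (simp add: q_def)
  then have "\<bar>(g (1 / q) - g 0) * q\<bar> \<le> (1 / q * B) * q"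
    using *[of "1 / q"] by (simp only: abs_mult abs_of_pos) (intro mult_right_mono; simp)
  also have "\<dots> = B" using q by simp
  finally show ?thesis unfolding q_def .
qed

text \<open>The flow preserves the measure, so the integral of \<open>\<psi>\<close> along it is constant in time.\<close>

lemma integral_frame_deriv:
  assumes "\<psi> \<in> smooth_S3" shows "(LINT w|\<mu>S3. frame_deriv i \<psi> w) = 0"
proof -
  obtain B where B: "\<And>w. w \<in> S3 \<Longrightarrow> \<bar>frame_deriv i \<psi> w\<bar> \<le> B"
    using smooth_S3_bounded[OF smooth_S3_frame_deriv[OF assms]] by metis
  let ?s = "\<lambda>n w. (\<psi> (flow i (1 / Suc n) w) - \<psi> w) * Suc n"
  have m: "\<psi> \<in> borel_measurable \<mu>S3" using smooth_S3_L2[OF assms] by (rule L2_measurable)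
  have mf: "(\<lambda>w. \<psi> (flow i t w)) \<in> borel_measurable \<mu>S3" for t
    using measurable_compose[OF isometry_measurable_\<mu>S3[OF flow_linear norm_flow] m] .
  have lim: "(\<lambda>n. ?s n w) \<longlonglongrightarrow> frame_deriv i \<psi> w" if w: "w \<in> S3" for w
  proof -
    note d = difference_quotient_tendsto[OF smooth_S3_flow[OF assms w, of i 0]]
    show ?thesis by (rule d[unfolded flow_zero])
  qed
  have bd: "norm (?s n w) \<le> B" if w: "w \<in> S3" for n w
  proof -
    have "\<bar>frame_deriv i \<psi> (flow i t w)\<bar> \<le> B" for t using B[of "flow i t w"] w by simp
    note d = difference_quotient_bound[OF smooth_S3_flow[OF assms w] this]
    show ?thesis unfolding real_norm_def by (rule d[unfolded flow_zero])
  qed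
  have "(\<lambda>n. LINT w|\<mu>S3. ?s n w) \<longlonglongrightarrow> (LINT w|\<mu>S3. frame_deriv i \<psi> w)"
  proof (rule integral_dominated_convergence[where w = "\<lambda>_. B"])
    show "frame_deriv i \<psi> \<in> borel_measurable \<mu>S3"
      using smooth_S3_L2[OF smooth_S3_frame_deriv[OF assms]] by (rule L2_measurable)
    show "?s n \<in> borel_measurable \<mu>S3" for n
      by (intro borel_measurable_times borel_measurable_diff mf m borel_measurable_const)
    show "AE w in \<mu>S3. (\<lambda>n. ?s n w) \<longlonglongrightarrow> frame_deriv i \<psi> w"
      by (rule AE_I2) (rule lim, simp)
    show "AE w in \<mu>S3. norm (?s n w) \<le> B" for n
      by (rule AE_I2) (rule bd, simp)
  qed simp
  moreover have "(LINT w|\<mu>S3. ?s n w) = 0" for n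
  proof -
    have i0: "integrable \<mu>S3 \<psi>" by (rule \<mu>S3.L2_integrable[OF smooth_S3_L2[OF assms]])
    have "integrable (distr \<mu>S3 \<mu>S3 (flow i t)) \<psi>" for t
      unfolding distr_\<mu>S3_isometry[OF flow_linear norm_flow] by (rule i0)
    then have it: "integrable \<mu>S3 (\<lambda>w. \<psi> (flow i t w))" for t
      by (rule integrable_distr[OF isometry_measurable_\<mu>S3[OF flow_linear norm_flow]])
    have "(LINT w|\<mu>S3. ?s n w) = (LINT w|\<mu>S3. \<psi> (flow i (1 / Suc n) w) - \<psi> w) * Suc n"
      by (rule integral_mult_left_zero)
    also have "(LINT w|\<mu>S3. \<psi> (flow i (1 / Suc n) w) - \<psi> w) = 0"
      unfolding Bochner_Integration.integral_diff[OF it i0]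
      by (simp only: integral_\<mu>S3_isometry[OF flow_linear norm_flow m] diff_self)
    finally show ?thesis by (simp only: mult_zero_left)
  qed
  ultimately have "(\<lambda>n. 0) \<longlonglongrightarrow> (LINT w|\<mu>S3. frame_deriv i \<psi> w)" by (simp only:)
  from LIMSEQ_unique[OF this tendsto_const] show ?thesis .
qed

lemma integration_by_parts_smooth:
  assumes "\<psi> \<in> smooth_S3" "\<xi> \<in> smooth_S3"
  shows "(LINT w|\<mu>S3. frame_deriv i \<psi> w * \<xi> w) = - (LINT w|\<mu>S3. \<psi> w * frame_deriv i \<xi> w)"
proof -
  note L = smooth_S3_L2 smooth_S3_frame_deriv assms
  have "0 = (LINT w|\<mu>S3. frame_deriv i (\<lambda>w. \<psi> w * \<xi> w) w)"
    using integral_frame_deriv[OF smooth_S3_mult[OF assms]] by simp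
  also have "\<dots> = (LINT w|\<mu>S3. frame_deriv i \<psi> w * \<xi> w + \<psi> w * frame_deriv i \<xi> w)"
    by (intro Bochner_Integration.integral_cong) (simp_all add: frame_deriv_mult assms)
  also have "\<dots> = (LINT w|\<mu>S3. frame_deriv i \<psi> w * \<xi> w) + (LINT w|\<mu>S3. \<psi> w * frame_deriv i \<xi> w)"
    by (intro Bochner_Integration.integral_add L2_mult_integrable L)
  finally show ?thesis by simp
qed

section \<open>Polynomials on \<open>S\<^sup>3\<close>\<close>

definition ip :: "(c2 \<Rightarrow> real) \<Rightarrow> (c2 \<Rightarrow> real) \<Rightarrow> real" where
  "ip f g = (LINT w|\<mu>S3. f w * g w)"

lemma ip_commute: "ip f g = ip g f"
  unfolding ip_def by (simp only: mult.commute)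

lemma ip_cong:
  assumes "\<And>w. w \<in> S3 \<Longrightarrow> f w = f' w" "\<And>w. w \<in> S3 \<Longrightarrow> g w = g' w" shows "ip f g = ip f' g'"
  unfolding ip_def by (rule Bochner_Integration.integral_cong[OF refl]) (simp only: space_\<mu>S3 assms)

lemma ip_cong_AE:
  assumes "AE w in \<mu>S3. f w = f' w" "f \<in> L2 \<mu>S3" "f' \<in> L2 \<mu>S3" "g \<in> L2 \<mu>S3"
  shows "ip f g = ip f' g"
  unfolding ip_def
  by (rule integral_cong_AE) (use assms in \<open>auto dest!: L2_measurable\<close>)

lemma ip_add_left:
  "f \<in> L2 \<mu>S3 \<Longrightarrow> f' \<in> L2 \<mu>S3 \<Longrightarrow> g \<in> L2 \<mu>S3 \<Longrightarrow> ip (\<lambda>w. f w + f' w) g = ip f g + ip f' g"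
  unfolding ip_def by (simp add: L2_mult_integrable distrib_right)

lemma ip_diff_left:
  "f \<in> L2 \<mu>S3 \<Longrightarrow> f' \<in> L2 \<mu>S3 \<Longrightarrow> g \<in> L2 \<mu>S3 \<Longrightarrow> ip (\<lambda>w. f w - f' w) g = ip f g - ip f' g"
  unfolding ip_def by (simp add: L2_mult_integrable left_diff_distrib)

lemma ip_scale_left: "ip (\<lambda>w. c * f w) g = c * ip f g"
  unfolding ip_def by (simp add: mult.assoc)

lemma ip_add_right:
  "f \<in> L2 \<mu>S3 \<Longrightarrow> f' \<in> L2 \<mu>S3 \<Longrightarrow> g \<in> L2 \<mu>S3 \<Longrightarrow> ip g (\<lambda>w. f w + f' w) = ip g f + ip g f'"
  by (simp only: ip_add_left ip_commute[of g])

lemma ip_diff_right: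
  "f \<in> L2 \<mu>S3 \<Longrightarrow> f' \<in> L2 \<mu>S3 \<Longrightarrow> g \<in> L2 \<mu>S3 \<Longrightarrow> ip g (\<lambda>w. f w - f' w) = ip g f - ip g f'"
  by (simp only: ip_diff_left ip_commute[of g])

lemma ip_scale_right: "ip f (\<lambda>w. c * g w) = c * ip f g"
  by (simp only: ip_scale_left ip_commute[of f])

lemma ip_zero [simp]: "ip (\<lambda>w. 0) g = 0" "ip g (\<lambda>w. 0) = 0"
  by (simp_all add: ip_def)

lemma ip_sum_right:
  assumes "\<And>b. b \<in> B \<Longrightarrow> h b \<in> L2 \<mu>S3" "g \<in> L2 \<mu>S3"
  shows "ip g (\<lambda>w. \<Sum>b\<in>B. h b w) = (\<Sum>b\<in>B. ip g (h b))"
  using assms(1)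
proof (induction B rule: infinite_finite_induct)
  case (insert x F)
  then show ?case
    using L2_sum[of F h \<mu>S3] assms(2) by (simp add: ip_add_right)
qed simp_all

lemma ip_self_zero_AE: "f \<in> L2 \<mu>S3 \<Longrightarrow> ip f f = 0 \<Longrightarrow> AE w in \<mu>S3. f w = 0"
  unfolding ip_def by (rule L2_zero_AE) (simp_all add: power2_eq_square)

lemma ip_tendsto:
  assumes "L2_tendsto \<mu>S3 F f sequentially" "\<And>n. F n \<in> L2 \<mu>S3" "f \<in> L2 \<mu>S3"
    "L2_tendsto \<mu>S3 G g sequentially" "\<And>n. G n \<in> L2 \<mu>S3" "g \<in> L2 \<mu>S3"
  shows "(\<lambda>n. ip (F n) (G n)) \<longlonglongrightarrow> ip f g"
  unfolding ip_def by (rule L2_tendsto_inner) (simp_all add: assms)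

text \<open>The polynomials of degree at most \<open>n\<close>.\<close>

inductive polydeg :: "nat \<Rightarrow> (c2 \<Rightarrow> real) \<Rightarrow> bool" where
  const: "polydeg n (\<lambda>_. c)"
| linear: "polydeg n p \<Longrightarrow> bounded_linear l \<Longrightarrow> polydeg (Suc n) (\<lambda>x. l x * p x)"
| add: "polydeg n p \<Longrightarrow> polydeg n q \<Longrightarrow> polydeg n (\<lambda>x. p x + q x)"

lemma polydeg_scale: "polydeg n p \<Longrightarrow> polydeg n (\<lambda>x. c * p x)"
proof (induction rule: polydeg.induct)
  case (const n d)
  show ?case by (rule polydeg.const)
next
  case (linear n p l)
  have "(\<lambda>x. c * (l x * p x)) = (\<lambda>x. l x * (c * p x))" by (simp only: mult.left_commute)
  then show ?case using polydeg.linear[OF linear.IH linear.hyps(2)] by (simp only:)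
next
  case (add n p q)
  then show ?case using polydeg.add[OF add.IH] by (simp only: distrib_left)
qed

lemma polydeg_diff: "polydeg n p \<Longrightarrow> polydeg n q \<Longrightarrow> polydeg n (\<lambda>x. p x - q x)"
  using polydeg.add[of n p "\<lambda>x. -1 * q x"] polydeg_scale[of n q "-1"] by simp

lemma polydeg_Suc: "polydeg n p \<Longrightarrow> polydeg (Suc n) p"
  by (induction rule: polydeg.induct) (auto intro: polydeg.intros)

lemma polydeg_mono: "n \<le> m \<Longrightarrow> polydeg n p \<Longrightarrow> polydeg m p"
  by (induction m rule: dec_induct) (auto intro: polydeg_Suc)

lemma polydeg_mult: "polydeg n p \<Longrightarrow> polydeg m q \<Longrightarrow> polydeg (n + m) (\<lambda>x. p x * q x)"
proof (induction rule: polydeg.induct)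
  case (const n c)
  then show ?case using polydeg_mono[of m "n + m"] polydeg_scale by simp
next
  case (linear n p l)
  then show ?case using polydeg.linear[of "n + m" "\<lambda>x. p x * q x" l] by (simp add: mult.assoc)
next
  case (add n p p')
  then show ?case using polydeg.add by (simp add: distrib_right)
qed

lemma polydeg_real_polynomial: "polydeg n p \<Longrightarrow> real_polynomial_function p"
  by (induction rule: polydeg.induct)
    (auto intro: real_polynomial_function.intros)

lemma real_polynomial_polydeg: "real_polynomial_function p \<Longrightarrow> \<exists>n. polydeg n p"
proof (induction rule: real_polynomial_function.induct)
  case (linear l)
  then have "polydeg (Suc 0) (\<lambda>x. l x * 1)" by (intro polydeg.linear polydeg.const)
  then show ?case by auto
next
  case (const c)
  then show ?case using polydeg.const by blast
next
  case (add p q)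
  then obtain n m where "polydeg n p" "polydeg m q" by blast
  then have "polydeg (max n m) p" "polydeg (max n m) q"
    by (auto intro: polydeg_mono[rotated])
  then show ?case using polydeg.add by blast
next
  case (mult p q)
  then show ?case using polydeg_mult by blast
qed

text \<open>The frame fields are linear, so derivatives along them do not raise the degree.\<close>

lemma polydeg_frame_deriv:
  "polydeg n p \<Longrightarrow> \<exists>q. polydeg n q \<and> (\<forall>w\<in>S3. frame_deriv i p w = q w)"
proof (induction rule: polydeg.induct)
  case (const n c)
  show ?case using polydeg.const[of n 0] by auto
next
  case (linear n p l)
  then obtain q where q: "polydeg n q" "\<forall>w\<in>S3. frame_deriv i p w = q w" by blast
  have "polydeg (Suc n) (\<lambda>x. l (frame i x) * p x + l x * q x)"
    using linear.hyps q(1) frame_bounded_linear bounded_linear_compose[of l "frame i"]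
    by (intro polydeg.add polydeg.linear) auto
  moreover have "frame_deriv i (\<lambda>x. l x * p x) w = l (frame i w) * p w + l w * q w" if "w \<in> S3" for w
    using frame_deriv_mult[OF smooth_S3_bounded_linear[OF linear.hyps(2)]
        real_polynomial_smooth_S3[OF polydeg_real_polynomial[OF linear.hyps(1)]] that, of i]
      frame_deriv_bounded_linear[OF linear.hyps(2) that, of i] q(2) that by auto
  ultimately show ?case by blast
next
  case (add n p p')
  then obtain q q' where q: "polydeg n q" "\<forall>w\<in>S3. frame_deriv i p w = q w"
    "polydeg n q'" "\<forall>w\<in>S3. frame_deriv i p' w = q' w" by blast
  have "frame_deriv i (\<lambda>x. p x + p' x) w = q w + q' w" if "w \<in> S3" for w
    using frame_deriv_add[OF real_polynomial_smooth_S3[OF polydeg_real_polynomial[OF add.hyps(1)]]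
        real_polynomial_smooth_S3[OF polydeg_real_polynomial[OF add.hyps(2)]] that, of i] q that by simp
  then show ?case using polydeg.add[OF q(1,3)] by blast
qed

lemma polydeg_smooth: "polydeg n p \<Longrightarrow> p \<in> smooth_S3"
  by (intro real_polynomial_smooth_S3 polydeg_real_polynomial)

lemma polydeg_L2: "polydeg n p \<Longrightarrow> p \<in> L2 \<mu>S3"
  by (intro smooth_S3_L2 polydeg_smooth)

definition combination :: "(c2 \<Rightarrow> real) set \<Rightarrow> (c2 \<Rightarrow> real) \<Rightarrow> bool" where
  "combination B p \<longleftrightarrow> (\<exists>c. p = (\<lambda>x. \<Sum>b\<in>B. c b * b x))"

lemma combination_add: "combination B p \<Longrightarrow> combination B q \<Longrightarrow> combination B (\<lambda>x. p x + q x)"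
  unfolding combination_def
proof (elim exE)
  fix c d assume "p = (\<lambda>x. \<Sum>b\<in>B. c b * b x)" "q = (\<lambda>x. \<Sum>b\<in>B. d b * b x)"
  then show "\<exists>c. (\<lambda>x. p x + q x) = (\<lambda>x. \<Sum>b\<in>B. c b * b x)"
    by (intro exI[of _ "\<lambda>b. c b + d b"]) (simp add: distrib_right sum.distrib)
qed

lemma combination_scale: "combination B p \<Longrightarrow> combination B (\<lambda>x. t * p x)"
  unfolding combination_def
proof (elim exE)
  fix c assume "p = (\<lambda>x. \<Sum>b\<in>B. c b * b x)"
  then show "\<exists>c. (\<lambda>x. t * p x) = (\<lambda>x. \<Sum>b\<in>B. c b * b x)"
    by (intro exI[of _ "\<lambda>b. t * c b"]) (simp add: sum_distrib_left mult.assoc)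
qed

lemma combination_zero: "combination B (\<lambda>x. 0)"
  unfolding combination_def by (intro exI[of _ "\<lambda>b. 0"]) simp

lemma combination_sum:
  assumes "\<And>a. a \<in> A \<Longrightarrow> combination B (h a)" shows "combination B (\<lambda>x. \<Sum>a\<in>A. h a x)"
  using assms by (induction A rule: infinite_finite_induct) (auto intro: combination_zero combination_add)

lemma combination_base: "finite B \<Longrightarrow> b \<in> B \<Longrightarrow> combination B b"
  unfolding combination_def
  by (intro exI[of _ "\<lambda>b'. if b' = b then 1 else 0"]) (simp add: if_distrib[of "\<lambda>x. x * _"] cong: if_cong)

lemma combination_mono:
  assumes "finite C" "B \<subseteq> C" "combination B p" shows "combination C p"
proof -
  obtain c where c: "p = (\<lambda>x. \<Sum>b\<in>B. c b * b x)" using assms(3) unfolding combination_def by blast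
  show ?thesis unfolding c
    using assms(1,2) by (intro combination_sum combination_scale combination_base) auto
qed

lemma polydeg_finite_basis:
  "\<exists>B. finite B \<and> (\<forall>b\<in>B. polydeg n b) \<and> (\<forall>p. polydeg n p \<longrightarrow> combination B p)"
proof (induction n)
  case 0
  have "polydeg n p \<Longrightarrow> n = 0 \<Longrightarrow> combination {\<lambda>_. 1} p" for n p
  proof (induction rule: polydeg.induct)
    case (const n c)
    show ?case unfolding combination_def by (intro exI[of _ "\<lambda>_. c"]) simp
  qed (simp_all add: combination_add)
  then show ?case using polydeg.const by (intro exI[of _ "{\<lambda>_. 1}"]) auto
next
  case (Suc n)
  then obtain B where B: "finite B" "\<forall>b\<in>B. polydeg n b" "\<forall>p. polydeg n p \<longrightarrow> combination B p" by blast
  define g :: "c2 \<times> (c2 \<Rightarrow> real) \<Rightarrow> c2 \<Rightarrow> real" where "g = (\<lambda>(e, b) x. (x \<bullet> e) * b x)"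
  define C where "C = B \<union> g ` ((Basis :: c2 set) \<times> B)"
  have C: "finite C" "B \<subseteq> C" using B(1) by (auto simp: C_def)
  have gC: "g (e, b) \<in> C" if "e \<in> Basis" "b \<in> B" for e b using that by (auto simp: C_def)
  have "polydeg (Suc n) (g (e, b))" if "b \<in> B" for e b
    using polydeg.linear[OF bspec[OF B(2) that] bounded_linear_inner_left] by (simp add: g_def)
  then have "polydeg (Suc n) b" if "b \<in> C" for b
    using that B(2) polydeg_Suc unfolding C_def by blast
  moreover have "polydeg m p \<Longrightarrow> m = Suc n \<Longrightarrow> combination C p" for m p
  proof (induction rule: polydeg.induct)
    case (const m c)
    show ?case using combination_mono[OF C] B(3) polydeg.const by blast
  next
    case (linear m p l)
    then have "combination B p" using B(3) by simp
    then obtain c where c: "p = (\<lambda>x. \<Sum>b\<in>B. c b * b x)" unfolding combination_def by blast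
    have "l x * p x = (\<Sum>e\<in>Basis. \<Sum>b\<in>B. (l e * c b) * g (e, b) x)" for x
    proof -
      have "l x = l (\<Sum>e\<in>Basis. (x \<bullet> e) *\<^sub>R e)" by (simp only: euclidean_representation)
      also have "\<dots> = (\<Sum>e\<in>Basis. (x \<bullet> e) * l e)"
        by (simp add: linear_sum linear_scale bounded_linear.linear[OF linear.hyps(2)])
      finally have "l x * p x = (\<Sum>e\<in>Basis. (x \<bullet> e) * l e) * (\<Sum>b\<in>B. c b * b x)"
        by (simp only: c)
      also have "\<dots> = (\<Sum>e\<in>Basis. \<Sum>b\<in>B. ((x \<bullet> e) * l e) * (c b * b x))" by (rule sum_product)
      also have "\<dots> = (\<Sum>e\<in>Basis. \<Sum>b\<in>B. (l e * c b) * g (e, b) x)"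
        by (intro sum.cong refl) (simp add: g_def)
      finally show ?thesis .
    qed
    then have "(\<lambda>x. l x * p x) = (\<lambda>x. \<Sum>e\<in>Basis. \<Sum>b\<in>B. (l e * c b) * g (e, b) x)" by blast
    moreover have "combination C (\<lambda>x. \<Sum>e\<in>Basis. \<Sum>b\<in>B. (l e * c b) * g (e, b) x)"
      by (intro combination_sum combination_scale combination_base C gC)
    ultimately show ?case by (simp only:)
  next
    case (add m p q)
    then show ?case by (simp add: combination_add)
  qed
  ultimately show ?case using C(1) by (intro exI[of _ C]) blast
qed

lemma combination_orthogonal:
  assumes B: "\<And>b. b \<in> B \<Longrightarrow> b \<in> L2 \<mu>S3" "\<And>b. b \<in> B \<Longrightarrow> ip f b = 0"
    and f: "f \<in> L2 \<mu>S3" and p: "combination B p"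
  shows "ip f p = 0"
proof -
  obtain c where c: "p = (\<lambda>x. \<Sum>b\<in>B. c b * b x)" using p unfolding combination_def by blast
  show ?thesis unfolding c
    using B f by (subst ip_sum_right) (auto intro: L2_scale simp: ip_scale_right)
qed

lemma combination_L2:
  assumes B: "\<And>b. b \<in> B \<Longrightarrow> b \<in> L2 \<mu>S3" and p: "combination B p" shows "p \<in> L2 \<mu>S3"
proof -
  obtain c where c: "p = (\<lambda>x. \<Sum>b\<in>B. c b * b x)" using p unfolding combination_def by blast
  show ?thesis unfolding c by (intro L2_sum L2_scale B)
qed

lemma ip_null:
  assumes "e \<in> L2 \<mu>S3" "ip e e = 0" "f \<in> L2 \<mu>S3" shows "ip f e = 0"
  using ip_cong_AE[OF ip_self_zero_AE[OF assms(1,2)] assms(1) L2_zero assms(3)]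
  by (simp add: ip_commute[of f])

text \<open>Gram-Schmidt: if \<open>e\<close> is the component of \<open>b\<close> orthogonal to \<open>B\<close>, the projection to the span of
  \<open>insert b B\<close> is the one to the span of \<open>B\<close> plus a multiple of \<open>e\<close>.\<close>

lemma orthogonal_projection:
  assumes "finite B" "\<And>b. b \<in> B \<Longrightarrow> b \<in> L2 \<mu>S3" "f \<in> L2 \<mu>S3"
  shows "\<exists>p. combination B p \<and> (\<forall>b\<in>B. ip (\<lambda>w. f w - p w) b = 0)"
  using assms
proof (induction B arbitrary: f rule: finite_induct)
  case empty
  then show ?case using combination_zero by blast
next
  case (insert b B)
  have BL: "\<And>b. b \<in> B \<Longrightarrow> b \<in> L2 \<mu>S3" and bL: "b \<in> L2 \<mu>S3" using insert.prems by auto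
  obtain p0 where p0: "combination B p0" "\<forall>b\<in>B. ip (\<lambda>w. f w - p0 w) b = 0"
    using insert.IH[OF BL insert.prems(2)] by blast
  obtain b0 where b0: "combination B b0" "\<forall>b'\<in>B. ip (\<lambda>w. b w - b0 w) b' = 0"
    using insert.IH[OF BL bL] by blast
  define e where "e = (\<lambda>w. b w - b0 w)"
  define r where "r = (\<lambda>w. f w - p0 w)"
  have L: "p0 \<in> L2 \<mu>S3" "b0 \<in> L2 \<mu>S3" using combination_L2[OF BL] p0(1) b0(1) by auto
  have eL: "e \<in> L2 \<mu>S3" and rL: "r \<in> L2 \<mu>S3"
    unfolding e_def r_def by (intro L2_diff bL L insert.prems(2))+
  have b_eq: "b = (\<lambda>w. e w + b0 w)" by (simp add: e_def)
  define t where "t = (if ip e e = 0 then 0 else ip r e / ip e e)"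
  have te: "ip r e = t * ip e e"
    using ip_null[OF eL _ rL] by (simp add: t_def)
  let ?p = "\<lambda>w. p0 w + t * e w"
  have C: "finite (insert b B)" using insert.hyps by simp
  have "combination (insert b B) p0" "combination (insert b B) b0" "combination (insert b B) b"
    using combination_mono[OF C] p0(1) b0(1) combination_base[OF C] by auto
  then have "combination (insert b B) (\<lambda>w. p0 w + t * (b w + (-1) * b0 w))"
    by (intro combination_add combination_scale)
  then have comb: "combination (insert b B) ?p" by (simp add: e_def)
  have eq: "(\<lambda>w. f w - ?p w) = (\<lambda>w. r w - t * e w)" by (simp add: r_def algebra_simps)
  have ipB: "ip (\<lambda>w. r w - t * e w) b' = 0" if "b' \<in> B" for b'
  proof -
    have "ip r b' = 0" "ip e b' = 0"
      using p0(2) b0(2) that unfolding r_def e_def by auto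
    then show ?thesis
      unfolding ip_diff_left[OF rL L2_scale[OF eL] BL[OF that]] ip_scale_left by simp
  qed
  have "ip (\<lambda>w. r w - t * e w) b = 0"
  proof -
    have rte: "(\<lambda>w. r w - t * e w) \<in> L2 \<mu>S3" by (intro L2_diff L2_scale rL eL)
    have "ip (\<lambda>w. r w - t * e w) b0 = 0"
      by (rule combination_orthogonal[OF BL ipB rte b0(1)])
    moreover have "ip (\<lambda>w. r w - t * e w) e = 0"
      unfolding ip_diff_left[OF rL L2_scale[OF eL] eL] ip_scale_left te by simp
    moreover have "ip (\<lambda>w. r w - t * e w) b
        = ip (\<lambda>w. r w - t * e w) e + ip (\<lambda>w. r w - t * e w) b0"
      using ip_add_right[OF eL L(2) rte] by (simp only: b_eq[symmetric])
    ultimately show ?thesis by simp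
  qed
  with ipB have "\<forall>b'\<in>insert b B. ip (\<lambda>w. f w - ?p w) b' = 0" unfolding eq by blast
  with comb show ?case by blast
qed

text \<open>The orthogonal projection of \<open>L\<^sup>2\<close> onto the polynomials of degree at most \<open>n\<close>, determined up to null
  sets.\<close>

definition proj :: "nat \<Rightarrow> (c2 \<Rightarrow> real) \<Rightarrow> c2 \<Rightarrow> real" where
  "proj n f = (SOME p. polydeg n p \<and> (\<forall>q. polydeg n q \<longrightarrow> ip (\<lambda>w. f w - p w) q = 0))"

lemma proj:
  assumes "f \<in> L2 \<mu>S3"
  shows polydeg_proj: "polydeg n (proj n f)"
    and proj_orthogonal: "polydeg n q \<Longrightarrow> ip (\<lambda>w. f w - proj n f w) q = 0"
proof -
  obtain B where B: "finite B" "\<forall>b\<in>B. polydeg n b" "\<forall>p. polydeg n p \<longrightarrow> combination B p"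
    using polydeg_finite_basis by blast
  have BL: "b \<in> L2 \<mu>S3" if "b \<in> B" for b using B(2) that polydeg_L2 by blast
  obtain p where p: "combination B p" "\<forall>b\<in>B. ip (\<lambda>w. f w - p w) b = 0"
    using orthogonal_projection[OF B(1) BL assms] by blast
  have "polydeg n p"
  proof -
    obtain c where c: "p = (\<lambda>x. \<Sum>b\<in>B. c b * b x)" using p(1) unfolding combination_def by blast
    have "polydeg n (\<lambda>x. \<Sum>b\<in>A. c b * b x)" if "A \<subseteq> B" for A
      using finite_subset[OF that B(1)] that
    proof (induction A rule: finite_induct)
      case empty
      show ?case by (simp add: polydeg.const)
    next
      case (insert a A)
      then show ?case using B(2) by (auto intro!: polydeg.add polydeg_scale)
    qed
    then show ?thesis unfolding c by blast
  qed
  moreover have "ip (\<lambda>w. f w - p w) q = 0" if "polydeg n q" for q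
  proof (rule combination_orthogonal[OF BL])
    show "ip (\<lambda>w. f w - p w) b = 0" if "b \<in> B" for b using p(2) that by blast
    show "(\<lambda>w. f w - p w) \<in> L2 \<mu>S3" by (rule L2_diff[OF assms combination_L2[OF BL p(1)]])
    show "combination B q" using B(3) that by blast
  qed
  ultimately have "polydeg n p \<and> (\<forall>q. polydeg n q \<longrightarrow> ip (\<lambda>w. f w - p w) q = 0)" by blast
  then have *: "polydeg n (proj n f) \<and> (\<forall>q. polydeg n q \<longrightarrow> ip (\<lambda>w. f w - proj n f w) q = 0)"
    unfolding proj_def
    by (rule someI[where P = "\<lambda>p. polydeg n p \<and> (\<forall>q. polydeg n q \<longrightarrow> ip (\<lambda>w. f w - p w) q = 0)"])
  from * show "polydeg n (proj n f)" by (rule conjunct1)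
  from * show "polydeg n q \<Longrightarrow> ip (\<lambda>w. f w - proj n f w) q = 0" by blast
qed

lemma ip_proj:
  assumes "f \<in> L2 \<mu>S3" "polydeg n q" shows "ip (proj n f) q = ip f q"
proof -
  have "proj n f \<in> L2 \<mu>S3" by (rule polydeg_L2[OF polydeg_proj[OF assms(1)]])
  from ip_diff_left[OF assms(1) this polydeg_L2[OF assms(2)]] proj_orthogonal[OF assms]
  show ?thesis by simp
qed

lemma proj_L2: "f \<in> L2 \<mu>S3 \<Longrightarrow> proj n f \<in> L2 \<mu>S3"
  by (rule polydeg_L2[OF polydeg_proj])

lemma proj_smooth: "f \<in> L2 \<mu>S3 \<Longrightarrow> proj n f \<in> smooth_S3"
  by (rule polydeg_smooth[OF polydeg_proj])

lemma L2_tendsto_dominated: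
  fixes f :: "'a \<Rightarrow> real"
  assumes g: "\<And>n. g n \<in> borel_measurable M" and f: "f \<in> L2 M" and h: "h \<in> L2 M"
    and lim: "\<And>x. x \<in> space M \<Longrightarrow> (\<lambda>n. g n x) \<longlonglongrightarrow> f x"
    and le: "\<And>n x. x \<in> space M \<Longrightarrow> \<bar>g n x\<bar> \<le> \<bar>h x\<bar>"
  shows "L2_tendsto M g f sequentially" "\<And>n. g n \<in> L2 M"
proof -
  note fm = L2_measurable[OF f] and hm = L2_measurable[OF h]
  have gL: "g n \<in> L2 M" for n
  proof -
    have "integrable M (\<lambda>x. (g n x)\<^sup>2)"
    proof (rule Bochner_Integration.integrable_bound[OF L2_integrable_sq[OF h]])
      show "AE x in M. norm ((g n x)\<^sup>2) \<le> norm ((h x)\<^sup>2)"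
        using le[of _ n] by (intro AE_I2) (simp add: abs_le_square_iff)
    qed (use g in simp)
    then show ?thesis using g by (simp add: L2_real_iff)
  qed
  then show "\<And>n. g n \<in> L2 M" .
  have "(\<lambda>n. LINT x|M. (g n x - f x)\<^sup>2) \<longlonglongrightarrow> (LINT x|M. 0)"
  proof (rule integral_dominated_convergence[where w = "\<lambda>x. 2 * (h x)\<^sup>2 + 2 * (f x)\<^sup>2"])
    show "(\<lambda>x. (g n x - f x)\<^sup>2) \<in> borel_measurable M" for n using g fm by simp
    show "integrable M (\<lambda>x. 2 * (h x)\<^sup>2 + 2 * (f x)\<^sup>2)"
      using L2_integrable_sq[OF h] L2_integrable_sq[OF f] by simp
    show "AE x in M. (\<lambda>n. (g n x - f x)\<^sup>2) \<longlonglongrightarrow> 0"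
    proof (rule AE_I2)
      fix x assume "x \<in> space M"
      then have "(\<lambda>n. (g n x - f x)\<^sup>2) \<longlonglongrightarrow> (f x - f x)\<^sup>2"
        by (intro tendsto_intros lim)
      then show "(\<lambda>n. (g n x - f x)\<^sup>2) \<longlonglongrightarrow> 0" by (simp only: diff_self power_zero_numeral)
    qed
    show "AE x in M. norm ((g n x - f x)\<^sup>2) \<le> 2 * (h x)\<^sup>2 + 2 * (f x)\<^sup>2" for n
    proof (rule AE_I2)
      fix x assume "x \<in> space M"
      then have "(g n x)\<^sup>2 \<le> (h x)\<^sup>2" using le[of x n] by (simp add: abs_le_square_iff)
      then show "norm ((g n x - f x)\<^sup>2) \<le> 2 * (h x)\<^sup>2 + 2 * (f x)\<^sup>2"
        using norm_add_sq_le[of "g n x" "- f x"] by simp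
    qed
  qed simp
  then show "L2_tendsto M g f sequentially" by (simp add: L2_tendsto_real)
qed

definition approximable :: "(c2 \<Rightarrow> real) \<Rightarrow> bool" where
  "approximable f \<longleftrightarrow> f \<in> L2 \<mu>S3 \<and>
     (\<forall>e>0. \<exists>p. real_polynomial_function p \<and> (LINT w|\<mu>S3. (f w - p w)\<^sup>2) < e)"

lemma L2_sq_triangle:
  fixes a b c :: "'a \<Rightarrow> real"
  assumes "a \<in> L2 M" "b \<in> L2 M" "c \<in> L2 M"
  shows "(LINT x|M. (a x - c x)\<^sup>2) \<le> 2 * (LINT x|M. (a x - b x)\<^sup>2) + 2 * (LINT x|M. (b x - c x)\<^sup>2)"
proof -
  note i = L2_integrable_sq[OF L2_diff[OF assms(1,2)]] L2_integrable_sq[OF L2_diff[OF assms(2,3)]]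
  have "(LINT x|M. (a x - c x)\<^sup>2) \<le> (LINT x|M. 2 * (a x - b x)\<^sup>2 + 2 * (b x - c x)\<^sup>2)"
  proof (rule integral_mono[OF L2_integrable_sq[OF L2_diff[OF assms(1,3)]]])
    show "(a x - c x)\<^sup>2 \<le> 2 * (a x - b x)\<^sup>2 + 2 * (b x - c x)\<^sup>2" for x
      using norm_add_sq_le[of "a x - b x" "b x - c x"] by simp
  qed (use i in simp)
  then show ?thesis using i by simp
qed

lemma approximableI_limit:
  assumes f: "f \<in> L2 \<mu>S3" and g: "\<And>n::nat. approximable (g n)" and lim: "L2_tendsto \<mu>S3 g f sequentially"
  shows "approximable f"
  unfolding approximable_def
proof (intro conjI f allI impI)
  fix e :: real assume e: "0 < e"
  have "\<forall>\<^sub>F n in sequentially. (LINT w|\<mu>S3. (g n w - f w)\<^sup>2) < e / 4"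
    using lim e unfolding L2_tendsto_real by (intro order_tendstoD(2)[of _ 0]) auto
  then obtain n where n: "(LINT w|\<mu>S3. (g n w - f w)\<^sup>2) < e / 4"
    by (auto simp: eventually_sequentially)
  obtain p where p: "real_polynomial_function p" "(LINT w|\<mu>S3. (g n w - p w)\<^sup>2) < e / 4"
    using g[of n] divide_pos_pos[OF e zero_less_numeral[of "num.Bit0 (num.Bit0 num.One)"]]
    unfolding approximable_def by blast
  have gL: "g n \<in> L2 \<mu>S3" using g unfolding approximable_def by blast
  have "(LINT w|\<mu>S3. (f w - g n w)\<^sup>2) = (LINT w|\<mu>S3. (g n w - f w)\<^sup>2)"
    by (simp only: power2_commute[of "f _"])
  with L2_sq_triangle[OF f gL smooth_S3_L2[OF real_polynomial_smooth_S3[OF p(1)]]] n p(2)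
  have "(LINT w|\<mu>S3. (f w - p w)\<^sup>2) < e" by linarith
  with p(1) show "\<exists>p. real_polynomial_function p \<and> (LINT w|\<mu>S3. (f w - p w)\<^sup>2) < e" by blast
qed

lemma approximable_add:
  assumes "approximable f" "approximable g" shows "approximable (\<lambda>w. f w + g w)"
  unfolding approximable_def
proof (intro conjI allI impI)
  have L: "f \<in> L2 \<mu>S3" "g \<in> L2 \<mu>S3" using assms unfolding approximable_def by auto
  then show fg: "(\<lambda>w. f w + g w) \<in> L2 \<mu>S3" by (rule L2_add)
  fix e :: real assume "0 < e"
  then have e: "0 < e / 4" by simp
  obtain p q where pq: "real_polynomial_function p" "(LINT w|\<mu>S3. (f w - p w)\<^sup>2) < e / 4"
    "real_polynomial_function q" "(LINT w|\<mu>S3. (g w - q w)\<^sup>2) < e / 4"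
    using assms e unfolding approximable_def by blast
  have pL: "p \<in> L2 \<mu>S3" "q \<in> L2 \<mu>S3" using pq by (auto intro: smooth_S3_L2 real_polynomial_smooth_S3)
  have "(LINT w|\<mu>S3. ((f w + g w) - (p w + q w))\<^sup>2) \<le> 2 * (LINT w|\<mu>S3. ((f w + g w) - (p w + g w))\<^sup>2)
      + 2 * (LINT w|\<mu>S3. ((p w + g w) - (p w + q w))\<^sup>2)"
    by (rule L2_sq_triangle) (intro L2_add L pL)+
  also have "\<dots> = 2 * (LINT w|\<mu>S3. (f w - p w)\<^sup>2) + 2 * (LINT w|\<mu>S3. (g w - q w)\<^sup>2)"
    by (simp only: add_diff_cancel_left add_diff_cancel_right)
  also have "\<dots> < e" using pq by linarith
  finally show "\<exists>p. real_polynomial_function p \<and> (LINT w|\<mu>S3. (f w + g w - p w)\<^sup>2) < e"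
    using real_polynomial_function.intros(3)[OF pq(1,3)] by blast
qed

lemma approximable_const_mult:
  assumes "approximable f" shows "approximable (\<lambda>w. c * f w)"
proof (cases "c = 0")
  case True
  show ?thesis unfolding approximable_def True
    by (auto intro!: exI[of _ "\<lambda>_. 0"])
next
  case False
  have L: "f \<in> L2 \<mu>S3" using assms unfolding approximable_def by auto
  show ?thesis
    unfolding approximable_def
  proof (intro conjI allI impI L2_scale L)
    fix e :: real assume "0 < e"
    then have "0 < e / c\<^sup>2" using False by simp
    then obtain p where p: "real_polynomial_function p" "(LINT w|\<mu>S3. (f w - p w)\<^sup>2) < e / c\<^sup>2"
      using assms unfolding approximable_def by blast
    have "(c * f w - c * p w)\<^sup>2 = c\<^sup>2 * (f w - p w)\<^sup>2" for w
      by (simp only: right_diff_distrib[symmetric] power_mult_distrib)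
    then have "(LINT w|\<mu>S3. (c * f w - c * p w)\<^sup>2) = c\<^sup>2 * (LINT w|\<mu>S3. (f w - p w)\<^sup>2)" by simp
    also have "\<dots> < c\<^sup>2 * (e / c\<^sup>2)" using p(2) False by (intro mult_strict_left_mono) auto
    also have "\<dots> = e" using False by simp
    finally show "\<exists>p. real_polynomial_function p \<and> (LINT w|\<mu>S3. (c * f w - p w)\<^sup>2) < e"
      using p(1) by (intro exI[of _ "\<lambda>w. c * p w"]) auto
  qed
qed

lemma approximable_sum:
  assumes "\<And>i. i \<in> A \<Longrightarrow> approximable (h i)" shows "approximable (\<lambda>w. \<Sum>i\<in>A. h i w)"
proof -
  have 0: "approximable (\<lambda>w. 0)" unfolding approximable_def by (auto intro!: exI[of _ "\<lambda>_. 0"])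
  show ?thesis
    using assms by (induction A rule: infinite_finite_induct) (auto intro: 0 approximable_add)
qed

lemma approximable_continuous:
  assumes "continuous_on S3 f" shows "approximable f"
  unfolding approximable_def
proof (intro conjI allI impI)
  show f: "f \<in> L2 \<mu>S3" by (rule continuous_L2_\<mu>S3[OF assms])
  fix e :: real assume e: "0 < e"
  define V where "V = measure \<mu>S3 S3 + 1"
  have V: "0 < V" by (simp add: V_def add_nonneg_pos)
  have "0 < sqrt (e / V)" using e V by simp
  then obtain p where p: "real_polynomial_function p" "\<And>w. w \<in> S3 \<Longrightarrow> \<bar>f w - p w\<bar> < sqrt (e / V)"
    using Stone_Weierstrass_real_polynomial_function[OF compact_sphere assms] by blast
  have pL: "p \<in> L2 \<mu>S3" by (intro smooth_S3_L2 real_polynomial_smooth_S3 p(1))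
  have "(LINT w|\<mu>S3. (f w - p w)\<^sup>2) \<le> (LINT w|\<mu>S3. e / V)"
  proof (rule integral_mono[OF L2_integrable_sq[OF L2_diff[OF f pL]]])
    fix w assume "w \<in> space \<mu>S3"
    then have "w \<in> S3" unfolding space_\<mu>S3 .
    from p(2)[OF this] have "\<bar>f w - p w\<bar> \<le> \<bar>sqrt (e / V)\<bar>" by linarith
    then have "(f w - p w)\<^sup>2 \<le> (sqrt (e / V))\<^sup>2" by (simp only: abs_le_square_iff)
    also have "\<dots> = e / V" using e V by simp
    finally show "(f w - p w)\<^sup>2 \<le> e / V" .
  qed simp
  also have "\<dots> = e / V * (V - 1)" by (simp add: V_def)
  also have "\<dots> < e" using e V by (simp add: field_simps)
  finally show "\<exists>p. real_polynomial_function p \<and> (LINT w|\<mu>S3. (f w - p w)\<^sup>2) < e"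
    using p(1) by blast
qed

lemma borel_indicator_L2: "A \<in> sets borel \<Longrightarrow> (indicator A :: c2 \<Rightarrow> real) \<in> L2 \<mu>S3"
proof -
  assume A: "A \<in> sets borel"
  have "(indicator A :: c2 \<Rightarrow> real) \<in> borel_measurable \<mu>S3"
    unfolding measurable_cong_sets[OF sets_\<mu>S3 refl] using A by (intro measurable_restrict_space1) simp
  then show ?thesis by (rule \<mu>S3.L2_bounded[of _ 1]) (simp add: indicator_def)
qed

lemma approximable_closed_indicator:
  assumes "closed C" shows "approximable (indicator C)"
proof (cases "C = {}")
  case True
  have "indicator C = (\<lambda>w::c2. 0 :: real)" unfolding True by (simp add: fun_eq_iff)
  then show ?thesis using approximable_continuous[of "\<lambda>_. 0"] by simp
next
  case False
  let ?g = "\<lambda>n w. max 0 (1 - real n * infdist w C)"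
  have c: "continuous_on S (?g n)" for n S by (intro continuous_intros)
  have C: "C \<in> sets borel" using assms by simp
  have lim: "(\<lambda>n. ?g n w) \<longlonglongrightarrow> indicator C w" for w
  proof (cases "w \<in> C")
    case True
    then show ?thesis by (simp add: infdist_zero)
  next
    case False
    then have d: "0 < infdist w C"
      using in_closed_iff_infdist_zero[OF assms \<open>C \<noteq> {}\<close>, of w] infdist_nonneg[of w C] by simp
    obtain N where N: "1 < real N * infdist w C" using reals_Archimedean3[OF d] by blast
    have "?g n w = 0" if "N \<le> n" for n
    proof -
      have "real N * infdist w C \<le> real n * infdist w C"
        using that d by (intro mult_right_mono) auto
      then show ?thesis using N by simp
    qed
    then have "\<forall>\<^sub>F n in sequentially. ?g n w = indicator C w"
      using False by (auto simp: eventually_sequentially)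
    then show ?thesis by (rule tendsto_eventually)
  qed
  show ?thesis
  proof (rule approximableI_limit[OF borel_indicator_L2[OF C] approximable_continuous[OF c]])
    show "L2_tendsto \<mu>S3 ?g (indicator C) sequentially"
    proof (rule L2_tendsto_dominated(1)[where h = "\<lambda>_. 1"])
      show "?g n \<in> borel_measurable \<mu>S3" for n by (rule continuous_measurable_\<mu>S3[OF c])
      show "\<bar>?g n x\<bar> \<le> \<bar>1\<bar>" for n x using infdist_nonneg[of x C] by simp
      show "(\<lambda>_. 1 :: real) \<in> L2 \<mu>S3" by (rule continuous_L2_\<mu>S3) simp
    qed (use borel_indicator_L2[OF C] lim in auto)
  qed
qed

lemma approximable_borel_indicator:
  assumes "A \<in> sets (borel :: c2 measure)" shows "approximable (indicator A)"
proof -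
  have sb: "sets (borel :: c2 measure) = sigma_sets UNIV (Collect closed)"
    by (simp add: borel_eq_closed)
  have "Int_stable (Collect closed :: c2 set set)" by (auto simp: Int_stable_def)
  moreover have "(Collect closed :: c2 set set) \<subseteq> Pow UNIV" by simp
  moreover have "A \<in> sigma_sets UNIV (Collect closed)" using assms unfolding sb .
  ultimately show ?thesis
  proof (induction rule: sigma_sets_induct_disjoint)
    case (basic A)
    then show ?case using approximable_closed_indicator by simp
  next
    case empty
    show ?case by (rule approximable_closed_indicator) (rule closed_empty)
  next
    case (compl A)
    have "indicator (UNIV - A) = (\<lambda>w::c2. 1 + (-1) * indicator A w :: real)"
      by (auto simp: fun_eq_iff indicator_def)
    then show ?case
      using approximable_add[OF approximable_continuous[of "\<lambda>_. 1"] approximable_const_mult[OF compl.IH, of "-1"]]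
      by simp
  next
    case (union A)
    have A: "A i \<in> sets borel" for i
      using union(2) unfolding sb by blast
    have "range A \<subseteq> sets borel" using A by auto
    then have U: "\<Union>(range A) \<in> sets borel" by (rule sets.countable_UN)
    let ?g = "\<lambda>n w. \<Sum>i<n. indicator (A i) w :: real"
    have g: "?g n w = indicator (\<Union>i<n. A i) w" for n w
      using union(1) by (subst indicator_UN_disjoint) (auto simp: disjoint_family_on_def)
    show ?case
    proof (rule approximableI_limit[OF borel_indicator_L2[OF U]])
      show "approximable (?g n)" for n by (intro approximable_sum union.IH)
      show "L2_tendsto \<mu>S3 ?g (indicator (\<Union>(range A))) sequentially"
      proof (rule L2_tendsto_dominated(1)[where h = "\<lambda>_. 1"])
        show "?g n \<in> borel_measurable \<mu>S3" for n
          by (intro borel_measurable_sum L2_measurable borel_indicator_L2 A)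
        show "\<bar>?g n x\<bar> \<le> \<bar>1\<bar>" for n x unfolding g by (simp add: indicator_def)
        show "(\<lambda>_. 1 :: real) \<in> L2 \<mu>S3" by (rule continuous_L2_\<mu>S3) simp
        show "(\<lambda>n. ?g n x) \<longlonglongrightarrow> indicator (\<Union>(range A)) x" for x
          unfolding g by (rule LIMSEQ_indicator_UN)
      qed (rule borel_indicator_L2[OF U])
    qed
  qed
qed

text \<open>Polynomials are dense in \<open>L\<^sup>2\<close>: they approximate continuous functions (Stone-Weierstrass),
  hence indicators of closed sets, of Borel sets, and simple functions.\<close>

lemma approximable_L2:
  assumes f: "f \<in> L2 \<mu>S3" shows "approximable f"
proof -
  obtain s where s0: "(\<forall>i. simple_function \<mu>S3 (s i)) \<and> (\<forall>x\<in>space \<mu>S3. (\<lambda>i. s i x) \<longlonglongrightarrow> f x) \<and>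
      (\<forall>i. \<forall>x\<in>space \<mu>S3. dist (s i x) 0 \<le> 2 * dist (f x) 0)"
    by (rule exE[OF borel_measurable_implies_sequence_metric[OF L2_measurable[OF f], of 0]])
  have s: "simple_function \<mu>S3 (s i)" "x \<in> space \<mu>S3 \<Longrightarrow> (\<lambda>i. s i x) \<longlonglongrightarrow> f x"
    "x \<in> space \<mu>S3 \<Longrightarrow> dist (s i x) 0 \<le> 2 * dist (f x) 0" for i x
    using s0 by blast+
  have "approximable (s i)" for i
  proof -
    have "approximable (indicator (s i -` {y} \<inter> space \<mu>S3))" for y
    proof -
      have "s i -` {y} \<inter> space \<mu>S3 \<in> sets \<mu>S3" using s(1) by (rule simple_functionD(2))
      then show ?thesis using approximable_borel_indicator
        by (auto simp: sets_\<mu>S3 sets_restrict_space_iff)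
    qed
    then have a: "approximable (\<lambda>x. \<Sum>y\<in>s i ` space \<mu>S3. y * indicator (s i -` {y} \<inter> space \<mu>S3) x)"
      by (intro approximable_sum approximable_const_mult)
    have e: "s i x = (\<Sum>y\<in>s i ` space \<mu>S3. y * indicator (s i -` {y} \<inter> space \<mu>S3) x)"
      if "x \<in> space \<mu>S3" for x
      using simple_function_indicator_representation_banach[OF s(1) that, of i]
      by (simp only: real_scaleR_def mult.commute[of "indicator _ _"])
    have m: "s i \<in> L2 \<mu>S3"
    proof (rule L2_cong_AE[OF _ borel_measurable_simple_function[OF s(1)]])
      show "(\<lambda>x. \<Sum>y\<in>s i ` space \<mu>S3. y * indicator (s i -` {y} \<inter> space \<mu>S3) x) \<in> L2 \<mu>S3"
        using a unfolding approximable_def by (rule conjunct1)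
    qed (rule AE_I2, rule e[symmetric])
    have I: "(LINT x|\<mu>S3. (s i x - p x)\<^sup>2)
      = (LINT x|\<mu>S3. ((\<Sum>y\<in>s i ` space \<mu>S3. y * indicator (s i -` {y} \<inter> space \<mu>S3) x) - p x)\<^sup>2)" for p
      by (rule Bochner_Integration.integral_cong[OF refl]) (simp only: e)
    from a have "\<forall>d>0. \<exists>p. real_polynomial_function p \<and> (LINT x|\<mu>S3.
        ((\<Sum>y\<in>s i ` space \<mu>S3. y * indicator (s i -` {y} \<inter> space \<mu>S3) x) - p x)\<^sup>2) < d"
      unfolding approximable_def by (rule conjunct2)
    with m show ?thesis unfolding approximable_def I by (rule conjI)
  qed
  moreover have "L2_tendsto \<mu>S3 s f sequentially"
  proof (rule L2_tendsto_dominated(1)[where h = "\<lambda>x. 2 * f x"])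
    show "s n \<in> borel_measurable \<mu>S3" for n by (rule borel_measurable_simple_function[OF s(1)])
    show "\<bar>s n x\<bar> \<le> \<bar>2 * f x\<bar>" if "x \<in> space \<mu>S3" for n x
      using s(3)[OF that, of n] by (simp add: abs_mult)
  qed (rule f L2_scale[OF f] s(2); assumption?)+
  ultimately show ?thesis using approximableI_limit[OF f] by blast
qed

lemma proj_tendsto:
  assumes f: "f \<in> L2 \<mu>S3" shows "L2_tendsto \<mu>S3 (\<lambda>n. proj n f) f sequentially"
  unfolding L2_tendsto_real
proof (rule LIMSEQ_I)
  fix e :: real assume "0 < e"
  then obtain p where p: "real_polynomial_function p" "(LINT w|\<mu>S3. (f w - p w)\<^sup>2) < e"
    using approximable_L2[OF f] unfolding approximable_def by blast
  obtain N where N: "polydeg N p" using real_polynomial_polydeg[OF p(1)] by blast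
  have "norm ((LINT w|\<mu>S3. (proj n f w - f w)\<^sup>2) - 0) < e" if "N \<le> n" for n
  proof -
    let ?u = "\<lambda>w. f w - proj n f w" and ?v = "\<lambda>w. proj n f w - p w"
    have v: "polydeg n ?v" by (intro polydeg_diff polydeg_proj f polydeg_mono[OF that N])
    have L: "?u \<in> L2 \<mu>S3" "?v \<in> L2 \<mu>S3" using polydeg_L2[OF v] L2_diff[OF f proj_L2[OF f]] by auto
    have "(LINT w|\<mu>S3. (f w - p w)\<^sup>2) = ip (\<lambda>w. ?u w + ?v w) (\<lambda>w. ?u w + ?v w)"
      unfolding ip_def by (rule Bochner_Integration.integral_cong[OF refl]) (simp add: power2_eq_square)
    also have "\<dots> = ip ?u ?u + 2 * ip ?u ?v + ip ?v ?v"
      using ip_commute[of ?v ?u]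
      by (simp only: ip_add_left[OF L L2_add[OF L]] ip_add_right[OF L L(1)] ip_add_right[OF L L(2)])
    also have "ip ?u ?v = 0" by (rule proj_orthogonal[OF f v])
    finally have "ip ?u ?u + ip ?v ?v < e" using p(2) by simp
    moreover have "0 \<le> ip ?v ?v" unfolding ip_def by simp
    moreover have "ip ?u ?u = (LINT w|\<mu>S3. (proj n f w - f w)\<^sup>2)"
      unfolding ip_def power2_eq_square[symmetric] by (simp only: power2_commute[of "f _"])
    ultimately show ?thesis by simp
  qed
  then show "\<exists>no. \<forall>n\<ge>no. norm ((LINT w|\<mu>S3. (proj n f w - f w)\<^sup>2) - 0) < e" by blast
qed

lemma ip_polynomial_eqI:
  assumes f: "f \<in> L2 \<mu>S3" and g: "g \<in> L2 \<mu>S3"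
    and eq: "\<And>p. real_polynomial_function p \<Longrightarrow> ip f p = ip g p"
  shows "AE w in \<mu>S3. f w = g w"
proof -
  let ?h = "\<lambda>w. f w - g w"
  have h: "?h \<in> L2 \<mu>S3" by (rule L2_diff[OF f g])
  have "ip ?h (proj n ?h) = 0" for n
    using eq[OF polydeg_real_polynomial[OF polydeg_proj[OF h]]]
    by (simp only: ip_diff_left[OF f g proj_L2[OF h]])
  moreover have "(\<lambda>n. ip ?h (proj n ?h)) \<longlonglongrightarrow> ip ?h ?h"
    by (rule ip_tendsto[OF L2_tendsto_const h h proj_tendsto[OF h] proj_L2[OF h] h])
  ultimately have "(\<lambda>n. 0) \<longlonglongrightarrow> ip ?h ?h" by (simp only:)
  then have "ip ?h ?h = 0" by (rule LIMSEQ_unique[OF _ tendsto_const])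
  from ip_self_zero_AE[OF h this] show ?thesis by simp
qed

section \<open>Weak derivatives\<close>

text \<open>Polynomials suffice as test functions because they are dense in \<open>L\<^sup>2\<close>; they are convenient because
  those of bounded degree form finite-dimensional spaces preserved by the frame derivatives.\<close>

definition wd :: "axis \<Rightarrow> (c2 \<Rightarrow> real) \<Rightarrow> (c2 \<Rightarrow> real) \<Rightarrow> bool" where
  "wd i f g \<longleftrightarrow> f \<in> L2 \<mu>S3 \<and> g \<in> L2 \<mu>S3 \<and>
     (\<forall>p. real_polynomial_function p \<longrightarrow> ip f (frame_deriv i p) = - ip g p)"

lemma wdD: "wd i f g \<Longrightarrow> f \<in> L2 \<mu>S3" "wd i f g \<Longrightarrow> g \<in> L2 \<mu>S3"
  "wd i f g \<Longrightarrow> real_polynomial_function p \<Longrightarrow> ip f (frame_deriv i p) = - ip g p"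
  unfolding wd_def by auto

lemma wdI:
  assumes "f \<in> L2 \<mu>S3" "g \<in> L2 \<mu>S3"
    "\<And>p. real_polynomial_function p \<Longrightarrow> ip f (frame_deriv i p) = - ip g p"
  shows "wd i f g"
  using assms unfolding wd_def by blast

lemma polynomial_L2: "real_polynomial_function p \<Longrightarrow> p \<in> L2 \<mu>S3"
  by (intro smooth_S3_L2 real_polynomial_smooth_S3)

lemma polynomial_frame_deriv_L2: "real_polynomial_function p \<Longrightarrow> frame_deriv i p \<in> L2 \<mu>S3"
  by (intro smooth_S3_L2 smooth_S3_frame_deriv real_polynomial_smooth_S3)

lemma wd_smooth:
  assumes "\<psi> \<in> smooth_S3" shows "wd i \<psi> (frame_deriv i \<psi>)"
proof (rule wdI)
  fix p :: "c2 \<Rightarrow> real" assume "real_polynomial_function p"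
  then have "p \<in> smooth_S3" by (rule real_polynomial_smooth_S3)
  from integration_by_parts_smooth[OF assms this, of i]
  show "ip \<psi> (frame_deriv i p) = - ip (frame_deriv i \<psi>) p" unfolding ip_def by simp
qed (intro smooth_S3_L2 smooth_S3_frame_deriv assms)+

lemma wd_limit:
  assumes "\<And>n::nat. wd i (F n) (G n)" "L2_tendsto \<mu>S3 F f sequentially" "L2_tendsto \<mu>S3 G g sequentially"
    "f \<in> L2 \<mu>S3" "g \<in> L2 \<mu>S3"
  shows "wd i f g"
proof (rule wdI[OF assms(4,5)])
  fix p :: "c2 \<Rightarrow> real" assume p: "real_polynomial_function p"
  have "(\<lambda>n. ip (F n) (frame_deriv i p)) \<longlonglongrightarrow> ip f (frame_deriv i p)"
    using polynomial_frame_deriv_L2[OF p]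
    by (intro ip_tendsto assms L2_tendsto_const wdD(1)[OF assms(1)])
  moreover have "(\<lambda>n. - ip (G n) p) \<longlonglongrightarrow> - ip g p"
    using polynomial_L2[OF p]
    by (intro tendsto_minus ip_tendsto assms L2_tendsto_const wdD(2)[OF assms(1)])
  moreover have "ip (F n) (frame_deriv i p) = - ip (G n) p" for n by (rule wdD(3)[OF assms(1) p])
  ultimately show "ip f (frame_deriv i p) = - ip g p" by (simp only: LIMSEQ_unique)
qed

lemma wd_unique: "wd i f g \<Longrightarrow> wd i f h \<Longrightarrow> AE w in \<mu>S3. g w = h w"
proof (rule ip_polynomial_eqI)
  assume a: "wd i f g" "wd i f h"
  fix p :: "c2 \<Rightarrow> real" assume "real_polynomial_function p"
  from wdD(3)[OF a(1) this] wdD(3)[OF a(2) this] show "ip g p = ip h p" by simp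
qed (auto dest: wdD)

lemma wd_cong_AE:
  assumes "wd i f g" "AE w in \<mu>S3. f w = f' w" "AE w in \<mu>S3. g w = g' w"
    "f' \<in> borel_measurable \<mu>S3" "g' \<in> borel_measurable \<mu>S3"
  shows "wd i f' g'"
proof (rule wdI)
  show f': "f' \<in> L2 \<mu>S3" by (rule L2_cong_AE[OF wdD(1)[OF assms(1)] assms(4,2)])
  show g': "g' \<in> L2 \<mu>S3" by (rule L2_cong_AE[OF wdD(2)[OF assms(1)] assms(5,3)])
  fix p :: "c2 \<Rightarrow> real" assume p: "real_polynomial_function p"
  show "ip f' (frame_deriv i p) = - ip g' p"
    using wdD(3)[OF assms(1) p] ip_cong_AE[OF assms(2) wdD(1)[OF assms(1)] f' polynomial_frame_deriv_L2[OF p]]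
      ip_cong_AE[OF assms(3) wdD(2)[OF assms(1)] g' polynomial_L2[OF p]] by simp
qed

lemma wd_add:
  assumes "wd i f f'" "wd i g g'" shows "wd i (\<lambda>w. f w + g w) (\<lambda>w. f' w + g' w)"
proof (rule wdI)
  fix p :: "c2 \<Rightarrow> real" assume p: "real_polynomial_function p"
  show "ip (\<lambda>w. f w + g w) (frame_deriv i p) = - ip (\<lambda>w. f' w + g' w) p"
    using wdD(3)[OF assms(1) p] wdD(3)[OF assms(2) p]
    by (simp add: ip_add_left wdD[OF assms(1)] wdD[OF assms(2)] polynomial_L2[OF p] polynomial_frame_deriv_L2[OF p])
qed (intro L2_add wdD[OF assms(1)] wdD[OF assms(2)])+

lemma wd_scale:
  assumes "wd i f f'" shows "wd i (\<lambda>w. c * f w) (\<lambda>w. c * f' w)"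
proof (rule wdI)
  fix p :: "c2 \<Rightarrow> real" assume p: "real_polynomial_function p"
  show "ip (\<lambda>w. c * f w) (frame_deriv i p) = - ip (\<lambda>w. c * f' w) p"
    using wdD(3)[OF assms(1) p] by (simp add: ip_scale_left)
qed (intro L2_scale wdD[OF assms(1)])+

lemma wd_diff:
  assumes "wd i f f'" "wd i g g'" shows "wd i (\<lambda>w. f w - g w) (\<lambda>w. f' w - g' w)"
  using wd_add[OF assms(1) wd_scale[OF assms(2), of "-1"]] by simp

lemma wd_const: "wd i (\<lambda>w. c) (\<lambda>w. 0)"
  using wd_smooth[OF smooth_S3_const, of i c] by simp

text \<open>The frame derivatives map polynomials of degree \<open>n\<close> to such polynomials and are antisymmetric,
  hence they commute with the orthogonal projections onto these spaces. This is what makes weak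
  derivatives strong.\<close>

lemma frame_deriv_proj:
  assumes "wd i f g" shows "AE w in \<mu>S3. frame_deriv i (proj n f) w = proj n g w"
proof -
  note f = wdD(1)[OF assms] and g = wdD(2)[OF assms]
  obtain q where q: "polydeg n q" "\<forall>w\<in>S3. frame_deriv i (proj n f) w = q w"
    using polydeg_frame_deriv[OF polydeg_proj[OF f]] by blast
  have "ip q r = ip (proj n g) r" if r: "polydeg n r" for r
  proof -
    obtain r' where r': "polydeg n r'" "\<forall>w\<in>S3. frame_deriv i r w = r' w"
      using polydeg_frame_deriv[OF r] by blast
    have "ip q r = ip (frame_deriv i (proj n f)) r" using q(2) by (intro ip_cong) simp_all
    also have "\<dots> = - ip (proj n f) (frame_deriv i r)"
      using integration_by_parts_smooth[OF proj_smooth[OF f] polydeg_smooth[OF r]] unfolding ip_def .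
    also have "ip (proj n f) (frame_deriv i r) = ip (proj n f) r'" using r'(2) by (intro ip_cong) simp_all
    also have "\<dots> = ip f r'" by (rule ip_proj[OF f r'(1)])
    also have "\<dots> = ip f (frame_deriv i r)" using r'(2) by (intro ip_cong) simp_all
    also have "\<dots> = - ip g r" by (rule wdD(3)[OF assms polydeg_real_polynomial[OF r]])
    also have "ip g r = ip (proj n g) r" by (rule ip_proj[OF g r, symmetric])
    finally show ?thesis by simp
  qed
  moreover have d: "polydeg n (\<lambda>w. q w - proj n g w)" by (rule polydeg_diff[OF q(1) polydeg_proj[OF g]])
  ultimately have "ip (\<lambda>w. q w - proj n g w) (\<lambda>w. q w - proj n g w) = 0"
    by (simp only: ip_diff_left[OF polydeg_L2[OF q(1)] proj_L2[OF g] polydeg_L2[OF d]] diff_self)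
  from ip_self_zero_AE[OF polydeg_L2[OF d] this]
  have "AE w in \<mu>S3. q w = proj n g w" by simp
  moreover have "AE w in \<mu>S3. frame_deriv i (proj n f) w = q w"
    using q(2) by (intro AE_I2) simp
  ultimately show ?thesis by eventually_elim simp
qed

lemma frame_deriv_proj_tendsto:
  assumes "wd i f g" shows "L2_tendsto \<mu>S3 (\<lambda>n. frame_deriv i (proj n f)) g sequentially"
proof -
  note f = wdD(1)[OF assms] and g = wdD(2)[OF assms]
  have "L2_tendsto \<mu>S3 (\<lambda>n. frame_deriv i (proj n f)) g sequentially
    \<longleftrightarrow> L2_tendsto \<mu>S3 (\<lambda>n. proj n g) g sequentially"
    by (rule L2_tendsto_cong_AE)
      (simp_all add: frame_deriv_proj[OF assms] L2_measurable[OF g] L2_measurable[OF proj_L2[OF g]]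
        L2_measurable[OF smooth_S3_L2[OF smooth_S3_frame_deriv[OF proj_smooth[OF f]]]])
  then show ?thesis using proj_tendsto[OF g] by simp
qed

text \<open>For a weakly differentiable function, \<open>proj n f\<close> is an approximating sequence, by \<open>frame_deriv_proj\<close>.\<close>

lemma L2_closure_iff_wd: "L2_closure \<mu>S3 smooth_S3 (frame_deriv i) f g \<longleftrightarrow> wd i f g"
proof
  assume "L2_closure \<mu>S3 smooth_S3 (frame_deriv i) f g"
  then obtain \<psi> :: "nat \<Rightarrow> c2 \<Rightarrow> real" where \<psi>: "\<And>n. \<psi> n \<in> smooth_S3" "L2_tendsto \<mu>S3 \<psi> f sequentially"
    "L2_tendsto \<mu>S3 (\<lambda>n. frame_deriv i (\<psi> n)) g sequentially" and L: "f \<in> L2 \<mu>S3" "g \<in> L2 \<mu>S3"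
    unfolding L2_closure_def by blast
  show "wd i f g" by (rule wd_limit[OF wd_smooth[OF \<psi>(1)] \<psi>(2,3) L])
next
  assume wd: "wd i f g"
  note f = wdD(1)[OF wd]
  show "L2_closure \<mu>S3 smooth_S3 (frame_deriv i) f g"
    unfolding L2_closure_def
    by (intro conjI exI[of _ "\<lambda>n. proj n f"] allI wdD[OF wd] proj_smooth[OF f] proj_L2[OF f]
        proj_tendsto[OF f] frame_deriv_proj_tendsto[OF wd] smooth_S3_L2 smooth_S3_frame_deriv)
qed

lemma E_invariant_iff_wd: "E_invariant f \<longleftrightarrow> wd A1 f (\<lambda>_. 0)"
  unfolding E_invariant_def by (rule L2_closure_iff_wd)

lemma sobolev_deriv_eq: "sobolev_deriv i f = (SOME g. wd i f g)"
  unfolding sobolev_deriv_def L2_closure_iff_wd ..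

lemma wd_sobolev_deriv: "wd i f g \<Longrightarrow> wd i f (sobolev_deriv i f)"
  unfolding sobolev_deriv_eq by (rule someI[of "wd i f"])

lemma sobolev_deriv_AE: "wd i f g \<Longrightarrow> AE w in \<mu>S3. sobolev_deriv i f w = g w"
  by (rule wd_unique[OF wd_sobolev_deriv])

lemma wd_cong_fun_AE:
  assumes "AE w in \<mu>S3. f w = f' w" "f \<in> borel_measurable \<mu>S3" "f' \<in> borel_measurable \<mu>S3"
  shows "wd i f g \<longleftrightarrow> wd i f' g"
proof -
  have r: "AE w in \<mu>S3. g w = g w" by (rule AE_I2) (rule refl)
  have "AE w in \<mu>S3. f' w = f w" using assms(1) by eventually_elim simp
  then show ?thesis
    using wd_cong_AE[OF _ assms(1) r assms(3)] wd_cong_AE[OF _ _ r assms(2)] L2_measurable wdD(2) by blast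
qed

lemma sobolev_deriv_cong_AE:
  assumes "AE w in \<mu>S3. f w = f' w" "f \<in> borel_measurable \<mu>S3" "f' \<in> borel_measurable \<mu>S3"
  shows "sobolev_deriv i f = sobolev_deriv i f'"
  unfolding sobolev_deriv_eq wd_cong_fun_AE[OF assms] by (rule refl)

lemma borel_measurable_\<mu>S3_cong:
  assumes "\<And>w. w \<in> S3 \<Longrightarrow> f w = f' w"
  shows "f \<in> borel_measurable \<mu>S3 \<longleftrightarrow> f' \<in> borel_measurable \<mu>S3"
  by (rule measurable_cong) (simp only: space_\<mu>S3 assms)

lemma L2_\<mu>S3_cong:
  fixes f f' :: "c2 \<Rightarrow> 'b::real_normed_vector"
  assumes "\<And>w. w \<in> S3 \<Longrightarrow> f w = f' w" shows "f \<in> L2 \<mu>S3 \<longleftrightarrow> f' \<in> L2 \<mu>S3"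
proof -
  have "integrable \<mu>S3 (\<lambda>w. (norm (f w))\<^sup>2) \<longleftrightarrow> integrable \<mu>S3 (\<lambda>w. (norm (f' w))\<^sup>2)"
    by (rule Bochner_Integration.integrable_cong[OF refl]) (simp only: space_\<mu>S3 assms)
  then show ?thesis unfolding L2_def using borel_measurable_\<mu>S3_cong[of f f'] assms by simp
qed

lemma wd_cong:
  assumes "\<And>w. w \<in> S3 \<Longrightarrow> f w = f' w" shows "wd i f g \<longleftrightarrow> wd i f' g"
proof -
  have "f \<in> L2 \<mu>S3 \<longleftrightarrow> f' \<in> L2 \<mu>S3" by (rule L2_\<mu>S3_cong[OF assms])
  moreover have "ip f p = ip f' p" for p by (rule ip_cong[OF assms refl])
  ultimately show ?thesis unfolding wd_def by simp
qed

lemma sobolev_deriv_cong: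
  assumes "\<And>w. w \<in> S3 \<Longrightarrow> f w = f' w" shows "sobolev_deriv i f = sobolev_deriv i f'"
proof -
  have "wd i f = wd i f'" by (rule ext) (rule wd_cong[OF assms])
  then show ?thesis unfolding sobolev_deriv_eq by (simp only:)
qed

lemma sobolev_deriv_add:
  assumes "wd i f f'" "wd i g g'"
  shows "AE w in \<mu>S3. sobolev_deriv i (\<lambda>w. f w + g w) w = sobolev_deriv i f w + sobolev_deriv i g w"
  by (rule sobolev_deriv_AE[OF wd_add[OF wd_sobolev_deriv[OF assms(1)] wd_sobolev_deriv[OF assms(2)]]])

text \<open>Integration by parts, obtained from projections of the second function.\<close>

lemma wd_integration_by_parts:
  assumes f: "wd i f f'" and g: "wd i g g'" shows "ip f g' = - ip f' g"
proof -
  note L = wdD(1,2)[OF f] wdD(1,2)[OF g]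
  have "(\<lambda>n. ip f (frame_deriv i (proj n g))) \<longlonglongrightarrow> ip f g'"
    by (intro ip_tendsto L2_tendsto_const L frame_deriv_proj_tendsto[OF g] smooth_S3_L2
        smooth_S3_frame_deriv proj_smooth)
  moreover have "(\<lambda>n. - ip f' (proj n g)) \<longlonglongrightarrow> - ip f' g"
    by (intro tendsto_minus ip_tendsto L2_tendsto_const L proj_tendsto proj_L2)
  moreover have "ip f (frame_deriv i (proj n g)) = - ip f' (proj n g)" for n
    by (rule wdD(3)[OF f polydeg_real_polynomial[OF polydeg_proj[OF L(3)]]])
  ultimately show ?thesis by (simp only: LIMSEQ_unique)
qed

lemma wd_polynomial_mult:
  assumes p: "real_polynomial_function p" and f: "wd i f f'"
  shows "wd i (\<lambda>w. p w * f w) (\<lambda>w. frame_deriv i p w * f w + p w * f' w)"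
proof -
  have bL: "(\<lambda>w. u w * h w) \<in> L2 \<mu>S3" if u: "u \<in> smooth_S3" and h: "h \<in> L2 \<mu>S3" for u h
  proof -
    obtain B where "\<forall>w\<in>S3. \<bar>u w\<bar> \<le> B" using smooth_S3_bounded[OF u] by blast
    then show ?thesis by (intro L2_bounded_mult[of _ _ B] L2_measurable[OF smooth_S3_L2[OF u]] h AE_I2) simp
  qed
  note ps = real_polynomial_smooth_S3[OF p] and fL = wdD(1,2)[OF f]
  note L = bL[OF smooth_S3_frame_deriv[OF ps] fL(1)] bL[OF ps fL(1)] bL[OF ps fL(2)]
  show ?thesis
  proof (rule wdI[OF L(2) L2_add[OF L(1,3)]])
    fix q :: "c2 \<Rightarrow> real" assume q: "real_polynomial_function q"
    note qs = real_polynomial_smooth_S3[OF q]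
    have qL: "q \<in> L2 \<mu>S3" by (rule smooth_S3_L2[OF qs])
    have "ip f (frame_deriv i (\<lambda>w. p w * q w)) = - ip f' (\<lambda>w. p w * q w)"
      using p q by (intro wdD(3)[OF f]) auto
    also have "ip f (frame_deriv i (\<lambda>w. p w * q w))
        = ip f (\<lambda>w. frame_deriv i p w * q w + p w * frame_deriv i q w)"
      by (rule ip_cong[OF refl]) (rule frame_deriv_mult[OF ps qs])
    also have "\<dots> = ip f (\<lambda>w. frame_deriv i p w * q w) + ip f (\<lambda>w. p w * frame_deriv i q w)"
      by (intro ip_add_right bL smooth_S3_frame_deriv ps smooth_S3_L2 qs fL)
    finally have "ip f (\<lambda>w. p w * frame_deriv i q w)
        = - (ip f (\<lambda>w. frame_deriv i p w * q w) + ip f' (\<lambda>w. p w * q w))" by simp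
    moreover have "ip (\<lambda>w. p w * f w) h = ip f (\<lambda>w. p w * h w)" for p f h
      unfolding ip_def by (simp only: mult_ac)
    ultimately show "ip (\<lambda>w. p w * f w) (frame_deriv i q)
        = - ip (\<lambda>w. frame_deriv i p w * f w + p w * f' w) q"
      by (simp only: ip_add_left[OF L(1,3) qL])
  qed
qed


section \<open>Commutators of the frame\<close>

lemma frame_commutators:
  "frame A2 (frame A1 w) - frame A1 (frame A2 w) = -2 *\<^sub>R frame A3 w"
  "frame A3 (frame A2 w) - frame A2 (frame A3 w) = -2 *\<^sub>R frame A1 w"
  "frame A1 (frame A3 w) - frame A3 (frame A1 w) = -2 *\<^sub>R frame A2 w"
  by (simp_all add: prod_eq_iff complex_eq_iff)

lemma frame_deriv_commutator_polynomial:
  assumes fr: "\<And>w. frame j (frame i w) - frame i (frame j w) = c *\<^sub>R frame k w"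
    and p: "real_polynomial_function p" and w: "w \<in> S3"
  shows "frame_deriv i (frame_deriv j p) w - frame_deriv j (frame_deriv i p) w = c * frame_deriv k p w"
  using p
proof (induction rule: real_polynomial_function.induct)
  case (linear l)
  have ll: "bounded_linear (\<lambda>w. l (frame j w))" for j
    by (rule bounded_linear_compose[OF linear frame_bounded_linear])
  have "frame_deriv i (frame_deriv j l) w = l (frame j (frame i w))" for i j
  proof -
    have "frame_deriv i (frame_deriv j l) w = frame_deriv i (\<lambda>w. l (frame j w)) w"
      by (rule frame_deriv_cong[OF w]) (rule frame_deriv_bounded_linear[OF linear])
    then show ?thesis using frame_deriv_bounded_linear[OF ll w] by simp
  qed
  then have "frame_deriv i (frame_deriv j l) w - frame_deriv j (frame_deriv i l) w
      = l (frame j (frame i w) - frame i (frame j w))"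
    by (simp add: linear_diff bounded_linear.linear[OF linear])
  also have "\<dots> = c * frame_deriv k l w"
    by (simp add: fr linear_scale bounded_linear.linear[OF linear] frame_deriv_bounded_linear[OF linear w])
  finally show ?case .
next
  case (const d)
  show ?case by simp
next
  case (add p q)
  note s = real_polynomial_smooth_S3[OF add.hyps(1)] real_polynomial_smooth_S3[OF add.hyps(2)]
  have "frame_deriv i (frame_deriv j (\<lambda>x. p x + q x)) w
      = frame_deriv i (frame_deriv j p) w + frame_deriv i (frame_deriv j q) w" for i j
  proof -
    have "frame_deriv i (frame_deriv j (\<lambda>x. p x + q x)) w = frame_deriv i (\<lambda>w. frame_deriv j p w + frame_deriv j q w) w"
      by (rule frame_deriv_cong[OF w]) (rule frame_deriv_add[OF s])
    then show ?thesis
      by (simp only: frame_deriv_add[OF smooth_S3_frame_deriv[OF s(1)] smooth_S3_frame_deriv[OF s(2)] w])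
  qed
  then show ?case using add.IH frame_deriv_add[OF s w, of k] by (simp add: algebra_simps)
next
  case (mult p q)
  note s = real_polynomial_smooth_S3[OF mult.hyps(1)] real_polynomial_smooth_S3[OF mult.hyps(2)]
  note d = smooth_S3_frame_deriv
  have 2: "frame_deriv i (frame_deriv j (\<lambda>x. p x * q x)) w
      = frame_deriv i (frame_deriv j p) w * q w + frame_deriv j p w * frame_deriv i q w
        + (frame_deriv i p w * frame_deriv j q w + p w * frame_deriv i (frame_deriv j q) w)" for i j
  proof -
    have "frame_deriv i (frame_deriv j (\<lambda>x. p x * q x)) w
        = frame_deriv i (\<lambda>w. frame_deriv j p w * q w + p w * frame_deriv j q w) w"
      by (rule frame_deriv_cong[OF w]) (rule frame_deriv_mult[OF s])
    then show ?thesis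
      by (simp only: frame_deriv_add[OF smooth_S3_mult[OF d[OF s(1)] s(2)] smooth_S3_mult[OF s(1) d[OF s(2)]] w]
        frame_deriv_mult[OF d[OF s(1)] s(2) w] frame_deriv_mult[OF s(1) d[OF s(2)] w])
  qed
  have "frame_deriv i (frame_deriv j (\<lambda>x. p x * q x)) w - frame_deriv j (frame_deriv i (\<lambda>x. p x * q x)) w
    = (frame_deriv i (frame_deriv j p) w - frame_deriv j (frame_deriv i p) w) * q w
      + p w * (frame_deriv i (frame_deriv j q) w - frame_deriv j (frame_deriv i q) w)"
    unfolding 2 by (simp add: algebra_simps)
  also have "\<dots> = c * frame_deriv k (\<lambda>x. p x * q x) w"
    unfolding mult.IH frame_deriv_mult[OF s w] by (simp add: algebra_simps)
  finally show ?case .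
qed

text \<open>Weak derivatives inherit the commutation relations of the frame from the polynomials against which
  they are tested.\<close>

lemma wd_commutator:
  assumes fr: "\<And>w. frame j (frame i w) - frame i (frame j w) = c *\<^sub>R frame k w"
    and f: "wd j f fj" "wd i fj fij" "wd i f fi" "wd j fi fji" "wd k f fk"
  shows "AE w in \<mu>S3. fij w - fji w = c * fk w"
proof (rule ip_polynomial_eqI)
  note L = wdD(1,2)[OF f(1)] wdD(1,2)[OF f(2)] wdD(1,2)[OF f(3)] wdD(1,2)[OF f(4)] wdD(1,2)[OF f(5)]
  show "(\<lambda>w. fij w - fji w) \<in> L2 \<mu>S3" "(\<lambda>w. c * fk w) \<in> L2 \<mu>S3"
    by (intro L2_diff L2_scale L)+
  fix p :: "c2 \<Rightarrow> real" assume p: "real_polynomial_function p"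
  note s = real_polynomial_smooth_S3[OF p]
  note d = smooth_S3_frame_deriv[OF s] and dd = smooth_S3_frame_deriv[OF smooth_S3_frame_deriv[OF s]]
  have "ip fij p = ip f (frame_deriv j (frame_deriv i p))"
    using wd_integration_by_parts[OF f(2) wd_smooth[OF s]] wd_integration_by_parts[OF f(1) wd_smooth[OF d]] by simp
  moreover have "ip fji p = ip f (frame_deriv i (frame_deriv j p))"
    using wd_integration_by_parts[OF f(4) wd_smooth[OF s]] wd_integration_by_parts[OF f(3) wd_smooth[OF d]] by simp
  moreover have "ip fk p = - ip f (frame_deriv k p)"
    using wd_integration_by_parts[OF f(5) wd_smooth[OF s]] by simp
  moreover have "ip f (frame_deriv i (frame_deriv j p)) - ip f (frame_deriv j (frame_deriv i p))
      = ip f (\<lambda>w. c * frame_deriv k p w)"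
    unfolding ip_diff_right[OF smooth_S3_L2[OF dd] smooth_S3_L2[OF dd] L(1), symmetric]
    by (rule ip_cong[OF refl]) (rule frame_deriv_commutator_polynomial[OF fr p])
  ultimately show "ip (\<lambda>w. fij w - fji w) p = ip (\<lambda>w. c * fk w) p"
    by (simp add: ip_diff_left[OF L(4,8) smooth_S3_L2[OF s]] ip_scale_left ip_scale_right)
qed


section \<open>Sobolev spaces by weak derivatives\<close>

text \<open>This recursive form of \<open>H\<^sup>k\<close> admits induction on \<open>k\<close>; see \<open>sobolev_iff_sob\<close>.\<close>

primrec sob :: "nat \<Rightarrow> (c2 \<Rightarrow> real) \<Rightarrow> bool" where
  "sob 0 f \<longleftrightarrow> f \<in> L2 \<mu>S3"
| "sob (Suc k) f \<longleftrightarrow> (\<forall>i. \<exists>g. wd i f g \<and> sob k g)"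

lemma sob_L2: "sob k f \<Longrightarrow> f \<in> L2 \<mu>S3"
proof (cases k)
  case (Suc n)
  assume "sob k f"
  then obtain g where "wd A1 f g" unfolding Suc by auto
  then show ?thesis by (rule wdD(1))
qed simp

lemma sob_cong_AE:
  assumes "sob k f" "AE w in \<mu>S3. f w = f' w" "f' \<in> borel_measurable \<mu>S3" shows "sob k f'"
proof (cases k)
  case 0
  then show ?thesis using assms L2_cong_AE by auto
next
  case (Suc n)
  then show ?thesis
    using assms wd_cong_fun_AE[OF assms(2) L2_measurable[OF sob_L2[OF assms(1)]] assms(3)] by simp
qed

lemma sob_SucD: "sob (Suc k) f \<Longrightarrow> sob k f"
proof (induction k arbitrary: f)
  case 0
  show ?case using sob_L2[OF 0] by simp
next
  case (Suc k)
  from Suc.prems have "\<exists>g. wd i f g \<and> sob (Suc k) g" for i by (simp only: sob.simps(2)[of "Suc k"])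
  then have "\<exists>g. wd i f g \<and> sob k g" for i using Suc.IH by blast
  then show ?case by simp
qed

lemma sob_mono: "k \<le> m \<Longrightarrow> sob m f \<Longrightarrow> sob k f"
  by (induction m rule: dec_induct) (auto dest: sob_SucD simp del: sob.simps)

lemma sob_sobolev_deriv:
  assumes "sob (Suc k) f"
  shows "wd i f (sobolev_deriv i f)" "sob k (sobolev_deriv i f)"
proof -
  obtain g where g: "wd i f g" "sob k g" using assms by auto
  show w: "wd i f (sobolev_deriv i f)" by (rule wd_sobolev_deriv[OF g(1)])
  show "sob k (sobolev_deriv i f)"
    by (rule sob_cong_AE[OF g(2) wd_unique[OF g(1) w] L2_measurable[OF wdD(2)[OF w]]])
qed

lemma sob_add: "sob k f \<Longrightarrow> sob k g \<Longrightarrow> sob k (\<lambda>w. f w + g w)"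
proof (induction k arbitrary: f g)
  case 0
  then show ?case by (simp add: L2_add)
next
  case (Suc k)
  show ?case
    unfolding sob.simps(2)
    using wd_add[OF sob_sobolev_deriv(1)[OF Suc.prems(1)] sob_sobolev_deriv(1)[OF Suc.prems(2)]]
      Suc.IH[OF sob_sobolev_deriv(2)[OF Suc.prems(1)] sob_sobolev_deriv(2)[OF Suc.prems(2)]] by blast
qed

lemma sob_scale: "sob k f \<Longrightarrow> sob k (\<lambda>w. c * f w)"
proof (induction k arbitrary: f)
  case 0
  then show ?case by (simp add: L2_scale)
next
  case (Suc k)
  show ?case
    unfolding sob.simps(2)
    using wd_scale[OF sob_sobolev_deriv(1)[OF Suc.prems(1)]] Suc.IH[OF sob_sobolev_deriv(2)[OF Suc.prems(1)]] by blast
qed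

lemma sob_smooth: "\<psi> \<in> smooth_S3 \<Longrightarrow> sob k \<psi>"
proof (induction k arbitrary: \<psi>)
  case 0
  then show ?case by (simp add: smooth_S3_L2)
next
  case (Suc k)
  then show ?case unfolding sob.simps(2) using wd_smooth smooth_S3_frame_deriv by blast
qed

lemma foldr_sobolev_deriv:
  assumes "sob k f" "length \<alpha> \<le> k" shows "sob (k - length \<alpha>) (foldr sobolev_deriv \<alpha> f)"
  using assms(2)
proof (induction \<alpha>)
  case Nil
  then show ?case using assms(1) by simp
next
  case (Cons i \<alpha>)
  then have "k - length \<alpha> = Suc (k - length (i # \<alpha>))" by simp
  with Cons have "sob (Suc (k - length (i # \<alpha>))) (foldr sobolev_deriv \<alpha> f)" by simp
  then show ?case unfolding foldr_Cons o_apply by (rule sob_sobolev_deriv(2))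
qed

lemma smooth_foldr_frame_deriv: "\<psi> \<in> smooth_S3 \<Longrightarrow> foldr frame_deriv \<alpha> \<psi> \<in> smooth_S3"
  by (induction \<alpha>) (simp_all add: smooth_S3_frame_deriv)

lemma foldr_frame_deriv_proj:
  assumes "sob k f" "length \<alpha> \<le> k"
  shows "AE w in \<mu>S3. foldr frame_deriv \<alpha> (proj n f) w = proj n (foldr sobolev_deriv \<alpha> f) w"
  using assms(2)
proof (induction \<alpha>)
  case Nil
  then show ?case by simp
next
  case (Cons i \<alpha>)
  let ?a = "foldr frame_deriv \<alpha> (proj n f)" and ?D = "foldr sobolev_deriv \<alpha> f"
  have "k - length \<alpha> = Suc (k - length (i # \<alpha>))" using Cons.prems by simp
  then have "sob (Suc (k - length (i # \<alpha>))) ?D" using foldr_sobolev_deriv[OF assms(1), of \<alpha>] Cons.prems by simp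
  then have D: "wd i ?D (sobolev_deriv i ?D)" by (rule sob_sobolev_deriv(1))
  have a: "?a \<in> smooth_S3" and b: "proj n ?D \<in> smooth_S3"
    using proj_smooth[OF sob_L2[OF assms(1)]] proj_smooth[OF wdD(1)[OF D]] smooth_foldr_frame_deriv by auto
  have "AE w in \<mu>S3. ?a w = proj n ?D w" using Cons by simp
  then have "wd i (proj n ?D) (frame_deriv i ?a)"
    using wd_cong_fun_AE[of ?a "proj n ?D"] wd_smooth[OF a, of i] smooth_S3_L2[OF a] smooth_S3_L2[OF b] L2_measurable by blast
  from wd_unique[OF this wd_smooth[OF b]] frame_deriv_proj[OF D, of n]
  have "AE w in \<mu>S3. frame_deriv i ?a w = proj n (sobolev_deriv i ?D) w" by eventually_elim simp
  then show ?case by simp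
qed

lemma sobolev_frame_deriv:
  assumes "f \<in> sobolev (Suc k)" shows "\<exists>g. wd i f g \<and> g \<in> sobolev k"
proof -
  obtain \<psi> :: "nat \<Rightarrow> c2 \<Rightarrow> real" and D where \<psi>: "\<And>n. \<psi> n \<in> smooth_S3" "D [] = f"
    and D: "\<And>\<alpha>. length \<alpha> \<le> Suc k \<Longrightarrow> D \<alpha> \<in> L2 \<mu>S3"
      "\<And>\<alpha>. length \<alpha> \<le> Suc k \<Longrightarrow> L2_tendsto \<mu>S3 (\<lambda>n. foldr frame_deriv \<alpha> (\<psi> n)) (D \<alpha>) sequentially"
    using assms unfolding sobolev_def by blast
  have "wd i (D []) (D [i])"
    by (rule wd_limit[OF wd_smooth[OF \<psi>(1)]]) (use D(1)[of "[]"] D(1)[of "[i]"] D(2)[of "[]"] D(2)[of "[i]"] in simp_all)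
  moreover have "D [i] \<in> sobolev k"
    unfolding sobolev_def mem_Collect_eq
  proof (intro exI[of _ "\<lambda>n. frame_deriv i (\<psi> n)"] exI[of _ "\<lambda>\<alpha>. D (\<alpha> @ [i])"] conjI allI impI)
    show "frame_deriv i (\<psi> n) \<in> smooth_S3" for n by (rule smooth_S3_frame_deriv[OF \<psi>(1)])
    show "D ([] @ [i]) = D [i]" by simp
    show "D (\<alpha> @ [i]) \<in> L2 \<mu>S3" if "length \<alpha> \<le> k" for \<alpha> using that by (intro D(1)) simp
    show "L2_tendsto \<mu>S3 (\<lambda>n. foldr frame_deriv \<alpha> (frame_deriv i (\<psi> n))) (D (\<alpha> @ [i])) sequentially"
      if "length \<alpha> \<le> k" for \<alpha> using D(2)[of "\<alpha> @ [i]"] that by simp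
  qed
  ultimately show ?thesis using \<psi>(2) by blast
qed

text \<open>The single sequence \<open>proj n f\<close> approximates all iterated derivatives at once, because projections
  commute with derivatives.\<close>

lemma sobolev_iff_sob: "f \<in> sobolev k \<longleftrightarrow> sob k f"
proof
  show "f \<in> sobolev k \<Longrightarrow> sob k f"
  proof (induction k arbitrary: f)
    case 0
    then show ?case unfolding sobolev_def by force
  next
    case (Suc k)
    show ?case unfolding sob.simps(2) using sobolev_frame_deriv[OF Suc.prems] Suc.IH by blast
  qed
next
  assume f: "sob k f"
  note fL = sob_L2[OF f]
  show "f \<in> sobolev k"
    unfolding sobolev_def mem_Collect_eq
  proof (intro exI conjI allI impI)
    show "proj n f \<in> smooth_S3" for n by (rule proj_smooth[OF fL])
    show "foldr sobolev_deriv [] f = f" by simp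
    fix \<alpha> :: "axis list" assume \<alpha>: "length \<alpha> \<le> k"
    let ?D = "foldr sobolev_deriv \<alpha> f"
    show D: "?D \<in> L2 \<mu>S3" by (rule sob_L2[OF foldr_sobolev_deriv[OF f \<alpha>]])
    have "L2_tendsto \<mu>S3 (\<lambda>n. foldr frame_deriv \<alpha> (proj n f)) ?D sequentially
      \<longleftrightarrow> L2_tendsto \<mu>S3 (\<lambda>n. proj n ?D) ?D sequentially"
      by (rule L2_tendsto_cong_AE)
        (simp_all add: foldr_frame_deriv_proj[OF f \<alpha>] L2_measurable[OF D] L2_measurable[OF proj_L2[OF D]]
          L2_measurable[OF smooth_S3_L2[OF smooth_foldr_frame_deriv[OF proj_smooth[OF fL]]]])
    then show "L2_tendsto \<mu>S3 (\<lambda>n. foldr frame_deriv \<alpha> (proj n f)) ?D sequentially"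
      using proj_tendsto[OF D] by simp
  qed
qed

section \<open>Sobolev embedding\<close>

text \<open>The minimum of \<open>\<bar>g\<bar>\<close> is at most its mean value, and the integral of \<open>H\<close> bounds the distance from the
  minimum to \<open>g 0\<close>.\<close>

lemma abs_le_integral_deriv:
  fixes g g' H :: "real \<Rightarrow> real"
  assumes a: "0 < a"
    and g: "\<And>t. t \<in> {0..a} \<Longrightarrow> (g has_vector_derivative g' t) (at t within {0..a})"
    and H: "continuous_on {0..a} H" and le: "\<And>t. t \<in> {0..a} \<Longrightarrow> \<bar>g' t\<bar> \<le> H t"
  shows "\<bar>g 0\<bar> \<le> integral {0..a} (\<lambda>t. \<bar>g t\<bar> / a + H t)"
proof -
  have cg: "continuous_on {0..a} g"
    by (rule continuous_on_vector_derivative[OF g])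
  then have ca: "continuous_on {0..a} (\<lambda>t. \<bar>g t\<bar>)" by (intro continuous_intros)
  obtain s where s: "s \<in> {0..a}" "\<And>t. t \<in> {0..a} \<Longrightarrow> \<bar>g s\<bar> \<le> \<bar>g t\<bar>"
    using continuous_attains_inf[OF compact_Icc _ ca] a by auto
  have I: "(\<lambda>t. \<bar>g t\<bar> / a) integrable_on {0..a}" "H integrable_on {0..a}"
    using ca H a by (auto intro!: integrable_continuous_real continuous_intros)
  have "\<bar>g s\<bar> = integral {0..a} (\<lambda>t. \<bar>g s\<bar> / a)" using a by simp
  also have "\<dots> \<le> integral {0..a} (\<lambda>t. \<bar>g t\<bar> / a)"
    using s(2) a by (intro integral_le I) (auto intro!: divide_right_mono)
  finally have 1: "\<bar>g s\<bar> \<le> integral {0..a} (\<lambda>t. \<bar>g t\<bar> / a)" .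
  have sub: "{0..s} \<subseteq> {0..a}" using s(1) by auto
  have F: "(g' has_integral (g s - g 0)) {0..s}"
    using s(1) by (intro fundamental_theorem_of_calculus has_vector_derivative_within_subset[OF g sub]) auto
  have H': "H integrable_on {0..s}" using H sub by (intro integrable_continuous_real) (rule continuous_on_subset)
  have "norm (integral {0..s} g') \<le> integral {0..s} H"
    using le sub by (intro integral_norm_bound_integral H' has_integral_integrable[OF F]) auto
  also have "\<dots> \<le> integral {0..a} H"
    using le abs_ge_zero order_trans by (intro integral_subset_le sub H' I(2)) blast
  finally have "\<bar>g s - g 0\<bar> \<le> integral {0..a} H" using integral_unique[OF F] by simp
  then have "\<bar>g 0\<bar> \<le> integral {0..a} (\<lambda>t. \<bar>g t\<bar> / a) + integral {0..a} H" using 1 by linarith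
  also have "\<dots> = integral {0..a} (\<lambda>t. \<bar>g t\<bar> / a + H t)" by (rule Henstock_Kurzweil_Integration.integral_add[OF I, symmetric])
  finally show ?thesis .
qed

text \<open>The differential operators of order at most one.\<close>

definition ops :: "axis list set" where "ops = {[], [A1], [A2], [A3]}"

lemma finite_ops [simp]: "finite ops" by (simp add: ops_def)

lemma ops_sum: "(\<Sum>a\<in>ops. h a) = h [] + h [A1] + h [A2] + h [A3]" for h :: "_ \<Rightarrow> 'a::comm_monoid_add"
  by (simp add: ops_def add.assoc)

text \<open>The sum of the absolute values of the derivatives of order at most \<open>k\<close>, with repetitions. Values in
  the extended reals make it possible to exchange integrals freely; the indicator gives a Borel function on the
  ambient space.\<close>

primrec mag :: "nat \<Rightarrow> (c2 \<Rightarrow> real) \<Rightarrow> c2 \<Rightarrow> ennreal" where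
  "mag 0 \<psi> y = ennreal (indicator S3 y * \<bar>\<psi> y\<bar>)"
| "mag (Suc k) \<psi> y = (\<Sum>a\<in>ops. mag k (foldr frame_deriv a \<psi>) y)"

lemma mag_measurable [measurable]: "\<psi> \<in> smooth_S3 \<Longrightarrow> mag k \<psi> \<in> borel_measurable borel"
proof (induction k arbitrary: \<psi>)
  case 0
  have "continuous_on S3 (\<lambda>y. \<bar>\<psi> y\<bar>)"
    by (intro continuous_intros smooth_S3_continuous[OF 0])
  then have "(\<lambda>y. indicator S3 y *\<^sub>R \<bar>\<psi> y\<bar>) \<in> borel_measurable borel"
    by (intro borel_measurable_continuous_on_indicator) simp_all
  then show ?case by (simp add: measurable_compose[OF _ measurable_ennreal])
next
  case (Suc k)
  show ?case
    unfolding mag.simps(2)[abs_def] by (intro borel_measurable_sum Suc.IH smooth_foldr_frame_deriv Suc.prems)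
qed

definition radial :: "c2 \<Rightarrow> c2" where "radial x = x /\<^sub>R norm x"

lemma radial_measurable [measurable]: "radial \<in> borel_measurable borel"
  unfolding radial_def by measurable

lemma radial_S3: "x \<noteq> 0 \<Longrightarrow> radial x \<in> S3" by (simp add: radial_def)

lemma abs_sum3_le:
  fixes p q r u v z :: real
  assumes "\<bar>p\<bar> \<le> 4 * u" "\<bar>q\<bar> \<le> 4 * v" "\<bar>r\<bar> \<le> 4 * z"
  shows "\<bar>p + q + r\<bar> \<le> 4 * (u + v + z)"
proof -
  have "\<bar>p + q + r\<bar> \<le> \<bar>p\<bar> + \<bar>q\<bar> + \<bar>r\<bar>" by simp
  also have "\<dots> \<le> 4 * u + 4 * v + 4 * z" by (intro add_mono assms)
  finally show ?thesis by simp
qed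

lemma radial_line_deriv:
  assumes \<psi>: "\<psi> \<in> smooth_S3" and b: "norm b = 1" and n: "1/4 \<le> norm (x + t *\<^sub>R b)"
  shows "\<exists>d. ((\<lambda>s. \<psi> (radial (x + s *\<^sub>R b))) has_real_derivative d) (at t) \<and>
    \<bar>d\<bar> \<le> 4 * (\<bar>frame_deriv A1 \<psi> (radial (x + t *\<^sub>R b))\<bar> + \<bar>frame_deriv A2 \<psi> (radial (x + t *\<^sub>R b))\<bar>
      + \<bar>frame_deriv A3 \<psi> (radial (x + t *\<^sub>R b))\<bar>)"
proof -
  let ?y = "x + t *\<^sub>R b"
  have y: "?y \<noteq> 0" using n by auto
  have l: "((\<lambda>s. x + s *\<^sub>R b) has_vector_derivative b) (at t)"
    by (auto intro!: derivative_eq_intros)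
  have "((\<lambda>s. norm (x + s *\<^sub>R b)) has_derivative (\<lambda>h. (h *\<^sub>R b) \<bullet> sgn ?y)) (at t)"
    using has_derivative_compose[OF l[unfolded has_vector_derivative_def] has_derivative_norm[OF y]] .
  then have "((\<lambda>s. norm (x + s *\<^sub>R b)) has_real_derivative (b \<bullet> sgn ?y)) (at t)"
    by (simp add: has_field_derivative_def mult_commute_abs)
  from DERIV_inverse'[OF this] y obtain k
    where "((\<lambda>s. inverse (norm (x + s *\<^sub>R b))) has_real_derivative k) (at t)" by auto
  then have "((\<lambda>s. radial (x + s *\<^sub>R b)) has_vector_derivative inverse (norm ?y) *\<^sub>R b + k *\<^sub>R ?y) (at t)"
    unfolding radial_def using has_vector_derivative_scaleR[OF _ l] by blast
  moreover have "\<forall>\<^sub>F s in nhds t. radial (x + s *\<^sub>R b) \<in> S3"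
  proof -
    have "open ((\<lambda>s. x + s *\<^sub>R b) -` (- {0}))"
      by (intro open_vimage continuous_intros)
    then have "\<forall>\<^sub>F s in nhds t. s \<in> (\<lambda>s. x + s *\<^sub>R b) -` (- {0})"
      using y by (intro eventually_nhds_in_open) auto
    then show ?thesis by eventually_elim (rule radial_S3, simp)
  qed
  ultimately have D: "((\<lambda>s. \<psi> (radial (x + s *\<^sub>R b))) has_real_derivative
      sphere_deriv \<psi> (radial ?y) (inverse (norm ?y) *\<^sub>R b + k *\<^sub>R ?y)) (at t)"
    by (intro smooth_S3_chain[OF \<psi>])
  have "?y \<bullet> frame i (radial ?y) = 0" for i
    by (simp add: radial_def linear_scale[OF frame_linear])
  then have i: "(inverse (norm ?y) *\<^sub>R b + k *\<^sub>R ?y) \<bullet> frame i (radial ?y)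
      = inverse (norm ?y) * (b \<bullet> frame i (radial ?y))" for i
    by (simp only: inner_add_left inner_scaleR_left mult_zero_right add_0_right)
  have "\<bar>inverse (norm ?y) * (b \<bullet> frame i (radial ?y))\<bar> \<le> 4 * 1" for i
    unfolding abs_mult
  proof (rule mult_mono)
    show "\<bar>inverse (norm ?y)\<bar> \<le> 4" using le_imp_inverse_le[OF n] by simp
    show "\<bar>b \<bullet> frame i (radial ?y)\<bar> \<le> 1"
      using Cauchy_Schwarz_ineq2[of b "frame i (radial ?y)"] b radial_S3[OF y] by simp
  qed simp_all
  then have *: "\<bar>inverse (norm ?y) * (b \<bullet> frame i (radial ?y)) * e\<bar> \<le> 4 * \<bar>e\<bar>" for i e
    unfolding abs_mult[of _ e] by (intro mult_right_mono) simp_all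
  have "\<bar>sphere_deriv \<psi> (radial ?y) (inverse (norm ?y) *\<^sub>R b + k *\<^sub>R ?y)\<bar> \<le>
      4 * (\<bar>frame_deriv A1 \<psi> (radial ?y)\<bar> + \<bar>frame_deriv A2 \<psi> (radial ?y)\<bar> + \<bar>frame_deriv A3 \<psi> (radial ?y)\<bar>)"
    unfolding sphere_deriv_def i by (rule abs_sum3_le[OF * * *])
  with D show ?thesis by blast
qed

text \<open>Along a line that avoids the origin, the derivative of \<open>\<psi> (x / norm x)\<close> is a combination of first
  order frame derivatives with bounded coefficients. Hence the one-dimensional estimate can be iterated in three
  directions, at the cost of one derivative each.\<close>

lemma mag_line:
  assumes "\<psi> \<in> smooth_S3" and b: "norm b = 1" and n: "\<And>t. 0 \<le> t \<Longrightarrow> t \<le> 1/4 \<Longrightarrow> 1/4 \<le> norm (x + t *\<^sub>R b)"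
  shows "mag k \<psi> (radial x) \<le> 4 * (\<integral>\<^sup>+t. mag (Suc k) \<psi> (radial (x + t *\<^sub>R b)) * indicator {0..1/4} t \<partial>lborel)"
  using assms(1)
proof (induction k arbitrary: \<psi>)
  case 0
  note \<psi> = 0
  let ?c = "\<lambda>t. radial (x + t *\<^sub>R b)"
  define K where "K = (\<lambda>t. \<bar>\<psi> (?c t)\<bar> + \<bar>frame_deriv A1 \<psi> (?c t)\<bar> + \<bar>frame_deriv A2 \<psi> (?c t)\<bar> + \<bar>frame_deriv A3 \<psi> (?c t)\<bar>)"
  have ne: "x + t *\<^sub>R b \<noteq> 0" if "t \<in> {0..1/4}" for t using n[of t] that by auto
  have cS: "?c t \<in> S3" if "t \<in> {0..1/4}" for t by (rule radial_S3[OF ne[OF that]])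
  have cc: "continuous_on {0..1/4} ?c" unfolding radial_def using ne by (intro continuous_intros) auto
  have c\<psi>: "continuous_on {0..1/4} (\<lambda>t. \<xi> (?c t))" if "\<xi> \<in> smooth_S3" for \<xi>
    by (rule continuous_on_compose2[OF smooth_S3_continuous[OF that] cc]) (use cS in blast)
  note d = smooth_S3_frame_deriv[OF \<psi>]
  have cK: "continuous_on {0..1/4} K" unfolding K_def by (intro continuous_intros c\<psi> \<psi> d)
  have "\<forall>t\<in>{0..1/4}. \<exists>d. ((\<lambda>s. \<psi> (?c s)) has_real_derivative d) (at t) \<and> \<bar>d\<bar> \<le> 4 * (\<bar>frame_deriv A1 \<psi> (?c t)\<bar>
      + \<bar>frame_deriv A2 \<psi> (?c t)\<bar> + \<bar>frame_deriv A3 \<psi> (?c t)\<bar>)"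
    using radial_line_deriv[OF \<psi> b n] by auto
  from bchoice[OF this] obtain g' where g': "\<forall>t\<in>{0..1/4}. ((\<lambda>s. \<psi> (?c s)) has_real_derivative g' t) (at t) \<and>
      \<bar>g' t\<bar> \<le> 4 * (\<bar>frame_deriv A1 \<psi> (?c t)\<bar> + \<bar>frame_deriv A2 \<psi> (?c t)\<bar> + \<bar>frame_deriv A3 \<psi> (?c t)\<bar>)" by blast
  have "\<bar>\<psi> (?c 0)\<bar> \<le> integral {0..1/4} (\<lambda>t. \<bar>\<psi> (?c t)\<bar> / (1/4) +
      4 * (\<bar>frame_deriv A1 \<psi> (?c t)\<bar> + \<bar>frame_deriv A2 \<psi> (?c t)\<bar> + \<bar>frame_deriv A3 \<psi> (?c t)\<bar>))"
  proof (rule abs_le_integral_deriv)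
    show "((\<lambda>s. \<psi> (?c s)) has_vector_derivative g' t) (at t within {0..1/4})" if "t \<in> {0..1/4}" for t
      using g' that by (auto simp: has_real_derivative_iff_has_vector_derivative intro: has_vector_derivative_at_within)
    show "\<bar>g' t\<bar> \<le> 4 * (\<bar>frame_deriv A1 \<psi> (?c t)\<bar> + \<bar>frame_deriv A2 \<psi> (?c t)\<bar> + \<bar>frame_deriv A3 \<psi> (?c t)\<bar>)"
      if "t \<in> {0..1/4}" for t using g' that by blast
  qed (simp, intro continuous_intros c\<psi> d)
  also have "(\<lambda>t. \<bar>\<psi> (?c t)\<bar> / (1/4) + 4 * (\<bar>frame_deriv A1 \<psi> (?c t)\<bar> + \<bar>frame_deriv A2 \<psi> (?c t)\<bar>
      + \<bar>frame_deriv A3 \<psi> (?c t)\<bar>)) = (\<lambda>t. 4 * K t)" by (simp add: K_def algebra_simps)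
  finally have le: "\<bar>\<psi> (?c 0)\<bar> \<le> 4 * integral {0..1/4} K" by simp
  have K0: "0 \<le> K t" for t by (simp add: K_def)
  have "(K has_integral integral {0..1/4} K) {0..1/4}"
    using cK by (intro integrable_integral integrable_continuous_real)
  then have I: "(\<integral>\<^sup>+t. ennreal (K t) * indicator {0..1/4} t \<partial>lborel) = ennreal (integral {0..1/4} K)"
    by (rule nn_integral_has_integral_lebesgue'[OF K0])
  have "mag 0 \<psi> (radial x) = ennreal \<bar>\<psi> (?c 0)\<bar>" using cS[of 0] by simp
  also have "\<dots> \<le> ennreal (4 * integral {0..1/4} K)" using le by (rule ennreal_leI)
  also have "\<dots> = 4 * (\<integral>\<^sup>+t. ennreal (K t) * indicator {0..1/4} t \<partial>lborel)"
    unfolding I by (simp add: ennreal_mult' K0 integral_nonneg)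
  also have "(\<integral>\<^sup>+t. ennreal (K t) * indicator {0..1/4} t \<partial>lborel)
      = (\<integral>\<^sup>+t. mag (Suc 0) \<psi> (?c t) * indicator {0..1/4} t \<partial>lborel)"
  proof (rule nn_integral_cong)
    fix t
    show "ennreal (K t) * indicator {0..1/4} t = mag (Suc 0) \<psi> (?c t) * indicator {0..1/4} t"
    proof (cases "t \<in> {0..1/4}")
      case True
      have "mag (Suc 0) \<psi> (?c t) = ennreal (K t)"
        using cS[OF True] by (simp add: ops_sum K_def ennreal_plus[symmetric] del: ennreal_plus)
      then show ?thesis using True by simp
    qed simp
  qed
  finally show ?case .
next
  case (Suc k)
  have m: "(\<lambda>t. mag (Suc k) (foldr frame_deriv a \<psi>) (radial (x + t *\<^sub>R b)) * indicator {0..1/4} t) \<in> borel_measurable lborel" for a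
    using mag_measurable[OF smooth_foldr_frame_deriv[OF Suc.prems], of "Suc k" a] by (simp del: mag.simps)
  have "mag (Suc k) \<psi> (radial x) \<le> (\<Sum>a\<in>ops. 4 * (\<integral>\<^sup>+t. mag (Suc k) (foldr frame_deriv a \<psi>) (radial (x + t *\<^sub>R b)) * indicator {0..1/4} t \<partial>lborel))"
    unfolding mag.simps(2)[of k \<psi>] by (intro sum_mono Suc.IH smooth_foldr_frame_deriv Suc.prems)
  also have "\<dots> = 4 * (\<integral>\<^sup>+t. (\<Sum>a\<in>ops. mag (Suc k) (foldr frame_deriv a \<psi>) (radial (x + t *\<^sub>R b)) * indicator {0..1/4} t) \<partial>lborel)"
    unfolding sum_distrib_left[symmetric] by (subst nn_integral_sum[OF m]) (rule refl)
  also have "\<dots> = 4 * (\<integral>\<^sup>+t. mag (Suc (Suc k)) \<psi> (radial (x + t *\<^sub>R b)) * indicator {0..1/4} t \<partial>lborel)"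
    unfolding mag.simps(2)[of "Suc k" \<psi>] sum_distrib_right by (rule refl)
  finally show ?case .
qed

lemma mag_cube:
  assumes \<psi>: "\<psi> \<in> smooth_S3" and w: "w \<in> S3" and l: "1/4 \<le> l"
    and b: "norm b1 = 1" "norm b2 = 1" "norm b3 = 1" "b1 \<bullet> w = 0" "b2 \<bullet> w = 0" "b3 \<bullet> w = 0"
  shows "mag 0 \<psi> w \<le> 64 * (\<integral>\<^sup>+t. (\<integral>\<^sup>+t'. (\<integral>\<^sup>+t''.
      mag 3 \<psi> (radial (l *\<^sub>R w + t *\<^sub>R b1 + t' *\<^sub>R b2 + t'' *\<^sub>R b3))
      * indicator {0..1/4} t'' \<partial>lborel) * indicator {0..1/4} t' \<partial>lborel) * indicator {0..1/4} t \<partial>lborel)"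
proof -
  let ?p = "\<lambda>t t' t''. l *\<^sub>R w + t *\<^sub>R b1 + t' *\<^sub>R b2 + t'' *\<^sub>R b3"
  have nw: "norm w = 1" using w by simp
  have n: "1/4 \<le> norm (?p t t' t'')" for t t' t''
  proof -
    have "?p t t' t'' \<bullet> w = l" using nw b by (simp add: inner_add_left norm_eq_1)
    then have "l \<le> norm (?p t t' t'') * norm w" using norm_cauchy_schwarz[of "?p t t' t''" w] by simp
    then show ?thesis using l nw by simp
  qed
  have n1: "1/4 \<le> norm (l *\<^sub>R w + t *\<^sub>R b1)" "1/4 \<le> norm (l *\<^sub>R w + t *\<^sub>R b1 + t' *\<^sub>R b2)" for t t'
    using n[of t 0 0] n[of t t' 0] by simp_all
  have 1: "mag 1 \<psi> (radial (l *\<^sub>R w + t *\<^sub>R b1)) \<le> 4 * (\<integral>\<^sup>+t'. mag (Suc 1) \<psi> (radial (l *\<^sub>R w + t *\<^sub>R b1 + t' *\<^sub>R b2)) * indicator {0..1/4} t' \<partial>lborel)" for t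
    by (rule mag_line[OF \<psi> b(2) n1(2)])
  have 2: "mag 2 \<psi> (radial (l *\<^sub>R w + t *\<^sub>R b1 + t' *\<^sub>R b2)) \<le> 4 * (\<integral>\<^sup>+t''. mag (Suc 2) \<psi> (radial (?p t t' t'')) * indicator {0..1/4} t'' \<partial>lborel)" for t t'
    by (rule mag_line[OF \<psi> b(3) n])
  have 0: "mag 0 \<psi> (radial (l *\<^sub>R w)) \<le> 4 * (\<integral>\<^sup>+t. mag (Suc 0) \<psi> (radial (l *\<^sub>R w + t *\<^sub>R b1)) * indicator {0..1/4} t \<partial>lborel)"
    by (rule mag_line[OF \<psi> b(1) n1(1)])
  have e: "Suc 0 = 1" "Suc 1 = 2" "Suc 2 = 3" by simp_all
  have "radial (l *\<^sub>R w) = w" using l nw by (simp add: radial_def)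
  then have "mag 0 \<psi> w = mag 0 \<psi> (radial (l *\<^sub>R w))" by (simp only:)
  also have "\<dots> \<le> 4 * (\<integral>\<^sup>+t. mag 1 \<psi> (radial (l *\<^sub>R w + t *\<^sub>R b1)) * indicator {0..1/4} t \<partial>lborel)"
    using 0 unfolding e .
  also have "\<dots> \<le> 4 * (\<integral>\<^sup>+t. (4 * (\<integral>\<^sup>+t'. (4 * (\<integral>\<^sup>+t''. mag 3 \<psi> (radial (?p t t' t'')) * indicator {0..1/4} t'' \<partial>lborel))
      * indicator {0..1/4} t' \<partial>lborel)) * indicator {0..1/4} t \<partial>lborel)"
    by (intro mult_left_mono nn_integral_mono mult_right_mono order_trans[OF 1[unfolded e]] 2[unfolded e] zero_le)
  also have "\<dots> = 64 * (\<integral>\<^sup>+t. (\<integral>\<^sup>+t'. (\<integral>\<^sup>+t''. mag 3 \<psi> (radial (?p t t' t'')) * indicator {0..1/4} t'' \<partial>lborel)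
      * indicator {0..1/4} t' \<partial>lborel) * indicator {0..1/4} t \<partial>lborel)"
  proof -
    have [measurable]: "mag 3 \<psi> \<in> borel_measurable borel" by (rule mag_measurable[OF \<psi>])
    have c: "(\<integral>\<^sup>+t. (4 * h t) * indicator A t \<partial>lborel) = 4 * (\<integral>\<^sup>+t. h t * indicator A t \<partial>lborel)"
      if [measurable]: "h \<in> borel_measurable borel" "A \<in> sets borel" for h :: "real \<Rightarrow> ennreal" and A
      unfolding mult.assoc by (rule nn_integral_cmult) measurable
    have 64: "4 * (4 * (4 * x)) = 64 * x" for x :: ennreal by (simp flip: mult.assoc)
    have m1: "(\<lambda>t'. \<integral>\<^sup>+t''. mag 3 \<psi> (radial (?p t t' t'')) * indicator {0..1/4} t'' \<partial>lborel) \<in> borel_measurable borel" for t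
      by measurable
    have m2: "(\<lambda>t. \<integral>\<^sup>+t'. (\<integral>\<^sup>+t''. mag 3 \<psi> (radial (?p t t' t'')) * indicator {0..1/4} t'' \<partial>lborel)
        * indicator {0..1/4} t' \<partial>lborel) \<in> borel_measurable borel" by measurable
    have A: "{0..1/4} \<in> sets (borel :: real measure)" by simp
    have m3: "(\<lambda>t. 4 * (\<integral>\<^sup>+t'. (\<integral>\<^sup>+t''. mag 3 \<psi> (radial (?p t t' t'')) * indicator {0..1/4} t'' \<partial>lborel)
        * indicator {0..1/4} t' \<partial>lborel)) \<in> borel_measurable borel" by measurable
    show ?thesis
      unfolding c[OF m1 A] c[OF m3 A] c[OF m2 A] 64 by (rule refl)
  qed
  finally show ?thesis .
qed

lemma nn_integral_lborel_pair:
  fixes h :: "'a::euclidean_space \<times> 'b::euclidean_space \<Rightarrow> ennreal"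
  assumes "h \<in> borel_measurable borel"
  shows "(\<integral>\<^sup>+x. \<integral>\<^sup>+y. h (x, y) \<partial>lborel \<partial>lborel) = (\<integral>\<^sup>+z. h z \<partial>lborel)"
    and "(\<lambda>x. \<integral>\<^sup>+y. h (x, y) \<partial>lborel) \<in> borel_measurable borel"
proof -
  have h: "h \<in> borel_measurable (lborel \<Otimes>\<^sub>M lborel)"
    unfolding lborel_prod using assms by simp
  from lborel.nn_integral_fst[OF h] show "(\<integral>\<^sup>+x. \<integral>\<^sup>+y. h (x, y) \<partial>lborel \<partial>lborel) = (\<integral>\<^sup>+z. h z \<partial>lborel)"
    unfolding lborel_prod .
  from lborel.borel_measurable_nn_integral_fst[OF h]
  show "(\<lambda>x. \<integral>\<^sup>+y. h (x, y) \<partial>lborel) \<in> borel_measurable borel" by simp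
qed

lemma nn_integral_lborel_pair2:
  fixes h :: "(real \<times> real) \<times> (real \<times> real) \<Rightarrow> ennreal"
  assumes h: "h \<in> borel_measurable borel"
  shows "(\<integral>\<^sup>+l. (\<integral>\<^sup>+t. (\<integral>\<^sup>+t'. (\<integral>\<^sup>+t''. h ((l, t), (t', t'')) \<partial>lborel) \<partial>lborel) \<partial>lborel) \<partial>lborel)
    = (\<integral>\<^sup>+z. h z \<partial>lborel)"
proof -
  have hx: "(\<lambda>y. h (x, y)) \<in> borel_measurable borel" for x
    by (rule measurable_compose[OF borel_measurable_continuous_onI h]) (intro continuous_intros)
  have 1: "(\<integral>\<^sup>+t'. (\<integral>\<^sup>+t''. h (x, (t', t'')) \<partial>lborel) \<partial>lborel) = (\<integral>\<^sup>+y. h (x, y) \<partial>lborel)" for x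
    by (rule nn_integral_lborel_pair(1)[OF hx])
  have "(\<integral>\<^sup>+l. (\<integral>\<^sup>+t. (\<integral>\<^sup>+y. h ((l, t), y) \<partial>lborel) \<partial>lborel) \<partial>lborel) = (\<integral>\<^sup>+x. (\<integral>\<^sup>+y. h (x, y) \<partial>lborel) \<partial>lborel)"
    by (rule nn_integral_lborel_pair(1)[OF nn_integral_lborel_pair(2)[OF h]])
  also have "\<dots> = (\<integral>\<^sup>+z. h z \<partial>lborel)" by (rule nn_integral_lborel_pair(1)[OF h])
  finally show ?thesis unfolding 1 .
qed

text \<open>In coordinates adapted to the orthonormal basis \<open>w, b1, b2, b3\<close> of the Euclidean space
  around \<open>S\<^sup>3\<close>, the bounds of \<open>mag_cube\<close> for \<open>l\<close> between \<open>1/4\<close> and \<open>1/2\<close> add up to an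
  integral over a cube inside the unit ball.\<close>

lemma mag_le_integral:
  assumes \<psi>: "\<psi> \<in> smooth_S3" and w: "w \<in> S3"
  shows "mag 0 \<psi> w \<le> 64 * (\<integral>\<^sup>+y. mag 3 \<psi> y \<partial>\<mu>S3)"
proof -
  define b1 b2 b3 where b: "b1 = frame A1 w" "b2 = frame A2 w" "b3 = frame A3 w"
  have nw: "norm w = 1" using w by simp
  have on: "norm b1 = 1" "norm b2 = 1" "norm b3 = 1" "b1 \<bullet> w = 0" "b2 \<bullet> w = 0" "b3 \<bullet> w = 0"
    unfolding b using nw by (simp_all del: frame.simps)
  have orth: "b1 \<bullet> b2 = 0" "b1 \<bullet> b3 = 0" "b2 \<bullet> b3 = 0"
    unfolding b using frame_orthonormal(1)[OF w] by (simp_all del: frame.simps)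
  define Q :: "(real \<times> real) \<times> (real \<times> real) \<Rightarrow> c2" where
    "Q = (\<lambda>z. fst (fst z) *\<^sub>R w + snd (fst z) *\<^sub>R b1 + fst (snd z) *\<^sub>R b2 + snd (snd z) *\<^sub>R b3)"
  have lin: "linear Q" unfolding Q_def by (rule linearI) (simp_all add: algebra_simps)
  have iso: "norm (Q z) = norm z" for z
  proof -
    have "Q z \<bullet> Q z = z \<bullet> z"
    proof -
      have "z \<bullet> z = fst (fst z) * fst (fst z) + snd (fst z) * snd (fst z)
          + (fst (snd z) * fst (snd z) + snd (snd z) * snd (snd z))"
        by (simp add: inner_prod_def)
      moreover have "w \<bullet> w = 1" "b1 \<bullet> b1 = 1" "b2 \<bullet> b2 = 1" "b3 \<bullet> b3 = 1"
        using nw on by (simp_all add: norm_eq_1)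
      ultimately show ?thesis
        using on(4-6) orth unfolding Q_def by (simp add: inner_add_left inner_add_right inner_commute)
    qed
    then show ?thesis by (simp add: norm_eq_sqrt_inner)
  qed
  have [measurable]: "mag 3 \<psi> \<in> borel_measurable borel" by (rule mag_measurable[OF \<psi>])
  have Qm [measurable]: "Q \<in> borel_measurable borel"
    using lin by (intro borel_measurable_continuous_onI linear_continuous_on)
      (simp add: linear_conv_bounded_linear)
  define J where "J = {0..1/4 :: real}"
  define L where "L = {1/4..1/2 :: real}"
  have [measurable]: "J \<in> sets borel" "L \<in> sets borel" by (simp_all add: J_def L_def)
  let ?G = "\<lambda>z. mag 3 \<psi> (radial (Q z)) * (indicator J (snd (snd z)) * (indicator J (fst (snd z))
      * (indicator J (snd (fst z)) * indicator L (fst (fst z)))))"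
  have mQ: "(\<lambda>z. mag 3 \<psi> (radial (Q z))) \<in> borel_measurable borel"
    by (rule measurable_compose[OF measurable_compose[OF Qm radial_measurable] mag_measurable[OF \<psi>]])
  have mi: "(\<lambda>z. indicator A (c z) :: ennreal) \<in> borel_measurable borel"
    if "continuous_on UNIV c" "A \<in> sets borel" for c :: "(real \<times> real) \<times> (real \<times> real) \<Rightarrow> real" and A
    using that by (intro measurable_compose[OF borel_measurable_continuous_onI borel_measurable_indicator])
  have JL: "J \<in> sets borel" "L \<in> sets borel" by (simp_all add: J_def L_def)
  have G: "(\<lambda>z. 64 * ?G z) \<in> borel_measurable borel"
    by (intro borel_measurable_times_ennreal borel_measurable_const mQ mi JL continuous_intros)
  have "(\<integral>\<^sup>+l. mag 0 \<psi> w * indicator L l \<partial>lborel) \<le> (\<integral>\<^sup>+l. (64 * (\<integral>\<^sup>+t. (\<integral>\<^sup>+t'. (\<integral>\<^sup>+t''.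
      mag 3 \<psi> (radial (l *\<^sub>R w + t *\<^sub>R b1 + t' *\<^sub>R b2 + t'' *\<^sub>R b3))
      * indicator J t'' \<partial>lborel) * indicator J t' \<partial>lborel) * indicator J t \<partial>lborel)) * indicator L l \<partial>lborel)"
  proof (rule nn_integral_mono)
    fix l
    show "mag 0 \<psi> w * indicator L l \<le> (64 * (\<integral>\<^sup>+t. (\<integral>\<^sup>+t'. (\<integral>\<^sup>+t''.
      mag 3 \<psi> (radial (l *\<^sub>R w + t *\<^sub>R b1 + t' *\<^sub>R b2 + t'' *\<^sub>R b3))
      * indicator J t'' \<partial>lborel) * indicator J t' \<partial>lborel) * indicator J t \<partial>lborel)) * indicator L l"
    proof (cases "l \<in> L")
      case True
      then have "1/4 \<le> l" by (simp add: L_def)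
      from mag_cube[OF \<psi> w this on] show ?thesis
        unfolding J_def by (intro mult_right_mono zero_le)
    qed simp
  qed
  also have "(\<integral>\<^sup>+l. mag 0 \<psi> w * indicator L l \<partial>lborel) = mag 0 \<psi> w * ennreal (1/4)"
    by (subst nn_integral_cmult_indicator) (simp_all add: L_def del: mag.simps)
  also have "(\<integral>\<^sup>+l. (64 * (\<integral>\<^sup>+t. (\<integral>\<^sup>+t'. (\<integral>\<^sup>+t''.
      mag 3 \<psi> (radial (l *\<^sub>R w + t *\<^sub>R b1 + t' *\<^sub>R b2 + t'' *\<^sub>R b3))
      * indicator J t'' \<partial>lborel) * indicator J t' \<partial>lborel) * indicator J t \<partial>lborel)) * indicator L l \<partial>lborel)
    = (\<integral>\<^sup>+l. (\<integral>\<^sup>+t. (\<integral>\<^sup>+t'. (\<integral>\<^sup>+t''. 64 * ?G ((l, t), (t', t''))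
       \<partial>lborel) \<partial>lborel) \<partial>lborel) \<partial>lborel)"
  proof (rule nn_integral_cong)
    fix l
    define m where "m = (\<lambda>t t' t''. mag 3 \<psi> (radial (l *\<^sub>R w + t *\<^sub>R b1 + t' *\<^sub>R b2 + t'' *\<^sub>R b3)))"
    have m1: "(\<lambda>t''. m t t' t'' * indicator J t'') \<in> borel_measurable lborel" for t t'
      unfolding m_def by measurable
    have m2: "(\<lambda>t'. (\<integral>\<^sup>+t''. m t t' t'' * indicator J t'' \<partial>lborel) * indicator J t') \<in> borel_measurable lborel" for t
      unfolding m_def by measurable
    have m3: "(\<lambda>t. (\<integral>\<^sup>+t'. (\<integral>\<^sup>+t''. m t t' t'' * indicator J t'' \<partial>lborel) * indicator J t' \<partial>lborel) * indicator J t)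
        \<in> borel_measurable lborel"
      unfolding m_def by measurable
    have r: "64 * (x * (j'' * (j' * (j * k)))) = (x * j'') * (j' * (j * (64 * k)))" for x j'' j' j k :: ennreal
      by (simp only: mult_ac)
    have "(\<integral>\<^sup>+t. (\<integral>\<^sup>+t'. (\<integral>\<^sup>+t''. 64 * ?G ((l, t), (t', t'')) \<partial>lborel) \<partial>lborel) \<partial>lborel)
      = (\<integral>\<^sup>+t. (\<integral>\<^sup>+t'. (\<integral>\<^sup>+t''. (m t t' t'' * indicator J t'') * (indicator J t' * (indicator J t * (64 * indicator L l))) \<partial>lborel) \<partial>lborel) \<partial>lborel)"
      unfolding Q_def fst_conv snd_conv m_def r by (rule refl)
    also have "\<dots> = (\<integral>\<^sup>+t. (\<integral>\<^sup>+t'. ((\<integral>\<^sup>+t''. m t t' t'' * indicator J t'' \<partial>lborel) * indicator J t') * (indicator J t * (64 * indicator L l)) \<partial>lborel) \<partial>lborel)"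
      unfolding nn_integral_multc[OF m1] by (simp only: mult.assoc)
    also have "\<dots> = (\<integral>\<^sup>+t. ((\<integral>\<^sup>+t'. (\<integral>\<^sup>+t''. m t t' t'' * indicator J t'' \<partial>lborel) * indicator J t' \<partial>lborel) * indicator J t) * (64 * indicator L l) \<partial>lborel)"
      unfolding nn_integral_multc[OF m2] by (simp only: mult.assoc)
    also have "\<dots> = (\<integral>\<^sup>+t. (\<integral>\<^sup>+t'. (\<integral>\<^sup>+t''. m t t' t'' * indicator J t'' \<partial>lborel) * indicator J t' \<partial>lborel) * indicator J t \<partial>lborel) * (64 * indicator L l)"
      by (rule nn_integral_multc[OF m3])
    finally show "(64 * (\<integral>\<^sup>+t. (\<integral>\<^sup>+t'. (\<integral>\<^sup>+t''.
        mag 3 \<psi> (radial (l *\<^sub>R w + t *\<^sub>R b1 + t' *\<^sub>R b2 + t'' *\<^sub>R b3))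
        * indicator J t'' \<partial>lborel) * indicator J t' \<partial>lborel) * indicator J t \<partial>lborel)) * indicator L l
      = (\<integral>\<^sup>+t. (\<integral>\<^sup>+t'. (\<integral>\<^sup>+t''. 64 * ?G ((l, t), (t', t'')) \<partial>lborel) \<partial>lborel) \<partial>lborel)"
      unfolding m_def by (simp only: mult_ac)
  qed
  also have "\<dots> = (\<integral>\<^sup>+z. 64 * ?G z \<partial>lborel)"
    by (rule nn_integral_lborel_pair2[OF G])
  also have "\<dots> \<le> (\<integral>\<^sup>+z. 64 * (mag 3 \<psi> (radial (Q z)) * indicator (ball 0 1 - {0}) (Q z)) \<partial>lborel)"
  proof (intro nn_integral_mono mult_left_mono zero_le)
    fix z
    show "indicator J (snd (snd z)) * (indicator J (fst (snd z)) * (indicator J (snd (fst z)) * indicator L (fst (fst z))))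
      \<le> (indicator (ball 0 1 - {0}) (Q z) :: ennreal)"
    proof (cases "snd (snd z) \<in> J \<and> fst (snd z) \<in> J \<and> snd (fst z) \<in> J \<and> fst (fst z) \<in> L")
      case True
      have J: "t\<^sup>2 \<le> 1/16" if "t \<in> J" for t
        using power_mono[of t "1/4" 2] that by (simp add: J_def power2_eq_square)
      have "(fst (fst z))\<^sup>2 \<le> 1/4"
        using power_mono[of "fst (fst z)" "1/2" 2] True by (simp add: L_def power2_eq_square)
      moreover have "(norm z)\<^sup>2 = (fst (fst z))\<^sup>2 + (snd (fst z))\<^sup>2 + ((fst (snd z))\<^sup>2 + (snd (snd z))\<^sup>2)"
        by (simp add: norm_prod_def)
      ultimately have "(norm z)\<^sup>2 < 1\<^sup>2" using True J[of "snd (snd z)"] J[of "fst (snd z)"] J[of "snd (fst z)"] by simp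
      then have "norm z < 1" by (rule power2_less_imp_less) simp
      moreover have "z \<noteq> 0" using True by (auto simp: L_def)
      ultimately have "Q z \<in> ball 0 1 - {0}" using iso[of z] by auto
      then show ?thesis by (simp add: indicator_def)
    qed auto
  qed
  also have "\<dots> = (\<integral>\<^sup>+x. 64 * (mag 3 \<psi> (radial x) * indicator (ball 0 1 - {0}) x) \<partial>distr lborel borel Q)"
  proof (rule nn_integral_distr[symmetric])
    have [measurable]: "ball 0 1 - {0 :: c2} \<in> sets borel" by simp
    show "(\<lambda>x. 64 * (mag 3 \<psi> (radial x) * indicator (ball 0 1 - {0}) x)) \<in> borel_measurable (distr lborel borel Q)"
      by measurable
  qed simp
  also have "distr lborel borel Q = lborel" by (rule distr_lborel_isometry[OF lin iso]) simp
  also have "(\<integral>\<^sup>+x. 64 * (mag 3 \<psi> (radial x) * indicator (ball 0 1 - {0}) x) \<partial>lborel)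
      = 16 * (4 * (\<integral>\<^sup>+x. mag 3 \<psi> (x /\<^sub>R norm x) * indicator (ball 0 1 - {0}) x \<partial>lborel))"
  proof -
    have [measurable]: "ball 0 1 - {0 :: c2} \<in> sets borel" by simp
    have "(\<integral>\<^sup>+x. 64 * (mag 3 \<psi> (radial x) * indicator (ball 0 1 - {0}) x) \<partial>lborel)
        = 64 * (\<integral>\<^sup>+x. mag 3 \<psi> (radial x) * indicator (ball 0 1 - {0}) x \<partial>lborel)"
      by (rule nn_integral_cmult) measurable
    then show ?thesis unfolding radial_def by (simp flip: mult.assoc)
  qed
  also have "\<dots> = 16 * (\<integral>\<^sup>+y. mag 3 \<psi> y \<partial>\<mu>S3)"
    by (subst nn_integral_\<mu>S3) (auto intro: measurable_restrict_space1)
  finally have "4 * (mag 0 \<psi> w * ennreal (1/4)) \<le> 4 * (16 * (\<integral>\<^sup>+y. mag 3 \<psi> y \<partial>\<mu>S3))"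
    by (intro mult_left_mono zero_le)
  moreover have "4 * (mag 0 \<psi> w * ennreal (1/4)) = mag 0 \<psi> w"
  proof -
    have "4 * ennreal (1/4) = 1"
      using ennreal_mult'[of 4 "1/4"] by simp
    then show ?thesis by (metis mult.assoc mult.commute mult_1)
  qed
  ultimately show ?thesis by (simp add: mult.assoc[symmetric] del: mag.simps)
qed

lemma abs_le_imp_square_le: "\<bar>a\<bar> \<le> b \<Longrightarrow> a\<^sup>2 \<le> b\<^sup>2" for a b :: real
  by (rule abs_le_square_iff[THEN iffD1]) simp

lemma borel_measurable_\<mu>S3: "f \<in> borel_measurable borel \<Longrightarrow> f \<in> borel_measurable \<mu>S3"
  unfolding measurable_cong_sets[OF sets_\<mu>S3 refl] by (rule measurable_restrict_space1)

lemma nn_integral_mag_0: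
  assumes "\<psi> \<in> smooth_S3" shows "(\<integral>\<^sup>+y. mag 0 \<psi> y \<partial>\<mu>S3) = ennreal (LINT y|\<mu>S3. \<bar>\<psi> y\<bar>)"
proof -
  have "(\<integral>\<^sup>+y. mag 0 \<psi> y \<partial>\<mu>S3) = (\<integral>\<^sup>+y. ennreal \<bar>\<psi> y\<bar> \<partial>\<mu>S3)"
    by (rule nn_integral_cong) (simp add: indicator_def)
  also have "\<dots> = ennreal (LINT y|\<mu>S3. \<bar>\<psi> y\<bar>)"
    using \<mu>S3.L2_integrable[OF smooth_S3_L2[OF assms]] by (intro nn_integral_eq_integral) simp_all
  finally show ?thesis .
qed

lemma smooth_sup_bound:
  assumes \<psi>: "\<psi> \<in> smooth_S3" and w: "w \<in> S3"
  shows "\<bar>\<psi> w\<bar> \<le> 64 * (\<Sum>a\<in>ops. \<Sum>b\<in>ops. \<Sum>c\<in>ops. LINT y|\<mu>S3. \<bar>foldr frame_deriv (c @ b @ a) \<psi> y\<bar>)"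
proof -
  note s = smooth_foldr_frame_deriv[OF \<psi>]
  have m: "mag k \<xi> \<in> borel_measurable \<mu>S3" if "\<xi> \<in> smooth_S3" for k \<xi>
    by (rule borel_measurable_\<mu>S3[OF mag_measurable[OF that]])
  have I: "(\<integral>\<^sup>+y. mag (Suc k) \<xi> y \<partial>\<mu>S3) = (\<Sum>a\<in>ops. \<integral>\<^sup>+y. mag k (foldr frame_deriv a \<xi>) y \<partial>\<mu>S3)"
    if "\<xi> \<in> smooth_S3" for k \<xi>
    unfolding mag.simps(2) by (rule nn_integral_sum) (intro m smooth_foldr_frame_deriv that)
  have 3: "(3::nat) = Suc (Suc (Suc 0))" by simp
  have "(\<integral>\<^sup>+y. mag 3 \<psi> y \<partial>\<mu>S3)
      = (\<Sum>a\<in>ops. \<Sum>b\<in>ops. \<Sum>c\<in>ops. \<integral>\<^sup>+y. mag 0 (foldr frame_deriv c (foldr frame_deriv b (foldr frame_deriv a \<psi>))) y \<partial>\<mu>S3)"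
    unfolding 3 I[OF \<psi>] I[OF s] I[OF smooth_foldr_frame_deriv[OF s]] by (rule refl)
  also have "\<dots> = (\<Sum>a\<in>ops. \<Sum>b\<in>ops. \<Sum>c\<in>ops. ennreal (LINT y|\<mu>S3. \<bar>foldr frame_deriv (c @ b @ a) \<psi> y\<bar>))"
    unfolding foldr_append o_apply
    by (intro sum.cong refl nn_integral_mag_0 smooth_foldr_frame_deriv \<psi>)
  also have "\<dots> = ennreal (\<Sum>a\<in>ops. \<Sum>b\<in>ops. \<Sum>c\<in>ops. LINT y|\<mu>S3. \<bar>foldr frame_deriv (c @ b @ a) \<psi> y\<bar>)"
    by (simp add: sum_nonneg)
  finally have "ennreal \<bar>\<psi> w\<bar> \<le> 64 * ennreal (\<Sum>a\<in>ops. \<Sum>b\<in>ops. \<Sum>c\<in>ops. LINT y|\<mu>S3. \<bar>foldr frame_deriv (c @ b @ a) \<psi> y\<bar>)"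
    using mag_le_integral[OF \<psi> w] w by simp
  also have "\<dots> = ennreal (64 * (\<Sum>a\<in>ops. \<Sum>b\<in>ops. \<Sum>c\<in>ops. LINT y|\<mu>S3. \<bar>foldr frame_deriv (c @ b @ a) \<psi> y\<bar>))"
    by (subst ennreal_mult') simp_all
  finally show ?thesis
    by (subst (asm) ennreal_le_iff) (auto intro!: mult_nonneg_nonneg sum_nonneg)
qed

lemma foldr_frame_deriv_diff:
  assumes "\<psi> \<in> smooth_S3" "\<xi> \<in> smooth_S3" "w \<in> S3"
  shows "foldr frame_deriv \<alpha> (\<lambda>w. \<psi> w - \<xi> w) w = foldr frame_deriv \<alpha> \<psi> w - foldr frame_deriv \<alpha> \<xi> w"
  using assms(3)
proof (induction \<alpha> arbitrary: w)
  case Nil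
  show ?case by simp
next
  case (Cons i \<alpha>)
  have "frame_deriv i (foldr frame_deriv \<alpha> (\<lambda>w. \<psi> w - \<xi> w)) w
      = frame_deriv i (\<lambda>w. foldr frame_deriv \<alpha> \<psi> w - foldr frame_deriv \<alpha> \<xi> w) w"
    by (rule frame_deriv_cong[OF Cons.prems Cons.IH])
  also have "\<dots> = frame_deriv i (foldr frame_deriv \<alpha> \<psi>) w - frame_deriv i (foldr frame_deriv \<alpha> \<xi>) w"
    by (intro frame_deriv_diff smooth_foldr_frame_deriv assms Cons.prems)
  finally show ?case by simp
qed

lemma L2_tendsto_L1:
  assumes F: "L2_tendsto \<mu>S3 F f sequentially" "\<And>n. F n \<in> L2 \<mu>S3" and f: "f \<in> L2 \<mu>S3"
  shows "(\<lambda>n. LINT w|\<mu>S3. \<bar>F n w - f w\<bar>) \<longlonglongrightarrow> (0 :: real)"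
proof (rule Lim_null_comparison)
  let ?V = "LINT w|\<mu>S3. (1::real)\<^sup>2"
  show "\<forall>\<^sub>F n in sequentially. norm (LINT w|\<mu>S3. \<bar>F n w - f w\<bar>) \<le> sqrt ((LINT w|\<mu>S3. (F n w - f w)\<^sup>2) * ?V)"
  proof (rule always_eventually, rule allI)
    fix n
    have d: "(\<lambda>w. F n w - f w) \<in> L2 \<mu>S3" by (rule L2_diff[OF F(2) f])
    have a: "(\<lambda>w. \<bar>F n w - f w\<bar>) \<in> L2 \<mu>S3"
      unfolding L2_real_iff power2_abs using borel_measurable_abs[OF L2_measurable[OF d]] L2_integrable_sq[OF d] by simp
    have "(\<lambda>w. 1 :: real) \<in> L2 \<mu>S3" by (rule smooth_S3_L2) simp
    from L2_Cauchy_Schwarz[OF a this]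
    show "norm (LINT w|\<mu>S3. \<bar>F n w - f w\<bar>) \<le> sqrt ((LINT w|\<mu>S3. (F n w - f w)\<^sup>2) * ?V)"
      by (simp add: real_le_rsqrt)
  qed
  have "(\<lambda>n. sqrt ((LINT w|\<mu>S3. (F n w - f w)\<^sup>2) * ?V)) \<longlonglongrightarrow> sqrt (0 * ?V)"
    using F(1) unfolding L2_tendsto_real by (intro tendsto_intros)
  then show "(\<lambda>n. sqrt ((LINT w|\<mu>S3. (F n w - f w)\<^sup>2) * ?V)) \<longlonglongrightarrow> 0" by simp
qed

text \<open>The bound of \<open>smooth_sup_bound\<close> applies to the differences of the projections \<open>proj n f\<close>, because their
  iterated derivatives are the projections of those of \<open>f\<close>.\<close>

theorem sobolev_uniform_approximation:
  assumes f: "sob 3 f"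
  shows "\<exists>B. B \<longlonglongrightarrow> 0 \<and> (\<forall>n. AE w in \<mu>S3. \<bar>proj n f w - f w\<bar> \<le> B n)"
proof -
  note fL = sob_L2[OF f]
  define e where "e = (\<lambda>\<alpha> n. LINT w|\<mu>S3. \<bar>foldr frame_deriv \<alpha> (proj n f) w - foldr sobolev_deriv \<alpha> f w\<bar>)"
  define B where "B = (\<lambda>n. 64 * (\<Sum>a\<in>ops. \<Sum>b\<in>ops. \<Sum>c\<in>ops. e (c @ b @ a) n))"
  have len: "length (c @ b @ a) \<le> 3" if "a \<in> ops" "b \<in> ops" "c \<in> ops" for a b c
    using that by (auto simp: ops_def)
  have D: "foldr sobolev_deriv \<alpha> f \<in> L2 \<mu>S3" if "length \<alpha> \<le> 3" for \<alpha>
    by (rule sob_L2[OF foldr_sobolev_deriv[OF f that]])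
  have P: "foldr frame_deriv \<alpha> (proj n f) \<in> L2 \<mu>S3" for \<alpha> n
    by (intro smooth_S3_L2 smooth_foldr_frame_deriv proj_smooth fL)
  have e: "e \<alpha> \<longlonglongrightarrow> 0" if \<alpha>: "length \<alpha> \<le> 3" for \<alpha>
    unfolding e_def
  proof (rule L2_tendsto_L1[OF _ P D[OF \<alpha>]])
    have "L2_tendsto \<mu>S3 (\<lambda>n. foldr frame_deriv \<alpha> (proj n f)) (foldr sobolev_deriv \<alpha> f) sequentially
      \<longleftrightarrow> L2_tendsto \<mu>S3 (\<lambda>n. proj n (foldr sobolev_deriv \<alpha> f)) (foldr sobolev_deriv \<alpha> f) sequentially"
      by (rule L2_tendsto_cong_AE)
        (simp_all add: foldr_frame_deriv_proj[OF f \<alpha>] L2_measurable[OF D[OF \<alpha>]] L2_measurable[OF proj_L2[OF D[OF \<alpha>]]]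
          L2_measurable[OF P])
    then show "L2_tendsto \<mu>S3 (\<lambda>n. foldr frame_deriv \<alpha> (proj n f)) (foldr sobolev_deriv \<alpha> f) sequentially"
      using proj_tendsto[OF D[OF \<alpha>]] by simp
  qed
  have "B \<longlonglongrightarrow> 64 * (\<Sum>a\<in>ops. \<Sum>b\<in>ops. \<Sum>c\<in>ops. 0)"
    unfolding B_def by (intro tendsto_mult tendsto_const tendsto_sum e len)
  then have B: "B \<longlonglongrightarrow> 0" by simp
  have nm: "\<bar>proj n f w - proj m f w\<bar> \<le> B n + B m" if w: "w \<in> S3" for n m w
  proof -
    have s: "(\<lambda>w. proj n f w - proj m f w) \<in> smooth_S3" by (intro smooth_S3_diff proj_smooth fL)
    have "\<bar>proj n f w - proj m f w\<bar> \<le> 64 * (\<Sum>a\<in>ops. \<Sum>b\<in>ops. \<Sum>c\<in>ops.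
        LINT y|\<mu>S3. \<bar>foldr frame_deriv (c @ b @ a) (\<lambda>w. proj n f w - proj m f w) y\<bar>)"
      by (rule smooth_sup_bound[OF s w])
    also have "\<dots> \<le> 64 * (\<Sum>a\<in>ops. \<Sum>b\<in>ops. \<Sum>c\<in>ops. e (c @ b @ a) n + e (c @ b @ a) m)"
    proof (intro mult_left_mono sum_mono)
      fix a b c assume "a \<in> ops" "b \<in> ops" "c \<in> ops"
      then have \<alpha>: "length (c @ b @ a) \<le> 3" by (rule len)
      let ?\<alpha> = "c @ b @ a"
      have d: "integrable \<mu>S3 (\<lambda>y. \<bar>foldr frame_deriv ?\<alpha> (proj n f) y - foldr sobolev_deriv ?\<alpha> f y\<bar>)" for n
        by (intro integrable_abs \<mu>S3.L2_integrable L2_diff P D \<alpha>)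
      have "(LINT y|\<mu>S3. \<bar>foldr frame_deriv ?\<alpha> (\<lambda>w. proj n f w - proj m f w) y\<bar>)
        \<le> (LINT y|\<mu>S3. \<bar>foldr frame_deriv ?\<alpha> (proj n f) y - foldr sobolev_deriv ?\<alpha> f y\<bar>
            + \<bar>foldr frame_deriv ?\<alpha> (proj m f) y - foldr sobolev_deriv ?\<alpha> f y\<bar>)"
      proof (rule integral_mono)
        show "integrable \<mu>S3 (\<lambda>y. \<bar>foldr frame_deriv ?\<alpha> (\<lambda>w. proj n f w - proj m f w) y\<bar>)"
          by (intro integrable_abs \<mu>S3.L2_integrable smooth_S3_L2 smooth_foldr_frame_deriv s)
        show "integrable \<mu>S3 (\<lambda>y. \<bar>foldr frame_deriv ?\<alpha> (proj n f) y - foldr sobolev_deriv ?\<alpha> f y\<bar>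
            + \<bar>foldr frame_deriv ?\<alpha> (proj m f) y - foldr sobolev_deriv ?\<alpha> f y\<bar>)"
          by (intro Bochner_Integration.integrable_add d)
        fix y assume "y \<in> space \<mu>S3"
        then have "y \<in> S3" unfolding space_\<mu>S3 .
        from foldr_frame_deriv_diff[OF proj_smooth[OF fL] proj_smooth[OF fL] this]
        show "\<bar>foldr frame_deriv ?\<alpha> (\<lambda>w. proj n f w - proj m f w) y\<bar>
          \<le> \<bar>foldr frame_deriv ?\<alpha> (proj n f) y - foldr sobolev_deriv ?\<alpha> f y\<bar>
            + \<bar>foldr frame_deriv ?\<alpha> (proj m f) y - foldr sobolev_deriv ?\<alpha> f y\<bar>"
          by (simp only:)
      qed
      also have "\<dots> = e ?\<alpha> n + e ?\<alpha> m" unfolding e_def by (intro Bochner_Integration.integral_add d)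
      finally show "(LINT y|\<mu>S3. \<bar>foldr frame_deriv ?\<alpha> (\<lambda>w. proj n f w - proj m f w) y\<bar>) \<le> e ?\<alpha> n + e ?\<alpha> m" .
    qed simp
    also have "\<dots> = B n + B m" by (simp add: B_def sum.distrib distrib_left)
    finally show ?thesis .
  qed
  obtain r where r: "strict_mono r" "AE w in \<mu>S3. (\<lambda>m. proj (r m) f w) \<longlonglongrightarrow> f w"
    using L2_tendsto_AE_subseq[OF proj_tendsto[OF fL] proj_L2[OF fL] fL] by blast
  have "AE w in \<mu>S3. \<bar>proj n f w - f w\<bar> \<le> B n" for n
    using r(2) AE_space
  proof eventually_elim
    case (elim w)
    have "(\<lambda>m. \<bar>proj n f w - proj (r m) f w\<bar>) \<longlonglongrightarrow> \<bar>proj n f w - f w\<bar>"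
      by (intro tendsto_intros elim)
    moreover have "(\<lambda>m. B n + B (r m)) \<longlonglongrightarrow> B n + 0"
      using LIMSEQ_subseq_LIMSEQ[OF B r(1)] by (intro tendsto_intros) (simp add: o_def)
    ultimately have "\<bar>proj n f w - f w\<bar> \<le> B n + 0"
    proof (rule LIMSEQ_le)
      show "\<exists>N. \<forall>m\<ge>N. \<bar>proj n f w - proj (r m) f w\<bar> \<le> B n + B (r m)"
        using nm[OF elim(2)[unfolded space_\<mu>S3]] by blast
    qed
    then show ?case by simp
  qed
  with B show ?thesis by blast
qed

text \<open>Uniform convergence of the functions, together with convergence of the derivatives in \<open>L\<^sup>2\<close>,
  makes this notion stable under products, unlike plain weak differentiability.\<close>

definition strong :: "axis \<Rightarrow> (c2 \<Rightarrow> real) \<Rightarrow> (c2 \<Rightarrow> real) \<Rightarrow> bool" where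
  "strong i u u' \<longleftrightarrow> u \<in> borel_measurable \<mu>S3 \<and> u' \<in> L2 \<mu>S3 \<and>
     (\<exists>(\<psi>::nat \<Rightarrow> c2 \<Rightarrow> real) B. (\<forall>n. \<psi> n \<in> smooth_S3) \<and> B \<longlonglongrightarrow> 0 \<and>
        (\<forall>n. AE w in \<mu>S3. \<bar>\<psi> n w - u w\<bar> \<le> B n) \<and>
        L2_tendsto \<mu>S3 (\<lambda>n. frame_deriv i (\<psi> n)) u' sequentially)"

lemma strongE:
  assumes "strong i u u'"
  obtains \<psi> B where "\<And>n::nat. \<psi> n \<in> smooth_S3" "B \<longlonglongrightarrow> 0" "\<And>n. AE w in \<mu>S3. \<bar>\<psi> n w - u w\<bar> \<le> B n"
    "L2_tendsto \<mu>S3 (\<lambda>n. frame_deriv i (\<psi> n)) u' sequentially"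
  using assms unfolding strong_def by blast

lemma strongD: "strong i u u' \<Longrightarrow> u \<in> borel_measurable \<mu>S3" "strong i u u' \<Longrightarrow> u' \<in> L2 \<mu>S3"
  unfolding strong_def by auto

lemma strong_sobolev:
  assumes "sob 3 u" shows "strong i u (sobolev_deriv i u)"
proof -
  have "sob (Suc 2) u" using assms by (simp only: numeral_3_eq_3 numeral_2_eq_2)
  note w = sob_sobolev_deriv(1)[OF this]
  note uL = sob_L2[OF assms]
  obtain B where "B \<longlonglongrightarrow> 0" "\<forall>n. AE w in \<mu>S3. \<bar>proj n u w - u w\<bar> \<le> B n"
    using sobolev_uniform_approximation[OF assms] by blast
  then show ?thesis
    unfolding strong_def
    by (intro conjI exI[of _ "\<lambda>n. proj n u"] exI[of _ B] L2_measurable[OF uL] wdD(2)[OF w] allI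
        proj_smooth[OF uL] frame_deriv_proj_tendsto[OF w]) simp_all
qed

lemma strong_bounded:
  assumes "strong i u u'" shows "\<exists>K\<ge>0. AE w in \<mu>S3. \<bar>u w\<bar> \<le> K"
proof -
  obtain \<psi> B where \<psi>: "\<And>n::nat. \<psi> n \<in> smooth_S3" "\<And>n. AE w in \<mu>S3. \<bar>\<psi> n w - u w\<bar> \<le> B n"
    using assms by (rule strongE) blast
  obtain K where K: "\<forall>w\<in>S3. \<bar>\<psi> 0 w\<bar> \<le> K" using smooth_S3_bounded[OF \<psi>(1)] by blast
  have "AE w in \<mu>S3. \<bar>u w\<bar> \<le> max 0 (B 0 + K)"
    using \<psi>(2)[of 0] AE_space
  proof eventually_elim
    case (elim w)
    then have "\<bar>\<psi> 0 w\<bar> \<le> K" using K unfolding space_\<mu>S3 by blast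
    with elim(1) show ?case by linarith
  qed
  then show ?thesis by (intro exI[of _ "max 0 (B 0 + K)"]) simp
qed

lemma strong_L2: "strong i u u' \<Longrightarrow> u \<in> L2 \<mu>S3"
  using strong_bounded \<mu>S3.L2_bounded strongD(1) by blast

lemma strong_mult_L2: "strong i u u' \<Longrightarrow> h \<in> L2 \<mu>S3 \<Longrightarrow> (\<lambda>w. u w * h w) \<in> L2 \<mu>S3"
  using strong_bounded L2_bounded_mult strongD(1) by blast

lemma strong_wd:
  assumes "strong i u u'" shows "wd i u u'"
proof -
  obtain \<psi> B where \<psi>: "\<And>n::nat. \<psi> n \<in> smooth_S3" "B \<longlonglongrightarrow> 0" "\<And>n. AE w in \<mu>S3. \<bar>\<psi> n w - u w\<bar> \<le> B n"
    "L2_tendsto \<mu>S3 (\<lambda>n. frame_deriv i (\<psi> n)) u' sequentially"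
    using assms by (rule strongE) blast
  note uL = strong_L2[OF assms]
  have "L2_tendsto \<mu>S3 \<psi> u sequentially"
    unfolding L2_tendsto_real
  proof (rule Lim_null_comparison)
    show "\<forall>\<^sub>F n in sequentially. norm (LINT w|\<mu>S3. (\<psi> n w - u w)\<^sup>2) \<le> (LINT w|\<mu>S3. (B n)\<^sup>2)"
    proof (rule always_eventually, rule allI)
      fix n
      have "(LINT w|\<mu>S3. (\<psi> n w - u w)\<^sup>2) \<le> (LINT w|\<mu>S3. (B n)\<^sup>2)"
      proof (rule integral_mono_AE)
        show "AE w in \<mu>S3. (\<psi> n w - u w)\<^sup>2 \<le> (B n)\<^sup>2"
          using \<psi>(3)[of n] by eventually_elim (rule abs_le_imp_square_le)
      qed (use L2_integrable_sq[OF L2_diff[OF smooth_S3_L2[OF \<psi>(1)] uL]] in simp_all)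
      then show "norm (LINT w|\<mu>S3. (\<psi> n w - u w)\<^sup>2) \<le> (LINT w|\<mu>S3. (B n)\<^sup>2)" by simp
    qed
    have "(\<lambda>n. measure \<mu>S3 S3 * (B n)\<^sup>2) \<longlonglongrightarrow> measure \<mu>S3 S3 * 0\<^sup>2" by (intro tendsto_intros \<psi>(2))
    then show "(\<lambda>n. LINT w|\<mu>S3. (B n)\<^sup>2) \<longlonglongrightarrow> 0" by simp
  qed
  then show ?thesis by (rule wd_limit[OF wd_smooth[OF \<psi>(1)] _ \<psi>(4) uL strongD(2)[OF assms]])
qed

lemma L2_tendsto_uniform_mult:
  fixes F :: "nat \<Rightarrow> c2 \<Rightarrow> real"
  assumes F: "L2_tendsto \<mu>S3 F f sequentially" "\<And>n. F n \<in> L2 \<mu>S3" and f: "f \<in> L2 \<mu>S3"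
    and v: "v \<in> borel_measurable \<mu>S3" "AE w in \<mu>S3. \<bar>v w\<bar> \<le> K"
    and \<xi>: "\<And>n. \<xi> n \<in> borel_measurable \<mu>S3" "B \<longlonglongrightarrow> 0" "\<And>n. AE w in \<mu>S3. \<bar>\<xi> n w - v w\<bar> \<le> B n"
  shows "L2_tendsto \<mu>S3 (\<lambda>n w. \<xi> n w * F n w) (\<lambda>w. v w * f w) sequentially"
proof -
  have d: "(\<lambda>w. (\<xi> n w - v w) * F n w) \<in> L2 \<mu>S3" for n
    by (rule L2_bounded_mult[OF _ \<xi>(3) F(2)]) (use \<xi>(1) v(1) in simp)
  have "L2_tendsto \<mu>S3 (\<lambda>n w. (\<xi> n w - v w) * F n w) (\<lambda>w. 0) sequentially"
    unfolding L2_tendsto_real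
  proof (rule Lim_null_comparison)
    show "\<forall>\<^sub>F n in sequentially. norm (LINT w|\<mu>S3. ((\<xi> n w - v w) * F n w - 0)\<^sup>2) \<le> (B n)\<^sup>2 * ip (F n) (F n)"
    proof (rule always_eventually, rule allI)
      fix n
      have "(LINT w|\<mu>S3. ((\<xi> n w - v w) * F n w)\<^sup>2) \<le> (LINT w|\<mu>S3. (B n)\<^sup>2 * (F n w)\<^sup>2)"
      proof (rule integral_mono_AE)
        show "AE w in \<mu>S3. ((\<xi> n w - v w) * F n w)\<^sup>2 \<le> (B n)\<^sup>2 * (F n w)\<^sup>2"
          using \<xi>(3)[of n]
        proof eventually_elim
          case (elim w)
          then have "(\<xi> n w - v w)\<^sup>2 \<le> (B n)\<^sup>2" by (rule abs_le_imp_square_le)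
          then show ?case by (simp add: power_mult_distrib mult_right_mono)
        qed
      qed (use L2_integrable_sq[OF d] L2_integrable_sq[OF F(2)] in simp_all)
      then show "norm (LINT w|\<mu>S3. ((\<xi> n w - v w) * F n w - 0)\<^sup>2) \<le> (B n)\<^sup>2 * ip (F n) (F n)"
        by (simp add: ip_def power2_eq_square[of "F n _"])
    qed
    have "(\<lambda>n. (B n)\<^sup>2 * ip (F n) (F n)) \<longlonglongrightarrow> 0\<^sup>2 * ip f f"
      by (intro tendsto_intros \<xi>(2) ip_tendsto F f)
    then show "(\<lambda>n. (B n)\<^sup>2 * ip (F n) (F n)) \<longlonglongrightarrow> 0" by simp
  qed
  then have "L2_tendsto \<mu>S3 (\<lambda>n w. (\<xi> n w - v w) * F n w + v w * F n w) (\<lambda>w. 0 + v w * f w) sequentially"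
    by (intro L2_tendsto_add L2_tendsto_bounded_mult[OF F(1) _ f v] always_eventually allI d L2_zero F(2)
        L2_bounded_mult[OF v] f)
  then show ?thesis by (simp add: algebra_simps)
qed

lemma strong_mult:
  assumes u: "strong i u u'" and v: "strong i v v'"
  shows "strong i (\<lambda>w. u w * v w) (\<lambda>w. v w * u' w + u w * v' w)"
proof -
  obtain \<psi> B where \<psi>: "\<And>n::nat. \<psi> n \<in> smooth_S3" "B \<longlonglongrightarrow> 0" "\<And>n. AE w in \<mu>S3. \<bar>\<psi> n w - u w\<bar> \<le> B n"
    "L2_tendsto \<mu>S3 (\<lambda>n. frame_deriv i (\<psi> n)) u' sequentially"
    using u by (rule strongE) blast
  obtain \<xi> C where \<xi>: "\<And>n::nat. \<xi> n \<in> smooth_S3" "C \<longlonglongrightarrow> 0" "\<And>n. AE w in \<mu>S3. \<bar>\<xi> n w - v w\<bar> \<le> C n"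
    "L2_tendsto \<mu>S3 (\<lambda>n. frame_deriv i (\<xi> n)) v' sequentially"
    using v by (rule strongE) blast
  obtain K where K: "K \<ge> 0" "AE w in \<mu>S3. \<bar>u w\<bar> \<le> K" using strong_bounded[OF u] by blast
  obtain L where L: "L \<ge> 0" "AE w in \<mu>S3. \<bar>v w\<bar> \<le> L" using strong_bounded[OF v] by blast
  note um = strongD(1)[OF u] and vm = strongD(1)[OF v] and u'L = strongD(2)[OF u] and v'L = strongD(2)[OF v]
  note sm = L2_measurable[OF smooth_S3_L2]
  show ?thesis
    unfolding strong_def
  proof (intro conjI exI[of _ "\<lambda>n w. \<psi> n w * \<xi> n w"] exI[of _ "\<lambda>n. \<bar>B n\<bar> * (L + \<bar>C n\<bar>) + K * \<bar>C n\<bar>"] allI)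
    show "(\<lambda>w. u w * v w) \<in> borel_measurable \<mu>S3" using um vm by simp
    show "(\<lambda>w. v w * u' w + u w * v' w) \<in> L2 \<mu>S3"
      by (intro L2_add L2_bounded_mult[OF vm L(2)] L2_bounded_mult[OF um K(2)] u'L v'L)
    show "(\<lambda>w. \<psi> n w * \<xi> n w) \<in> smooth_S3" for n by (intro smooth_S3_mult \<psi> \<xi>)
    have "(\<lambda>n. \<bar>B n\<bar> * (L + \<bar>C n\<bar>) + K * \<bar>C n\<bar>) \<longlonglongrightarrow> \<bar>0\<bar> * (L + \<bar>0\<bar>) + K * \<bar>0\<bar>"
      by (intro tendsto_intros \<psi>(2) \<xi>(2))
    then show "(\<lambda>n. \<bar>B n\<bar> * (L + \<bar>C n\<bar>) + K * \<bar>C n\<bar>) \<longlonglongrightarrow> 0" by simp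
    show "AE w in \<mu>S3. \<bar>\<psi> n w * \<xi> n w - u w * v w\<bar> \<le> \<bar>B n\<bar> * (L + \<bar>C n\<bar>) + K * \<bar>C n\<bar>" for n
      using \<psi>(3)[of n] \<xi>(3)[of n] K(2) L(2)
    proof eventually_elim
      case (elim w)
      have "\<bar>\<psi> n w * \<xi> n w - u w * v w\<bar> = \<bar>(\<psi> n w - u w) * \<xi> n w + u w * (\<xi> n w - v w)\<bar>"
        by (simp add: algebra_simps)
      also have "\<dots> \<le> \<bar>(\<psi> n w - u w) * \<xi> n w\<bar> + \<bar>u w * (\<xi> n w - v w)\<bar>" by (rule abs_triangle_ineq)
      also have "\<dots> \<le> \<bar>B n\<bar> * (L + \<bar>C n\<bar>) + K * \<bar>C n\<bar>"
        unfolding abs_mult using elim K(1) by (intro add_mono mult_mono) linarith+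
      finally show ?case .
    qed
    have "L2_tendsto \<mu>S3 (\<lambda>n w. \<xi> n w * frame_deriv i (\<psi> n) w + \<psi> n w * frame_deriv i (\<xi> n) w)
        (\<lambda>w. v w * u' w + u w * v' w) sequentially"
    proof (rule L2_tendsto_add)
      show "L2_tendsto \<mu>S3 (\<lambda>n w. \<xi> n w * frame_deriv i (\<psi> n) w) (\<lambda>w. v w * u' w) sequentially"
        by (rule L2_tendsto_uniform_mult[OF \<psi>(4) smooth_S3_L2[OF smooth_S3_frame_deriv[OF \<psi>(1)]] u'L vm L(2) sm[OF \<xi>(1)] \<xi>(2,3)])
      show "L2_tendsto \<mu>S3 (\<lambda>n w. \<psi> n w * frame_deriv i (\<xi> n) w) (\<lambda>w. u w * v' w) sequentially"
        by (rule L2_tendsto_uniform_mult[OF \<xi>(4) smooth_S3_L2[OF smooth_S3_frame_deriv[OF \<xi>(1)]] v'L um K(2) sm[OF \<psi>(1)] \<psi>(2,3)])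
      show "(\<lambda>w. v w * u' w) \<in> L2 \<mu>S3" "(\<lambda>w. u w * v' w) \<in> L2 \<mu>S3"
        by (intro L2_bounded_mult[OF vm L(2)] L2_bounded_mult[OF um K(2)] u'L v'L)+
      show "\<forall>\<^sub>F n in sequentially. (\<lambda>w. \<xi> n w * frame_deriv i (\<psi> n) w) \<in> L2 \<mu>S3"
        by (intro always_eventually allI smooth_S3_L2 smooth_S3_mult smooth_S3_frame_deriv \<psi> \<xi>)
      show "\<forall>\<^sub>F n in sequentially. (\<lambda>w. \<psi> n w * frame_deriv i (\<xi> n) w) \<in> L2 \<mu>S3"
        by (intro always_eventually allI smooth_S3_L2 smooth_S3_mult smooth_S3_frame_deriv \<psi> \<xi>)
    qed
    moreover have "L2_tendsto \<mu>S3 (\<lambda>n. frame_deriv i (\<lambda>w. \<psi> n w * \<xi> n w)) (\<lambda>w. v w * u' w + u w * v' w) sequentially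
      \<longleftrightarrow> L2_tendsto \<mu>S3 (\<lambda>n w. \<xi> n w * frame_deriv i (\<psi> n) w + \<psi> n w * frame_deriv i (\<xi> n) w)
        (\<lambda>w. v w * u' w + u w * v' w) sequentially"
    proof -
      have "(LINT w|\<mu>S3. (frame_deriv i (\<lambda>w. \<psi> n w * \<xi> n w) w - (v w * u' w + u w * v' w))\<^sup>2)
        = (LINT w|\<mu>S3. (\<xi> n w * frame_deriv i (\<psi> n) w + \<psi> n w * frame_deriv i (\<xi> n) w - (v w * u' w + u w * v' w))\<^sup>2)" for n
        by (rule Bochner_Integration.integral_cong[OF refl])
          (simp only: space_\<mu>S3 frame_deriv_mult[OF \<psi>(1) \<xi>(1)] mult.commute[of "\<xi> n _"])
      then show ?thesis unfolding L2_tendsto_real by (simp only:)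
    qed
    ultimately show "L2_tendsto \<mu>S3 (\<lambda>n. frame_deriv i (\<lambda>w. \<psi> n w * \<xi> n w)) (\<lambda>w. v w * u' w + u w * v' w) sequentially"
      by (simp only:)
  qed
qed

section \<open>Invariant functions, brackets and the contact Laplacian\<close>

declare frame.simps [simp del]

abbreviation D :: "axis \<Rightarrow> (c2 \<Rightarrow> real) \<Rightarrow> c2 \<Rightarrow> real" where "D \<equiv> sobolev_deriv"

abbreviation inv\<^sub>E :: "(c2 \<Rightarrow> real) \<Rightarrow> bool" where "inv\<^sub>E f \<equiv> wd A1 f (\<lambda>_. 0)"

lemma sobolev_inv_iff: "f \<in> sobolev_inv k \<longleftrightarrow> sob k f \<and> inv\<^sub>E f"
  by (simp add: sobolev_inv_def sobolev_iff_sob E_invariant_iff_wd)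

lemma sob_1_iff: "sob 1 f \<longleftrightarrow> (\<forall>i. \<exists>g. wd i f g)"
  unfolding One_nat_def sob.simps using wdD(2) by blast

lemma sob_D: "sob k f \<Longrightarrow> 1 \<le> k \<Longrightarrow> wd i f (D i f)"
  using sob_sobolev_deriv(1)[of "k - 1" f] by simp

lemma sob_DD: "sob k f \<Longrightarrow> Suc m \<le> k \<Longrightarrow> sob m (D i f)"
  using sob_sobolev_deriv(2)[of m f] sob_mono[of "Suc m" k f] by simp

lemma inv_scale: "inv\<^sub>E f \<Longrightarrow> inv\<^sub>E (\<lambda>w. c * f w)"
  using wd_scale[of A1 f "\<lambda>_. 0" c] by simp

lemma inv_add: "inv\<^sub>E f \<Longrightarrow> inv\<^sub>E g \<Longrightarrow> inv\<^sub>E (\<lambda>w. f w + g w)"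
  using wd_add[of A1 f "\<lambda>_. 0" g "\<lambda>_. 0"] by simp

lemma inv_diff: "inv\<^sub>E f \<Longrightarrow> inv\<^sub>E g \<Longrightarrow> inv\<^sub>E (\<lambda>w. f w - g w)"
  using wd_diff[of A1 f "\<lambda>_. 0" g "\<lambda>_. 0"] by simp

lemma inv_limit:
  assumes "\<And>n::nat. inv\<^sub>E (F n)" "L2_tendsto \<mu>S3 F f sequentially" "f \<in> L2 \<mu>S3" shows "inv\<^sub>E f"
  by (rule wd_limit[OF assms(1,2) L2_tendsto_const assms(3) L2_zero])

lemma inv_cong_AE:
  assumes "inv\<^sub>E f" "AE w in \<mu>S3. f w = f' w" "f' \<in> borel_measurable \<mu>S3" shows "inv\<^sub>E f'"
  using wd_cong_fun_AE[OF assms(2) L2_measurable[OF wdD(1)[OF assms(1)]] assms(3)] assms(1) by simp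

lemma inv_deriv_cong_AE:
  assumes "wd A1 f g" "AE w in \<mu>S3. g w = 0" shows "inv\<^sub>E f"
  by (rule wd_cong_AE[OF assms(1) _ assms(2)]) (simp_all add: L2_measurable[OF wdD(1)[OF assms(1)]])

lemma inv_D_A1: "inv\<^sub>E f \<Longrightarrow> AE w in \<mu>S3. D A1 f w = 0"
  by (rule sobolev_deriv_AE)

lemma inv_smooth: "inv\<^sub>E f \<Longrightarrow> \<psi> \<in> smooth_S3 \<Longrightarrow> ip f (frame_deriv A1 \<psi>) = 0"
  using wd_integration_by_parts[OF _ wd_smooth, of A1 f "\<lambda>_. 0" \<psi>] by simp

lemma inv_proj:
  assumes "inv\<^sub>E f" shows "inv\<^sub>E (proj n f)"
proof -
  note fL = wdD(1)[OF assms]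
  have z: "polydeg n (proj n (\<lambda>_. 0))" by (rule polydeg_proj[OF L2_zero])
  have "ip (proj n (\<lambda>_. 0)) (proj n (\<lambda>_. 0)) = 0"
    using ip_proj[OF L2_zero z] by simp
  from ip_self_zero_AE[OF proj_L2[OF L2_zero] this] frame_deriv_proj[OF assms, of n]
  have "AE w in \<mu>S3. frame_deriv A1 (proj n f) w = 0" by eventually_elim simp
  from inv_deriv_cong_AE[OF wd_smooth[OF proj_smooth[OF fL]] this] show ?thesis .
qed

text \<open>An invariant function is determined by its inner products with smooth invariant functions,
  since the projections \<open>proj n\<close> of the difference are such functions.\<close>

lemma inv_eqI:
  assumes f: "inv\<^sub>E f" and g: "inv\<^sub>E g" and eq: "\<And>k. k \<in> smooth_S3 \<Longrightarrow> inv\<^sub>E k \<Longrightarrow> ip f k = ip g k"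
  shows "AE w in \<mu>S3. f w = g w"
proof -
  let ?h = "\<lambda>w. f w - g w"
  have hi: "inv\<^sub>E ?h" by (rule inv_diff[OF f g])
  note h = wdD(1)[OF hi] and fg = wdD(1)[OF f] wdD(1)[OF g]
  have "ip ?h (proj n ?h) = 0" for n
    using eq[OF proj_smooth[OF h] inv_proj[OF hi]]
    by (simp only: ip_diff_left[OF fg proj_L2[OF h]])
  moreover have "(\<lambda>n. ip ?h (proj n ?h)) \<longlonglongrightarrow> ip ?h ?h"
    by (rule ip_tendsto[OF L2_tendsto_const h h proj_tendsto[OF h] proj_L2[OF h] h])
  ultimately have "(\<lambda>n. 0) \<longlonglongrightarrow> ip ?h ?h" by (simp only:)
  then have "ip ?h ?h = 0" by (rule LIMSEQ_unique[OF _ tendsto_const])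
  from ip_self_zero_AE[OF h this] show ?thesis by simp
qed

lemma flow_invariant_inv:
  assumes u: "u \<in> L2 \<mu>S3" and inv: "\<And>t w. w \<in> S3 \<Longrightarrow> u (flow A1 t w) = u w"
  shows "inv\<^sub>E u"
proof (rule wdI[OF u L2_zero])
  fix p :: "c2 \<Rightarrow> real" assume "real_polynomial_function p"
  note s = real_polynomial_smooth_S3[OF this]
  note sL = smooth_S3_L2[OF s]
  obtain B where B: "\<And>w. w \<in> S3 \<Longrightarrow> \<bar>frame_deriv A1 p w\<bar> \<le> B"
    using smooth_S3_bounded[OF smooth_S3_frame_deriv[OF s], of A1] by blast
  let ?s = "\<lambda>n w. (p (flow A1 (1 / real (Suc n)) w) - p w) * real (Suc n)"
  have mf: "(\<lambda>w. p (flow A1 t w)) \<in> borel_measurable \<mu>S3" for t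
    using measurable_compose[OF isometry_measurable_\<mu>S3[OF flow_linear norm_flow] L2_measurable[OF sL]] .
  have m: "?s n \<in> borel_measurable \<mu>S3" for n
    by (intro borel_measurable_times borel_measurable_diff mf L2_measurable[OF sL] borel_measurable_const)
  have lim: "(\<lambda>n. ?s n w) \<longlonglongrightarrow> frame_deriv A1 p w" if w: "w \<in> S3" for w
  proof -
    note d = difference_quotient_tendsto[OF smooth_S3_flow[OF s w, of A1 0]]
    show ?thesis by (rule d[unfolded flow_zero])
  qed
  have bd: "\<bar>?s n w\<bar> \<le> B" if w: "w \<in> S3" for n w
  proof -
    have "\<bar>frame_deriv A1 p (flow A1 t w)\<bar> \<le> B" for t using B[of "flow A1 t w"] w by simp
    note d = difference_quotient_bound[OF smooth_S3_flow[OF s w] this]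
    show ?thesis by (rule d[unfolded flow_zero])
  qed
  have dom: "L2_tendsto \<mu>S3 ?s (frame_deriv A1 p) sequentially" "?s n \<in> L2 \<mu>S3" for n
  proof -
    have h: "(\<lambda>_. B) \<in> L2 \<mu>S3" by (rule smooth_S3_L2) simp
    have b: "\<bar>?s n x\<bar> \<le> \<bar>B\<bar>" if "x \<in> space \<mu>S3" for n x
      using bd[OF that[unfolded space_\<mu>S3]] by (rule order_trans) simp
    have l: "(\<lambda>n. ?s n x) \<longlonglongrightarrow> frame_deriv A1 p x" if "x \<in> space \<mu>S3" for x
      by (rule lim[OF that[unfolded space_\<mu>S3]])
    show "L2_tendsto \<mu>S3 ?s (frame_deriv A1 p) sequentially"
      by (rule L2_tendsto_dominated(1)[OF m smooth_S3_L2[OF smooth_S3_frame_deriv[OF s]] h l b])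
    show "?s n \<in> L2 \<mu>S3"
      by (rule L2_tendsto_dominated(2)[OF m smooth_S3_L2[OF smooth_S3_frame_deriv[OF s]] h l b])
  qed
  have "ip u (\<lambda>w. p (flow A1 t w)) = ip u p" for t
  proof -
    have "ip u (\<lambda>w. p (flow A1 t w)) = (LINT w|\<mu>S3. u (flow A1 t w) * p (flow A1 t w))"
      unfolding ip_def by (rule Bochner_Integration.integral_cong[OF refl]) (simp only: inv space_\<mu>S3)
    also have "\<dots> = ip u p"
      unfolding ip_def using L2_measurable[OF u] L2_measurable[OF sL]
      by (intro integral_\<mu>S3_isometry[OF flow_linear norm_flow, where h = "\<lambda>w. u w * p w"]) simp
    finally show ?thesis .
  qed
  moreover have "(\<lambda>w. p (flow A1 t w)) \<in> L2 \<mu>S3" for t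
  proof -
    obtain C where "\<forall>w\<in>S3. \<bar>p w\<bar> \<le> C" using smooth_S3_bounded[OF s] by blast
    then show ?thesis by (intro \<mu>S3.L2_bounded[OF mf, of _ C] AE_I2) simp
  qed
  ultimately have "ip u (\<lambda>w. p (flow A1 t w) - p w) = 0" for t
    by (simp only: ip_diff_right[OF _ sL u] diff_self)
  then have z: "ip u (?s n) = 0" for n
    using ip_scale_right[of u "real (Suc n)" "\<lambda>w. p (flow A1 (1 / real (Suc n)) w) - p w"]
    by (simp only: mult.commute[of "real (Suc n)"] mult_zero_left)
  have "(\<lambda>n. ip u (?s n)) \<longlonglongrightarrow> ip u (frame_deriv A1 p)"
    by (rule ip_tendsto[OF L2_tendsto_const u u dom smooth_S3_L2[OF smooth_S3_frame_deriv[OF s]]])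
  then have "(\<lambda>n. 0) \<longlonglongrightarrow> ip u (frame_deriv A1 p)" unfolding z .
  then have "ip u (frame_deriv A1 p) = 0" by (rule LIMSEQ_unique[OF _ tendsto_const])
  then show "ip u (frame_deriv A1 p) = - ip (\<lambda>_. 0) p" by simp
qed

lemma flow_A1: "flow A1 t w = (cis t * fst w, cis t * snd w)"
  by (simp add: flow_def frame.simps prod_eq_iff complex_eq_iff)

lemma hopf_flow [simp]: "hopf (flow A1 t w) = hopf w"
proof -
  have "cis t * a * cnj (cis t * b) = a * cnj b" for a b
  proof -
    have "cis t * cnj (cis t) = 1" by (simp add: cis_cnj cis_mult)
    then show ?thesis by (metis (no_types) complex_cnj_mult mult.assoc mult.commute mult_1)
  qed
  then show ?thesis by (simp add: hopf_def flow_A1 norm_mult)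
qed

lemma inv_hopf: "u \<circ> hopf \<in> L2 \<mu>S3 \<Longrightarrow> inv\<^sub>E (u \<circ> hopf)"
  by (rule flow_invariant_inv) simp_all

text \<open>The flow of \<open>E\<close> rotates the horizontal frame.\<close>

lemma inv_horizontal:
  assumes f: "sob 2 f" and inv: "inv\<^sub>E f"
  shows "wd A1 (D A2 f) (\<lambda>w. -2 * D A3 f w)" "wd A1 (D A3 f) (\<lambda>w. 2 * D A2 f w)"
    "AE w in \<mu>S3. D A2 (D A3 f) w = D A3 (D A2 f) w"
proof -
  have d: "wd i f (D i f)" "sob 1 (D i f)" for i
    using sob_D[OF f] sob_DD[OF f, of 1] by auto
  have dd: "wd i (D j f) (D i (D j f))" for i j by (rule sob_D[OF d(2)]) simp
  have m: "(\<lambda>w. c * D i f w) \<in> borel_measurable \<mu>S3" for c i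
    by (rule L2_measurable[OF L2_scale[OF wdD(2)[OF d(1)]]])
  have "AE w in \<mu>S3. D A1 (D A2 f) w - 0 = -2 * D A3 f w"
    by (rule wd_commutator[OF frame_commutators(1) d(1) dd inv wd_const d(1)])
  then show "wd A1 (D A2 f) (\<lambda>w. -2 * D A3 f w)"
    by (intro wd_cong_AE[OF dd[where i = A1 and j = A2]] m L2_measurable[OF wdD(2)[OF d(1)]]) simp_all
  have "AE w in \<mu>S3. 0 - D A1 (D A3 f) w = -2 * D A2 f w"
    by (rule wd_commutator[OF frame_commutators(3) inv wd_const d(1) dd d(1)])
  then show "wd A1 (D A3 f) (\<lambda>w. 2 * D A2 f w)"
    by (intro wd_cong_AE[OF dd[where i = A1 and j = A3]] m L2_measurable[OF wdD(2)[OF d(1)]]) simp_all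
  have "AE w in \<mu>S3. D A2 (D A3 f) w - D A3 (D A2 f) w = -2 * 0"
    by (rule wd_commutator[OF frame_commutators(2) d(1) dd d(1) dd inv])
  then show "AE w in \<mu>S3. D A2 (D A3 f) w = D A3 (D A2 f) w" by eventually_elim simp
qed

lemma S\<theta>_components:
  assumes "w \<in> S3"
  shows "S\<theta> f w \<bullet> frame A1 w = f w" "S\<theta> f w \<bullet> frame A2 w = - (D A3 f w / 2)"
    "S\<theta> f w \<bullet> frame A3 w = D A2 f w / 2"
  by (simp_all add: S\<theta>_def inner_add_left inner_diff_left frame_orthonormal(1)[OF assms])

lemma bracket_eq:
  assumes "w \<in> S3"
  shows "bracket f g w = f w * D A1 g w - D A3 f w / 2 * D A2 g w + D A2 f w / 2 * D A3 g w"
  unfolding bracket_def field_deriv_def S\<theta>_components[OF assms] by simp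

text \<open>The bracket without the vertical term \<open>f E g\<close>, which vanishes for invariant \<open>g\<close>.\<close>

definition horizontal_bracket :: "(c2 \<Rightarrow> real) \<Rightarrow> (c2 \<Rightarrow> real) \<Rightarrow> c2 \<Rightarrow> real" where
  "horizontal_bracket f g w = (D A2 f w * D A3 g w + (-1) * (D A3 f w * D A2 g w)) * (1/2)"

lemma bracket_horizontal:
  "w \<in> S3 \<Longrightarrow> bracket f g w = f w * D A1 g w + horizontal_bracket f g w"
  by (simp add: bracket_eq horizontal_bracket_def field_simps)

lemma bracket_horizontal_AE:
  assumes "inv\<^sub>E g" shows "AE w in \<mu>S3. bracket f g w = horizontal_bracket f g w"
  using inv_D_A1[OF assms] AE_space
  by eventually_elim (simp add: bracket_horizontal)

lemma sob4_strong:
  assumes "sob 4 f" shows "strong i f (D i f)" "strong i (D j f) (D i (D j f))"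
proof -
  show "strong i f (D i f)" by (rule strong_sobolev[OF sob_mono[OF _ assms]]) simp
  show "strong i (D j f) (D i (D j f))" by (rule strong_sobolev[OF sob_DD[OF assms]]) simp
qed

lemma horizontal_bracket_L2:
  assumes f: "sob 4 f" and g: "sob 1 g"
  shows "horizontal_bracket f g \<in> L2 \<mu>S3"
proof -
  have "(\<lambda>w. 1/2 * (D A2 f w * D A3 g w + (-1) * (D A3 f w * D A2 g w))) \<in> L2 \<mu>S3"
    by (intro L2_scale L2_add strong_mult_L2[OF sob4_strong(2)[OF f, of A1]] wdD(2)[OF sob_D[OF g]]) simp_all
  then show ?thesis unfolding horizontal_bracket_def[abs_def] by (simp only: mult.commute[of "1/2"])
qed

lemma bracket_L2:
  assumes f: "sob 4 f" and g: "sob 1 g"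
  shows "bracket f g \<in> L2 \<mu>S3"
proof -
  have "(\<lambda>w. f w * D A1 g w + horizontal_bracket f g w) \<in> L2 \<mu>S3"
    by (intro L2_add strong_mult_L2[OF sob4_strong(1)[OF f, of A1]] wdD(2)[OF sob_D[OF g]] horizontal_bracket_L2 f g) simp
  moreover have "bracket f g \<in> L2 \<mu>S3 \<longleftrightarrow> (\<lambda>w. f w * D A1 g w + horizontal_bracket f g w) \<in> L2 \<mu>S3"
    by (rule L2_\<mu>S3_cong) (rule bracket_horizontal)
  ultimately show ?thesis by blast
qed

lemma ip_mult_left: "ip (\<lambda>w. u w * f w) g = ip f (\<lambda>w. u w * g w)"
  unfolding ip_def by (simp only: mult_ac)

text \<open>The cocycle in terms of the bracket: \<open>\<integral> \<phi> {f,g} = - \<integral> {f,\<phi>} g\<close>, because \<open>S\<^sub>\<theta> f\<close> is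
  divergence free.\<close>

lemma bracket_integration_by_parts:
  assumes f: "sob 4 f" "inv\<^sub>E f" and g: "sob 4 g" "inv\<^sub>E g" and \<phi>: "sob 1 \<phi>"
  shows "ip \<phi> (bracket f g) = - ip (bracket f \<phi>) g"
proof -
  note sf = sob4_strong[OF f(1)] and sg = sob4_strong[OF g(1)]
  have d\<phi>: "wd i \<phi> (D i \<phi>)" for i by (rule sob_D[OF \<phi>]) simp
  note \<phi>L = wdD(1)[OF d\<phi>] and d\<phi>L = wdD(2)[OF d\<phi>]
  note gL = sob_L2[OF g(1)]
  let ?a = "D A2 f" and ?b = "D A3 f"
  let ?u3 = "\<lambda>w. ?a w * D A3 g w + g w * D A3 ?a w" and ?u2 = "\<lambda>w. ?b w * D A2 g w + g w * D A2 ?b w"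
  note w3 = strong_wd[OF strong_mult[OF sg(1) sf(2)], of A3 A2] and w2 = strong_wd[OF strong_mult[OF sg(1) sf(2)], of A2 A3]
  note L3 = wdD(2)[OF w3] and L2' = wdD(2)[OF w2]
  have f2: "sob 2 f" by (rule sob_mono[OF _ f(1)]) simp
  have g1: "sob 1 g" by (rule sob_mono[OF _ g(1)]) simp
  note brL = bracket_L2[OF f(1) g1]
  have "AE w in \<mu>S3. 2 * bracket f g w = ?u3 w - ?u2 w"
    using bracket_horizontal_AE[OF g(2), of f] inv_horizontal(3)[OF f2 f(2)]
    by eventually_elim (simp add: horizontal_bracket_def)
  then have "ip (\<lambda>w. 2 * bracket f g w) \<phi> = ip (\<lambda>w. ?u3 w - ?u2 w) \<phi>"
    by (rule ip_cong_AE[OF _ L2_scale[OF brL] L2_diff[OF L3 L2'] \<phi>L])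
  then have "2 * ip \<phi> (bracket f g) = ip \<phi> ?u3 - ip \<phi> ?u2"
    by (simp only: ip_scale_left ip_diff_left[OF L3 L2' \<phi>L] ip_commute[of \<phi>])
  moreover have "ip \<phi> ?u3 = - ip (D A3 \<phi>) (\<lambda>w. g w * ?a w)"
    by (rule wd_integration_by_parts[OF d\<phi> w3])
  moreover have "ip \<phi> ?u2 = - ip (D A2 \<phi>) (\<lambda>w. g w * ?b w)"
    by (rule wd_integration_by_parts[OF d\<phi> w2])
  ultimately have 1: "2 * ip \<phi> (bracket f g) = ip (D A2 \<phi>) (\<lambda>w. g w * ?b w) - ip (D A3 \<phi>) (\<lambda>w. g w * ?a w)"
    by simp
  have z: "ip (D A1 \<phi>) (\<lambda>w. f w * g w) = 0"
  proof -
    note w1 = strong_wd[OF strong_mult[OF sf(1) sg(1)], of A1]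
    have "AE w in \<mu>S3. g w * D A1 f w + f w * D A1 g w = 0"
      using inv_D_A1[OF f(2)] inv_D_A1[OF g(2)] by eventually_elim simp
    from wd_integration_by_parts[OF d\<phi> inv_deriv_cong_AE[OF w1 this]] show ?thesis by simp
  qed
  have La: "(\<lambda>w. ?a w * D A3 \<phi> w) \<in> L2 \<mu>S3" and Lb: "(\<lambda>w. ?b w * D A2 \<phi> w) \<in> L2 \<mu>S3"
    and Lf: "(\<lambda>w. f w * D A1 \<phi> w) \<in> L2 \<mu>S3"
    by (intro strong_mult_L2[OF sf(2)[of A1]] strong_mult_L2[OF sf(1)[of A1]] d\<phi>L)+
  note Lb' = L2_scale[OF Lb, of "-1"]
  note Lh = L2_scale[OF L2_add[OF La Lb'], of "1/2"]
  have "ip (bracket f \<phi>) g = ip (\<lambda>w. f w * D A1 \<phi> w + 1/2 * (?a w * D A3 \<phi> w + (-1) * (?b w * D A2 \<phi> w))) g"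
    by (rule ip_cong[OF _ refl]) (simp only: bracket_horizontal horizontal_bracket_def mult.commute[of _ "1/2"])
  also have "\<dots> = ip (\<lambda>w. f w * D A1 \<phi> w) g + 1/2 * (ip (\<lambda>w. ?a w * D A3 \<phi> w) g + (-1) * ip (\<lambda>w. ?b w * D A2 \<phi> w) g)"
    by (simp only: ip_add_left[OF Lf Lh gL] ip_scale_left ip_add_left[OF La Lb' gL])
  also have "ip (\<lambda>w. f w * D A1 \<phi> w) g = 0" unfolding ip_mult_left by (rule z)
  also have "ip (\<lambda>w. ?a w * D A3 \<phi> w) g = ip (D A3 \<phi>) (\<lambda>w. g w * ?a w)"
    unfolding ip_mult_left by (simp only: mult.commute[of "g _"])
  also have "ip (\<lambda>w. ?b w * D A2 \<phi> w) g = ip (D A2 \<phi>) (\<lambda>w. g w * ?b w)"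
    unfolding ip_mult_left by (simp only: mult.commute[of "g _"])
  finally show ?thesis using 1 by simp
qed

lemma horizontal_bracket_wd:
  assumes f: "sob 4 f" and g: "sob 4 g"
  shows "wd i (horizontal_bracket f g) (\<lambda>w. 1/2 * ((D A3 g w * D i (D A2 f) w + D A2 f w * D i (D A3 g) w)
    + (-1) * (D A2 g w * D i (D A3 f) w + D A3 f w * D i (D A2 g) w)))"
proof -
  note sf = sob4_strong[OF f] and sg = sob4_strong[OF g]
  have "wd i (\<lambda>w. 1/2 * (D A2 f w * D A3 g w + (-1) * (D A3 f w * D A2 g w)))
    (\<lambda>w. 1/2 * ((D A3 g w * D i (D A2 f) w + D A2 f w * D i (D A3 g) w)
    + (-1) * (D A2 g w * D i (D A3 f) w + D A3 f w * D i (D A2 g) w)))"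
    by (intro wd_scale wd_add strong_wd[OF strong_mult[OF sf(2) sg(2)]])
  then show ?thesis unfolding horizontal_bracket_def[abs_def] by (simp only: mult.commute[of _ "1/2"])
qed

lemma bracket_sob_1:
  assumes f: "sob 4 f" and g: "sob 4 g" "inv\<^sub>E g" shows "sob 1 (bracket f g)"
proof -
  have g1: "sob 1 g" by (rule sob_mono[OF _ g(1)]) simp
  have "sob 1 (horizontal_bracket f g)" unfolding sob_1_iff using horizontal_bracket_wd[OF f g(1)] by blast
  moreover have "AE w in \<mu>S3. horizontal_bracket f g w = bracket f g w"
    using bracket_horizontal_AE[OF g(2), of f] by eventually_elim simp
  ultimately show ?thesis by (rule sob_cong_AE) (rule L2_measurable[OF bracket_L2[OF f g1]])
qed

text \<open>For regular \<open>m\<close> this holds because \<open>E\<close> rotates the horizontal derivatives of both functions in the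
  same way; in general \<open>m\<close> is the limit of its invariant projections.\<close>

lemma inv_bracket:
  assumes f: "sob 4 f" "inv\<^sub>E f" and m: "sob 1 m" "inv\<^sub>E m" shows "inv\<^sub>E (bracket f m)"
proof -
  note mL = wdD(1)[OF m(2)]
  note brL = bracket_L2[OF f(1) m(1)]
  have dm: "wd i m (D i m)" for i by (rule sob_D[OF m(1)]) simp
  have f2: "sob 2 f" by (rule sob_mono[OF _ f(1)]) simp
  have inv_smooth_case: "inv\<^sub>E (horizontal_bracket f g)" if g: "sob 4 g" "inv\<^sub>E g" for g
  proof (rule inv_deriv_cong_AE[OF horizontal_bracket_wd[OF f(1) g(1), of A1]])
    have g2: "sob 2 g" by (rule sob_mono[OF _ g(1)]) simp
    show "AE w in \<mu>S3. 1/2 * ((D A3 g w * D A1 (D A2 f) w + D A2 f w * D A1 (D A3 g) w)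
      + (-1) * (D A2 g w * D A1 (D A3 f) w + D A3 f w * D A1 (D A2 g) w)) = 0"
      using sobolev_deriv_AE[OF inv_horizontal(1)[OF f2 f(2)]] sobolev_deriv_AE[OF inv_horizontal(2)[OF f2 f(2)]]
        sobolev_deriv_AE[OF inv_horizontal(1)[OF g2 g(2)]] sobolev_deriv_AE[OF inv_horizontal(2)[OF g2 g(2)]]
      by eventually_elim simp
  qed
  have ps: "proj n m \<in> smooth_S3" for n by (rule proj_smooth[OF mL])
  have pd: "wd i (proj n m) (D i (proj n m))" for n i by (rule wd_sobolev_deriv[OF wd_smooth[OF ps]])
  have lim: "L2_tendsto \<mu>S3 (\<lambda>n. D i (proj n m)) (D i m) sequentially" for i
  proof -
    have "L2_tendsto \<mu>S3 (\<lambda>n. D i (proj n m)) (D i m) sequentially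
      \<longleftrightarrow> L2_tendsto \<mu>S3 (\<lambda>n. frame_deriv i (proj n m)) (D i m) sequentially"
      by (rule L2_tendsto_cong_AE)
        (simp_all add: sobolev_deriv_AE[OF wd_smooth[OF ps]] L2_measurable[OF wdD(2)[OF pd]] L2_measurable[OF wdD(2)[OF dm]]
          L2_measurable[OF smooth_S3_L2[OF smooth_S3_frame_deriv[OF ps]]])
    then show ?thesis using frame_deriv_proj_tendsto[OF dm] by simp
  qed
  obtain K where K: "\<And>j. AE w in \<mu>S3. \<bar>D j f w\<bar> \<le> K j"
    using strong_bounded[OF sob4_strong(2)[OF f(1)]] by metis
  have mul: "L2_tendsto \<mu>S3 (\<lambda>n w. D j f w * D i (proj n m) w) (\<lambda>w. D j f w * D i m w) sequentially" for i j
    by (rule L2_tendsto_bounded_mult[OF lim _ wdD(2)[OF dm] strongD(1)[OF sob4_strong(2)[OF f(1)]] K])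
      (simp add: wdD(2)[OF pd])
  have Lj: "(\<lambda>w. D j f w * D i (proj n m) w) \<in> L2 \<mu>S3" "(\<lambda>w. D j f w * D i m w) \<in> L2 \<mu>S3" for i j n
    by (intro strong_mult_L2[OF sob4_strong(2)[OF f(1), of A1]] wdD(2)[OF pd] wdD(2)[OF dm])+
  have "L2_tendsto \<mu>S3 (\<lambda>n w. 1/2 * (D A2 f w * D A3 (proj n m) w + (-1) * (D A3 f w * D A2 (proj n m) w)))
    (\<lambda>w. 1/2 * (D A2 f w * D A3 m w + (-1) * (D A3 f w * D A2 m w))) sequentially"
    by (intro L2_tendsto_scale L2_tendsto_add always_eventually allI L2_scale Lj mul)
  then have "L2_tendsto \<mu>S3 (\<lambda>n. horizontal_bracket f (proj n m)) (horizontal_bracket f m) sequentially"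
    unfolding horizontal_bracket_def[abs_def] by (simp only: mult.commute[of _ "1/2"])
  from inv_limit[OF inv_smooth_case[OF sob_smooth[OF ps] inv_proj[OF m(2)]] this horizontal_bracket_L2[OF f(1) m(1)]]
  have "inv\<^sub>E (horizontal_bracket f m)" .
  moreover have "AE w in \<mu>S3. horizontal_bracket f m w = bracket f m w"
    using bracket_horizontal_AE[OF m(2), of f] by eventually_elim simp
  ultimately show ?thesis by (rule inv_cong_AE) (rule L2_measurable[OF brL])
qed

lemma strong_smooth:
  assumes "\<psi> \<in> smooth_S3" shows "strong i \<psi> (frame_deriv i \<psi>)"
  unfolding strong_def
  by (intro conjI exI[of _ "\<lambda>_. \<psi>"] exI[of _ "\<lambda>_. 0"])
    (simp_all add: assms smooth_S3_frame_deriv smooth_S3_L2 L2_measurable)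

lemma inv_mult:
  assumes u: "strong A1 u u'" "inv\<^sub>E u" and f: "inv\<^sub>E f" shows "inv\<^sub>E (\<lambda>w. u w * f w)"
proof -
  note fL = wdD(1)[OF f]
  obtain K where K: "AE w in \<mu>S3. \<bar>u w\<bar> \<le> K" using strong_bounded[OF u(1)] by blast
  note um = strongD(1)[OF u(1)]
  have "inv\<^sub>E (\<lambda>w. u w * proj n f w)" for n
  proof (rule inv_deriv_cong_AE[OF strong_wd[OF strong_mult[OF u(1) strong_smooth[OF proj_smooth[OF fL]]]]])
    show "AE w in \<mu>S3. proj n f w * u' w + u w * frame_deriv A1 (proj n f) w = 0"
      using wd_unique[OF strong_wd[OF u(1)] u(2)] wd_unique[OF wd_smooth[OF proj_smooth[OF fL]] inv_proj[OF f, of n]]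
      by eventually_elim simp
  qed
  moreover have "L2_tendsto \<mu>S3 (\<lambda>n w. u w * proj n f w) (\<lambda>w. u w * f w) sequentially"
    by (rule L2_tendsto_bounded_mult[OF proj_tendsto[OF fL] _ fL um K]) (simp add: proj_L2[OF fL])
  ultimately show ?thesis by (rule inv_limit) (rule L2_bounded_mult[OF um K fL])
qed

text \<open>The lift of the Laplacian of \<open>S\<^sup>2\<close>: the horizontal Laplacian of \<open>S\<^sup>3\<close>, with the factor \<open>1/4\<close> that comes
  from the factors \<open>1/2\<close> in \<open>S\<theta>\<close>.\<close>

definition lap :: "(c2 \<Rightarrow> real) \<Rightarrow> c2 \<Rightarrow> real" where
  "lap f w = 1/4 * (D A2 (D A2 f) w + D A3 (D A3 f) w)"

lemma lap_L2: "sob 2 f \<Longrightarrow> lap f \<in> L2 \<mu>S3"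
  unfolding lap_def[abs_def]
  by (intro L2_scale L2_add sob_L2[of 0] sob_DD[of 1] sob_DD[of 2]) simp_all

lemma lap_sob: "sob (Suc (Suc k)) f \<Longrightarrow> sob k (lap f)"
  unfolding lap_def[abs_def]
  by (intro sob_scale sob_add sob_DD[of "Suc k"] sob_DD[of "Suc (Suc k)"]) simp_all

lemma inv_lap:
  assumes f: "sob 2 f" and inv: "inv\<^sub>E f" shows "inv\<^sub>E (lap f)"
proof (rule wdI[OF lap_L2[OF f] L2_zero])
  have d: "wd i f (D i f)" "sob 1 (D i f)" for i
    using sob_D[OF f] sob_DD[OF f, of 1] by auto
  have dd: "wd i (D j f) (D i (D j f))" for i j by (rule sob_D[OF d(2)]) simp
  note dL = wdD(2)[OF d(1)] and ddL = wdD(2)[OF dd]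
  fix p :: "c2 \<Rightarrow> real" assume p: "real_polynomial_function p"
  note s = real_polynomial_smooth_S3[OF p]
  note s1 = smooth_S3_frame_deriv[OF s]
  note s2 = smooth_S3_frame_deriv[OF s1]
  note pL = smooth_S3_L2[OF s] and s1L = smooth_S3_L2[OF s1] and s2L = smooth_S3_L2[OF s2]
  have c12: "ip h (frame_deriv A2 (frame_deriv A1 p)) = ip h (frame_deriv A1 (frame_deriv A2 p)) + 2 * ip h (frame_deriv A3 p)"
    if h: "h \<in> L2 \<mu>S3" for h
  proof -
    have "ip h (frame_deriv A2 (frame_deriv A1 p)) = ip h (\<lambda>w. frame_deriv A1 (frame_deriv A2 p) w + 2 * frame_deriv A3 p w)"
      using frame_deriv_commutator_polynomial[OF frame_commutators(1) p] by (intro ip_cong refl) (simp add: algebra_simps)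
    then show ?thesis by (simp only: ip_add_right[OF s2L L2_scale[OF s1L] h] ip_scale_right)
  qed
  have c13: "ip h (frame_deriv A3 (frame_deriv A1 p)) = ip h (frame_deriv A1 (frame_deriv A3 p)) - 2 * ip h (frame_deriv A2 p)"
    if h: "h \<in> L2 \<mu>S3" for h
  proof -
    have "ip h (frame_deriv A3 (frame_deriv A1 p)) = ip h (\<lambda>w. frame_deriv A1 (frame_deriv A3 p) w - 2 * frame_deriv A2 p w)"
      using frame_deriv_commutator_polynomial[OF frame_commutators(3) p] by (intro ip_cong refl) (simp add: algebra_simps)
    then show ?thesis by (simp only: ip_diff_right[OF s2L L2_scale[OF s1L] h] ip_scale_right)
  qed
  note ibp = wd_integration_by_parts[OF _ wd_smooth]
  have "ip (D A2 (D A2 f)) (frame_deriv A1 p) = - ip (D A2 f) (frame_deriv A2 (frame_deriv A1 p))"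
    using ibp[OF dd s1, of A2 A2 A1] by simp
  also have "\<dots> = - ip (D A2 f) (frame_deriv A1 (frame_deriv A2 p)) - 2 * ip (D A2 f) (frame_deriv A3 p)"
    unfolding c12[OF dL] by simp
  also have "ip (D A2 f) (frame_deriv A1 (frame_deriv A2 p)) = 2 * ip (D A3 f) (frame_deriv A2 p)"
    using ibp[OF inv_horizontal(1)[OF f inv] s1, of A2] unfolding ip_scale_left by simp
  finally have 2: "ip (D A2 (D A2 f)) (frame_deriv A1 p) = - 2 * ip (D A3 f) (frame_deriv A2 p) - 2 * ip (D A2 f) (frame_deriv A3 p)"
    by simp
  have "ip (D A3 (D A3 f)) (frame_deriv A1 p) = - ip (D A3 f) (frame_deriv A3 (frame_deriv A1 p))"
    using ibp[OF dd s1, of A3 A3 A1] by simp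
  also have "\<dots> = - ip (D A3 f) (frame_deriv A1 (frame_deriv A3 p)) + 2 * ip (D A3 f) (frame_deriv A2 p)"
    unfolding c13[OF dL] by simp
  also have "ip (D A3 f) (frame_deriv A1 (frame_deriv A3 p)) = - 2 * ip (D A2 f) (frame_deriv A3 p)"
    using ibp[OF inv_horizontal(2)[OF f inv] s1, of A3] unfolding ip_scale_left by simp
  finally have 3: "ip (D A3 (D A3 f)) (frame_deriv A1 p) = 2 * ip (D A2 f) (frame_deriv A3 p) + 2 * ip (D A3 f) (frame_deriv A2 p)"
    by simp
  have "ip (lap f) (frame_deriv A1 p) = 1/4 * (ip (D A2 (D A2 f)) (frame_deriv A1 p) + ip (D A3 (D A3 f)) (frame_deriv A1 p))"
    unfolding lap_def[abs_def] ip_scale_left ip_add_left[OF ddL ddL s1L] by (rule refl)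
  then show "ip (lap f) (frame_deriv A1 p) = - ip (\<lambda>_. 0) p" unfolding 2 3 by simp
qed

definition contact_lap :: "(cr \<Rightarrow> real) \<Rightarrow> (c2 \<Rightarrow> real) \<Rightarrow> c2 \<Rightarrow> real" where
  "contact_lap \<rho> f w = (\<rho> (hopf w) * \<rho> (hopf w)) * f w - lap f w"

lemma strong_rho:
  assumes "sob 3 (\<rho> \<circ> hopf)"
  shows "\<exists>r'. strong i (\<lambda>w. \<rho> (hopf w) * \<rho> (hopf w)) r'" "inv\<^sub>E (\<lambda>w. \<rho> (hopf w) * \<rho> (hopf w))"
proof -
  have s: "strong i (\<lambda>w. \<rho> (hopf w)) (D i (\<rho> \<circ> hopf))" for i
    using strong_sobolev[OF assms] by (simp add: o_def)
  then show "\<exists>r'. strong i (\<lambda>w. \<rho> (hopf w) * \<rho> (hopf w)) r'" using strong_mult by blast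
  have "inv\<^sub>E (\<lambda>w. \<rho> (hopf w))" using inv_hopf[OF sob_L2[OF assms]] by (simp add: o_def)
  from inv_mult[OF s this this] show "inv\<^sub>E (\<lambda>w. \<rho> (hopf w) * \<rho> (hopf w))" .
qed

lemma contact_lap_L2:
  assumes "sob 3 (\<rho> \<circ> hopf)" "sob 2 f" shows "contact_lap \<rho> f \<in> L2 \<mu>S3"
proof -
  obtain r' where r: "strong A1 (\<lambda>w. \<rho> (hopf w) * \<rho> (hopf w)) r'" using strong_rho(1)[OF assms(1)] by blast
  show ?thesis unfolding contact_lap_def[abs_def]
    by (intro L2_diff strong_mult_L2[OF r] sob_L2[OF assms(2)] lap_L2 assms(2))
qed

lemma inv_contact_lap:
  assumes "sob 3 (\<rho> \<circ> hopf)" "sob 2 f" "inv\<^sub>E f" shows "inv\<^sub>E (contact_lap \<rho> f)"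
proof -
  obtain r' where r: "strong A1 (\<lambda>w. \<rho> (hopf w) * \<rho> (hopf w)) r'" using strong_rho(1)[OF assms(1)] by blast
  show ?thesis unfolding contact_lap_def[abs_def]
    by (intro inv_diff inv_mult[OF r strong_rho(2)[OF assms(1)]] inv_lap assms(2,3))
qed

lemma contact_lap_sob_1:
  assumes "sob 3 (\<rho> \<circ> hopf)" "sob 4 f" shows "sob 1 (contact_lap \<rho> f)"
  unfolding sob_1_iff
proof
  fix i
  obtain r' where r: "strong i (\<lambda>w. \<rho> (hopf w) * \<rho> (hopf w)) r'" using strong_rho(1)[OF assms(1)] by blast
  have "Suc (Suc 2) = (4::nat)" by simp
  then have "sob (Suc (Suc 2)) f" using assms(2) by (simp only:)
  then have "sob 2 (lap f)" by (rule lap_sob)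
  then have "wd i (lap f) (D i (lap f))" by (rule sob_D) simp
  from wd_diff[OF strong_wd[OF strong_mult[OF r sob4_strong(1)[OF assms(2)]]] this]
  show "\<exists>g. wd i (contact_lap \<rho> f) g" unfolding contact_lap_def[abs_def] by blast
qed

lemma metric_contact_lap:
  assumes \<rho>: "sob 3 (\<rho> \<circ> hopf)" and f: "sob 2 f" and k: "sob 1 k"
  shows "metric \<rho> (S\<theta> f) (S\<theta> k) = ip (contact_lap \<rho> f) k"
proof -
  have d: "wd i f (D i f)" "sob 1 (D i f)" for i
    using sob_D[OF f] sob_DD[OF f, of 1] by auto
  have dd: "wd i (D j f) (D i (D j f))" for i j by (rule sob_D[OF d(2)]) simp
  have dk: "wd i k (D i k)" for i by (rule sob_D[OF k]) simp
  note dL = wdD(2)[OF d(1)] and ddL = wdD(2)[OF dd] and dkL = wdD(2)[OF dk] and kL = sob_L2[OF k]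
  obtain r' where r: "strong A1 (\<lambda>w. \<rho> (hopf w) * \<rho> (hopf w)) r'" using strong_rho(1)[OF \<rho>] by blast
  let ?rf = "\<lambda>w. (\<rho> (hopf w) * \<rho> (hopf w)) * f w"
  have rfL: "?rf \<in> L2 \<mu>S3" by (rule strong_mult_L2[OF r sob_L2[OF f]])
  note int = L2_mult_integrable[OF rfL kL] L2_mult_integrable[OF dL dkL]
  have "metric \<rho> (S\<theta> f) (S\<theta> k) = (LINT w|\<mu>S3. ?rf w * k w + 1/4 * (D A2 f w * D A2 k w + D A3 f w * D A3 k w))"
    unfolding metric_def
  proof (rule Bochner_Integration.integral_cong[OF refl])
    fix w assume "w \<in> space \<mu>S3"
    then have w: "w \<in> S3" unfolding space_\<mu>S3 .
    show "inertia \<rho> (S\<theta> f) w \<bullet> S\<theta> k w = ?rf w * k w + 1/4 * (D A2 f w * D A2 k w + D A3 f w * D A3 k w)"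
      unfolding inertia_def inner_add_left inner_scaleR_left S\<theta>_components[OF w]
        inner_commute[of "frame _ _" "S\<theta> k w"]
      by (simp add: power2_eq_square algebra_simps)
  qed
  also have "\<dots> = ip ?rf k + 1/4 * (ip (D A2 f) (D A2 k) + ip (D A3 f) (D A3 k))"
    unfolding ip_def using int by simp
  also have "ip (D A2 f) (D A2 k) = - ip (D A2 (D A2 f)) k" by (rule wd_integration_by_parts[OF dd dk])
  also have "ip (D A3 f) (D A3 k) = - ip (D A3 (D A3 f)) k" by (rule wd_integration_by_parts[OF dd dk])
  also have "ip ?rf k + 1/4 * (- ip (D A2 (D A2 f)) k + - ip (D A3 (D A3 f)) k) = ip (contact_lap \<rho> f) k"
    unfolding contact_lap_def[abs_def] ip_diff_left[OF rfL lap_L2[OF f] kL]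
    unfolding lap_def[abs_def] ip_scale_left ip_add_left[OF ddL ddL kL] by (simp add: field_simps)
  finally show ?thesis .
qed

text \<open>Integration by parts turns \<open>metric \<rho> (S\<theta> f) (S\<theta> k)\<close> into the inner product of \<open>contact_lap \<rho> f\<close> with \<open>k\<close>,
  and an invariant function is determined by its inner products with invariant smooth functions.\<close>

lemma contact_laplacian_AE:
  assumes \<rho>: "sob 3 (\<rho> \<circ> hopf)" and f: "sob 2 f" "inv\<^sub>E f"
  shows "contact_laplacian s \<rho> f \<in> L2 \<mu>S3" "AE w in \<mu>S3. contact_laplacian s \<rho> f w = contact_lap \<rho> f w"
proof -
  let ?P = "\<lambda>m. m \<in> sobolev_inv 0 \<and> (\<forall>k\<in>sobolev_inv (s + 1). (LINT w|\<mu>S3. m w * k w) = metric \<rho> (S\<theta> f) (S\<theta> k))"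
  have me: "metric \<rho> (S\<theta> f) (S\<theta> k) = ip (contact_lap \<rho> f) k" if "sob (s + 1) k" for k
    by (rule metric_contact_lap[OF \<rho> f(1) sob_mono[OF _ that]]) simp
  have "?P (contact_lap \<rho> f)"
  proof (intro conjI ballI)
    show "contact_lap \<rho> f \<in> sobolev_inv 0"
      unfolding sobolev_inv_iff sob.simps(1) using contact_lap_L2[OF \<rho> f(1)] inv_contact_lap[OF \<rho> f] by blast
    fix k assume "k \<in> sobolev_inv (s + 1)"
    then have "sob (s + 1) k" unfolding sobolev_inv_iff by blast
    from me[OF this] show "(LINT w|\<mu>S3. contact_lap \<rho> f w * k w) = metric \<rho> (S\<theta> f) (S\<theta> k)"
      unfolding ip_def by (rule sym)
  qed
  then have P: "?P (contact_laplacian s \<rho> f)"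
    unfolding contact_laplacian_def S\<theta>_adj_def by (rule someI[of ?P])
  then have inv: "inv\<^sub>E (contact_laplacian s \<rho> f)" unfolding sobolev_inv_iff by blast
  then show "contact_laplacian s \<rho> f \<in> L2 \<mu>S3" by (rule wdD(1))
  show "AE w in \<mu>S3. contact_laplacian s \<rho> f w = contact_lap \<rho> f w"
  proof (rule inv_eqI[OF inv inv_contact_lap[OF \<rho> f]])
    fix k assume k: "k \<in> smooth_S3" "inv\<^sub>E k"
    then have "k \<in> sobolev_inv (s + 1)" unfolding sobolev_inv_iff using sob_smooth by blast
    then show "ip (contact_laplacian s \<rho> f) k = ip (contact_lap \<rho> f) k"
      using P me[OF sob_smooth[OF k(1)]] unfolding ip_def by metis
  qed
qed

section \<open>The Euler-Arnold equation\<close>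

lemma lap_linear:
  assumes p: "sob 2 p" and q: "sob 2 q"
  shows "AE w in \<mu>S3. lap (\<lambda>w. p w + c * q w) w = lap p w + c * lap q w"
proof -
  have d: "wd i h (D i h)" "wd i (D j h) (D i (D j h))" if "sob 2 h" for i j h
    using sob_D[OF that] sob_D[OF sob_DD[OF that, of 1]] by auto
  have *: "AE w in \<mu>S3. D i (D i (\<lambda>w. p w + c * q w)) w = D i (D i p) w + c * D i (D i q) w" for i
  proof -
    note w1 = wd_add[OF d(1)[OF p] wd_scale[OF d(1)[OF q]], of i c]
    note w2 = wd_add[OF d(2)[OF p] wd_scale[OF d(2)[OF q]], of i i c]
    have "D i (D i (\<lambda>w. p w + c * q w)) = D i (\<lambda>w. D i p w + c * D i q w)"
      by (rule sobolev_deriv_cong_AE[OF sobolev_deriv_AE[OF w1] L2_measurable[OF wdD(2)[OF wd_sobolev_deriv[OF w1]]]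
          L2_measurable[OF wdD(2)[OF w1]]])
    then show ?thesis using sobolev_deriv_AE[OF w2] by simp
  qed
  show ?thesis
    using *[of A2] *[of A3] by eventually_elim (simp add: lap_def algebra_simps)
qed

lemma contact_lap_linear:
  assumes "sob 2 p" "sob 2 q"
  shows "AE w in \<mu>S3. contact_lap \<rho> (\<lambda>w. p w + c * q w) w = contact_lap \<rho> p w + c * contact_lap \<rho> q w"
  using lap_linear[OF assms, of c] by eventually_elim (simp add: contact_lap_def algebra_simps)

lemma lap_cong_AE:
  assumes "AE w in \<mu>S3. p w = q w" "p \<in> L2 \<mu>S3" "q \<in> L2 \<mu>S3" shows "lap p = lap q"
  unfolding lap_def[abs_def] sobolev_deriv_cong_AE[OF assms(1) L2_measurable[OF assms(2)] L2_measurable[OF assms(3)]] by (rule refl)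

lemma contact_lap_cong_AE:
  assumes "AE w in \<mu>S3. p w = q w" "p \<in> L2 \<mu>S3" "q \<in> L2 \<mu>S3"
  shows "AE w in \<mu>S3. contact_lap \<rho> p w = contact_lap \<rho> q w"
  using assms(1) by eventually_elim (simp add: contact_lap_def lap_cong_AE[OF assms])

lemma S\<theta>_cong_AE:
  assumes "AE w in \<mu>S3. p w = q w" "p \<in> L2 \<mu>S3" "q \<in> L2 \<mu>S3" shows "AE w in \<mu>S3. S\<theta> p w = S\<theta> q w"
proof -
  have D: "D i p = D i q" for i
    by (rule sobolev_deriv_cong_AE[OF assms(1) L2_measurable[OF assms(2)] L2_measurable[OF assms(3)]])
  show ?thesis using assms(1) by eventually_elim (simp add: S\<theta>_def D)
qed

lemma S\<theta>_cong: 
  assumes "\<And>w. w \<in> S3 \<Longrightarrow> p w = q w" "w \<in> S3" shows "S\<theta> p w = S\<theta> q w"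
proof -
  have "D i p = D i q" for i by (rule sobolev_deriv_cong) (rule assms(1))
  then show ?thesis unfolding S\<theta>_def by (simp only: assms(1)[OF assms(2)])
qed

lemma S\<theta>_linear:
  assumes p: "sob 2 p" and q: "sob 2 q"
  shows "AE w in \<mu>S3. S\<theta> (\<lambda>w. p w + c * q w) w = S\<theta> p w + c *\<^sub>R S\<theta> q w"
proof -
  have d: "wd i h (D i h)" if "sob 2 h" for i h using sob_D[OF that] by simp
  have *: "AE w in \<mu>S3. D i (\<lambda>w. p w + c * q w) w = D i p w + c * D i q w" for i
    by (rule sobolev_deriv_AE[OF wd_add[OF d[OF p] wd_scale[OF d[OF q]]]])
  show ?thesis
    using *[of A2] *[of A3] by eventually_elim (simp add: S\<theta>_def algebra_simps add_divide_distrib)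
qed

lemma frame_continuous: "continuous_on S (frame i)"
  by (intro linear_continuous_on frame_bounded_linear)

lemma scaleR_frame_L2:
  assumes "u \<in> L2 \<mu>S3" shows "(\<lambda>w. u w *\<^sub>R frame i w) \<in> L2 \<mu>S3"
proof -
  have m: "(\<lambda>w. u w *\<^sub>R frame i w) \<in> borel_measurable \<mu>S3"
    by (intro borel_measurable_scaleR L2_measurable[OF assms] continuous_measurable_\<mu>S3 frame_continuous)
  have "integrable \<mu>S3 (\<lambda>w. (norm (u w *\<^sub>R frame i w))\<^sup>2) \<longleftrightarrow> integrable \<mu>S3 (\<lambda>w. (u w)\<^sup>2)"
    by (rule Bochner_Integration.integrable_cong[OF refl]) (simp add: power_mult_distrib)
  then show ?thesis unfolding L2_def using m L2_integrable_sq[OF assms] by simp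
qed

lemma S\<theta>_L2: assumes "sob 1 p" shows "S\<theta> p \<in> L2 \<mu>S3"
proof -
  have d: "D i p \<in> L2 \<mu>S3" for i by (rule wdD(2)[OF sob_D[OF assms]]) simp
  have "(\<lambda>w. p w *\<^sub>R frame A1 w + (- 1/2 * D A3 p w) *\<^sub>R frame A2 w + (1/2 * D A2 p w) *\<^sub>R frame A3 w) \<in> L2 \<mu>S3"
    by (intro L2_add scaleR_frame_L2 L2_scale sob_L2[OF assms] d)
  then show ?thesis unfolding S\<theta>_def[abs_def] by (simp add: scaleR_diff_left)
qed

lemma eventually_quotient_L2:
  fixes F :: "real \<Rightarrow> 'a \<Rightarrow> 'b::{second_countable_topology, real_normed_vector}"
  assumes "\<forall>\<tau>\<in>I. F \<tau> \<in> L2 M" "t \<in> I"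
  shows "\<forall>\<^sub>F \<tau> in at t within I. (\<lambda>x. (F \<tau> x - F t x) /\<^sub>R (\<tau> - t)) \<in> L2 M"
proof -
  have "\<forall>\<^sub>F \<tau> in at t within I. \<tau> \<in> I" by (simp add: eventually_at_filter)
  then show ?thesis by eventually_elim (intro L2_scaleR L2_diff; use assms in blast)
qed

lemma has_L2_derivative_cong_AE:
  fixes G :: "'a \<Rightarrow> 'b::{second_countable_topology, real_normed_vector}"
  assumes t: "t \<in> I" and ae: "AE x in M. G x = G' x" and m: "G \<in> borel_measurable M" "G' \<in> borel_measurable M"
  shows "has_L2_derivative M I F G t \<longleftrightarrow> has_L2_derivative M I F G' t"
proof -
  have ae': "AE x in M. G' x = G x" using ae by eventually_elim simp
  have L: "G \<in> L2 M \<longleftrightarrow> G' \<in> L2 M" using L2_cong_AE[OF _ m(2) ae] L2_cong_AE[OF _ m(1) ae'] by blast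
  have "L2_tendsto M (\<lambda>\<tau> x. (F \<tau> x - F t x) /\<^sub>R (\<tau> - t)) G (at t within I)
    \<longleftrightarrow> L2_tendsto M (\<lambda>\<tau> x. (F \<tau> x - F t x) /\<^sub>R (\<tau> - t)) G' (at t within I)"
    if F: "\<forall>\<tau>\<in>I. F \<tau> \<in> L2 M"
  proof -
    have q: "\<forall>\<^sub>F \<tau> in at t within I. (\<lambda>x. (F \<tau> x - F t x) /\<^sub>R (\<tau> - t)) \<in> borel_measurable M"
      using eventually_quotient_L2[OF F t] by eventually_elim (rule L2_measurable)
    show ?thesis by (rule L2_tendsto_cong_AE[OF _ ae q q m]) simp
  qed
  then show ?thesis unfolding has_L2_derivative_def using L by blast
qed

lemma has_L2_derivative_cong_curve:
  fixes F F' :: "real \<Rightarrow> 'a \<Rightarrow> real"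
  assumes t: "t \<in> I" and ae: "\<And>\<tau>. \<tau> \<in> I \<Longrightarrow> AE x in M. F \<tau> x = F' \<tau> x"
    and F: "\<And>\<tau>. \<tau> \<in> I \<Longrightarrow> F \<tau> \<in> L2 M" and F': "\<And>\<tau>. \<tau> \<in> I \<Longrightarrow> F' \<tau> \<in> L2 M"
  shows "has_L2_derivative M I F G t \<longleftrightarrow> has_L2_derivative M I F' G t"
proof -
  have FF: "\<forall>\<tau>\<in>I. F \<tau> \<in> L2 M" "\<forall>\<tau>\<in>I. F' \<tau> \<in> L2 M" using F F' by blast+
  have "L2_tendsto M (\<lambda>\<tau> x. (F \<tau> x - F t x) /\<^sub>R (\<tau> - t)) G (at t within I)
    \<longleftrightarrow> L2_tendsto M (\<lambda>\<tau> x. (F' \<tau> x - F' t x) /\<^sub>R (\<tau> - t)) G (at t within I)" if G: "G \<in> L2 M"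
  proof (rule L2_tendsto_cong_AE)
    have "\<forall>\<^sub>F \<tau> in at t within I. \<tau> \<in> I" by (simp add: eventually_at_filter)
    then show "\<forall>\<^sub>F \<tau> in at t within I. AE x in M. (F \<tau> x - F t x) /\<^sub>R (\<tau> - t) = (F' \<tau> x - F' t x) /\<^sub>R (\<tau> - t)"
    proof eventually_elim
      case (elim \<tau>)
      show ?case using ae[OF elim] ae[OF t] by eventually_elim simp
    qed
    show "\<forall>\<^sub>F \<tau> in at t within I. (\<lambda>x. (F \<tau> x - F t x) /\<^sub>R (\<tau> - t)) \<in> borel_measurable M"
      using eventually_quotient_L2[OF FF(1) t] by eventually_elim (rule L2_measurable)
    show "\<forall>\<^sub>F \<tau> in at t within I. (\<lambda>x. (F' \<tau> x - F' t x) /\<^sub>R (\<tau> - t)) \<in> borel_measurable M"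
      using eventually_quotient_L2[OF FF(2) t] by eventually_elim (rule L2_measurable)
  qed (simp_all add: L2_measurable[OF G])
  then show ?thesis unfolding has_L2_derivative_def using F F' by blast
qed

lemma has_L2_derivative_unique:
  fixes F :: "real \<Rightarrow> 'a \<Rightarrow> real"
  assumes "has_L2_derivative M I F G t" "has_L2_derivative M I F G' t" "t \<in> I" "at t within I \<noteq> bot"
  shows "AE x in M. G x = G' x"
proof (rule L2_tendsto_unique[OF assms(4)])
  show "L2_tendsto M (\<lambda>\<tau> x. (F \<tau> x - F t x) /\<^sub>R (\<tau> - t)) G (at t within I)" "G \<in> L2 M"
    using assms(1) unfolding has_L2_derivative_def by blast+
  show "L2_tendsto M (\<lambda>\<tau> x. (F \<tau> x - F t x) /\<^sub>R (\<tau> - t)) G' (at t within I)" "G' \<in> L2 M"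
    using assms(2) unfolding has_L2_derivative_def by blast+
  show "\<forall>\<^sub>F \<tau> in at t within I. (\<lambda>x. (F \<tau> x - F t x) /\<^sub>R (\<tau> - t)) \<in> L2 M"
    using assms(1) unfolding has_L2_derivative_def by (intro eventually_quotient_L2 assms(3)) blast
qed

lemma metric_cong:
  assumes "\<And>w. w \<in> S3 \<Longrightarrow> u w = u' w" "\<And>w. w \<in> S3 \<Longrightarrow> v w = v' w"
  shows "metric \<rho> u v = metric \<rho> u' v'"
  unfolding metric_def inertia_def
  by (rule Bochner_Integration.integral_cong[OF refl]) (simp only: space_\<mu>S3 assms)

lemma metric_minus_right: "metric \<rho> u (\<lambda>w. - v w) = - metric \<rho> u v"
  unfolding metric_def by simp

lemma bracket_cong:
  assumes "\<And>w. w \<in> S3 \<Longrightarrow> f w = f' w" "\<And>w. w \<in> S3 \<Longrightarrow> g w = g' w" "w \<in> S3"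
  shows "bracket f g w = bracket f' g' w"
proof -
  have "D i f = D i f'" for i by (rule sobolev_deriv_cong) (rule assms(1))
  moreover have "D i g = D i g'" for i by (rule sobolev_deriv_cong) (rule assms(2))
  ultimately show ?thesis unfolding bracket_eq[OF assms(3)] by (simp only: assms(1)[OF assms(3)])
qed

lemma \<theta>_S\<theta>: "w \<in> S3 \<Longrightarrow> \<theta> w (S\<theta> f w) = f w"
  by (rule S\<theta>_characterization(1))

lemma bracket_\<theta>:
  "w \<in> S3 \<Longrightarrow> bracket (\<lambda>w. \<theta> w (S\<theta> f w)) (\<lambda>w. \<theta> w (S\<theta> k w)) w = bracket f k w"
  by (rule bracket_cong) (rule \<theta>_S\<theta>, assumption)+

lemma cocycle_S\<theta>: "cocycle \<phi> (S\<theta> f) (S\<theta> k) = ip \<phi> (bracket f k)"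
  unfolding cocycle_def ip_def
  by (rule Bochner_Integration.integral_cong[OF refl]) (simp only: space_\<mu>S3 bracket_\<theta>)

lemma lie_bracket_S\<theta>: "w \<in> S3 \<Longrightarrow> lie_bracket (S\<theta> f) (S\<theta> k) w = S\<theta> (bracket f k) w"
  unfolding lie_bracket_def by (rule S\<theta>_cong) (rule bracket_\<theta>)

locale contact_metric =
  fixes s :: nat and \<rho> :: "cr \<Rightarrow> real"
  assumes s: "3 \<le> s" and rho: "sob 3 (\<rho> \<circ> hopf)" and invertible: "contact_laplacian_invertible s \<rho>"
begin

abbreviation CL :: "(c2 \<Rightarrow> real) \<Rightarrow> c2 \<Rightarrow> real" where "CL \<equiv> contact_lap \<rho>"

lemma solve:
  assumes "inv\<^sub>E k" shows "\<exists>p. sob 2 p \<and> inv\<^sub>E p \<and> (AE w in \<mu>S3. CL p w = k w)"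
proof -
  have "k \<in> sobolev_inv 0" using assms wdD(1)[OF assms] by (simp add: sobolev_inv_iff)
  then obtain p where p: "p \<in> sobolev_inv 2" "AE w in \<mu>S3. contact_laplacian s \<rho> p w = k w"
    using invertible unfolding contact_laplacian_invertible_def by blast
  then have p2: "sob 2 p" "inv\<^sub>E p" unfolding sobolev_inv_iff by auto
  have "AE w in \<mu>S3. CL p w = k w"
    using p(2) contact_laplacian_AE(2)[OF rho p2, of s] by eventually_elim simp
  with p2 show ?thesis by blast
qed

lemma injective:
  assumes p: "sob 2 p" "inv\<^sub>E p" and q: "sob 2 q" "inv\<^sub>E q" and eq: "AE w in \<mu>S3. CL p w = CL q w"
  shows "AE w in \<mu>S3. p w = q w"
proof -
  have "AE w in \<mu>S3. contact_laplacian s \<rho> p w = contact_laplacian s \<rho> q w"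
    using contact_laplacian_AE(2)[OF rho p, of s] contact_laplacian_AE(2)[OF rho q, of s] eq
    by eventually_elim simp
  moreover have "p \<in> sobolev_inv 2" "q \<in> sobolev_inv 2" unfolding sobolev_inv_iff using p q by blast+
  ultimately show ?thesis
    using conjunct2[OF invertible[unfolded contact_laplacian_invertible_def]] by (simp only:)
qed

text \<open>The field \<open>x = S\<theta> (\<Delta>\<^sup>-\<^sup>1 K)\<close> whose metric product with \<open>S\<theta> k\<close> is the inner product of \<open>K\<close> and \<open>k\<close>. Each of
  \<open>ad\<^sup>*\<close>, \<open>T\<close> and the extended \<open>ad\<^sup>*\<close> is computed by exhibiting its \<open>K\<close>.\<close>

definition represents :: "(c2 \<Rightarrow> c2) \<Rightarrow> (c2 \<Rightarrow> real) \<Rightarrow> bool" where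
  "represents x K \<longleftrightarrow> (\<exists>p. x = S\<theta> p \<and> sob 2 p \<and> inv\<^sub>E p \<and> (AE w in \<mu>S3. CL p w = K w))"

lemma sobolev_inv_regular:
  assumes "k \<in> sobolev_inv (s + 1)" shows "sob 4 k" "sob 2 k" "sob 1 k" "inv\<^sub>E k"
proof -
  have k: "sob (s + 1) k" "inv\<^sub>E k" using assms unfolding sobolev_inv_iff by (rule conjunct1, rule conjunct2)
  show "sob 4 k" by (rule sob_mono[OF _ k(1)]) (use s in simp)
  show "sob 2 k" by (rule sob_mono[OF _ k(1)]) (use s in simp)
  show "sob 1 k" by (rule sob_mono[OF _ k(1)]) simp
  show "inv\<^sub>E k" by (rule k(2))
qed

text \<open>The Lie algebra contains \<open>S\<theta> k\<close> for all smooth invariant \<open>k\<close>, which is enough to identify \<open>K\<close>.\<close>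

lemma representsI:
  assumes K: "inv\<^sub>E K" and x: "x \<in> quanto_fields 2"
    and L: "\<And>k. k \<in> sobolev_inv (s + 1) \<Longrightarrow> metric \<rho> x (S\<theta> k) = ip K k"
  shows "represents x K"
proof -
  obtain p where p: "x = S\<theta> p" "sob 2 p" "inv\<^sub>E p"
    using x unfolding quanto_fields_def sobolev_inv_iff image_iff Bex_def by blast
  have "AE w in \<mu>S3. CL p w = K w"
  proof (rule inv_eqI[OF inv_contact_lap[OF rho p(2,3)] K])
    fix k assume k: "k \<in> smooth_S3" "inv\<^sub>E k"
    have "k \<in> sobolev_inv (s + 1)" unfolding sobolev_inv_iff using k sob_smooth by blast
    from L[OF this] show "ip (CL p) k = ip K k"
      unfolding p(1) metric_contact_lap[OF rho p(2) sob_smooth[OF k(1)]] .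
  qed
  with p show ?thesis unfolding represents_def by blast
qed

lemma represents_exists: "inv\<^sub>E K \<Longrightarrow> \<exists>x. represents x K"
  unfolding represents_def using solve by blast

lemma represents_metric:
  assumes "represents x K" "K \<in> L2 \<mu>S3" "k \<in> sobolev_inv (s + 1)"
  shows "x \<in> quanto_fields 2" "metric \<rho> x (S\<theta> k) = ip K k"
proof -
  obtain p where p: "x = S\<theta> p" "sob 2 p" "inv\<^sub>E p" "AE w in \<mu>S3. CL p w = K w"
    using assms(1) unfolding represents_def by blast
  then show "x \<in> quanto_fields 2" unfolding quanto_fields_def using sobolev_inv_iff by blast
  note k = sobolev_inv_regular[OF assms(3)]
  show "metric \<rho> x (S\<theta> k) = ip K k"
    unfolding p(1) metric_contact_lap[OF rho p(2) k(3)]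
    by (rule ip_cong_AE[OF p(4) contact_lap_L2[OF rho p(2)] assms(2) sob_L2[OF k(3)]])
qed

lemma zero_sobolev_inv: "(\<lambda>_. 0) \<in> sobolev_inv k"
  unfolding sobolev_inv_iff using sob_smooth wd_const by simp

lemma represents_choice:
  assumes K: "inv\<^sub>E K" and L: "\<And>k. k \<in> sobolev_inv (s + 1) \<Longrightarrow> L (S\<theta> k) = ip K k"
  shows "represents (SOME x. x \<in> quanto_fields 2 \<and> (\<forall>y\<in>quanto_fields (s + 1). metric \<rho> x y = L y)) K"
proof -
  let ?P = "\<lambda>x. x \<in> quanto_fields 2 \<and> (\<forall>y\<in>quanto_fields (s + 1). metric \<rho> x y = L y)"
  obtain x where x: "represents x K" using represents_exists[OF K] by blast
  have "?P x"
  proof (intro conjI ballI)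
    show "x \<in> quanto_fields 2" by (rule represents_metric(1)[OF x wdD(1)[OF K] zero_sobolev_inv])
    fix y assume "y \<in> quanto_fields (s + 1)"
    then obtain k where k: "y = S\<theta> k" "k \<in> sobolev_inv (s + 1)" unfolding quanto_fields_def by blast
    show "metric \<rho> x y = L y"
      unfolding k(1) L[OF k(2)] by (rule represents_metric(2)[OF x wdD(1)[OF K] k(2)])
  qed
  then have 1: "?P (SOME x. ?P x)" by (rule someI[of ?P])
  define z where "z = (SOME x. ?P x)"
  have P: "?P z" unfolding z_def by (rule 1)
  have "represents z K"
  proof (rule representsI[OF K conjunct1[OF P]])
    fix k assume k: "k \<in> sobolev_inv (s + 1)"
    then have "S\<theta> k \<in> quanto_fields (s + 1)" unfolding quanto_fields_def by (rule imageI)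
    from bspec[OF conjunct2[OF P] this] show "metric \<rho> z (S\<theta> k) = ip K k" unfolding L[OF k] .
  qed
  then show ?thesis unfolding z_def .
qed

lemma represents_L2: "represents x K \<Longrightarrow> x \<in> L2 \<mu>S3"
proof -
  assume "represents x K"
  then obtain p where p: "x = S\<theta> p" "sob 2 p" unfolding represents_def by blast
  show "x \<in> L2 \<mu>S3" unfolding p(1) by (rule S\<theta>_L2[OF sob_mono[OF _ p(2)]]) simp
qed

lemma represents_combination:
  assumes x: "represents x K" and y: "represents y L" and z: "represents z M"
    and M: "AE w in \<mu>S3. M w = K w + c * L w"
  shows "AE w in \<mu>S3. z w = x w + c *\<^sub>R y w"
proof -
  obtain p where p: "x = S\<theta> p" "sob 2 p" "inv\<^sub>E p" "AE w in \<mu>S3. CL p w = K w"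
    using x unfolding represents_def by blast
  obtain q where q: "y = S\<theta> q" "sob 2 q" "inv\<^sub>E q" "AE w in \<mu>S3. CL q w = L w"
    using y unfolding represents_def by blast
  obtain r where r: "z = S\<theta> r" "sob 2 r" "inv\<^sub>E r" "AE w in \<mu>S3. CL r w = M w"
    using z unfolding represents_def by blast
  let ?h = "\<lambda>w. p w + c * q w"
  have h: "sob 2 ?h" "inv\<^sub>E ?h"
    using sob_add[OF p(2) sob_scale[OF q(2)]] inv_add[OF p(3) inv_scale[OF q(3)]] by blast+
  have "AE w in \<mu>S3. CL r w = CL ?h w"
    using contact_lap_linear[OF p(2) q(2), of \<rho> c] p(4) q(4) r(4) M by eventually_elim simp
  from S\<theta>_cong_AE[OF injective[OF r(2,3) h this] sob_L2[OF r(2)] sob_L2[OF h(1)]] S\<theta>_linear[OF p(2) q(2), of c]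
  show ?thesis unfolding p(1) q(1) r(1) by eventually_elim simp
qed

text \<open>The bracket is moved from \<open>k\<close> to \<open>\<Delta> f\<close> by integration by parts.\<close>

lemma metric_ad:
  assumes f: "sob 4 f" "inv\<^sub>E f" and k: "sob 4 k" "inv\<^sub>E k"
  shows "metric \<rho> (S\<theta> f) (\<lambda>w. - lie_bracket (S\<theta> f) (S\<theta> k) w) = ip (bracket f (CL f)) k"
proof -
  have f2: "sob 2 f" by (rule sob_mono[OF _ f(1)]) simp
  have "metric \<rho> (S\<theta> f) (\<lambda>w. - lie_bracket (S\<theta> f) (S\<theta> k) w) = - metric \<rho> (S\<theta> f) (S\<theta> (bracket f k))"
    unfolding metric_minus_right using metric_cong[OF refl lie_bracket_S\<theta>] by simp
  also have "\<dots> = - ip (CL f) (bracket f k)"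
    unfolding metric_contact_lap[OF rho f2 bracket_sob_1[OF f(1) k]] by (rule refl)
  also have "\<dots> = ip (bracket f (CL f)) k"
    using bracket_integration_by_parts[OF f k contact_lap_sob_1[OF rho f(1)]] by simp
  finally show ?thesis .
qed

context
  fixes f :: "c2 \<Rightarrow> real"
  assumes f: "f \<in> sobolev_inv (s + 1)"
begin

lemma inv_transport: "inv\<^sub>E (bracket f (CL f))"
  using sobolev_inv_regular[OF f]
  by (intro inv_bracket contact_lap_sob_1[OF rho] inv_contact_lap[OF rho])

lemma ad_star_represents: "represents (ad_star s \<rho> (S\<theta> f) (S\<theta> f)) (bracket f (CL f))"
  unfolding ad_star_def
proof (rule represents_choice[OF inv_transport])
  fix k assume "k \<in> sobolev_inv (s + 1)"
  note k = sobolev_inv_regular[OF this]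
  show "metric \<rho> (S\<theta> f) (ad (S\<theta> f) (S\<theta> k)) = ip (bracket f (CL f)) k"
    using metric_ad[OF sobolev_inv_regular(1,4)[OF f] k(1,4)] unfolding ad_def[abs_def] .
qed

lemma T_op_represents:
  assumes R: "inv\<^sub>E R" "\<And>k. k \<in> sobolev_inv (s + 1) \<Longrightarrow> cocycle \<phi> (S\<theta> f) (S\<theta> k) = ip R k"
  shows "represents (T_op s \<rho> \<phi> (S\<theta> f)) R"
  unfolding T_op_def by (rule represents_choice[OF R])

lemma ext_ad_star_represents:
  assumes R: "inv\<^sub>E R" "\<And>k. k \<in> sobolev_inv (s + 1) \<Longrightarrow> cocycle \<phi> (S\<theta> f) (S\<theta> k) = ip R k"
  shows "represents (fst (ext_ad_star s \<rho> \<phi> (S\<theta> f, a) (S\<theta> f, a))) (\<lambda>w. bracket f (CL f) w + (-a) * R w)"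
    and "snd (ext_ad_star s \<rho> \<phi> (S\<theta> f, a) (S\<theta> f, a)) = 0"
proof -
  let ?X = "(S\<theta> f, a)"
  let ?P = "\<lambda>Z. Z \<in> quanto_fields 2 \<times> UNIV \<and>
     (\<forall>W\<in>quanto_fields (s + 1) \<times> UNIV. ext_metric \<rho> Z W = ext_metric \<rho> ?X (ext_ad \<phi> ?X W))"
  let ?K = "\<lambda>w. bracket f (CL f) w + (-a) * R w"
  have K: "inv\<^sub>E ?K" by (intro inv_add inv_scale inv_transport R(1))
  note KL = wdD(1)[OF K] and BL = wdD(1)[OF inv_transport] and RL = wdD(1)[OF R(1)]
  have rhs: "ext_metric \<rho> ?X (ext_ad \<phi> ?X (S\<theta> k, b)) = ip ?K k" if k: "k \<in> sobolev_inv (s + 1)" for k b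
  proof -
    have kL: "k \<in> L2 \<mu>S3" by (rule sob_L2[OF sobolev_inv_regular(1)[OF k]])
    show ?thesis
      unfolding ext_metric_def ext_ad_def ext_bracket_def fst_conv snd_conv
        metric_ad[OF sobolev_inv_regular(1,4)[OF f] sobolev_inv_regular(1,4)[OF k]] R(2)[OF k]
        ip_add_left[OF BL L2_scale[OF RL] kL] ip_scale_left by simp
  qed
  have lhs: "ext_metric \<rho> Z (y, b) = metric \<rho> (fst Z) y + snd Z * b" for Z y b
    by (simp add: ext_metric_def)
  obtain x where x: "represents x ?K" using represents_exists[OF K] by blast
  have "?P (x, 0)"
  proof (intro conjI ballI)
    show "(x, 0) \<in> quanto_fields 2 \<times> UNIV" using represents_metric(1)[OF x KL zero_sobolev_inv] by simp
    fix W assume "W \<in> quanto_fields (s + 1) \<times> (UNIV :: real set)"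
    then obtain k b where W: "W = (S\<theta> k, b)" "k \<in> sobolev_inv (s + 1)"
      unfolding quanto_fields_def by auto
    show "ext_metric \<rho> (x, 0) W = ext_metric \<rho> ?X (ext_ad \<phi> ?X W)"
      unfolding W(1) rhs[OF W(2)] lhs using represents_metric(2)[OF x KL W(2)] by simp
  qed
  then have P: "?P (ext_ad_star s \<rho> \<phi> ?X ?X)" unfolding ext_ad_star_def by (rule someI[of ?P])
  define Z where "Z = ext_ad_star s \<rho> \<phi> ?X ?X"
  have e: "metric \<rho> (fst Z) (S\<theta> k) + snd Z * b = ip ?K k" if k: "k \<in> sobolev_inv (s + 1)" for k b
  proof -
    have "(S\<theta> k, b) \<in> quanto_fields (s + 1) \<times> (UNIV :: real set)" using k unfolding quanto_fields_def by auto
    then have "ext_metric \<rho> Z (S\<theta> k, b) = ext_metric \<rho> ?X (ext_ad \<phi> ?X (S\<theta> k, b))"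
      using P unfolding Z_def by blast
    then show ?thesis unfolding rhs[OF k] lhs .
  qed
  from e[OF zero_sobolev_inv, of 0] e[OF zero_sobolev_inv, of 1] show 0: "snd (ext_ad_star s \<rho> \<phi> ?X ?X) = 0"
    unfolding Z_def[symmetric] by simp
  show "represents (fst (ext_ad_star s \<rho> \<phi> ?X ?X)) ?K"
  proof (rule representsI[OF K])
    show "fst (ext_ad_star s \<rho> \<phi> ?X ?X) \<in> quanto_fields 2" using conjunct1[OF P] unfolding mem_Times_iff by (rule conjunct1)
    show "metric \<rho> (fst (ext_ad_star s \<rho> \<phi> ?X ?X)) (S\<theta> k) = ip ?K k" if "k \<in> sobolev_inv (s + 1)" for k
      using e[OF that, of 0] unfolding Z_def by simp
  qed
qed

end

end

lemma D_zero_AE: "AE w in \<mu>S3. D i (\<lambda>_. 0) w = 0"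
  by (rule sobolev_deriv_AE[OF wd_const])

lemma S\<theta>_scale:
  assumes "sob 2 q" shows "AE w in \<mu>S3. S\<theta> (\<lambda>w. c * q w) w = c *\<^sub>R S\<theta> q w"
  using S\<theta>_linear[OF sob_smooth[OF smooth_S3_const[of 0]] assms, of c] D_zero_AE[of A2] D_zero_AE[of A3]
  by eventually_elim (simp add: S\<theta>_def)

lemma contact_lap_scale:
  assumes "sob 2 q" shows "AE w in \<mu>S3. contact_lap \<rho> (\<lambda>w. c * q w) w = c * contact_lap \<rho> q w"
proof -
  have DD: "D i (D i (\<lambda>_. 0)) = D i (\<lambda>_. 0)" for i
    by (rule sobolev_deriv_cong_AE[OF D_zero_AE L2_measurable[OF wdD(2)[OF wd_sobolev_deriv[OF wd_const]]] L2_measurable[OF L2_zero]])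
  show ?thesis
    using contact_lap_linear[OF sob_smooth[OF smooth_S3_const[of 0]] assms, of \<rho> c] D_zero_AE[of A2] D_zero_AE[of A3]
    by eventually_elim (simp add: contact_lap_def[of _ "\<lambda>_. 0"] lap_def[of "\<lambda>_. 0"] DD)
qed

section \<open>Derivatives of curves\<close>

lemma has_L2_derivative_bot:
  assumes "at t within I = bot" "\<forall>\<tau>\<in>I. F \<tau> \<in> L2 M" "G \<in> L2 M" shows "has_L2_derivative M I F G t"
  unfolding has_L2_derivative_def L2_tendsto_def using assms by simp

lemma has_L2_derivativeD:
  "has_L2_derivative M I F G t \<Longrightarrow> \<forall>\<tau>\<in>I. F \<tau> \<in> L2 M" "has_L2_derivative M I F G t \<Longrightarrow> G \<in> L2 M"
  "has_L2_derivative M I F G t \<Longrightarrow> L2_tendsto M (\<lambda>\<tau> x. (F \<tau> x - F t x) /\<^sub>R (\<tau> - t)) G (at t within I)"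
  unfolding has_L2_derivative_def by blast+

lemma has_L2_derivative_add:
  fixes F F' :: "real \<Rightarrow> 'a \<Rightarrow> 'b::{second_countable_topology, real_normed_vector}"
  assumes F: "has_L2_derivative M I F G t" and F': "has_L2_derivative M I F' G' t" and t: "t \<in> I"
  shows "has_L2_derivative M I (\<lambda>\<tau> x. F \<tau> x + F' \<tau> x) (\<lambda>x. G x + G' x) t"
  unfolding has_L2_derivative_def
proof (intro conjI ballI)
  show "(\<lambda>x. F \<tau> x + F' \<tau> x) \<in> L2 M" if "\<tau> \<in> I" for \<tau>
    by (intro L2_add bspec[OF has_L2_derivativeD(1)[OF F] that] bspec[OF has_L2_derivativeD(1)[OF F'] that])
  show "(\<lambda>x. G x + G' x) \<in> L2 M" by (intro L2_add has_L2_derivativeD(2)[OF F] has_L2_derivativeD(2)[OF F'])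
  have "L2_tendsto M (\<lambda>\<tau> x. (F \<tau> x - F t x) /\<^sub>R (\<tau> - t) + (F' \<tau> x - F' t x) /\<^sub>R (\<tau> - t)) (\<lambda>x. G x + G' x) (at t within I)"
    by (intro L2_tendsto_add has_L2_derivativeD(2,3)[OF F] has_L2_derivativeD(2,3)[OF F']
        eventually_quotient_L2 has_L2_derivativeD(1)[OF F] has_L2_derivativeD(1)[OF F'] t)
  moreover have "(F \<tau> x - F t x) /\<^sub>R (\<tau> - t) + (F' \<tau> x - F' t x) /\<^sub>R (\<tau> - t)
      = (F \<tau> x + F' \<tau> x - (F t x + F' t x)) /\<^sub>R (\<tau> - t)" for \<tau> x
    by (simp only: scaleR_add_right[symmetric] add_diff_add)
  ultimately show "L2_tendsto M (\<lambda>\<tau> x. (F \<tau> x + F' \<tau> x - (F t x + F' t x)) /\<^sub>R (\<tau> - t)) (\<lambda>x. G x + G' x) (at t within I)"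
    by (simp only:)
qed

lemma has_L2_derivative_bounded_mult:
  fixes F :: "real \<Rightarrow> 'a \<Rightarrow> real"
  assumes F: "has_L2_derivative M I F G t" and t: "t \<in> I"
    and u: "u \<in> borel_measurable M" "AE x in M. \<bar>u x\<bar> \<le> B"
  shows "has_L2_derivative M I (\<lambda>\<tau> x. u x * F \<tau> x) (\<lambda>x. u x * G x) t"
  unfolding has_L2_derivative_def
proof (intro conjI ballI)
  show "(\<lambda>x. u x * F \<tau> x) \<in> L2 M" if "\<tau> \<in> I" for \<tau>
    by (rule L2_bounded_mult[OF u bspec[OF has_L2_derivativeD(1)[OF F] that]])
  show "(\<lambda>x. u x * G x) \<in> L2 M" by (rule L2_bounded_mult[OF u has_L2_derivativeD(2)[OF F]])
  have "L2_tendsto M (\<lambda>\<tau> x. u x * ((F \<tau> x - F t x) /\<^sub>R (\<tau> - t))) (\<lambda>x. u x * G x) (at t within I)"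
    by (intro L2_tendsto_bounded_mult[OF has_L2_derivativeD(3)[OF F] _ has_L2_derivativeD(2)[OF F] u]
        eventually_quotient_L2 has_L2_derivativeD(1)[OF F] t)
  moreover have "u x * ((F \<tau> x - F t x) /\<^sub>R (\<tau> - t)) = (u x * F \<tau> x - u x * F t x) /\<^sub>R (\<tau> - t)" for \<tau> x
    by (simp only: mult_scaleR_right right_diff_distrib)
  ultimately show "L2_tendsto M (\<lambda>\<tau> x. (u x * F \<tau> x - u x * F t x) /\<^sub>R (\<tau> - t)) (\<lambda>x. u x * G x) (at t within I)"
    by (simp only:)
qed

lemma has_L2_derivative_scale:
  fixes F :: "real \<Rightarrow> 'a \<Rightarrow> real"
  assumes "has_L2_derivative M I F G t" "t \<in> I"
  shows "has_L2_derivative M I (\<lambda>\<tau> x. c * F \<tau> x) (\<lambda>x. c * G x) t"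
  by (rule has_L2_derivative_bounded_mult[OF assms, of _ "\<bar>c\<bar>"]) simp_all

lemma has_L2_derivative_frame:
  assumes F: "has_L2_derivative \<mu>S3 I F G t"
  shows "has_L2_derivative \<mu>S3 I (\<lambda>\<tau> w. F \<tau> w *\<^sub>R frame i w) (\<lambda>w. G w *\<^sub>R frame i w) t"
  unfolding has_L2_derivative_def
proof (intro conjI ballI)
  show "(\<lambda>w. F \<tau> w *\<^sub>R frame i w) \<in> L2 \<mu>S3" if "\<tau> \<in> I" for \<tau>
    by (rule scaleR_frame_L2[OF bspec[OF has_L2_derivativeD(1)[OF F] that]])
  show "(\<lambda>w. G w *\<^sub>R frame i w) \<in> L2 \<mu>S3" by (rule scaleR_frame_L2[OF has_L2_derivativeD(2)[OF F]])
  have "(LINT w|\<mu>S3. (norm ((F \<tau> w *\<^sub>R frame i w - F t w *\<^sub>R frame i w) /\<^sub>R (\<tau> - t) - G w *\<^sub>R frame i w))\<^sup>2)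
      = (LINT w|\<mu>S3. (norm ((F \<tau> w - F t w) /\<^sub>R (\<tau> - t) - G w))\<^sup>2)" for \<tau>
  proof (rule Bochner_Integration.integral_cong[OF refl])
    fix w assume "w \<in> space \<mu>S3"
    then have "norm (frame i w) = 1" by simp
    moreover have "(F \<tau> w *\<^sub>R frame i w - F t w *\<^sub>R frame i w) /\<^sub>R (\<tau> - t) - G w *\<^sub>R frame i w
        = ((F \<tau> w - F t w) /\<^sub>R (\<tau> - t) - G w) *\<^sub>R frame i w"
      by (simp only: scaleR_diff_left[symmetric] scaleR_scaleR real_scaleR_def)
    ultimately show "(norm ((F \<tau> w *\<^sub>R frame i w - F t w *\<^sub>R frame i w) /\<^sub>R (\<tau> - t) - G w *\<^sub>R frame i w))\<^sup>2
        = (norm ((F \<tau> w - F t w) /\<^sub>R (\<tau> - t) - G w))\<^sup>2" by (simp only: norm_scaleR mult_1_right real_norm_def)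
  qed
  then show "L2_tendsto \<mu>S3 (\<lambda>\<tau> w. (F \<tau> w *\<^sub>R frame i w - F t w *\<^sub>R frame i w) /\<^sub>R (\<tau> - t)) (\<lambda>w. G w *\<^sub>R frame i w) (at t within I)"
    using has_L2_derivativeD(3)[OF F] unfolding L2_tendsto_def by (simp only:)
qed

lemma S\<theta>_sum: "S\<theta> f = (\<lambda>w. f w *\<^sub>R frame A1 w + (- 1/2 * D A3 f w) *\<^sub>R frame A2 w + (1/2 * D A2 f w) *\<^sub>R frame A3 w)"
  by (simp add: S\<theta>_def fun_eq_iff)

lemma has_L2_derivative_S\<theta>:
  assumes f: "has_L2_derivative \<mu>S3 I f g t" and D: "\<And>i. has_L2_derivative \<mu>S3 I (\<lambda>\<tau>. D i (f \<tau>)) (D i g) t"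
    and t: "t \<in> I"
  shows "has_L2_derivative \<mu>S3 I (\<lambda>\<tau>. S\<theta> (f \<tau>)) (S\<theta> g) t"
  unfolding S\<theta>_sum
  by (intro has_L2_derivative_add has_L2_derivative_frame has_L2_derivative_scale f D t)

lemma has_L2_derivative_S\<theta>_component:
  assumes S: "has_L2_derivative \<mu>S3 I (\<lambda>\<tau>. S\<theta> (f \<tau>)) (S\<theta> p) t" and f: "\<forall>\<tau>\<in>I. f \<tau> \<in> L2 \<mu>S3" and p: "p \<in> L2 \<mu>S3"
    and t: "t \<in> I"
  shows "has_L2_derivative \<mu>S3 I f p t"
  unfolding has_L2_derivative_def
proof (intro conjI f p)
  let ?Q = "\<lambda>\<tau> w. (S\<theta> (f \<tau>) w - S\<theta> (f t) w) /\<^sub>R (\<tau> - t)"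
  show "L2_tendsto \<mu>S3 (\<lambda>\<tau> x. (f \<tau> x - f t x) /\<^sub>R (\<tau> - t)) p (at t within I)"
    unfolding L2_tendsto_def
  proof (rule Lim_null_comparison[OF _ has_L2_derivativeD(3)[OF S, unfolded L2_tendsto_def]])
    show "\<forall>\<^sub>F \<tau> in at t within I. norm (LINT w|\<mu>S3. (norm ((f \<tau> w - f t w) /\<^sub>R (\<tau> - t) - p w))\<^sup>2)
        \<le> (LINT w|\<mu>S3. (norm (?Q \<tau> w - S\<theta> p w))\<^sup>2)"
      using eventually_quotient_L2[OF f t] eventually_quotient_L2[OF has_L2_derivativeD(1)[OF S] t]
    proof eventually_elim
      case (elim \<tau>)
      have "(LINT w|\<mu>S3. (norm ((f \<tau> w - f t w) /\<^sub>R (\<tau> - t) - p w))\<^sup>2) \<le> (LINT w|\<mu>S3. (norm (?Q \<tau> w - S\<theta> p w))\<^sup>2)"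
      proof (rule integral_mono)
        show "integrable \<mu>S3 (\<lambda>w. (norm ((f \<tau> w - f t w) /\<^sub>R (\<tau> - t) - p w))\<^sup>2)"
          by (rule L2_integrable_norm2[OF L2_diff[OF elim(1) p]])
        show "integrable \<mu>S3 (\<lambda>w. (norm (?Q \<tau> w - S\<theta> p w))\<^sup>2)"
          by (rule L2_integrable_norm2[OF L2_diff[OF elim(2) has_L2_derivativeD(2)[OF S]]])
        fix w assume "w \<in> space \<mu>S3"
        then have w: "w \<in> S3" unfolding space_\<mu>S3 .
        have "(?Q \<tau> w - S\<theta> p w) \<bullet> frame A1 w = (f \<tau> w - f t w) /\<^sub>R (\<tau> - t) - p w"
          by (simp add: inner_diff_left S\<theta>_components(1)[OF w])
        then have "norm ((f \<tau> w - f t w) /\<^sub>R (\<tau> - t) - p w) \<le> norm (?Q \<tau> w - S\<theta> p w)"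
          using Cauchy_Schwarz_ineq2[of "?Q \<tau> w - S\<theta> p w" "frame A1 w"] w by simp
        then show "(norm ((f \<tau> w - f t w) /\<^sub>R (\<tau> - t) - p w))\<^sup>2 \<le> (norm (?Q \<tau> w - S\<theta> p w))\<^sup>2"
          by (intro power_mono) simp_all
      qed
      then show ?case by simp
    qed
  qed
qed

lemma inv_time_derivative:
  assumes F: "has_L2_derivative \<mu>S3 I f g t" and inv: "\<forall>\<tau>\<in>I. inv\<^sub>E (f \<tau>)" and t: "t \<in> I" and nb: "at t within I \<noteq> bot"
  shows "inv\<^sub>E g"
proof (rule wdI[OF has_L2_derivativeD(2)[OF F] L2_zero])
  fix p :: "c2 \<Rightarrow> real" assume "real_polynomial_function p"
  note s = real_polynomial_smooth_S3[OF this]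
  note pL = smooth_S3_L2[OF smooth_S3_frame_deriv[OF s]]
  let ?q = "\<lambda>\<tau> x. (f \<tau> x - f t x) /\<^sub>R (\<tau> - t)"
  have "((\<lambda>\<tau>. LINT w|\<mu>S3. ?q \<tau> w * frame_deriv A1 p w) \<longlongrightarrow> (LINT w|\<mu>S3. g w * frame_deriv A1 p w)) (at t within I)"
    by (rule L2_tendsto_inner[OF has_L2_derivativeD(3)[OF F] eventually_quotient_L2[OF has_L2_derivativeD(1)[OF F] t]
          has_L2_derivativeD(2)[OF F] L2_tendsto_const _ pL]) (simp add: pL)
  then have 1: "((\<lambda>\<tau>. ip (?q \<tau>) (frame_deriv A1 p)) \<longlongrightarrow> ip g (frame_deriv A1 p)) (at t within I)"
    unfolding ip_def .
  have "\<forall>\<^sub>F \<tau> in at t within I. \<tau> \<in> I" by (simp add: eventually_at_filter)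
  then have "\<forall>\<^sub>F \<tau> in at t within I. ip (?q \<tau>) (frame_deriv A1 p) = 0"
  proof eventually_elim
    case (elim \<tau>)
    have "inv\<^sub>E (\<lambda>x. inverse (\<tau> - t) * (f \<tau> x - f t x))"
      by (intro inv_scale inv_diff bspec[OF inv] elim t)
    from inv_smooth[OF this s] show ?case unfolding real_scaleR_def .
  qed
  from tendsto_unique[OF nb 1 tendsto_eventually[OF this]]
  show "ip g (frame_deriv A1 p) = - ip (\<lambda>_. 0) p" by simp
qed

lemma has_sobolev_derivativeD:
  assumes "has_sobolev_derivative 2 I f g t"
  shows "has_L2_derivative \<mu>S3 I f g t" "has_L2_derivative \<mu>S3 I (\<lambda>\<tau>. D i (f \<tau>)) (D i g) t"
    "has_L2_derivative \<mu>S3 I (\<lambda>\<tau>. D i (D j (f \<tau>))) (D i (D j g)) t" "sob 2 g"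
proof -
  have a: "has_L2_derivative \<mu>S3 I (\<lambda>\<tau>. foldr D \<alpha> (f \<tau>)) (foldr D \<alpha> g) t" if "length \<alpha> \<le> 2" for \<alpha>
    using assms that unfolding has_sobolev_derivative_def by blast
  show "has_L2_derivative \<mu>S3 I f g t" using a[of "[]"] by simp
  show "has_L2_derivative \<mu>S3 I (\<lambda>\<tau>. D i (f \<tau>)) (D i g) t" using a[of "[i]"] by simp
  show "has_L2_derivative \<mu>S3 I (\<lambda>\<tau>. D i (D j (f \<tau>))) (D i (D j g)) t" using a[of "[i, j]"] by simp
  show "sob 2 g" using assms unfolding has_sobolev_derivative_def sobolev_iff_sob by blast
qed

context contact_metric
begin

lemma has_L2_derivative_CL:
  assumes fg: "has_sobolev_derivative 2 I f g t" and t: "t \<in> I"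
  shows "has_L2_derivative \<mu>S3 I (\<lambda>\<tau>. CL (f \<tau>)) (CL g) t"
proof -
  note d = has_sobolev_derivativeD[OF fg]
  obtain r' where r: "strong A1 (\<lambda>w. \<rho> (hopf w) * \<rho> (hopf w)) r'" using strong_rho(1)[OF rho] by blast
  obtain K where K: "AE w in \<mu>S3. \<bar>\<rho> (hopf w) * \<rho> (hopf w)\<bar> \<le> K" using strong_bounded[OF r] by blast
  have "has_L2_derivative \<mu>S3 I (\<lambda>\<tau> w. (\<rho> (hopf w) * \<rho> (hopf w)) * f \<tau> w
      + (-1/4) * (D A2 (D A2 (f \<tau>)) w + D A3 (D A3 (f \<tau>)) w))
    (\<lambda>w. (\<rho> (hopf w) * \<rho> (hopf w)) * g w + (-1/4) * (D A2 (D A2 g) w + D A3 (D A3 g) w)) t"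
    by (intro has_L2_derivative_add has_L2_derivative_scale d(3)
        has_L2_derivative_bounded_mult[OF d(1) t strongD(1)[OF r] K] t)
  moreover have "CL h = (\<lambda>w. (\<rho> (hopf w) * \<rho> (hopf w)) * h w + (-1/4) * (D A2 (D A2 h) w + D A3 (D A3 h) w))" for h
    by (simp add: fun_eq_iff contact_lap_def lap_def)
  ultimately show ?thesis by (simp only:)
qed

context
  fixes I :: "real set" and f :: "real \<Rightarrow> c2 \<Rightarrow> real"
  assumes f: "\<forall>t\<in>I. f t \<in> sobolev_inv (s + 1)"
begin

lemma f_regular:
  assumes "t \<in> I" shows "sob 4 (f t)" "sob 2 (f t)" "sob 1 (f t)" "inv\<^sub>E (f t)"
  using sobolev_inv_regular[OF bspec[OF f assms]] by auto

text \<open>By assumption the curve has the derivative \<open>S\<theta> g\<close>, and derivatives are unique, except at an isolated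
  point of \<open>I\<close>, where every function is a derivative.\<close>

lemma S\<theta>_derivative_iff:
  assumes t: "t \<in> I" and fg: "has_sobolev_derivative 2 I f g t" and p: "sob 2 p"
  shows "has_L2_derivative \<mu>S3 I (\<lambda>\<tau>. S\<theta> (f \<tau>)) (S\<theta> p) t \<longleftrightarrow> at t within I = bot \<or> (AE w in \<mu>S3. g w = p w)"
proof -
  note d = has_sobolev_derivativeD[OF fg]
  have p1: "sob 1 p" and g1: "sob 1 g" by (rule sob_mono[OF _ p], simp) (rule sob_mono[OF _ d(4)], simp)
  have fL: "\<forall>\<tau>\<in>I. f \<tau> \<in> L2 \<mu>S3" using f_regular(1) sob_L2 by blast
  have SL: "\<forall>\<tau>\<in>I. S\<theta> (f \<tau>) \<in> L2 \<mu>S3" using f_regular(3) S\<theta>_L2 by blast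
  note S = has_L2_derivative_S\<theta>[OF d(1,2) t]
  show ?thesis
  proof (cases "at t within I = bot")
    case True
    then show ?thesis using has_L2_derivative_bot[OF True SL S\<theta>_L2[OF p1]] by simp
  next
    case False
    have "AE w in \<mu>S3. g w = p w" if "has_L2_derivative \<mu>S3 I (\<lambda>\<tau>. S\<theta> (f \<tau>)) (S\<theta> p) t"
      by (rule has_L2_derivative_unique[OF d(1) has_L2_derivative_S\<theta>_component[OF that fL sob_L2[OF p] t] t False])
    moreover have "has_L2_derivative \<mu>S3 I (\<lambda>\<tau>. S\<theta> (f \<tau>)) (S\<theta> p) t" if "AE w in \<mu>S3. g w = p w"
      using has_L2_derivative_cong_AE[OF t S\<theta>_cong_AE[OF that sob_L2[OF d(4)] sob_L2[OF p]]
          L2_measurable[OF S\<theta>_L2[OF g1]] L2_measurable[OF S\<theta>_L2[OF p1]]] S by blast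
    ultimately show ?thesis using False by blast
  qed
qed

text \<open>The analogue for the contact Laplacian, which separates \<open>g\<close> from \<open>p\<close> because it is injective.\<close>

lemma contact_laplacian_derivative_iff:
  assumes t: "t \<in> I" and fg: "has_sobolev_derivative 2 I f g t" and p: "sob 2 p" "inv\<^sub>E p"
    and H: "H \<in> L2 \<mu>S3" "AE w in \<mu>S3. H w = CL p w"
  shows "has_L2_derivative \<mu>S3 I (\<lambda>\<tau>. contact_laplacian s \<rho> (f \<tau>)) H t
    \<longleftrightarrow> at t within I = bot \<or> (AE w in \<mu>S3. g w = p w)"
proof -
  note d = has_sobolev_derivativeD[OF fg]
  note cl = contact_laplacian_AE[OF rho f_regular(2,4)]
  have CLL: "CL (f \<tau>) \<in> L2 \<mu>S3" if "\<tau> \<in> I" for \<tau> by (rule contact_lap_L2[OF rho f_regular(2)[OF that]])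
  note C = has_L2_derivative_CL[OF fg t]
  note gL = contact_lap_L2[OF rho d(4)] and pL = contact_lap_L2[OF rho p(1)]
  have "has_L2_derivative \<mu>S3 I (\<lambda>\<tau>. contact_laplacian s \<rho> (f \<tau>)) H t \<longleftrightarrow> has_L2_derivative \<mu>S3 I (\<lambda>\<tau>. CL (f \<tau>)) H t"
    by (rule has_L2_derivative_cong_curve[OF t cl(2) cl(1) CLL])
  also have "\<dots> \<longleftrightarrow> has_L2_derivative \<mu>S3 I (\<lambda>\<tau>. CL (f \<tau>)) (CL p) t"
    by (rule has_L2_derivative_cong_AE[OF t H(2) L2_measurable[OF H(1)] L2_measurable[OF pL]])
  also have "\<dots> \<longleftrightarrow> at t within I = bot \<or> (AE w in \<mu>S3. g w = p w)"
  proof (cases "at t within I = bot")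
    case True
    then show ?thesis using has_L2_derivative_bot[OF True _ pL] CLL by simp
  next
    case False
    have inv: "\<forall>\<tau>\<in>I. inv\<^sub>E (f \<tau>)" using f_regular(4) by blast
    have "AE w in \<mu>S3. g w = p w" if "has_L2_derivative \<mu>S3 I (\<lambda>\<tau>. CL (f \<tau>)) (CL p) t"
      by (rule injective[OF d(4) inv_time_derivative[OF d(1) inv t False] p has_L2_derivative_unique[OF C that t False]])
    moreover have "has_L2_derivative \<mu>S3 I (\<lambda>\<tau>. CL (f \<tau>)) (CL p) t" if "AE w in \<mu>S3. g w = p w"
      using has_L2_derivative_cong_AE[OF t contact_lap_cong_AE[OF that sob_L2[OF d(4)] sob_L2[OF p(1)]]
          L2_measurable[OF gL] L2_measurable[OF pL]] C by blast
    ultimately show ?thesis using False by blast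
  qed
  finally show ?thesis .
qed

lemma bracket_contact_laplacian:
  assumes "t \<in> I" shows "bracket h (contact_laplacian s \<rho> (f t)) = bracket h (CL (f t))"
proof -
  note cl = contact_laplacian_AE[OF rho f_regular(2,4)[OF assms]]
  have "D i (contact_laplacian s \<rho> (f t)) = D i (CL (f t))" for i
    by (rule sobolev_deriv_cong_AE[OF cl(2) L2_measurable[OF cl(1)]
          L2_measurable[OF contact_lap_L2[OF rho f_regular(2)[OF assms]]]])
  then show ?thesis unfolding bracket_def field_deriv_def[abs_def] by (simp only:)
qed

text \<open>Both equations say that \<open>\<partial>\<^sub>t f\<close> is the function \<open>p\<close> with \<open>\<Delta> p = - {f, \<Delta> f} + c R\<close>, where \<open>R\<close> represents the
  cocycle.\<close>

lemma field_equation_iff_function_equation: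
  assumes t: "t \<in> I" and fg: "has_sobolev_derivative 2 I f g t"
    and R: "inv\<^sub>E R" "\<And>k. k \<in> sobolev_inv (s + 1) \<Longrightarrow> cocycle \<phi> (S\<theta> (f t)) (S\<theta> k) = ip R k"
  shows "field_equation s \<rho> \<phi> I f c t \<longleftrightarrow> function_equation s \<rho> I f c R t"
proof -
  note ft = bspec[OF f t]
  let ?B = "bracket (f t) (CL (f t))"
  obtain q where q: "ad_star s \<rho> (S\<theta> (f t)) (S\<theta> (f t)) = S\<theta> q" "sob 2 q" "inv\<^sub>E q" "AE w in \<mu>S3. CL q w = ?B w"
    using ad_star_represents[OF ft] unfolding represents_def by blast
  obtain y where y: "T_op s \<rho> \<phi> (S\<theta> (f t)) = S\<theta> y" "sob 2 y" "inv\<^sub>E y" "AE w in \<mu>S3. CL y w = R w"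
    using T_op_represents[OF ft R] unfolding represents_def by blast
  let ?q = "\<lambda>w. -1 * q w"
  let ?p = "\<lambda>w. ?q w + c * y w"
  have q': "sob 2 ?q" "inv\<^sub>E ?q" by (rule sob_scale[OF q(2)], rule inv_scale[OF q(3)])
  have p: "sob 2 ?p" "inv\<^sub>E ?p" by (rule sob_add[OF q'(1) sob_scale[OF y(2)]], rule inv_add[OF q'(2) inv_scale[OF y(3)]])
  have BL: "?B \<in> L2 \<mu>S3" by (rule wdD(1)[OF inv_transport[OF ft]])
  have RL: "R \<in> L2 \<mu>S3" by (rule wdD(1)[OF R(1)])
  have L1: "sob 1 h" if "sob 2 h" for h by (rule sob_mono[OF _ that]) simp
  have "AE w in \<mu>S3. S\<theta> ?q w = -1 *\<^sub>R S\<theta> q w" by (rule S\<theta>_scale[OF q(2)])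
  then have S: "AE w in \<mu>S3. S\<theta> ?p w = - (S\<theta> q w - c *\<^sub>R S\<theta> y w)"
    using S\<theta>_linear[OF q'(1) y(2), of c] by eventually_elim simp
  have "field_equation s \<rho> \<phi> I f c t \<longleftrightarrow> has_L2_derivative \<mu>S3 I (\<lambda>\<tau>. S\<theta> (f \<tau>)) (S\<theta> ?p) t"
    unfolding field_equation_def q(1) y(1)
  proof (rule has_L2_derivative_cong_AE[OF t])
    show "AE w in \<mu>S3. - (S\<theta> q w - c *\<^sub>R S\<theta> y w) = S\<theta> ?p w" using S by eventually_elim simp
    show "(\<lambda>w. - (S\<theta> q w - c *\<^sub>R S\<theta> y w)) \<in> borel_measurable \<mu>S3"
      by (intro L2_measurable L2_minus L2_diff L2_scaleR S\<theta>_L2 L1 q(2) y(2))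
    show "S\<theta> ?p \<in> borel_measurable \<mu>S3" by (rule L2_measurable[OF S\<theta>_L2[OF L1[OF p(1)]]])
  qed
  also have "\<dots> \<longleftrightarrow> at t within I = bot \<or> (AE w in \<mu>S3. g w = ?p w)" by (rule S\<theta>_derivative_iff[OF t fg p(1)])
  also have "\<dots> \<longleftrightarrow> function_equation s \<rho> I f c R t"
    unfolding function_equation_def bracket_contact_laplacian[OF t]
  proof (rule contact_laplacian_derivative_iff[OF t fg p, symmetric])
    show "(\<lambda>w. - (?B w - c * R w)) \<in> L2 \<mu>S3" by (intro L2_minus L2_diff L2_scale BL RL)
    have "AE w in \<mu>S3. CL ?q w = -1 * CL q w"
      by (rule contact_lap_scale[OF q(2)])
    then show "AE w in \<mu>S3. - (?B w - c * R w) = CL ?p w"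
      using contact_lap_linear[OF q'(1) y(2), of \<rho> c] q(4) y(4) by eventually_elim simp
  qed
  finally show ?thesis .
qed

lemma euler_arnold_iff:
  assumes R: "\<And>t. t \<in> I \<Longrightarrow> inv\<^sub>E (R t)"
    "\<And>t k. t \<in> I \<Longrightarrow> k \<in> sobolev_inv (s + 1) \<Longrightarrow> cocycle \<phi> (S\<theta> (f t)) (S\<theta> k) = ip (R t) k"
  shows "euler_arnold s \<rho> \<phi> I (\<lambda>t. S\<theta> (f t)) a \<longleftrightarrow>
    (\<forall>t\<in>I. field_equation s \<rho> \<phi> I f (a t) t \<and> (a has_real_derivative 0) (at t within I))"
  unfolding euler_arnold_def Let_def
proof (intro ball_cong refl conj_cong)
  fix t assume t: "t \<in> I"
  note ft = bspec[OF f t]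
  have E: "represents (fst (ext_ad_star s \<rho> \<phi> (S\<theta> (f t), a t) (S\<theta> (f t), a t)))
      (\<lambda>w. bracket (f t) (CL (f t)) w + (- a t) * R t w)"
    "snd (ext_ad_star s \<rho> \<phi> (S\<theta> (f t), a t) (S\<theta> (f t), a t)) = 0"
    by (rule ext_ad_star_represents[OF ft R(1)[OF t]]; rule R(2)[OF t]; assumption)+
  have T: "represents (T_op s \<rho> \<phi> (S\<theta> (f t))) (R t)"
    by (rule T_op_represents[OF ft R(1)[OF t]]; rule R(2)[OF t]; assumption)
  note A = ad_star_represents[OF ft]
  have AE: "AE w in \<mu>S3. fst (ext_ad_star s \<rho> \<phi> (S\<theta> (f t), a t) (S\<theta> (f t), a t)) w
      = ad_star s \<rho> (S\<theta> (f t)) (S\<theta> (f t)) w + (- a t) *\<^sub>R T_op s \<rho> \<phi> (S\<theta> (f t)) w"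
    by (rule represents_combination[OF A T E(1)]) (rule AE_I2, rule refl)
  show "has_L2_derivative \<mu>S3 I (\<lambda>t. S\<theta> (f t)) (\<lambda>w. - fst (ext_ad_star s \<rho> \<phi> (S\<theta> (f t), a t) (S\<theta> (f t), a t)) w) t
    \<longleftrightarrow> field_equation s \<rho> \<phi> I f (a t) t"
    unfolding field_equation_def
  proof (rule has_L2_derivative_cong_AE[OF t])
    show "AE w in \<mu>S3. - fst (ext_ad_star s \<rho> \<phi> (S\<theta> (f t), a t) (S\<theta> (f t), a t)) w
      = - (ad_star s \<rho> (S\<theta> (f t)) (S\<theta> (f t)) w - a t *\<^sub>R T_op s \<rho> \<phi> (S\<theta> (f t)) w)"
      using AE by eventually_elim simp
    show "(\<lambda>w. - fst (ext_ad_star s \<rho> \<phi> (S\<theta> (f t), a t) (S\<theta> (f t), a t)) w) \<in> borel_measurable \<mu>S3"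
      by (intro L2_measurable L2_minus represents_L2[OF E(1)])
    show "(\<lambda>w. - (ad_star s \<rho> (S\<theta> (f t)) (S\<theta> (f t)) w - a t *\<^sub>R T_op s \<rho> \<phi> (S\<theta> (f t)) w)) \<in> borel_measurable \<mu>S3"
      by (intro L2_measurable L2_minus L2_diff L2_scaleR represents_L2[OF A] represents_L2[OF T])
  qed
  show "(a has_real_derivative - snd (ext_ad_star s \<rho> \<phi> (S\<theta> (f t), a t) (S\<theta> (f t), a t))) (at t within I)
    \<longleftrightarrow> (a has_real_derivative 0) (at t within I)"
    unfolding E(2) by simp
qed

end

end

section \<open>Averages over the fibres\<close>

lemma smooth_AE_zero:
  assumes \<psi>: "\<psi> \<in> smooth_S3" and ae: "AE w in \<mu>S3. \<psi> w = 0" and w: "w \<in> S3"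
  shows "\<psi> w = 0"
proof -
  have "AE y in \<mu>S3. foldr frame_deriv \<alpha> \<psi> y = 0" for \<alpha>
  proof (induct \<alpha>)
    case Nil
    show ?case using ae by simp
  next
    case (Cons i \<alpha>)
    have s: "foldr frame_deriv \<alpha> \<psi> \<in> smooth_S3" by (rule smooth_foldr_frame_deriv[OF \<psi>])
    have "wd i (\<lambda>_. 0) (frame_deriv i (foldr frame_deriv \<alpha> \<psi>))"
      by (rule wd_cong_AE[OF wd_smooth[OF s] Cons AE_I2[OF refl] L2_measurable[OF L2_zero]
            L2_measurable[OF smooth_S3_L2[OF smooth_S3_frame_deriv[OF s]]]])
    then show ?case using wd_unique[OF _ wd_const] by simp
  qed
  then have "(LINT y|\<mu>S3. \<bar>foldr frame_deriv \<alpha> \<psi> y\<bar>) = 0" for \<alpha>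
    by (intro integral_eq_zero_AE) simp
  then show ?thesis using smooth_sup_bound[OF \<psi> w] by (simp only: sum.neutral_const mult_zero_right abs_le_zero_iff)
qed

lemma inv_smooth_flow:
  assumes \<psi>: "\<psi> \<in> smooth_S3" and inv: "inv\<^sub>E \<psi>" and w: "w \<in> S3"
  shows "\<psi> (flow A1 t w) = \<psi> w"
proof -
  have z: "frame_deriv A1 \<psi> v = 0" if "v \<in> S3" for v
    by (rule smooth_AE_zero[OF smooth_S3_frame_deriv[OF \<psi>] wd_unique[OF wd_smooth[OF \<psi>] inv] that])
  have "((\<lambda>t. \<psi> (flow A1 t w)) has_real_derivative 0) (at t)" for t
    using smooth_S3_flow[OF \<psi> w, of A1 t] z[of "flow A1 t w"] w by simp
  then have "\<psi> (flow A1 t w) = \<psi> (flow A1 0 w)" by (rule DERIV_isconst_all[OF allI])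
  then show ?thesis by simp
qed

interpretation orbit: pair_sigma_finite lborel \<mu>S3
  by (intro pair_sigma_finite.intro lborel.sigma_finite_measure_axioms \<mu>S3.sigma_finite_measure_axioms)

lemma flow_A1_flow: "flow A1 s (flow A1 t w) = flow A1 (s + t) w"
  by (simp add: flow_A1 cis_mult mult.assoc[symmetric])

lemma flow_pair_measurable [measurable]: "(\<lambda>x. flow A1 (c * fst x) (snd x)) \<in> measurable (lborel \<Otimes>\<^sub>M \<mu>S3) \<mu>S3"
proof -
  have [measurable]: "(\<lambda>w::c2. w) \<in> measurable \<mu>S3 borel" by (rule continuous_measurable_\<mu>S3[OF continuous_on_id])
  have [measurable]: "frame A1 \<in> measurable borel borel"
    by (rule borel_measurable_continuous_onI[OF linear_continuous_on[OF frame_bounded_linear]])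
  have "(\<lambda>x. flow A1 (c * fst x) (snd x)) \<in> measurable (lborel \<Otimes>\<^sub>M \<mu>S3) (restrict_space borel S3)"
  proof (rule measurable_restrict_space2)
    show "(\<lambda>x. flow A1 (c * fst x) (snd x)) \<in> space (lborel \<Otimes>\<^sub>M \<mu>S3) \<rightarrow> S3"
      by (auto simp: space_pair_measure)
    show "(\<lambda>x. flow A1 (c * fst x) (snd x)) \<in> borel_measurable (lborel \<Otimes>\<^sub>M \<mu>S3)"
      unfolding flow_def by measurable
  qed
  then show ?thesis by (simp add: measurable_cong_sets[OF refl sets_\<mu>S3])
qed

lemma flow_L2:
  fixes R :: "c2 \<Rightarrow> real"
  assumes "R \<in> L2 \<mu>S3"
  shows "(\<lambda>w. R (flow A1 t w)) \<in> L2 \<mu>S3"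
    "(LINT w|\<mu>S3. (R (flow A1 t w))\<^sup>2) = (LINT w|\<mu>S3. (R w)\<^sup>2)"
proof -
  have m: "flow A1 t \<in> measurable \<mu>S3 \<mu>S3" by (rule isometry_measurable_\<mu>S3[OF flow_linear norm_flow])
  have d: "distr \<mu>S3 \<mu>S3 (flow A1 t) = \<mu>S3" by (rule distr_\<mu>S3_isometry[OF flow_linear norm_flow])
  have R: "R \<in> borel_measurable \<mu>S3" by (rule L2_measurable[OF assms])
  have "integrable \<mu>S3 (\<lambda>w. (R (flow A1 t w))\<^sup>2)"
    by (rule integrable_distr[OF m]) (simp add: d L2_integrable_sq[OF assms])
  then show "(\<lambda>w. R (flow A1 t w)) \<in> L2 \<mu>S3"
    unfolding L2_real_iff using measurable_compose[OF m R] by simp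
  show "(LINT w|\<mu>S3. (R (flow A1 t w))\<^sup>2) = (LINT w|\<mu>S3. (R w)\<^sup>2)"
    by (rule integral_\<mu>S3_isometry[OF flow_linear norm_flow, of "\<lambda>w. (R w)\<^sup>2"]) (use R in measurable)
qed

text \<open>The hypothesis on the integrals is met by functions of \<open>flow A1 \<tau> w\<close>, since the flow preserves the
  measure.\<close>

lemma orbit_integrable_sections:
  fixes q :: "real \<Rightarrow> c2 \<Rightarrow> real"
  assumes m: "(\<lambda>x. q (fst x) (snd x)) \<in> borel_measurable (lborel \<Otimes>\<^sub>M \<mu>S3)"
    and q: "\<And>\<tau>. integrable \<mu>S3 (q \<tau>)" "\<And>\<tau> w. 0 \<le> q \<tau> w" "\<And>\<tau>. (LINT w|\<mu>S3. q \<tau> w) = C"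
  shows "integrable (lborel \<Otimes>\<^sub>M \<mu>S3) (\<lambda>x. indicator {0..2*pi} (fst x) * q (fst x) (snd x))"
proof (rule orbit.Fubini_integrable)
  show "(\<lambda>x. indicator {0..2*pi} (fst x) * q (fst x) (snd x)) \<in> borel_measurable (lborel \<Otimes>\<^sub>M \<mu>S3)"
    using m by measurable
  have "(LINT w|\<mu>S3. norm (indicator {0..2*pi} (fst (\<tau>, w)) * q (fst (\<tau>, w)) (snd (\<tau>, w)))) = indicator {0..2*pi} \<tau> * C" for \<tau>
    using q(2,3)[of \<tau>] by (simp add: abs_mult)
  moreover have "integrable lborel (\<lambda>\<tau>. indicator {0..2*pi} \<tau> * C :: real)" by simp
  ultimately show "integrable lborel (\<lambda>\<tau>. LINT w|\<mu>S3. norm (indicator {0..2*pi} (fst (\<tau>, w)) * q (fst (\<tau>, w)) (snd (\<tau>, w))))"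
    by (simp only:)
  show "AE \<tau> in lborel. integrable \<mu>S3 (\<lambda>w. indicator {0..2*pi} (fst (\<tau>, w)) * q (fst (\<tau>, w)) (snd (\<tau>, w)))"
    using q(1) by simp
qed

lemma orbit_integrable:
  fixes R S :: "c2 \<Rightarrow> real"
  assumes R: "R \<in> L2 \<mu>S3" and S: "S \<in> L2 \<mu>S3"
  shows "integrable (lborel \<Otimes>\<^sub>M \<mu>S3) (\<lambda>x. indicator {0..2*pi} (fst x) * (R (flow A1 (c * fst x) (snd x)))\<^sup>2)"
    and "integrable (lborel \<Otimes>\<^sub>M \<mu>S3) (\<lambda>x. indicator {0..2*pi} (fst x) * (R (flow A1 (c * fst x) (snd x)) * S (snd x)))"
proof -
  have [measurable]: "R \<in> borel_measurable \<mu>S3" "S \<in> borel_measurable \<mu>S3"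
    using R S by (auto intro: L2_measurable)
  show 1: "integrable (lborel \<Otimes>\<^sub>M \<mu>S3) (\<lambda>x. indicator {0..2*pi} (fst x) * (R (flow A1 (c * fst x) (snd x)))\<^sup>2)"
    by (rule orbit_integrable_sections[of "\<lambda>\<tau> w. (R (flow A1 (c * \<tau>) w))\<^sup>2", OF _ L2_integrable_sq[OF flow_L2(1)[OF R]] _ flow_L2(2)[OF R]])
       auto
  have 2: "integrable (lborel \<Otimes>\<^sub>M \<mu>S3) (\<lambda>x. indicator {0..2*pi} (fst x) * (S (snd x))\<^sup>2)"
    by (rule orbit_integrable_sections[of "\<lambda>\<tau> w. (S w)\<^sup>2", OF _ L2_integrable_sq[OF S] _ refl]) auto
  show "integrable (lborel \<Otimes>\<^sub>M \<mu>S3) (\<lambda>x. indicator {0..2*pi} (fst x) * (R (flow A1 (c * fst x) (snd x)) * S (snd x)))"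
  proof (rule Bochner_Integration.integrable_bound[OF Bochner_Integration.integrable_add[OF 1 2]])
    show "(\<lambda>x. indicator {0..2*pi} (fst x) * (R (flow A1 (c * fst x) (snd x)) * S (snd x))) \<in> borel_measurable (lborel \<Otimes>\<^sub>M \<mu>S3)"
      by measurable
    have ab: "\<bar>a * b\<bar> \<le> a\<^sup>2 + b\<^sup>2" for a b :: real
      using sum_squares_bound[of "\<bar>a\<bar>" "\<bar>b\<bar>"] abs_ge_zero[of "a * b"] unfolding abs_mult power2_abs by linarith
    show "AE x in lborel \<Otimes>\<^sub>M \<mu>S3. norm (indicator {0..2*pi} (fst x) * (R (flow A1 (c * fst x) (snd x)) * S (snd x)))
        \<le> norm (indicator {0..2*pi} (fst x) * (R (flow A1 (c * fst x) (snd x)))\<^sup>2 + indicator {0..2*pi} (fst x) * (S (snd x))\<^sup>2)"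
      by (rule AE_I2) (simp add: indicator_def ab)
  qed
qed

lemma orbit_Fubini:
  fixes R S :: "c2 \<Rightarrow> real"
  assumes R: "R \<in> L2 \<mu>S3" and S: "S \<in> L2 \<mu>S3"
  shows "(LINT w|\<mu>S3. (LINT \<tau>|lborel. indicator {0..2*pi} \<tau> * R (flow A1 (c * \<tau>) w)) * S w)
    = (LINT \<tau>|lborel. indicator {0..2*pi} \<tau> * (LINT w|\<mu>S3. R (flow A1 (c * \<tau>) w) * S w))"
proof -
  have "(LINT w|\<mu>S3. LINT \<tau>|lborel. indicator {0..2*pi} \<tau> * (R (flow A1 (c * \<tau>) w) * S w))
      = (LINT \<tau>|lborel. LINT w|\<mu>S3. indicator {0..2*pi} \<tau> * (R (flow A1 (c * \<tau>) w) * S w))"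
    using orbit.Fubini_integral[of "\<lambda>\<tau> w. indicator {0..2*pi} \<tau> * (R (flow A1 (c * \<tau>) w) * S w)"]
      orbit_integrable(2)[OF R S, of c] by (simp add: case_prod_beta')
  moreover have "(LINT \<tau>|lborel. indicator {0..2*pi} \<tau> * (R (flow A1 (c * \<tau>) w) * S w))
      = (LINT \<tau>|lborel. indicator {0..2*pi} \<tau> * R (flow A1 (c * \<tau>) w)) * S w" for w
    by (simp add: mult.assoc[symmetric])
  ultimately show ?thesis by (simp only: integral_mult_right_zero)
qed

lemma fibre_average_eq: "fibre_average R w = 1 / (2 * pi) * (LINT \<tau>|lborel. indicator {0..2*pi} \<tau> * R (flow A1 \<tau> w))"
  by (simp add: fibre_average_def set_lebesgue_integral_def flow_A1)

text \<open>By the Cauchy-Schwarz inequality on each fibre.\<close>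

lemma fibre_average_L2:
  assumes R: "R \<in> L2 \<mu>S3" shows "fibre_average R \<in> L2 \<mu>S3"
proof -
  let ?F = "\<lambda>w. LINT \<tau>|lborel. indicator {0..2*pi} \<tau> * R (flow A1 \<tau> w)"
  let ?i = "indicator {0..2*pi} :: real \<Rightarrow> real"
  have [measurable]: "R \<in> borel_measurable \<mu>S3" by (rule L2_measurable[OF R])
  have [measurable]: "(\<lambda>x. R (flow A1 (snd x) (fst x))) \<in> borel_measurable (\<mu>S3 \<Otimes>\<^sub>M lborel)"
    using measurable_compose[OF measurable_compose[OF measurable_pair_swap' flow_pair_measurable[of 1]], of R borel]
    by (simp add: case_prod_beta')
  have F: "?F \<in> borel_measurable \<mu>S3"
    by (rule lborel.borel_measurable_lebesgue_integral) (simp add: case_prod_beta')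
  have int: "integrable (lborel \<Otimes>\<^sub>M \<mu>S3) (\<lambda>(\<tau>, w). ?i \<tau> * (R (flow A1 \<tau> w))\<^sup>2)"
    using orbit_integrable(1)[OF R R, of 1] by (simp add: case_prod_beta')
  have ii: "?i \<tau> * ?i \<tau> = ?i \<tau>" for \<tau> by (simp add: indicator_def)
  have i: "?i \<in> L2 lborel" unfolding L2_real_iff by (simp add: power2_eq_square ii)
  have "AE w in \<mu>S3. (?F w)\<^sup>2 \<le> 2 * pi * (LINT \<tau>|lborel. ?i \<tau> * (R (flow A1 \<tau> w))\<^sup>2)"
    using orbit.AE_integrable_snd[OF int] AE_space
  proof eventually_elim
    case (elim w)
    have [measurable]: "(\<lambda>\<tau>. R (flow A1 \<tau> w)) \<in> borel_measurable lborel"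
      using measurable_compose[OF measurable_Pair1[OF flow_pair_measurable[of 1] elim(2)], of R borel] by simp
    have sq: "(?i \<tau> * R (flow A1 \<tau> w))\<^sup>2 = ?i \<tau> * (R (flow A1 \<tau> w))\<^sup>2" for \<tau>
      by (simp add: indicator_def)
    have R': "(\<lambda>\<tau>. ?i \<tau> * R (flow A1 \<tau> w)) \<in> L2 lborel"
      unfolding L2_real_iff sq using elim(1) by simp
    have "(LINT \<tau>|lborel. (?i \<tau>)\<^sup>2) = 2 * pi" by (simp add: power2_eq_square ii)
    then show ?case
      using L2_Cauchy_Schwarz[OF i R'] unfolding sq by (simp add: mult.assoc[symmetric] ii)
  qed
  then have le: "AE w in \<mu>S3. norm ((fibre_average R w)\<^sup>2)
      \<le> norm ((1 / (2 * pi))\<^sup>2 * (2 * pi * (LINT \<tau>|lborel. ?i \<tau> * (R (flow A1 \<tau> w))\<^sup>2)))"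
  proof eventually_elim
    case (elim w)
    then have "(1 / (2 * pi))\<^sup>2 * (?F w)\<^sup>2 \<le> (1 / (2 * pi))\<^sup>2 * (2 * pi * (LINT \<tau>|lborel. ?i \<tau> * (R (flow A1 \<tau> w))\<^sup>2))"
      by (rule mult_left_mono) simp
    then have le: "(fibre_average R w)\<^sup>2 \<le> (1 / (2 * pi))\<^sup>2 * (2 * pi * (LINT \<tau>|lborel. ?i \<tau> * (R (flow A1 \<tau> w))\<^sup>2))"
      unfolding fibre_average_eq power_mult_distrib .
    show ?case
      by (rule order_trans[OF eq_refl order_trans[OF le]]) (simp_all only: real_norm_def abs_ge_self abs_of_nonneg zero_le_power2)
  qed
  have m: "fibre_average R \<in> borel_measurable \<mu>S3"
    unfolding fibre_average_eq[abs_def] using F by measurable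
  have "integrable \<mu>S3 (\<lambda>w. (1 / (2 * pi))\<^sup>2 * (2 * pi * (LINT \<tau>|lborel. ?i \<tau> * (R (flow A1 \<tau> w))\<^sup>2)))"
    by (intro integrable_mult_right) (rule orbit.integrable_snd[OF int])
  then have "integrable \<mu>S3 (\<lambda>w. (fibre_average R w)\<^sup>2)"
    by (rule Bochner_Integration.integrable_bound[OF _ _ le]) (use m in measurable)
  then show ?thesis using m unfolding L2_real_iff by blast
qed

text \<open>Averaging is self-adjoint because the flow preserves the measure.\<close>

lemma ip_fibre_average:
  assumes R: "R \<in> L2 \<mu>S3" and S: "S \<in> L2 \<mu>S3"
  shows "ip (fibre_average R) S = 1 / (2 * pi) * (LINT \<tau>|lborel. indicator {0..2*pi} \<tau> * ip R (\<lambda>w. S (flow A1 (- \<tau>) w)))"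
proof -
  have "ip (\<lambda>w. R (flow A1 \<tau> w)) S = ip R (\<lambda>w. S (flow A1 (- \<tau>) w))" for \<tau>
  proof -
    have "(\<lambda>w. R (flow A1 \<tau> w) * S w) \<in> borel_measurable \<mu>S3"
      using L2_measurable[OF flow_L2(1)[OF R]] L2_measurable[OF S] by measurable
    from integral_\<mu>S3_isometry[OF flow_linear norm_flow this, of A1 "- \<tau>"]
    show ?thesis unfolding ip_def by (simp add: flow_A1_flow)
  qed
  then show ?thesis
    using orbit_Fubini[OF R S, of 1]
    unfolding ip_def fibre_average_eq by (simp add: mult.assoc)
qed

lemma fibre_average_ip:
  assumes R: "R \<in> L2 \<mu>S3" and k: "inv\<^sub>E k" shows "ip (fibre_average R) k = ip R k"
proof -
  note kL = wdD(1)[OF k]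
  have *: "ip (fibre_average R) (proj n k) = ip R (proj n k)" for n
  proof -
    have "ip R (\<lambda>w. proj n k (flow A1 (- \<tau>) w)) = ip R (proj n k)" for \<tau>
      by (rule ip_cong[OF refl inv_smooth_flow[OF proj_smooth[OF kL] inv_proj[OF k]]])
    then show ?thesis
      by (simp add: ip_fibre_average[OF R proj_L2[OF kL]])
  qed
  have "(\<lambda>n. ip (fibre_average R) (proj n k)) \<longlonglongrightarrow> ip (fibre_average R) k"
    by (rule ip_tendsto[OF L2_tendsto_const _ _ proj_tendsto[OF kL] proj_L2[OF kL] kL]) (rule fibre_average_L2[OF R])+
  moreover have "(\<lambda>n. ip R (proj n k)) \<longlonglongrightarrow> ip R k"
    by (rule ip_tendsto[OF L2_tendsto_const _ _ proj_tendsto[OF kL] proj_L2[OF kL] kL]) (rule R)+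
  ultimately show ?thesis unfolding * by (rule LIMSEQ_unique)
qed

text \<open>By self-adjointness, testing the average against \<open>E p\<close> amounts to testing \<open>R\<close> against the integrals of
  \<open>E p\<close> along full orbits of \<open>E\<close>, which vanish because the orbits are closed.\<close>

lemma inv_fibre_average:
  assumes R: "R \<in> L2 \<mu>S3" shows "inv\<^sub>E (fibre_average R)"
proof (rule wdI[OF fibre_average_L2[OF R] L2_zero])
  fix p :: "c2 \<Rightarrow> real" assume "real_polynomial_function p"
  then have p: "p \<in> smooth_S3" by (rule real_polynomial_smooth_S3)
  let ?e = "frame_deriv A1 p"
  have e: "?e \<in> smooth_S3" by (rule smooth_S3_frame_deriv[OF p])
  have z: "(LINT \<tau>|lborel. indicator {0..2*pi} \<tau> * ?e (flow A1 (- \<tau>) w)) = 0" if w: "w \<in> S3" for w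
  proof -
    have d: "((\<lambda>\<tau>. - \<psi> (flow A1 (- \<tau>) w)) has_real_derivative frame_deriv A1 \<psi> (flow A1 (- \<tau>) w)) (at \<tau>)"
      if "\<psi> \<in> smooth_S3" for \<psi> \<tau>
    proof -
      have "((\<lambda>\<tau>. \<psi> (flow A1 (- \<tau>) w)) has_real_derivative frame_deriv A1 \<psi> (flow A1 (- \<tau>) w) * (- 1)) (at \<tau>)"
        by (rule DERIV_chain2[OF smooth_S3_flow[OF that w]]) (auto intro!: derivative_eq_intros)
      from DERIV_minus[OF this] show ?thesis by simp
    qed
    have "(LINT \<tau>|lborel. ?e (flow A1 (- \<tau>) w) * indicator {0..2*pi} \<tau>)
        = - p (flow A1 (- (2 * pi)) w) - (- p (flow A1 (- 0) w))"
    proof (rule integral_FTC_Icc_real[OF _ d[OF p]])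
      show "isCont (\<lambda>\<tau>. ?e (flow A1 (- \<tau>) w)) \<tau>" for \<tau>
        using DERIV_isCont[OF DERIV_minus[OF d[OF e]]] by simp
    qed simp
    moreover have "flow A1 (- (2 * pi)) w = w" by (simp add: flow_def)
    ultimately have "(LINT \<tau>|lborel. ?e (flow A1 (- \<tau>) w) * indicator {0..2*pi} \<tau>) = 0" by simp
    then show ?thesis by (simp only: mult.commute[of _ "indicator {0..2*pi} _"])
  qed
  have "(LINT \<tau>|lborel. indicator {0..2*pi} \<tau> * ip R (\<lambda>w. ?e (flow A1 (- \<tau>) w)))
      = (LINT w|\<mu>S3. (LINT \<tau>|lborel. indicator {0..2*pi} \<tau> * ?e (flow A1 (- \<tau>) w)) * R w)"
    using orbit_Fubini[OF smooth_S3_L2[OF e] R, of "-1"] by (simp add: ip_def mult.commute)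
  also have "\<dots> = (LINT w|\<mu>S3. 0)"
    by (rule Bochner_Integration.integral_cong[OF refl]) (simp add: z)
  finally show "ip (fibre_average R) ?e = - ip (\<lambda>_. 0) p"
    using ip_fibre_average[OF R smooth_S3_L2[OF e]] by simp
qed

section \<open>The Hopf fibration and the Laplace-Beltrami operator\<close>

text \<open>Half of the derivative of \<open>hopf\<close> at \<open>w\<close> in the direction \<open>\<alpha> E\<^sub>2 + \<beta> E\<^sub>3\<close>, for the complex number
  \<open>\<alpha> + \<i> \<beta>\<close>.\<close>

definition hopf_tangent :: "complex \<Rightarrow> c2 \<Rightarrow> cr" where
  "hopf_tangent \<beta> w = ((cnj \<beta> * (fst w)\<^sup>2 - \<beta> * (cnj (snd w))\<^sup>2) / 2, - Re (cnj \<beta> * fst w * snd w))"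

text \<open>Horizontal great circles of \<open>S\<^sup>3\<close>, which \<open>hopf\<close> maps to great circles of \<open>S\<^sup>2\<close> at twice the angle.\<close>

definition lift_circle :: "real \<Rightarrow> real \<Rightarrow> c2 \<Rightarrow> real \<Rightarrow> c2" where
  "lift_circle \<alpha> \<beta> w s = cos s *\<^sub>R w + sin s *\<^sub>R (\<alpha> *\<^sub>R frame A2 w + \<beta> *\<^sub>R frame A3 w)"

lemma c2_cases:
  fixes w :: c2 obtains a b c d where "w = (Complex a b, Complex c d)"
  by (metis complex_surj prod.collapse)

lemma hopf_real: "hopf w = (fst w * cnj (snd w),
    (Re (fst w) * Re (fst w) + Im (fst w) * Im (fst w) - Re (snd w) * Re (snd w) - Im (snd w) * Im (snd w)) / 2)"
  unfolding hopf_def cmod_power2 by (simp add: power2_eq_square)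

lemma S3_coordinates: "(Complex a b, Complex c d) \<in> S3 \<Longrightarrow> a\<^sup>2 + b\<^sup>2 + c\<^sup>2 + d\<^sup>2 = 1"
  by (simp add: norm_Pair cmod_def)

lemma hopf_complex_line:
  "hopf (C *\<^sub>R w + S *\<^sub>R (\<alpha> *\<^sub>R frame A2 w + \<beta> *\<^sub>R frame A3 w))
    = (C\<^sup>2 - S\<^sup>2 * (\<alpha>\<^sup>2 + \<beta>\<^sup>2)) *\<^sub>R hopf w
      + (2 * C * S) *\<^sub>R (\<alpha> *\<^sub>R hopf_tangent 1 w + \<beta> *\<^sub>R hopf_tangent \<i> w)"
proof -
  obtain a b c d where w: "w = (Complex a b, Complex c d)" by (rule c2_cases)
  show ?thesis
    unfolding w by (simp add: hopf_real hopf_tangent_def frame.simps complex_eq_iff field_simps power2_eq_square power3_eq_cube)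
qed

lemma hopf_lift_circle:
  assumes "\<alpha>\<^sup>2 + \<beta>\<^sup>2 = 1"
  shows "hopf (lift_circle \<alpha> \<beta> w s) = cos (2 * s) *\<^sub>R hopf w
    + sin (2 * s) *\<^sub>R (\<alpha> *\<^sub>R hopf_tangent 1 w + \<beta> *\<^sub>R hopf_tangent \<i> w)"
  unfolding lift_circle_def hopf_complex_line assms unfolding cos_double sin_double by (simp add: mult.commute mult.left_commute)

lemma norm_hopf: "norm (hopf w) = (norm w)\<^sup>2 / 2"
proof -
  have w: "(norm w)\<^sup>2 = (cmod (fst w))\<^sup>2 + (cmod (snd w))\<^sup>2" by (simp add: norm_prod_def)
  have "(norm (hopf w))\<^sup>2 = ((norm w)\<^sup>2 / 2)\<^sup>2"
    unfolding w by (simp add: hopf_def norm_Pair norm_mult power_divide field_simps power2_eq_square)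
  then show ?thesis by (simp add: power2_eq_iff_nonneg)
qed

lemma hopf_frame_inner:
  assumes "w \<in> S3"
  shows "hopf w \<bullet> hopf_tangent 1 w = 0" "hopf w \<bullet> hopf_tangent \<i> w = 0" "hopf_tangent 1 w \<bullet> hopf_tangent \<i> w = 0"
    "hopf_tangent 1 w \<bullet> hopf_tangent 1 w = 1/4" "hopf_tangent \<i> w \<bullet> hopf_tangent \<i> w = 1/4"
proof -
  obtain a b c d where w: "w = (Complex a b, Complex c d)" by (rule c2_cases)
  have n: "a\<^sup>2 + b\<^sup>2 + c\<^sup>2 + d\<^sup>2 = 1" using assms unfolding w by (rule S3_coordinates)
  show "hopf w \<bullet> hopf_tangent 1 w = 0" "hopf w \<bullet> hopf_tangent \<i> w = 0" "hopf_tangent 1 w \<bullet> hopf_tangent \<i> w = 0"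
    unfolding w by (simp_all add: hopf_real hopf_tangent_def inner_prod_def inner_complex_def field_simps power2_eq_square)
  have "hopf_tangent 1 w \<bullet> hopf_tangent 1 w = (a\<^sup>2 + b\<^sup>2 + c\<^sup>2 + d\<^sup>2)\<^sup>2 / 4"
    "hopf_tangent \<i> w \<bullet> hopf_tangent \<i> w = (a\<^sup>2 + b\<^sup>2 + c\<^sup>2 + d\<^sup>2)\<^sup>2 / 4"
    unfolding w by (simp_all add: hopf_real hopf_tangent_def inner_prod_def inner_complex_def field_simps power2_eq_square)
  then show "hopf_tangent 1 w \<bullet> hopf_tangent 1 w = 1/4" "hopf_tangent \<i> w \<bullet> hopf_tangent \<i> w = 1/4"
    by (simp_all add: n)
qed

lemma hopf_frame_expansion:
  assumes "w \<in> S3"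
  shows "y = (4 * (hopf w \<bullet> y)) *\<^sub>R hopf w + (4 * (hopf_tangent 1 w \<bullet> y)) *\<^sub>R hopf_tangent 1 w
    + (4 * (hopf_tangent \<i> w \<bullet> y)) *\<^sub>R hopf_tangent \<i> w"
proof -
  obtain a b c d where w: "w = (Complex a b, Complex c d)" by (rule c2_cases)
  obtain p q r where y: "y = (Complex p q, r)" by (metis complex_surj prod.collapse)
  have n: "(a\<^sup>2 + b\<^sup>2 + c\<^sup>2 + d\<^sup>2)\<^sup>2 = 1" using S3_coordinates assms unfolding w by simp
  have "(a\<^sup>2 + b\<^sup>2 + c\<^sup>2 + d\<^sup>2)\<^sup>2 *\<^sub>R y = (4 * (hopf w \<bullet> y)) *\<^sub>R hopf w + (4 * (hopf_tangent 1 w \<bullet> y)) *\<^sub>R hopf_tangent 1 w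
    + (4 * (hopf_tangent \<i> w \<bullet> y)) *\<^sub>R hopf_tangent \<i> w"
    unfolding w y by (simp add: hopf_real hopf_tangent_def inner_prod_def inner_complex_def complex_eq_iff field_simps power2_eq_square)
  then show ?thesis unfolding n by simp
qed

lemma horizontal_frame_anticommute:
  assumes "\<alpha>\<^sup>2 + \<beta>\<^sup>2 = 1" and e: "e = \<alpha> *\<^sub>R frame A2 w + \<beta> *\<^sub>R frame A3 w"
  shows "\<alpha> *\<^sub>R frame A2 e + \<beta> *\<^sub>R frame A3 e = - w" "norm e = norm w" "e \<bullet> w = 0"
proof -
  have "\<alpha> *\<^sub>R frame A2 e + \<beta> *\<^sub>R frame A3 e = - ((\<alpha>\<^sup>2 + \<beta>\<^sup>2) *\<^sub>R w)"
    unfolding e by (simp add: frame.simps prod_eq_iff complex_eq_iff algebra_simps power2_eq_square)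
  then show "\<alpha> *\<^sub>R frame A2 e + \<beta> *\<^sub>R frame A3 e = - w" by (simp add: assms(1))
  show "e \<bullet> w = 0" unfolding e by (simp add: inner_add_left)
  have o: "frame A2 w \<bullet> frame A3 w = 0"
    by (simp add: frame.simps inner_prod_def inner_complex_def)
  have n: "frame i w \<bullet> frame i w = (norm w)\<^sup>2" for i using power2_norm_eq_inner[of "frame i w"] by simp
  have "(norm e)\<^sup>2 = (\<alpha>\<^sup>2 + \<beta>\<^sup>2) * (norm w)\<^sup>2"
    unfolding power2_norm_eq_inner[of e] unfolding e
    by (simp add: inner_add_left inner_add_right inner_commute[of "frame A3 w" "frame A2 w"] o n algebra_simps power2_eq_square)
  then show "norm e = norm w" by (simp add: assms(1))
qed

lemma lift_circle_derivative:
  assumes \<psi>: "\<psi> \<in> smooth_S3" and w: "w \<in> S3" and ab: "\<alpha>\<^sup>2 + \<beta>\<^sup>2 = 1"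
  shows "lift_circle \<alpha> \<beta> w s \<in> S3"
    "((\<lambda>s. \<psi> (lift_circle \<alpha> \<beta> w s)) has_real_derivative
      \<alpha> * frame_deriv A2 \<psi> (lift_circle \<alpha> \<beta> w s) + \<beta> * frame_deriv A3 \<psi> (lift_circle \<alpha> \<beta> w s)) (at s)"
proof -
  define e where "e = \<alpha> *\<^sub>R frame A2 w + \<beta> *\<^sub>R frame A3 w"
  note e = horizontal_frame_anticommute[OF ab e_def]
  have c: "lift_circle \<alpha> \<beta> w = (\<lambda>s. cos s *\<^sub>R w + sin s *\<^sub>R e)" by (simp add: lift_circle_def e_def fun_eq_iff)
  show S: "lift_circle \<alpha> \<beta> w s \<in> S3" for s using norm_cos_sin[OF e(2,3), of s] w by (simp add: c)
  let ?v = "\<alpha> *\<^sub>R frame A2 (lift_circle \<alpha> \<beta> w s) + \<beta> *\<^sub>R frame A3 (lift_circle \<alpha> \<beta> w s)"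
  have "?v = cos s *\<^sub>R e + sin s *\<^sub>R (\<alpha> *\<^sub>R frame A2 e + \<beta> *\<^sub>R frame A3 e)"
    unfolding c by (simp add: linear_add[OF frame_linear] linear_scale[OF frame_linear] algebra_simps e_def)
  then have v: "?v = cos s *\<^sub>R e - sin s *\<^sub>R w" by (simp add: e(1))
  have "(lift_circle \<alpha> \<beta> w has_vector_derivative ?v) (at s)"
    unfolding c v[unfolded c] by (auto intro!: derivative_eq_intros simp: has_vector_derivative_def algebra_simps)
  from smooth_S3_chain[OF \<psi> always_eventually[OF allI[OF S]] this]
  show "((\<lambda>s. \<psi> (lift_circle \<alpha> \<beta> w s)) has_real_derivative
      \<alpha> * frame_deriv A2 \<psi> (lift_circle \<alpha> \<beta> w s) + \<beta> * frame_deriv A3 \<psi> (lift_circle \<alpha> \<beta> w s)) (at s)"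
    by (simp add: sphere_deriv_def inner_add_left frame_orthonormal(1)[OF S])
qed

lemma second_deriv_eqI:
  assumes f: "\<forall>\<^sub>F t in nhds 0. (f has_real_derivative f' t) (at t)" and f': "(f' has_real_derivative d) (at 0)"
  shows "(deriv ^^ 2) f 0 = d"
proof -
  have "\<forall>\<^sub>F t in nhds 0. deriv f t = f' t" using f by eventually_elim (rule DERIV_imp_deriv)
  then have "deriv (deriv f) 0 = deriv f' 0" by (rule deriv_cong_ev) simp
  then show ?thesis using DERIV_imp_deriv[OF f'] by (simp add: numeral_2_eq_2)
qed

lemma half_arctan_derivative:
  assumes "0 < 1 + t * B"
  shows "((\<lambda>t. arctan (t * p / (1 + t * B)) / 2) has_real_derivative p / 2 / ((1 + t * B)\<^sup>2 + (t * p)\<^sup>2)) (at t)"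
proof -
  obtain K N where K: "K = 1 + t * B" "K \<noteq> 0" and N: "N = K\<^sup>2 + (t * p)\<^sup>2" using assms by simp
  have 1: "((\<lambda>t. t * p) has_real_derivative p) (at t)" by (auto intro!: derivative_eq_intros)
  have 2: "((\<lambda>t. 1 + t * B) has_real_derivative B) (at t)" by (auto intro!: derivative_eq_intros)
  have 3: "((\<lambda>t. t * p / (1 + t * B)) has_real_derivative p / (K * K)) (at t)"
    by (rule DERIV_cong[OF DERIV_divide[OF 1 2]]) (use K in \<open>simp_all add: algebra_simps\<close>)
  have "1 + (t * p / K)\<^sup>2 = N / K\<^sup>2" using K(2) by (simp add: N power_divide add_divide_distrib)
  then have "inverse (1 + (t * p / (1 + t * B))\<^sup>2) * (p / (K * K)) / 2 = p / 2 / N"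
    using K(2) by (simp add: K(1)[symmetric] power2_eq_square)
  then have "inverse (1 + (t * p / (1 + t * B))\<^sup>2) * (p / (K * K)) / 2 = p / 2 / ((1 + t * B)\<^sup>2 + (t * p)\<^sup>2)"
    by (simp only: N K(1))
  then show ?thesis by (rule DERIV_cong[OF DERIV_cdivide[OF DERIV_chain2[OF DERIV_arctan 3]]])
qed

text \<open>The reparametrization has first derivative \<open>p / 2\<close> and second derivative \<open>- p B\<close> at \<open>0\<close>.\<close>

lemma second_derivative_reparametrized:
  fixes G H f :: "real \<Rightarrow> real"
  assumes G: "\<And>u. (G has_real_derivative H u) (at u)" and H: "(H has_real_derivative K) (at 0)"
    and f: "\<And>t. 0 < 1 + t * B \<Longrightarrow> f t = G (arctan (t * p / (1 + t * B)) / 2)"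
  shows "(deriv ^^ 2) f 0 = K * (p / 2)\<^sup>2 - H 0 * (p * B)"
proof (rule second_deriv_eqI)
  define s where "s t = arctan (t * p / (1 + t * B)) / 2" for t
  define s' where "s' t = p / 2 / ((1 + t * B)\<^sup>2 + (t * p)\<^sup>2)" for t
  have ds: "(s has_real_derivative s' t) (at t)" if "0 < 1 + t * B" for t
    unfolding s_def[abs_def] s'_def by (rule half_arctan_derivative[OF that])
  have open_pos: "open {t. 0 < 1 + t * B}" by (intro open_Collect_less continuous_intros)
  have "((\<lambda>t. f t) has_real_derivative H (s t) * s' t) (at t)" if t: "0 < 1 + t * B" for t
  proof (rule has_field_derivative_transform_within_open[OF _ open_pos])
    show "((\<lambda>t. G (s t)) has_real_derivative H (s t) * s' t) (at t)"
      by (rule DERIV_chain2[OF G ds[OF t]])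
  qed (use t in \<open>simp_all add: f s_def\<close>)
  moreover have "\<forall>\<^sub>F t in nhds 0. 0 < 1 + t * B"
    using eventually_nhds_in_open[OF open_pos, of 0] by simp
  ultimately show "\<forall>\<^sub>F t in nhds 0. (f has_real_derivative H (s t) * s' t) (at t)"
    by (simp add: eventually_mono)
  have s0: "s 0 = 0" "s' 0 = p / 2" by (simp_all add: s_def s'_def)
  have N: "((\<lambda>t. (1 + t * B)\<^sup>2 + (t * p)\<^sup>2) has_real_derivative 2 * B) (at 0)"
    by (auto intro!: derivative_eq_intros)
  have sd: "(s' has_real_derivative - (p * B)) (at 0)"
    unfolding s'_def[abs_def] by (rule DERIV_cong[OF DERIV_divide[OF DERIV_const N]]) simp_all
  have H0: "(H has_real_derivative K) (at (s 0))" using H by (simp add: s0)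
  have d0: "(s has_real_derivative p / 2) (at 0)" using ds[of 0] by (simp add: s0)
  have "((\<lambda>t. H (s t)) has_real_derivative K * (p / 2)) (at 0)" by (rule DERIV_chain2[OF H0 d0])
  from DERIV_mult[OF this sd]
  show "((\<lambda>t. H (s t) * s' t) has_real_derivative K * (p / 2)\<^sup>2 - H 0 * (p * B)) (at 0)"
    by (rule DERIV_cong) (simp add: s0 power2_eq_square)
qed

text \<open>The radial projection of the line \<open>hopf w + t b\<close> runs along a great circle; its angle is read off from
  the components \<open>1 + t B\<close> and \<open>t p\<close> in the directions of \<open>hopf w\<close> and of the tangential part of \<open>b\<close>.\<close>

lemma lift_circle_direction:
  assumes ab: "\<alpha>\<^sup>2 + \<beta>\<^sup>2 = 1" and w: "w \<in> S3" and t: "0 < 1 + t * B"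
    and b: "b = B *\<^sub>R hopf w + (p * \<alpha>) *\<^sub>R hopf_tangent 1 w + (p * \<beta>) *\<^sub>R hopf_tangent \<i> w"
  shows "(1/2 / norm (hopf w + t *\<^sub>R b)) *\<^sub>R (hopf w + t *\<^sub>R b)
    = hopf (lift_circle \<alpha> \<beta> w (arctan (t * p / (1 + t * B)) / 2))"
proof -
  define e where "e = \<alpha> *\<^sub>R frame A2 w + \<beta> *\<^sub>R frame A3 w"
  note e = horizontal_frame_anticommute[OF ab e_def]
  define v where "v = \<alpha> *\<^sub>R hopf_tangent 1 w + \<beta> *\<^sub>R hopf_tangent \<i> w"
  obtain K q where K: "0 < K" "K * q = t * p" "K = 1 + t * B" "q = t * p / (1 + t * B)" using t by simp
  obtain r where r: "0 < r" "r = sqrt (1 + q\<^sup>2)" by (simp add: add_pos_nonneg)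
  obtain u where u: "u = hopf (lift_circle \<alpha> \<beta> w (arctan q / 2))" by blast
  have 2: "2 * (arctan q / 2) = arctan q" by simp
  have "u = (1 / r) *\<^sub>R hopf w + (q / r) *\<^sub>R v"
    by (simp only: u hopf_lift_circle[OF ab] 2 cos_arctan sin_arctan v_def r(2))
  then have "r *\<^sub>R u = hopf w + q *\<^sub>R v" using r(1) by (simp add: scaleR_add_right)
  then have "(K * r) *\<^sub>R u = K *\<^sub>R hopf w + (t * p) *\<^sub>R v"
    by (simp only: scaleR_scaleR[symmetric] scaleR_add_right) (simp add: K(2))
  also have "\<dots> = hopf w + t *\<^sub>R b" unfolding b v_def K(3) by (simp add: algebra_simps)
  finally have y: "hopf w + t *\<^sub>R b = (K * r) *\<^sub>R u" by (rule sym)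
  have "norm (lift_circle \<alpha> \<beta> w (arctan q / 2)) = 1"
    using norm_cos_sin[OF e(2,3), of "arctan q / 2"] w by (simp add: lift_circle_def e_def)
  then have u2: "norm u = 1/2" by (simp add: u norm_hopf)
  have Kr: "0 < K * r" using K(1) r(1) by simp
  have "(1/2 / norm ((K * r) *\<^sub>R u)) *\<^sub>R ((K * r) *\<^sub>R u) = u"
    by (simp only: norm_scaleR u2 scaleR_scaleR abs_of_pos[OF Kr]) (use K(1) r(1) in simp)
  then show ?thesis unfolding y K(4)[symmetric] u .
qed

lemma laplace_beltrami_summand:
  assumes \<psi>: "\<psi> \<circ> hopf \<in> smooth_S3" and w: "w \<in> S3"
    and b: "b = B *\<^sub>R hopf w + (p * \<alpha>) *\<^sub>R hopf_tangent 1 w + (p * \<beta>) *\<^sub>R hopf_tangent \<i> w" and ab: "\<alpha>\<^sup>2 + \<beta>\<^sup>2 = 1"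
  shows "(deriv ^^ 2) (\<lambda>t. \<psi> ((1/2 / norm (hopf w + t *\<^sub>R b)) *\<^sub>R (hopf w + t *\<^sub>R b))) 0
    = (let g = \<psi> \<circ> hopf; h = (\<lambda>w. \<alpha> * frame_deriv A2 g w + \<beta> * frame_deriv A3 g w)
       in (\<alpha> * frame_deriv A2 h w + \<beta> * frame_deriv A3 h w) * (p / 2)\<^sup>2 - h w * (p * B))"
proof -
  define g where "g = \<psi> \<circ> hopf"
  define h where "h = (\<lambda>w. \<alpha> * frame_deriv A2 g w + \<beta> * frame_deriv A3 g w)"
  let ?f = "\<lambda>t. \<psi> ((1/2 / norm (hopf w + t *\<^sub>R b)) *\<^sub>R (hopf w + t *\<^sub>R b))"
  have g: "g \<in> smooth_S3" using \<psi> by (simp add: g_def)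
  have h: "h \<in> smooth_S3" unfolding h_def by (intro smooth_S3_add smooth_S3_scale smooth_S3_frame_deriv g)
  have c0: "lift_circle \<alpha> \<beta> w 0 = w" by (simp add: lift_circle_def)
  have "(deriv ^^ 2) ?f 0 = (\<alpha> * frame_deriv A2 h w + \<beta> * frame_deriv A3 h w) * (p / 2)\<^sup>2
      - h (lift_circle \<alpha> \<beta> w 0) * (p * B)"
  proof (rule second_derivative_reparametrized[where G = "\<lambda>u. g (lift_circle \<alpha> \<beta> w u)"])
    show "((\<lambda>u. g (lift_circle \<alpha> \<beta> w u)) has_real_derivative h (lift_circle \<alpha> \<beta> w u)) (at u)" for u
      unfolding h_def by (rule lift_circle_derivative(2)[OF g w ab])
    show "((\<lambda>u. h (lift_circle \<alpha> \<beta> w u)) has_real_derivative \<alpha> * frame_deriv A2 h w + \<beta> * frame_deriv A3 h w) (at 0)"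
      using lift_circle_derivative(2)[OF h w ab, of 0] unfolding c0 .
  qed (simp only: lift_circle_direction[OF ab w _ b] g_def o_def)
  then show ?thesis unfolding Let_def g_def[symmetric] h_def[symmetric] c0 by (simp only: h_def)
qed

text \<open>In the sum of \<open>laplace_beltrami_summand\<close> over an orthonormal basis, the mixed terms and those of first order
  cancel, because \<open>hopf w\<close>, \<open>hopf_tangent 1 w\<close> and \<open>hopf_tangent \<i> w\<close> are orthogonal and of length \<open>1/2\<close>.\<close>

lemma laplace_beltrami_hopf:
  assumes \<psi>: "\<psi> \<in> smooth_S2" and w: "w \<in> S3"
  shows "laplace_beltrami (1/2) \<psi> (hopf w)
    = frame_deriv A2 (frame_deriv A2 (\<psi> \<circ> hopf)) w + frame_deriv A3 (frame_deriv A3 (\<psi> \<circ> hopf)) w"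
proof -
  define g where "g = \<psi> \<circ> hopf"
  have g: "g \<in> smooth_S3" using \<psi> by (simp add: smooth_S2_def g_def)
  define X Y Z where "X = hopf w" and "Y = hopf_tangent 1 w" and "Z = hopf_tangent \<i> w"
  let ?E = "\<lambda>i j. frame_deriv i (frame_deriv j g) w" and ?e = "\<lambda>i. frame_deriv i g w"
  have summand: "(deriv ^^ 2) (\<lambda>t. \<psi> ((1/2 / norm (X + t *\<^sub>R b)) *\<^sub>R (X + t *\<^sub>R b))) 0
    = 4 * ((Y \<bullet> b) * (Y \<bullet> b)) * ?E A2 A2 + 4 * ((Z \<bullet> b) * (Z \<bullet> b)) * ?E A3 A3
      + 4 * ((Y \<bullet> b) * (Z \<bullet> b)) * (?E A2 A3 + ?E A3 A2)
      - 16 * ((X \<bullet> b) * (Y \<bullet> b)) * ?e A2 - 16 * ((X \<bullet> b) * (Z \<bullet> b)) * ?e A3" for b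
  proof -
    obtain p u where u: "4 * (Y \<bullet> b) = p * cos u" "4 * (Z \<bullet> b) = p * sin u"
      using polar_Ex[of "4 * (Y \<bullet> b)" "4 * (Z \<bullet> b)"] by (elim exE conjE)
    define \<alpha> \<beta> where "\<alpha> = cos u" and "\<beta> = sin u"
    have p: "\<alpha>\<^sup>2 + \<beta>\<^sup>2 = 1" "4 * (Y \<bullet> b) = p * \<alpha>" "4 * (Z \<bullet> b) = p * \<beta>"
      by (simp_all only: u \<alpha>_def \<beta>_def sin_cos_squared_add2)
    have b: "b = (4 * (X \<bullet> b)) *\<^sub>R hopf w + (p * \<alpha>) *\<^sub>R hopf_tangent 1 w + (p * \<beta>) *\<^sub>R hopf_tangent \<i> w"
      unfolding p(2,3)[symmetric] unfolding X_def Y_def Z_def by (rule hopf_frame_expansion[OF w])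
    have h: "frame_deriv i (\<lambda>w. \<alpha> * frame_deriv A2 g w + \<beta> * frame_deriv A3 g w) w = \<alpha> * ?E i A2 + \<beta> * ?E i A3" for i
      by (simp only: frame_deriv_add[OF smooth_S3_scale[OF smooth_S3_frame_deriv[OF g]] smooth_S3_scale[OF smooth_S3_frame_deriv[OF g]] w]
          frame_deriv_scale[OF smooth_S3_frame_deriv[OF g] w])
    have quad: "(\<alpha> * (\<alpha> * e22 + \<beta> * e23) + \<beta> * (\<alpha> * e32 + \<beta> * e33)) * (p / 2)\<^sup>2 - (\<alpha> * e2 + \<beta> * e3) * (p * (4 * B))
      = 4 * (p * \<alpha> / 4 * (p * \<alpha> / 4)) * e22 + 4 * (p * \<beta> / 4 * (p * \<beta> / 4)) * e33
        + 4 * (p * \<alpha> / 4 * (p * \<beta> / 4)) * (e23 + e32)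
        - 16 * (B * (p * \<alpha> / 4)) * e2 - 16 * (B * (p * \<beta> / 4)) * e3" for e22 e23 e32 e33 e2 e3 B :: real
      by (simp add: algebra_simps power2_eq_square)
    have q: "Y \<bullet> b = p * \<alpha> / 4" "Z \<bullet> b = p * \<beta> / 4" using p(2,3) by simp_all
    show ?thesis
      unfolding X_def using laplace_beltrami_summand[OF \<psi>[unfolded smooth_S2_def mem_Collect_eq] w b p(1)]
      unfolding Let_def g_def[symmetric] h q unfolding X_def[symmetric]
      by (rule trans) (rule quad)
  qed
  have in1: "(\<Sum>b\<in>Basis. (u \<bullet> b) * (v \<bullet> b)) = u \<bullet> v" for u v :: cr by (rule euclidean_inner[symmetric])
  note o = hopf_frame_inner[OF w, folded X_def Y_def Z_def]
  show ?thesis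
    unfolding laplace_beltrami_def g_def[symmetric] X_def[symmetric] summand
    by (simp only: sum.distrib sum_subtractf sum_distrib_right[symmetric] sum_distrib_left[symmetric] in1 o)
qed

section \<open>Functions on \<open>S\<^sup>2\<close>\<close>

text \<open>A section of the Hopf fibration. It is discontinuous at the south pole, but Borel measurable.\<close>

definition hopf_section :: "cr \<Rightarrow> c2" where
  "hopf_section x = (if snd x = -1/2 then (0, 1)
     else (of_real (sqrt (1/2 + snd x)), cnj (fst x) / of_real (sqrt (1/2 + snd x))))"

lemma S2_iff: "x \<in> S2 \<longleftrightarrow> (cmod (fst x))\<^sup>2 + (snd x)\<^sup>2 = 1/4"
proof -
  have "x \<in> S2 \<longleftrightarrow> sqrt ((cmod (fst x))\<^sup>2 + (snd x)\<^sup>2) = sqrt (1/4)"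
    by (simp add: norm_prod_def real_sqrt_divide)
  then show ?thesis by simp
qed

lemma hopf_S2: "w \<in> S3 \<Longrightarrow> hopf w \<in> S2"
  by (simp add: norm_hopf)

lemma hopf_section:
  assumes x: "x \<in> S2"
  shows "hopf_section x \<in> S3" "hopf (hopf_section x) = x"
proof -
  obtain \<zeta> c where xc: "x = (\<zeta>, c)" by (cases x)
  have n: "(cmod \<zeta>)\<^sup>2 + c\<^sup>2 = 1/4" using x unfolding S2_iff xc by simp
  have "hopf_section x \<in> S3 \<and> hopf (hopf_section x) = x"
  proof (cases "c = -1/2")
    case True
    then have "\<zeta> = 0" using n by (simp add: power2_eq_square)
    then show ?thesis using True by (simp add: hopf_section_def xc hopf_def norm_Pair)
  next
    case False
    have "c\<^sup>2 \<le> 1/4" using n zero_le_power2[of "cmod \<zeta>"] by linarith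
    then have "c\<^sup>2 \<le> (1/2)\<^sup>2" by (simp add: power_divide)
    then have "-1/2 \<le> c" using abs_le_square_iff[of c "1/2"] by simp
    then have pos: "0 < 1/2 + c" using False by simp
    define r where "r = sqrt (1/2 + c)"
    have r: "0 < r" "r\<^sup>2 = 1/2 + c" using pos by (simp_all add: r_def)
    have s: "hopf_section x = (of_real r, cnj \<zeta> / of_real r)" using False by (simp add: hopf_section_def xc r_def)
    have "(cmod \<zeta>)\<^sup>2 = (1/2 + c) * (1/2 - c)" using n by (simp add: algebra_simps power2_eq_square)
    then have q: "(cmod (cnj \<zeta> / of_real r))\<^sup>2 = 1/2 - c"
      using pos r by (simp add: norm_divide power_divide)
    have "(norm (hopf_section x))\<^sup>2 = 1"
      unfolding s norm_Pair using r q by (simp add: norm_of_real)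
    then have 1: "hopf_section x \<in> S3" by (simp add: power2_eq_1_iff) (metis norm_ge_zero not_one_le_zero neg_0_le_iff_le)
    have "hopf (hopf_section x) = x"
      unfolding s unfolding hopf_def xc using r q by (simp add: norm_of_real)
    with 1 show ?thesis by blast
  qed
  then show "hopf_section x \<in> S3" "hopf (hopf_section x) = x" by blast+
qed

lemma hopf_fibre:
  assumes v: "v \<in> S3" and w: "w \<in> S3" and h: "hopf v = hopf w"
  obtains t where "v = flow A1 t w"
proof -
  have n: "(cmod (fst u))\<^sup>2 + (cmod (snd u))\<^sup>2 = 1" if "u \<in> S3" for u :: c2
    using that by (simp add: norm_prod_def)
  have e: "fst v * cnj (snd v) = fst w * cnj (snd w)"
    "(cmod (fst v))\<^sup>2 - (cmod (snd v))\<^sup>2 = (cmod (fst w))\<^sup>2 - (cmod (snd w))\<^sup>2"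
    using h by (simp_all add: hopf_def)
  have "(cmod (fst v))\<^sup>2 = (cmod (fst w))\<^sup>2" "(cmod (snd v))\<^sup>2 = (cmod (snd w))\<^sup>2"
    using n[OF v] n[OF w] e(2) by linarith+
  then have a: "cmod (fst v) = cmod (fst w)" "cmod (snd v) = cmod (snd w)" by simp_all
  have "\<exists>u. cmod u = 1 \<and> fst v = u * fst w \<and> snd v = u * snd w"
  proof (cases "fst w = 0")
    case True
    then have z: "fst v = 0" "snd w \<noteq> 0" using a n[OF w] by auto
    then show ?thesis using True a by (intro exI[of _ "snd v / snd w"]) (simp add: norm_divide)
  next
    case False
    define u where "u = fst v / fst w"
    have u: "cmod u = 1" "fst v = u * fst w" using False a by (simp_all add: u_def norm_divide)
    have "fst w * (u * cnj (snd v)) = fst w * cnj (snd w)" using e(1) u(2) by (simp add: mult_ac)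
    then have "u * cnj (snd v) = cnj (snd w)" using False by simp
    then have "cnj (u * cnj (snd v)) = snd w" by simp
    then have "u * (cnj u * snd v) = u * snd w" by simp
    moreover have "u * cnj u = 1" using u(1) by (simp add: complex_norm_square[symmetric])
    ultimately have "snd v = u * snd w" by (simp add: mult.assoc[symmetric])
    then show ?thesis using u by blast
  qed
  then obtain u where u: "cmod u = 1" "fst v = u * fst w" "snd v = u * snd w" by blast
  have "u = cis (Arg u)" using u(1) by (metis rcis_cmod_Arg rcis_def mult_1 of_real_1)
  then have "v = flow A1 (Arg u) w" using u(2,3) by (simp add: flow_A1 prod_eq_iff)
  then show ?thesis by (rule that)
qed

text \<open>A smooth invariant function is constant on the fibres, so its values on the section determine it.\<close>

lemma inv_smooth_descends:
  assumes g: "g \<in> smooth_S3" "inv\<^sub>E g"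
  shows "w \<in> S3 \<Longrightarrow> g (hopf_section (hopf w)) = g w" "g \<circ> hopf_section \<in> smooth_S2"
proof -
  show *: "g (hopf_section (hopf w)) = g w" if w: "w \<in> S3" for w
  proof -
    note s = hopf_section[OF hopf_S2[OF w]]
    obtain t where "hopf_section (hopf w) = flow A1 t w" by (rule hopf_fibre[OF s(1) w s(2)])
    then show ?thesis using inv_smooth_flow[OF g w] by simp
  qed
  show "g \<circ> hopf_section \<in> smooth_S2"
    unfolding smooth_S2_def mem_Collect_eq by (rule smooth_S3_cong[OF g(1)]) (simp add: *)
qed

lemma hopf_measurable: "hopf \<in> measurable \<mu>S3 (restrict_space borel S2)"
proof (rule measurable_restrict_space2)
  show "hopf \<in> space \<mu>S3 \<rightarrow> S2" using hopf_S2 by auto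
  have "continuous_on S3 hopf" unfolding hopf_def[abs_def] by (intro continuous_intros; simp)
  then show "hopf \<in> borel_measurable \<mu>S3" by (rule continuous_measurable_\<mu>S3)
qed

lemma hopf_section_measurable: "hopf_section \<in> measurable (restrict_space borel S2) \<mu>S3"
proof -
  have [measurable]: "cnj \<in> borel_measurable borel"
    by (rule borel_measurable_continuous_onI) (intro continuous_intros)
  have [measurable]: "fst \<in> borel_measurable (borel :: cr measure)" "snd \<in> borel_measurable (borel :: cr measure)"
    by (rule borel_measurable_continuous_onI, intro continuous_intros)+
  have "hopf_section \<in> borel_measurable borel"
    unfolding hopf_section_def[abs_def] by measurable
  then have "hopf_section \<in> measurable (restrict_space borel S2) (restrict_space borel S3)"
    by (intro measurable_restrict_space2 measurable_restrict_space1) (use hopf_section(1) in \<open>auto simp: space_restrict_space\<close>)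
  then show ?thesis by (simp add: measurable_cong_sets[OF refl sets_\<mu>S3])
qed

lemma sets_\<nu>S2: "sets \<nu>S2 = sets (restrict_space borel S2)" "space \<nu>S2 = S2"
  by (simp_all add: \<nu>S2_def space_restrict_space)

lemma borel_measurable_\<nu>S2_iff:
  fixes u :: "cr \<Rightarrow> real"
  shows "u \<in> borel_measurable \<nu>S2 \<longleftrightarrow> u \<circ> hopf \<in> borel_measurable \<mu>S3"
proof
  assume "u \<in> borel_measurable \<nu>S2"
  then have "u \<in> borel_measurable (restrict_space borel S2)" by (simp add: measurable_cong_sets[OF sets_\<nu>S2(1) refl])
  then show "u \<circ> hopf \<in> borel_measurable \<mu>S3" by (rule measurable_comp[OF hopf_measurable])
next
  assume "u \<circ> hopf \<in> borel_measurable \<mu>S3"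
  then have "(u \<circ> hopf) \<circ> hopf_section \<in> borel_measurable (restrict_space borel S2)"
    by (rule measurable_comp[OF hopf_section_measurable])
  then have "u \<in> borel_measurable (restrict_space borel S2)"
    by (subst measurable_cong[of _ u "(u \<circ> hopf) \<circ> hopf_section"]) (simp_all add: space_restrict_space hopf_section(2))
  then show "u \<in> borel_measurable \<nu>S2" by (simp add: measurable_cong_sets[OF sets_\<nu>S2(1) refl])
qed

lemma integral_\<nu>S2:
  fixes u :: "cr \<Rightarrow> real"
  assumes "u \<circ> hopf \<in> borel_measurable \<mu>S3"
  shows "(LINT x|\<nu>S2. u x) = (LINT w|\<mu>S3. u (hopf w))" "integrable \<nu>S2 u \<longleftrightarrow> integrable \<mu>S3 (\<lambda>w. u (hopf w))"
proof -
  have "u \<in> borel_measurable \<nu>S2" using assms by (simp add: borel_measurable_\<nu>S2_iff)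
  then have u: "u \<in> borel_measurable (restrict_space borel S2)" by (simp add: measurable_cong_sets[OF sets_\<nu>S2(1) refl])
  show "(LINT x|\<nu>S2. u x) = (LINT w|\<mu>S3. u (hopf w))"
    unfolding \<nu>S2_def by (rule integral_distr[OF hopf_measurable u])
  show "integrable \<nu>S2 u \<longleftrightarrow> integrable \<mu>S3 (\<lambda>w. u (hopf w))"
    unfolding \<nu>S2_def by (rule integrable_distr_eq[OF hopf_measurable u])
qed

lemma L2_\<nu>S2_iff: "u \<in> L2 \<nu>S2 \<longleftrightarrow> u \<circ> hopf \<in> L2 \<mu>S3" for u :: "cr \<Rightarrow> real"
proof (cases "u \<circ> hopf \<in> borel_measurable \<mu>S3")
  case True
  then have "(\<lambda>x. (u x)\<^sup>2) \<circ> hopf \<in> borel_measurable \<mu>S3" unfolding comp_def by measurable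
  from integral_\<nu>S2(2)[OF this] show ?thesis
    unfolding L2_real_iff borel_measurable_\<nu>S2_iff by (simp add: comp_def)
next
  case False
  then show ?thesis unfolding L2_real_iff borel_measurable_\<nu>S2_iff by blast
qed

lemma L2_tendsto_\<nu>S2_iff:
  fixes f :: "cr \<Rightarrow> real"
  assumes "\<forall>\<^sub>F i in Fl. F i \<circ> hopf \<in> L2 \<mu>S3" "f \<circ> hopf \<in> L2 \<mu>S3"
  shows "L2_tendsto \<nu>S2 F f Fl \<longleftrightarrow> L2_tendsto \<mu>S3 (\<lambda>i. F i \<circ> hopf) (f \<circ> hopf) Fl"
  unfolding L2_tendsto_real
proof (rule tendsto_cong)
  show "\<forall>\<^sub>F i in Fl. (LINT x|\<nu>S2. (F i x - f x)\<^sup>2) = (LINT w|\<mu>S3. ((F i \<circ> hopf) w - (f \<circ> hopf) w)\<^sup>2)"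
    using assms(1)
  proof eventually_elim
    case (elim i)
    have [measurable]: "(\<lambda>w. F i (hopf w)) \<in> borel_measurable \<mu>S3" "(\<lambda>w. f (hopf w)) \<in> borel_measurable \<mu>S3"
      using L2_measurable[OF elim] L2_measurable[OF assms(2)] by (simp_all add: comp_def)
    have "(\<lambda>x. (F i x - f x)\<^sup>2) \<circ> hopf \<in> borel_measurable \<mu>S3" unfolding comp_def by measurable
    from integral_\<nu>S2(1)[OF this] show ?case by (simp add: comp_def)
  qed
qed

lemma has_L2_derivative_\<nu>S2_iff:
  fixes F :: "real \<Rightarrow> cr \<Rightarrow> real"
  assumes t: "t \<in> I"
  shows "has_L2_derivative \<nu>S2 I F G t \<longleftrightarrow> has_L2_derivative \<mu>S3 I (\<lambda>\<tau>. F \<tau> \<circ> hopf) (G \<circ> hopf) t"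
proof -
  have "L2_tendsto \<nu>S2 (\<lambda>\<tau> x. (F \<tau> x - F t x) /\<^sub>R (\<tau> - t)) G (at t within I)
      \<longleftrightarrow> L2_tendsto \<mu>S3 (\<lambda>\<tau> w. ((F \<tau> \<circ> hopf) w - (F t \<circ> hopf) w) /\<^sub>R (\<tau> - t)) (G \<circ> hopf) (at t within I)"
    if F: "\<forall>\<tau>\<in>I. F \<tau> \<circ> hopf \<in> L2 \<mu>S3" and G: "G \<circ> hopf \<in> L2 \<mu>S3"
  proof -
    have "\<forall>\<^sub>F \<tau> in at t within I. (\<lambda>x. (F \<tau> x - F t x) /\<^sub>R (\<tau> - t)) \<circ> hopf \<in> L2 \<mu>S3"
      using eventually_quotient_L2[OF F t] by (simp add: comp_def)
    from L2_tendsto_\<nu>S2_iff[OF this G] show ?thesis by (simp add: comp_def)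
  qed
  then show ?thesis unfolding has_L2_derivative_def L2_\<nu>S2_iff by blast
qed

text \<open>Almost everywhere, \<open>k\<close> is the limit of a sequence of smooth invariant functions.\<close>

lemma inv_descends:
  assumes k: "inv\<^sub>E k"
  obtains b :: "cr \<Rightarrow> real" where "b \<circ> hopf \<in> L2 \<mu>S3" "AE w in \<mu>S3. b (hopf w) = k w"
proof -
  note kL = wdD(1)[OF k]
  obtain r :: "nat \<Rightarrow> nat" where r: "AE w in \<mu>S3. (\<lambda>n. proj (r n) k w) \<longlonglongrightarrow> k w"
    using L2_tendsto_AE_subseq[OF proj_tendsto[OF kL] proj_L2[OF kL] kL] by blast
  define b where "b x = lim (\<lambda>n. proj (r n) k (hopf_section x))" for x
  have b: "(b \<circ> hopf) w = lim (\<lambda>n. proj (r n) k w)" if "w \<in> S3" for w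
    unfolding b_def comp_def inv_smooth_descends(1)[OF proj_smooth[OF kL] inv_proj[OF k] that] ..
  have "(\<lambda>w. lim (\<lambda>n. proj (r n) k w)) \<in> borel_measurable \<mu>S3"
    by (rule borel_measurable_lim_metric) (rule L2_measurable[OF proj_L2[OF kL]])
  then have m: "b \<circ> hopf \<in> borel_measurable \<mu>S3"
    using borel_measurable_\<mu>S3_cong[of "b \<circ> hopf" "\<lambda>w. lim (\<lambda>n. proj (r n) k w)"] b by blast
  have ae: "AE w in \<mu>S3. b (hopf w) = k w"
    using r AE_space
  proof eventually_elim
    case (elim w)
    then show ?case using b[of w] limI[OF elim(1)] by simp
  qed
  then have "AE w in \<mu>S3. k w = (b \<circ> hopf) w" by eventually_elim simp
  then have "b \<circ> hopf \<in> L2 \<mu>S3" by (rule L2_cong_AE[OF kL m])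
  then show ?thesis using ae by (rule that)
qed

definition smooth_lap :: "(c2 \<Rightarrow> real) \<Rightarrow> c2 \<Rightarrow> real" where
  "smooth_lap g w = 1/4 * (frame_deriv A2 (frame_deriv A2 g) w + frame_deriv A3 (frame_deriv A3 g) w)"

lemma smooth_lap_smooth: "g \<in> smooth_S3 \<Longrightarrow> smooth_lap g \<in> smooth_S3"
  unfolding smooth_lap_def[abs_def] by (intro smooth_S3_scale smooth_S3_add smooth_S3_frame_deriv)

lemma ip_lap:
  assumes f: "sob 2 f" and p: "p \<in> smooth_S3" shows "ip (lap f) p = ip f (smooth_lap p)"
proof -
  have d: "ip (D i (D i f)) p = ip f (frame_deriv i (frame_deriv i p))" "D i (D i f) \<in> L2 \<mu>S3" for i
  proof -
    have 1: "wd i f (D i f)" by (rule sob_D[OF f]) simp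
    have "sob 1 (D i f)" by (rule sob_DD[OF f]) simp
    then have 2: "wd i (D i f) (D i (D i f))" by (rule sob_D) simp
    show "ip (D i (D i f)) p = ip f (frame_deriv i (frame_deriv i p))"
      using wd_integration_by_parts[OF 2 wd_smooth[OF p]] wd_integration_by_parts[OF 1 wd_smooth[OF smooth_S3_frame_deriv[OF p]]]
      by simp
    show "D i (D i f) \<in> L2 \<mu>S3" by (rule wdD(2)[OF 2])
  qed
  note s = smooth_S3_L2[OF smooth_S3_frame_deriv[OF smooth_S3_frame_deriv[OF p]]]
  show ?thesis
    unfolding lap_def[abs_def] smooth_lap_def[abs_def] ip_scale_left ip_scale_right
      ip_add_left[OF d(2) d(2) smooth_S3_L2[OF p]] ip_add_right[OF s s sob_L2[OF f]] d(1) ..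
qed

lemma lap_smooth:
  assumes g: "g \<in> smooth_S3" shows "AE w in \<mu>S3. smooth_lap g w = lap g w"
proof -
  have D: "AE w in \<mu>S3. D i (D i g) w = frame_deriv i (frame_deriv i g) w" for i
  proof -
    have "D i (D i g) = D i (frame_deriv i g)"
      by (rule sobolev_deriv_cong_AE[OF sobolev_deriv_AE[OF wd_smooth[OF g]]
            L2_measurable[OF wdD(2)[OF wd_sobolev_deriv[OF wd_smooth[OF g]]]]
            L2_measurable[OF smooth_S3_L2[OF smooth_S3_frame_deriv[OF g]]]])
    then show ?thesis using sobolev_deriv_AE[OF wd_smooth[OF smooth_S3_frame_deriv[OF g]]] by simp
  qed
  show ?thesis using D[of A2] D[of A3] by eventually_elim (simp add: smooth_lap_def lap_def)
qed

lemma smooth_lap_proj_tendsto: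
  assumes f: "sob 2 f" shows "L2_tendsto \<mu>S3 (\<lambda>n. smooth_lap (proj n f)) (lap f) sequentially"
proof -
  note fL = sob_L2[OF f]
  have s: "frame_deriv i (frame_deriv i (proj n f)) \<in> L2 \<mu>S3" for i n
    by (rule smooth_S3_L2[OF smooth_S3_frame_deriv[OF smooth_S3_frame_deriv[OF proj_smooth[OF fL]]]])
  have d: "D i (D i f) \<in> L2 \<mu>S3" for i
    using foldr_sobolev_deriv[OF f, of "[i, i]"] by (simp add: sob_L2)
  have t: "L2_tendsto \<mu>S3 (\<lambda>n. frame_deriv i (frame_deriv i (proj n f))) (D i (D i f)) sequentially" for i
  proof (rule L2_tendsto_cong_AE[where G = "\<lambda>n. proj n (D i (D i f))" and g = "D i (D i f)", THEN iffD2])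
    show "L2_tendsto \<mu>S3 (\<lambda>n. proj n (D i (D i f))) (D i (D i f)) sequentially" by (rule proj_tendsto[OF d])
    show "\<forall>\<^sub>F n in sequentially. AE w in \<mu>S3. frame_deriv i (frame_deriv i (proj n f)) w = proj n (D i (D i f)) w"
      using foldr_frame_deriv_proj[OF f, of "[i, i]"] by simp
  qed (intro always_eventually allI refl L2_measurable s d proj_L2)+
  show ?thesis unfolding lap_def[abs_def] smooth_lap_def[abs_def]
    by (rule L2_tendsto_scale[OF L2_tendsto_add[OF t always_eventually[OF allI[OF s]] d
          t always_eventually[OF allI[OF s]] d]])
qed

text \<open>The projections \<open>proj n f\<close> descend to smooth functions on \<open>S\<^sup>2\<close> and show that the closure is defined at
  \<open>F\<close>; its value is identified by testing the lift against polynomials.\<close>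

lemma laplacian_S2_lap:
  assumes F: "\<And>w. w \<in> S3 \<Longrightarrow> F (hopf w) = f w" and f: "sob 2 f" "inv\<^sub>E f"
  shows "laplacian_S2 F \<circ> hopf \<in> L2 \<mu>S3" "AE w in \<mu>S3. laplacian_S2 F (hopf w) = lap f w"
proof -
  let ?L = "\<lambda>\<psi> x. (1/2)\<^sup>2 * laplace_beltrami (1/2) \<psi> x"
  let ?C = "L2_closure \<nu>S2 smooth_S2 ?L F"
  note fL = sob_L2[OF f(1)]
  have FL: "F \<circ> hopf \<in> L2 \<mu>S3" using L2_\<mu>S3_cong[of "F \<circ> hopf" f] F fL by simp
  have L: "(?L \<psi> \<circ> hopf) w = smooth_lap (\<psi> \<circ> hopf) w" if "\<psi> \<in> smooth_S2" "w \<in> S3" for \<psi> w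
    using laplace_beltrami_hopf[OF that] by (simp add: smooth_lap_def power2_eq_square)
  have LL: "?L \<psi> \<circ> hopf \<in> L2 \<mu>S3" if "\<psi> \<in> smooth_S2" for \<psi>
    using L2_\<mu>S3_cong[of "?L \<psi> \<circ> hopf" "smooth_lap (\<psi> \<circ> hopf)"] L[OF that]
      smooth_S3_L2[OF smooth_lap_smooth[of "\<psi> \<circ> hopf"]] that unfolding smooth_S2_def by blast
  have conv: "L2_tendsto \<mu>S3 F f Fl \<longleftrightarrow> L2_tendsto \<mu>S3 F' f' Fl"
    if "\<And>i w. w \<in> S3 \<Longrightarrow> F i w = F' i w" "\<And>w. w \<in> S3 \<Longrightarrow> f w = f' w"
    for F F' :: "nat \<Rightarrow> c2 \<Rightarrow> real" and f f' Fl
  proof -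
    have "(LINT w|\<mu>S3. (norm (F i w - f w))\<^sup>2) = (LINT w|\<mu>S3. (norm (F' i w - f' w))\<^sup>2)" for i
      by (rule Bochner_Integration.integral_cong) (simp_all add: that)
    then show ?thesis unfolding L2_tendsto_def by simp
  qed
  have "\<exists>k. ?C k"
  proof -
    obtain b where b: "b \<circ> hopf \<in> L2 \<mu>S3" "AE w in \<mu>S3. b (hopf w) = lap f w"
      by (rule inv_descends[OF inv_lap[OF f]])
    define \<psi> where "\<psi> n = proj n f \<circ> hopf_section" for n
    have \<psi>: "\<psi> n \<in> smooth_S2" "w \<in> S3 \<Longrightarrow> (\<psi> n \<circ> hopf) w = proj n f w" for n w
      using inv_smooth_descends[OF proj_smooth[OF fL] inv_proj[OF f(2)]] by (simp_all add: \<psi>_def)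
    have \<psi>L: "\<psi> n \<circ> hopf \<in> L2 \<mu>S3" for n using \<psi>(1)[of n] smooth_S3_L2 unfolding smooth_S2_def by blast
    have sl: "smooth_lap (\<psi> n \<circ> hopf) w = smooth_lap (proj n f) w" if "w \<in> S3" for n w
    proof -
      have "frame_deriv i (frame_deriv i (\<psi> n \<circ> hopf)) w = frame_deriv i (frame_deriv i (proj n f)) w" for i
        by (rule frame_deriv_cong[OF that]) (rule frame_deriv_cong, assumption, rule \<psi>(2))
      then show ?thesis by (simp add: smooth_lap_def)
    qed
    have t1: "L2_tendsto \<mu>S3 (\<lambda>n. \<psi> n \<circ> hopf) (F \<circ> hopf) sequentially"
      by (rule iffD2[OF conv proj_tendsto[OF fL]]) (simp_all only: \<psi>(2), simp add: F)
    have t2: "L2_tendsto \<mu>S3 (\<lambda>n. ?L (\<psi> n) \<circ> hopf) (b \<circ> hopf) sequentially"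
    proof -
      have 1: "L2_tendsto \<mu>S3 (\<lambda>n. smooth_lap (proj n f)) (b \<circ> hopf) sequentially"
      proof (rule L2_tendsto_cong_AE[where G = "\<lambda>n. smooth_lap (proj n f)" and g = "lap f", THEN iffD2])
        show "L2_tendsto \<mu>S3 (\<lambda>n. smooth_lap (proj n f)) (lap f) sequentially"
          by (rule smooth_lap_proj_tendsto[OF f(1)])
        show "AE w in \<mu>S3. (b \<circ> hopf) w = lap f w" using b(2) by simp
      qed (use L2_measurable[OF b(1)] L2_measurable[OF lap_L2[OF f(1)]]
          L2_measurable[OF smooth_S3_L2[OF smooth_lap_smooth[OF proj_smooth[OF fL]]]] in simp_all)
      show ?thesis by (rule iffD2[OF conv 1]) (simp_all only: L[OF \<psi>(1)] sl)
    qed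
    have "?C b"
      unfolding L2_closure_def L2_\<nu>S2_iff
    proof (intro conjI exI[of _ \<psi>] allI)
      show "L2_tendsto \<nu>S2 \<psi> F sequentially"
        by (rule iffD2[OF L2_tendsto_\<nu>S2_iff[OF always_eventually[OF allI[OF \<psi>L]] FL] t1])
      show "L2_tendsto \<nu>S2 (\<lambda>n. ?L (\<psi> n)) b sequentially"
        by (rule iffD2[OF L2_tendsto_\<nu>S2_iff[OF always_eventually[OF allI[OF LL[OF \<psi>(1)]]] b(1)] t2])
    qed (rule FL b(1) \<psi>(1) \<psi>L LL[OF \<psi>(1)])+
    then show ?thesis by blast
  qed
  then have "?C (laplacian_S2 F)" unfolding laplacian_S2_def by (rule someI_ex)
  then obtain \<psi> where k: "laplacian_S2 F \<circ> hopf \<in> L2 \<mu>S3" and \<psi>: "\<And>n. \<psi> n \<in> smooth_S2"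
    and \<psi>L: "\<And>n. \<psi> n \<circ> hopf \<in> L2 \<mu>S3" and t1: "L2_tendsto \<nu>S2 \<psi> F sequentially"
    and t2: "L2_tendsto \<nu>S2 (\<lambda>n. ?L (\<psi> n)) (laplacian_S2 F) sequentially"
    unfolding L2_closure_def L2_\<nu>S2_iff by blast
  show "laplacian_S2 F \<circ> hopf \<in> L2 \<mu>S3" by (rule k)
  have "AE w in \<mu>S3. (laplacian_S2 F \<circ> hopf) w = lap f w"
  proof (rule ip_polynomial_eqI[OF k lap_L2[OF f(1)]])
    fix p :: "c2 \<Rightarrow> real" assume "real_polynomial_function p"
    then have p: "p \<in> smooth_S3" by (rule real_polynomial_smooth_S3)
    have s: "\<psi> n \<circ> hopf \<in> smooth_S3" for n using \<psi>[of n] by (simp add: smooth_S2_def)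
    have eq: "ip (?L (\<psi> n) \<circ> hopf) p = ip (\<psi> n \<circ> hopf) (smooth_lap p)" for n
    proof -
      have "ip (?L (\<psi> n) \<circ> hopf) p = ip (smooth_lap (\<psi> n \<circ> hopf)) p"
        by (rule ip_cong[OF L[OF \<psi>] refl])
      also have "\<dots> = ip (lap (\<psi> n \<circ> hopf)) p"
        by (rule ip_cong_AE[OF lap_smooth[OF s] smooth_S3_L2[OF smooth_lap_smooth[OF s]] lap_L2[OF sob_smooth[OF s]] smooth_S3_L2[OF p]])
      also have "\<dots> = ip (\<psi> n \<circ> hopf) (smooth_lap p)" by (rule ip_lap[OF sob_smooth[OF s] p])
      finally show ?thesis .
    qed
    note pL = smooth_S3_L2[OF p] and lpL = smooth_S3_L2[OF smooth_lap_smooth[OF p]]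
    have "(\<lambda>n. ip (\<psi> n \<circ> hopf) (smooth_lap p)) \<longlonglongrightarrow> ip (F \<circ> hopf) (smooth_lap p)"
      by (rule ip_tendsto[OF iffD1[OF L2_tendsto_\<nu>S2_iff[OF always_eventually[OF allI[OF \<psi>L]] FL] t1] \<psi>L FL L2_tendsto_const lpL lpL])
    moreover have "(\<lambda>n. ip (?L (\<psi> n) \<circ> hopf) p) \<longlonglongrightarrow> ip (laplacian_S2 F \<circ> hopf) p"
      by (rule ip_tendsto[OF iffD1[OF L2_tendsto_\<nu>S2_iff[OF always_eventually[OF allI[OF LL[OF \<psi>]]] k] t2] LL[OF \<psi>] k L2_tendsto_const pL pL])
    ultimately have "ip (laplacian_S2 F \<circ> hopf) p = ip (F \<circ> hopf) (smooth_lap p)"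
      unfolding eq by (intro LIMSEQ_unique)
    also have "\<dots> = ip f (smooth_lap p)" by (rule ip_cong) (simp_all add: F)
    finally show "ip (laplacian_S2 F \<circ> hopf) p = ip (lap f) p" by (simp only: ip_lap[OF f(1) p])
  qed
  then show "AE w in \<mu>S3. laplacian_S2 F (hopf w) = lap f w" by simp
qed

lemma bracket_S2:
  assumes "inv\<^sub>E (bracket (F \<circ> hopf) (M \<circ> hopf))"
  shows "bracket_S2 F M \<circ> hopf \<in> L2 \<mu>S3"
    "AE w in \<mu>S3. bracket_S2 F M (hopf w) = bracket (F \<circ> hopf) (M \<circ> hopf) w"
proof -
  obtain b where "b \<circ> hopf \<in> L2 \<mu>S3" "AE w in \<mu>S3. b (hopf w) = bracket (F \<circ> hopf) (M \<circ> hopf) w"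
    by (rule inv_descends[OF assms])
  then have "\<exists>b. b \<in> L2 \<nu>S2 \<and> (AE w in \<mu>S3. b (hopf w) = bracket (F \<circ> hopf) (M \<circ> hopf) w)"
    unfolding L2_\<nu>S2_iff by blast
  from someI_ex[OF this, folded bracket_S2_def]
  show "bracket_S2 F M \<circ> hopf \<in> L2 \<mu>S3"
    "AE w in \<mu>S3. bracket_S2 F M (hopf w) = bracket (F \<circ> hopf) (M \<circ> hopf) w"
    unfolding L2_\<nu>S2_iff by blast+
qed

section \<open>The equations on \<open>S\<^sup>2\<close>\<close>

lemma bracket_cong_AE:
  assumes "AE w in \<mu>S3. g w = g' w" "g \<in> borel_measurable \<mu>S3" "g' \<in> borel_measurable \<mu>S3"
  shows "bracket f g = bracket f g'"
  unfolding bracket_def field_deriv_def[abs_def] by (simp only: sobolev_deriv_cong_AE[OF assms])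

lemma bracket_add:
  assumes g: "sob 1 g" and g': "sob 1 g'"
  shows "AE w in \<mu>S3. bracket f (\<lambda>w. g w + g' w) w = bracket f g w + bracket f g' w"
proof -
  have D: "AE w in \<mu>S3. D i (\<lambda>w. g w + g' w) w = D i g w + D i g' w" for i
    by (rule sobolev_deriv_add[OF sob_D[OF g order_refl] sob_D[OF g' order_refl]])
  show ?thesis
    using D[of A1] D[of A2] D[of A3] AE_space by eventually_elim (simp add: bracket_eq algebra_simps)
qed

lemma has_L2_derivative_add_const:
  fixes F :: "real \<Rightarrow> 'a \<Rightarrow> real"
  assumes c: "c \<in> L2 M"
  shows "has_L2_derivative M I (\<lambda>\<tau> x. F \<tau> x + c x) G t \<longleftrightarrow> has_L2_derivative M I F G t"
proof -
  have "(\<lambda>x. F \<tau> x + c x) \<in> L2 M \<longleftrightarrow> F \<tau> \<in> L2 M" for \<tau>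
    using L2_add[OF _ c, of "F \<tau>"] L2_diff[OF _ c, of "\<lambda>x. F \<tau> x + c x"] by auto
  then show ?thesis unfolding has_L2_derivative_def by simp
qed

lemma zcoord_hopf_polynomial: "real_polynomial_function (\<lambda>w. zcoord (hopf w))"
proof -
  have [intro]: "real_polynomial_function (\<lambda>w::c2. Re (fst w))" "real_polynomial_function (\<lambda>w::c2. Im (fst w))"
    "real_polynomial_function (\<lambda>w::c2. Re (snd w))" "real_polynomial_function (\<lambda>w::c2. Im (snd w))"
    by (intro real_polynomial_function.intros(1) bounded_linear_compose[OF bounded_linear_Re] bounded_linear_compose[OF bounded_linear_Im]
        bounded_linear_fst bounded_linear_snd)+
  have "(\<lambda>w. zcoord (hopf w)) = (\<lambda>w. Re (fst w) * Re (fst w) + Im (fst w) * Im (fst w)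
      - Re (snd w) * Re (snd w) - Im (snd w) * Im (snd w))"
    by (simp add: zcoord_def hopf_real fun_eq_iff field_simps)
  then show ?thesis
    by (simp only:) (intro real_polynomial_function_diff real_polynomial_function.intros(3,4); blast)
qed

lemma sob_1_polynomial_mult:
  assumes "real_polynomial_function p" "sob 1 g" shows "sob 1 (\<lambda>w. p w * g w)"
  using assms wd_polynomial_mult unfolding sob_1_iff by blast

context contact_metric
begin

context
  fixes I :: "real set" and f :: "real \<Rightarrow> c2 \<Rightarrow> real"
  assumes f: "\<forall>t\<in>I. f t \<in> sobolev_inv (s + 1)"
begin

lemma cocycle_representative:
  assumes \<phi>: "sob 1 \<phi>" and t: "t \<in> I"
  shows "bracket_rev \<phi> (f t) \<in> L2 \<mu>S3"
    and "k \<in> sobolev_inv (s + 1) \<Longrightarrow> cocycle \<phi> (S\<theta> (f t)) (S\<theta> k) = ip (bracket_rev \<phi> (f t)) k"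
    and "inv\<^sub>E \<phi> \<Longrightarrow> inv\<^sub>E (bracket_rev \<phi> (f t))"
proof -
  note ft = f_regular[OF f t]
  have e: "bracket_rev \<phi> (f t) = (\<lambda>w. -1 * bracket (f t) \<phi> w)" by (simp add: fun_eq_iff bracket_rev_def)
  show "bracket_rev \<phi> (f t) \<in> L2 \<mu>S3" unfolding e by (rule L2_scale[OF bracket_L2[OF ft(1) \<phi>]])
  show "inv\<^sub>E (bracket_rev \<phi> (f t))" if "inv\<^sub>E \<phi>"
    unfolding e by (rule inv_scale[OF inv_bracket[OF ft(1,4) \<phi> that]])
  show "cocycle \<phi> (S\<theta> (f t)) (S\<theta> k) = ip (bracket_rev \<phi> (f t)) k" if "k \<in> sobolev_inv (s + 1)"
    unfolding e cocycle_S\<theta> ip_scale_left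
    using bracket_integration_by_parts[OF ft(1,4) sobolev_inv_regular(1,4)[OF that] \<phi>] by simp
qed

text \<open>The functions \<open>k\<close> are invariant, so they do not distinguish a function from its average.\<close>

lemma cocycle_fibre_average:
  assumes \<phi>: "sob 1 \<phi>" and t: "t \<in> I"
  shows "inv\<^sub>E (fibre_average (bracket_rev \<phi> (f t)))"
    and "k \<in> sobolev_inv (s + 1) \<Longrightarrow>
      cocycle \<phi> (S\<theta> (f t)) (S\<theta> k) = ip (fibre_average (bracket_rev \<phi> (f t))) k"
  using inv_fibre_average[OF cocycle_representative(1)[OF \<phi> t]]
    fibre_average_ip[OF cocycle_representative(1)[OF \<phi> t] sobolev_inv_regular(4)] cocycle_representative(2)[OF \<phi> t]
  by simp_all

text \<open>The lift of \<open>m t\<close> is the contact Laplacian of \<open>f t\<close>, and the lift of the bracket of \<open>F t\<close> with \<open>m_hat t\<close> is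
  \<open>{f, \<Delta> f} + {f, \<phi>}\<close>. Hence all the equations lift to one and the same equation on \<open>S\<^sup>3\<close>; \<open>m\<close> and \<open>m_hat\<close>
  differ by a function that is constant in time.\<close>

lemma sphere_equations:
  fixes h P :: "cr \<Rightarrow> real" and F m m_hat :: "real \<Rightarrow> cr \<Rightarrow> real"
  assumes df: "\<forall>t\<in>I. \<exists>g. has_sobolev_derivative 2 I f g t"
    and h: "sob 1 (h \<circ> hopf)" and rho2: "\<forall>x\<in>S2. (\<rho> x)\<^sup>2 = \<gamma> * (zcoord x)\<^sup>2"
    and F: "\<forall>t\<in>I. \<forall>w\<in>S3. f t w = F t (hopf w)"
    and P: "P = (\<lambda>x. 2 * zcoord x / Ro + 2 * zcoord x * h x)"
    and m: "m = (\<lambda>t x. \<gamma> * (zcoord x)\<^sup>2 * F t x - laplacian_S2 (F t) x)"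
    and m_hat: "m_hat = (\<lambda>t x. m t x + P x)"
  shows "euler_arnold s \<rho> (P \<circ> hopf) I (\<lambda>t. S\<theta> (f t)) (\<lambda>t. 1) \<longleftrightarrow>
      (\<forall>t\<in>I. has_L2_derivative \<nu>S2 I m (\<lambda>x. - bracket_S2 (F t) (m_hat t) x) t)" (is "?EA \<longleftrightarrow> ?S")
    and "(\<forall>t\<in>I. function_equation s \<rho> I f 1 (bracket_rev (P \<circ> hopf) (f t)) t) \<longleftrightarrow>
      (\<forall>t\<in>I. has_L2_derivative \<nu>S2 I m (\<lambda>x. - bracket_S2 (F t) (m_hat t) x) t)"
    and "(\<forall>t\<in>I. has_L2_derivative \<nu>S2 I m (\<lambda>x. - bracket_S2 (F t) (m_hat t) x) t) \<longleftrightarrow> transported_S2 I F m_hat"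
proof -
  let ?\<phi> = "P \<circ> hopf" and ?z = "\<lambda>w. zcoord (hopf w)"
  have z: "sob k ?z" for k by (rule sob_smooth[OF real_polynomial_smooth_S3[OF zcoord_hopf_polynomial]])
  have \<phi>_eq: "?\<phi> = (\<lambda>w. 2 / Ro * ?z w + 2 * (?z w * (h \<circ> hopf) w))"
    by (simp add: P fun_eq_iff)
  have \<phi>: "sob 1 ?\<phi>"
    unfolding \<phi>_eq by (intro sob_add sob_scale z sob_1_polynomial_mult[OF zcoord_hopf_polynomial h])
  have \<phi>_inv: "inv\<^sub>E ?\<phi>" by (rule inv_hopf[OF sob_L2[OF \<phi>]])
  have m_ae: "AE w in \<mu>S3. (m t \<circ> hopf) w = CL (f t) w" and m_L2: "m t \<circ> hopf \<in> L2 \<mu>S3" if t: "t \<in> I" for t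
  proof -
    note ft = f_regular[OF f t]
    have Ft: "F t (hopf w) = f t w" if "w \<in> S3" for w using F t that by simp
    have l: "laplacian_S2 (F t) \<circ> hopf \<in> L2 \<mu>S3" "AE w in \<mu>S3. laplacian_S2 (F t) (hopf w) = lap (f t) w"
      by (rule laplacian_S2_lap[OF _ ft(2,4)]; rule Ft; assumption)+
    have ae: "AE w in \<mu>S3. CL (f t) w = (m t \<circ> hopf) w"
      using l(2) AE_space
    proof eventually_elim
      case (elim w)
      have "(\<rho> (hopf w))\<^sup>2 = \<gamma> * (?z w)\<^sup>2" using rho2 hopf_S2[of w] elim(2) by simp
      then show ?case using elim Ft[of w] by (simp add: m contact_lap_def power2_eq_square)
    qed
    then show "AE w in \<mu>S3. (m t \<circ> hopf) w = CL (f t) w" by eventually_elim simp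
    have [measurable]: "?z \<in> borel_measurable \<mu>S3" by (rule L2_measurable[OF sob_L2[OF z]])
    have [measurable]: "(\<lambda>w. laplacian_S2 (F t) (hopf w)) \<in> borel_measurable \<mu>S3"
      using L2_measurable[OF l(1)] by (simp add: comp_def)
    have [measurable]: "(\<lambda>w. F t (hopf w)) \<in> borel_measurable \<mu>S3"
      by (rule iffD2[OF borel_measurable_\<mu>S3_cong[of "\<lambda>w. F t (hopf w)" "f t"] L2_measurable[OF sob_L2[OF ft(2)]]]) (rule Ft)
    have "m t \<circ> hopf \<in> borel_measurable \<mu>S3" unfolding m comp_def by measurable
    then show "m t \<circ> hopf \<in> L2 \<mu>S3" by (rule L2_cong_AE[OF contact_lap_L2[OF rho ft(2)] _ ae])
  qed
  define B where "B t = bracket (F t \<circ> hopf) (m_hat t \<circ> hopf)" for t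
  define X where "X t \<longleftrightarrow> has_L2_derivative \<mu>S3 I (\<lambda>\<tau>. m \<tau> \<circ> hopf) (\<lambda>w. - B t w) t" for t
  have B: "inv\<^sub>E (B t)" "AE w in \<mu>S3. B t w = bracket (f t) (CL (f t)) w + bracket (f t) ?\<phi> w" if t: "t \<in> I" for t
  proof -
    note ft = f_regular[OF f t]
    let ?m = "\<lambda>w. CL (f t) w + ?\<phi> w"
    note c1 = contact_lap_sob_1[OF rho ft(1)] and ci = inv_contact_lap[OF rho ft(2,4)]
    have m1: "sob 1 ?m" "inv\<^sub>E ?m" by (rule sob_add[OF c1 \<phi>], rule inv_add[OF ci \<phi>_inv])
    have ae: "AE w in \<mu>S3. (m_hat t \<circ> hopf) w = ?m w" using m_ae[OF t] by eventually_elim (simp add: m_hat)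
    have "m_hat t \<circ> hopf = (\<lambda>w. (m t \<circ> hopf) w + ?\<phi> w)" by (simp add: m_hat fun_eq_iff)
    then have "m_hat t \<circ> hopf \<in> L2 \<mu>S3" using L2_add[OF m_L2[OF t] sob_L2[OF \<phi>]] by simp
    then have 1: "bracket (f t) (m_hat t \<circ> hopf) = bracket (f t) ?m"
      by (rule bracket_cong_AE[OF ae L2_measurable L2_measurable[OF sob_L2[OF m1(1)]]])
    have eq: "bracket (f t) ?m w = B t w" if "w \<in> S3" for w
      unfolding 1[symmetric] B_def by (rule bracket_cong[OF _ refl that]) (use F t in simp)
    show "inv\<^sub>E (B t)"
      by (rule iffD1[OF wd_cong[of "bracket (f t) ?m" "B t"] inv_bracket[OF ft(1,4) m1]]) (rule eq)
    show "AE w in \<mu>S3. B t w = bracket (f t) (CL (f t)) w + bracket (f t) ?\<phi> w"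
      using bracket_add[OF c1 \<phi>, of "f t"] AE_space
    proof eventually_elim
      case (elim w)
      have "bracket (f t) ?m w = B t w" by (rule eq) (use elim(2) in simp)
      then show ?case using elim(1) by (simp only:)
    qed
  qed
  have Bm: "(\<lambda>w. - B t w) \<in> borel_measurable \<mu>S3" if "t \<in> I" for t
    by (rule L2_measurable[OF L2_minus[OF wdD(1)[OF B(1)[OF that]]]])
  have function_iff: "function_equation s \<rho> I f 1 (bracket_rev ?\<phi> (f t)) t \<longleftrightarrow> X t" if t: "t \<in> I" for t
  proof -
    note ft = f_regular[OF f t]
    have "function_equation s \<rho> I f 1 (bracket_rev ?\<phi> (f t)) t \<longleftrightarrow>
      has_L2_derivative \<mu>S3 I (\<lambda>\<tau>. contact_laplacian s \<rho> (f \<tau>))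
        (\<lambda>w. - (bracket (f t) (CL (f t)) w - 1 * bracket_rev ?\<phi> (f t) w)) t"
      unfolding function_equation_def bracket_contact_laplacian[OF f t] ..
    also have "\<dots> \<longleftrightarrow> has_L2_derivative \<mu>S3 I (\<lambda>\<tau>. contact_laplacian s \<rho> (f \<tau>)) (\<lambda>w. - B t w) t"
    proof (rule has_L2_derivative_cong_AE[OF t _ _ Bm[OF t]])
      show "AE w in \<mu>S3. - (bracket (f t) (CL (f t)) w - 1 * bracket_rev ?\<phi> (f t) w) = - B t w"
        using B(2)[OF t] by eventually_elim (simp add: bracket_rev_def)
      show "(\<lambda>w. - (bracket (f t) (CL (f t)) w - 1 * bracket_rev ?\<phi> (f t) w)) \<in> borel_measurable \<mu>S3"
        by (intro L2_measurable L2_minus L2_diff L2_scale bracket_L2[OF ft(1) contact_lap_sob_1[OF rho ft(1)]]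
            cocycle_representative(1)[OF \<phi> t])
    qed
    also have "\<dots> \<longleftrightarrow> X t"
      unfolding X_def
    proof (rule has_L2_derivative_cong_curve[OF t _ _ m_L2])
      fix \<tau> assume \<tau>: "\<tau> \<in> I"
      note c = contact_laplacian_AE[OF rho f_regular(2,4)[OF f \<tau>], of s]
      show "contact_laplacian s \<rho> (f \<tau>) \<in> L2 \<mu>S3" by (rule c(1))
      show "AE w in \<mu>S3. contact_laplacian s \<rho> (f \<tau>) w = (m \<tau> \<circ> hopf) w"
        using c(2) m_ae[OF \<tau>] by eventually_elim simp
    qed
    finally show ?thesis .
  qed
  have sphere: "has_L2_derivative \<nu>S2 I m (\<lambda>x. - bracket_S2 (F t) (m_hat t) x) t \<longleftrightarrow> X t" if t: "t \<in> I" for t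
  proof -
    note b = bracket_S2[OF B(1)[OF t, unfolded B_def]]
    have "has_L2_derivative \<nu>S2 I m (\<lambda>x. - bracket_S2 (F t) (m_hat t) x) t \<longleftrightarrow>
      has_L2_derivative \<mu>S3 I (\<lambda>\<tau>. m \<tau> \<circ> hopf) (\<lambda>w. - (bracket_S2 (F t) (m_hat t) \<circ> hopf) w) t"
      unfolding has_L2_derivative_\<nu>S2_iff[OF t] by (simp add: comp_def)
    also have "\<dots> \<longleftrightarrow> X t"
      unfolding X_def
    proof (rule has_L2_derivative_cong_AE[OF t _ _ Bm[OF t]])
      show "AE w in \<mu>S3. - (bracket_S2 (F t) (m_hat t) \<circ> hopf) w = - B t w"
        using b(2) by eventually_elim (simp add: B_def)
      show "(\<lambda>w. - (bracket_S2 (F t) (m_hat t) \<circ> hopf) w) \<in> borel_measurable \<mu>S3"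
        by (rule L2_measurable[OF L2_minus[OF b(1)]])
    qed
    finally show ?thesis .
  qed
  have transported: "transported_S2 I F m_hat \<longleftrightarrow> (\<forall>t\<in>I. X t)"
  proof -
    have "m_hat \<tau> \<circ> hopf = (\<lambda>w. (m \<tau> \<circ> hopf) w + ?\<phi> w)" for \<tau> by (simp add: m_hat fun_eq_iff)
    then show ?thesis
      unfolding transported_S2_def X_def B_def bracket_def
      by (simp only: has_L2_derivative_add_const[OF sob_L2[OF \<phi>]])
  qed
  note R = cocycle_representative(3)[OF \<phi> _ \<phi>_inv] cocycle_representative(2)[OF \<phi>]
  have "?EA \<longleftrightarrow> (\<forall>t\<in>I. field_equation s \<rho> ?\<phi> I f 1 t \<and> ((\<lambda>t. 1) has_real_derivative 0) (at t within I))"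
    by (rule euler_arnold_iff[OF f, of "\<lambda>t. bracket_rev ?\<phi> (f t)"]) (rule R, assumption+)+
  also have "\<dots> \<longleftrightarrow> (\<forall>t\<in>I. X t)"
  proof (rule ball_cong[OF refl])
    fix t assume t: "t \<in> I"
    obtain g where g: "has_sobolev_derivative 2 I f g t" using df t by blast
    have "field_equation s \<rho> ?\<phi> I f 1 t \<longleftrightarrow> function_equation s \<rho> I f 1 (bracket_rev ?\<phi> (f t)) t"
      by (rule field_equation_iff_function_equation[OF f t g R(1)[OF t]]) (rule R(2)[OF t])
    then show "field_equation s \<rho> ?\<phi> I f 1 t \<and> ((\<lambda>t. 1) has_real_derivative 0) (at t within I) \<longleftrightarrow> X t"
      using function_iff[OF t] by simp
  qed
  finally show "?EA \<longleftrightarrow> ?S" using sphere by simp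
  show "(\<forall>t\<in>I. function_equation s \<rho> I f 1 (bracket_rev (P \<circ> hopf) (f t)) t) \<longleftrightarrow> ?S"
    using sphere function_iff by simp
  show "?S \<longleftrightarrow> transported_S2 I F m_hat" using sphere transported by simp
qed

end

end

section \<open>The theorem\<close>

theorem mainTheorem2:
  fixes s :: nat and \<rho> :: "cr \<Rightarrow> real" and \<phi> :: "c2 \<Rightarrow> real"
    and I :: "real set" and f :: "real \<Rightarrow> c2 \<Rightarrow> real" and a :: "real \<Rightarrow> real"
  assumes s: "s \<ge> 3"
    and \<rho>: "\<rho> \<circ> hopf \<in> sobolev s"
    and invertible: "contact_laplacian_invertible s \<rho>"
    and \<phi>: "\<phi> \<in> sobolev 1"
    and I: "is_interval I"
    and f: "\<forall>t\<in>I. f t \<in> sobolev_inv (s + 1)"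
    and df: "\<forall>t\<in>I. \<exists>g. has_sobolev_derivative 2 I f g t"
  shows "(euler_arnold s \<rho> \<phi> I (\<lambda>t. S\<theta> (f t)) a \<longleftrightarrow>
      (\<forall>t\<in>I. field_equation s \<rho> \<phi> I f (a t) t \<and> (a has_real_derivative 0) (at t within I)))
    \<and> (euler_arnold s \<rho> \<phi> I (\<lambda>t. S\<theta> (f t)) a \<longrightarrow> (\<exists>c. \<forall>t\<in>I. a t = c))
    \<and> (\<forall>c. \<forall>t\<in>I. field_equation s \<rho> \<phi> I f c t \<longleftrightarrow>
        function_equation s \<rho> I f c (fibre_average (bracket_rev \<phi> (f t))) t)
    \<and> (E_invariant \<phi> \<longrightarrow> (\<forall>c. \<forall>t\<in>I. field_equation s \<rho> \<phi> I f c t \<longleftrightarrow>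
        function_equation s \<rho> I f c (bracket_rev \<phi> (f t)) t))
    \<and> (\<forall>(h :: cr \<Rightarrow> real) (Ro :: real) (\<gamma> :: real) (F :: real \<Rightarrow> cr \<Rightarrow> real).
        h \<circ> hopf \<in> sobolev 1 \<and> Ro \<noteq> 0 \<and> (\<forall>x\<in>S2. (\<rho> x)\<^sup>2 = \<gamma> * (zcoord x)\<^sup>2) \<and>
        (\<forall>t\<in>I. \<forall>w\<in>S3. f t w = F t (hopf w)) \<longrightarrow>
        (let P = (\<lambda>x. 2 * zcoord x / Ro + 2 * zcoord x * h x);
             m = (\<lambda>t x. \<gamma> * (zcoord x)\<^sup>2 * F t x - laplacian_S2 (F t) x);
             m_hat = (\<lambda>t x. m t x + P x);
             sphere_equation =
               (\<forall>t\<in>I. has_L2_derivative \<nu>S2 I m (\<lambda>x. - bracket_S2 (F t) (m_hat t) x) t)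
         in (euler_arnold s \<rho> (P \<circ> hopf) I (\<lambda>t. S\<theta> (f t)) (\<lambda>t. 1) \<longleftrightarrow> sphere_equation)
          \<and> ((\<forall>t\<in>I. function_equation s \<rho> I f 1 (bracket_rev (P \<circ> hopf) (f t)) t) \<longleftrightarrow>
               sphere_equation)
          \<and> (sphere_equation \<longleftrightarrow> transported_S2 I F m_hat)))"
proof -
  have \<phi>1: "sob 1 \<phi>" using \<phi> by (simp add: sobolev_iff_sob)
  interpret contact_metric s \<rho>
    by unfold_locales (use s \<rho> invertible sob_mono[OF s] in \<open>simp_all add: sobolev_iff_sob\<close>)
  let ?R = "\<lambda>t. fibre_average (bracket_rev \<phi> (f t))"
  have EA: "euler_arnold s \<rho> \<phi> I (\<lambda>t. S\<theta> (f t)) a \<longleftrightarrow>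
      (\<forall>t\<in>I. field_equation s \<rho> \<phi> I f (a t) t \<and> (a has_real_derivative 0) (at t within I))"
    by (rule euler_arnold_iff[OF f, of ?R]) (rule cocycle_fibre_average[OF f \<phi>1]; assumption)+
  have const: "\<exists>c. \<forall>t\<in>I. a t = c" if "euler_arnold s \<rho> \<phi> I (\<lambda>t. S\<theta> (f t)) a"
    by (rule has_field_derivative_zero_constant) (use I that EA in \<open>simp_all add: is_interval_convex\<close>)
  have FE: "field_equation s \<rho> \<phi> I f c t \<longleftrightarrow> function_equation s \<rho> I f c (?R t) t" if t: "t \<in> I" for c t
  proof -
    obtain g where g: "has_sobolev_derivative 2 I f g t" using df t by blast
    show ?thesis
      by (rule field_equation_iff_function_equation[OF f t g cocycle_fibre_average(1)[OF f \<phi>1 t]])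
        (rule cocycle_fibre_average(2)[OF f \<phi>1 t])
  qed
  have FI: "field_equation s \<rho> \<phi> I f c t \<longleftrightarrow> function_equation s \<rho> I f c (bracket_rev \<phi> (f t)) t"
    if inv: "E_invariant \<phi>" and t: "t \<in> I" for c t
  proof -
    obtain g where g: "has_sobolev_derivative 2 I f g t" using df t by blast
    show ?thesis
      by (rule field_equation_iff_function_equation[OF f t g
            cocycle_representative(3)[OF f \<phi>1 t inv[unfolded E_invariant_iff_wd]]])
        (rule cocycle_representative(2)[OF f \<phi>1 t])
  qed
  show ?thesis
    unfolding Let_def
  proof (intro conjI allI impI)
    show "\<exists>c. \<forall>t\<in>I. a t = c" if "euler_arnold s \<rho> \<phi> I (\<lambda>t. S\<theta> (f t)) a" by (rule const[OF that])
  next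
    fix h :: "cr \<Rightarrow> real" and Ro \<gamma> :: real and F :: "real \<Rightarrow> cr \<Rightarrow> real"
    assume H: "h \<circ> hopf \<in> sobolev 1 \<and> Ro \<noteq> 0 \<and> (\<forall>x\<in>S2. (\<rho> x)\<^sup>2 = \<gamma> * (zcoord x)\<^sup>2) \<and>
        (\<forall>t\<in>I. \<forall>w\<in>S3. f t w = F t (hopf w))"
    then have h: "sob 1 (h \<circ> hopf)" and rho2: "\<forall>x\<in>S2. (\<rho> x)\<^sup>2 = \<gamma> * (zcoord x)\<^sup>2"
      and F: "\<forall>t\<in>I. \<forall>w\<in>S3. f t w = F t (hopf w)"
      by (simp_all add: sobolev_iff_sob)
    note S = sphere_equations[OF f df h rho2 F refl refl refl, of Ro]
    let ?m = "\<lambda>t x. \<gamma> * (zcoord x)\<^sup>2 * F t x - laplacian_S2 (F t) x"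
    let ?P = "\<lambda>x. 2 * zcoord x / Ro + 2 * zcoord x * h x"
    let ?S = "\<forall>t\<in>I. has_L2_derivative \<nu>S2 I ?m (\<lambda>x. - bracket_S2 (F t) (\<lambda>x. ?m t x + ?P x) x) t"
    show "euler_arnold s \<rho> (?P \<circ> hopf) I (\<lambda>t. S\<theta> (f t)) (\<lambda>t. 1) \<longleftrightarrow> ?S" by (rule S(1))
    show "(\<forall>t\<in>I. function_equation s \<rho> I f 1 (bracket_rev (?P \<circ> hopf) (f t)) t) \<longleftrightarrow> ?S" by (rule S(2))
    show "?S \<longleftrightarrow> transported_S2 I F (\<lambda>t x. ?m t x + ?P x)" by (rule S(3))
  qed (use EA FE FI in blast)+
qed

end
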